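(* Let $\gamma:[0,T]\to M$ be an ample and equiregular geodesic of the affine optimal control problem, with $\gamma(0)=x_0$ and initial covector $\lambda\in T^*_{x_0}M$. Let $k=\dim\mathcal D_{x_0}$ and let $n_1,\dots,n_k$ be the lengths of the rows of the Young tableau of $\gamma$. Then the symmetric operator $\mathcal I_\lambda:\mathcal D_{x_0}\to\mathcal D_{x_0}$ satisfies: (i) $\mathrm{spec}\,\mathcal I_\lambda=\{n_1^2,\dots,n_k^2\}$ (eigenvalues counted with multiplicity); (ii) $\mathrm{tr}\,\mathcal I_\lambda=n_1^2+\cdots+n_k^2$.
   Context: Control system. $M$ is a connected smooth $n$-manifold. An affine control system is a pair $(\mathbb U,f)$, where $\mathbb U\to M$ is a smooth vector bundle of rank $r$ and $f:\mathbb U\to TM$ is a smooth bundle map over $\mathrm{id}_M$, affine on fibres. In a local trivialization $f(x,u)=f_0(x)+\sum_{i=1}^r u_if_i(x)$, with linear part $\bar f(x,u)=\sum_i u_if_i(x)$. Set $\mathcal D_x=\bar f(\mathbb U_x)\subset T_xM$, and let $\overline{\mathcal D}$ be the set of vector fields $\bar f\circ\sigma$, $\sigma$ a smooth section of $\mathbb U$. An admissible curve is a Lipschitz curve $\gamma$ with $\dot\gamma(t)=f(\gamma(t),u(t))$ for a.e. $t$, for a measurable essentially bounded control $u(t)\in\mathbb U_{\gamma(t)}$. $L:\mathbb U\to\mathbb R$ is a smooth Lagrangian, $J_T(u)=\int_0^TL(\gamma(t),u(t))\,dt$. Standing assumptions. (A1) The iterated brackets of the fields $(\mathrm{ad} f_0)^iX$,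 $i\ge0$, $X\in\overline{\mathcal D}$, span $T_xM$ at every $x$. (A2) $L$ is Tonelli: its restriction to each fibre has positive definite Hessian and superlinear growth. Geodesics. $H(\lambda)=\max_{u\in\mathbb U_x}(\langle\lambda,f(x,u)\rangle-L(x,u))$, $\lambda\in T_x^*M$, is a smooth function on $T^*M$, with Hamiltonian vector field $\vec H$ (assumed complete). A geodesic is a curve $\gamma(t)=\pi(e^{t\vec H}(\lambda))$, $\pi:T^*M\to M$ the projection; $\lambda$ is its initial covector; it is an admissible curve with control the (smooth) maximizer $u(t)$ along $e^{t\vec H}(\lambda)$. Flag, ample, equiregular. Let $P_{0,t}$ be the flow from time $0$ to $t$ of the time-dependent field $f_0+\sum_iu_i(t)f_i$ and $C_i(t)=(P_{0,t})_*^{-1}f_i(\gamma(t))\in T_{x_0}M$. The flag of $\gamma$ is $\mathcal F^i_\gamma(t)=\mathrm{span}\{\frac{d^j}{dt^j}v(t):v(t)=\sum_la_l(t)C_l(t),\ a_l\text{ smooth},\ j\le i-1\}=\mathrm{span}\{C_l^{(j)}(t):j\le i-1,\ 1\le l\le r\}$ ($i\ge1$), and $k_i(t)=\dim\mathcal F_\gamma^i(t)$. $\gamma$ is ample if for every $t\in[0,T]$ there is $m$ with $\mathcal F_\gamma^{m}(t)=T_{x_0}M$; equiregular if the functions $k_i(t)$ are locally constant at every $t\in[0,T]$. Young tableau. For ample equiregular $\gamma$ let $m$ be the least integer with $k_m=n$, $k_0=0$, $d_i=k_i-k_{i-1}$ for $i=1,\dots,m$. The sequence $d_1\ge\dots\ge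 d_m$ is nonincreasing, $d_1=k=\dim\mathcal D_{x_0}$, $\sum d_i=n$. The tableau has $m$ columns, the $i$-th of length $d_i$; $n_j=\#\{i:d_i\ge j\}$ is the length of the $j$-th row, $j=1,\dots,k$. Geodesic cost. Fix an open relatively compact $M'\subset M$ containing $\gamma$ and let $S_t(x,y)$ be the infimum of $J_t(u)$ over admissible pairs with $\gamma'(0)=x$, $\gamma'(t)=y$ and trajectory $\gamma'\subset M'$. Put $c_t(x)=-S_t(x,\gamma(t))$. For ample $\gamma$, $c_t(x)$ is smooth in $(t,x)$ for small $t>0$ and $x$ near $x_0$ and $\dot c_t=\partial_tc_t$ has a critical point at $x_0$, so that $d^2_{x_0}\dot c_t$ is a well-defined quadratic form on $T_{x_0}M$. Inner product and $\mathcal I_\lambda$. Let $H_x=H|_{T_x^*M}$. The second derivative $d_\lambda^2H_x:T_x^*M\to T_xM$ is a nonnegative self-adjoint linear map with image $\mathcal D_x$; $\langle w_1|w_2\rangle_\lambda:=\langle\eta_1,d^2_\lambda H_x(\eta_2)\rangle$ for $w_i=d^2_\lambda H_x(\eta_i)$ defines an inner product on $\mathcal D_x$. $\mathcal Q_\lambda(t)$ is the $\langle\cdot|\cdot\rangle_\lambda$-symmetric operator on $\mathcal D_{x_0}$ with $d^2_{x_0}\dot c_t(v)=\langle\mathcal Q_\lambda(t)v|v\rangle_\lambda$, $v\in\mathcal D_{x_0}$, and $\mathcal I_\lambda=\lim_{t\to0^+}t^2\mathcal Q_\lambda(t)$ (the limit exists). *)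

theory Defs
  imports "HOL-Analysis.Analysis"
begin

section \<open>Smooth maps between normed spaces\<close>

text \<open>Used with an open set and a finite-dimensional domain, where directional continuity of all
  iterated derivatives is the usual notion.\<close>

primrec Ck_on :: "nat \<Rightarrow> 'a::real_normed_vector set \<Rightarrow> ('a \<Rightarrow> 'b::real_normed_vector) \<Rightarrow> bool" where
  "Ck_on 0 S g \<longleftrightarrow> continuous_on S g"
| "Ck_on (Suc k) S g \<longleftrightarrow>
     (\<forall>x\<in>S. g differentiable (at x)) \<and> (\<forall>v. Ck_on k S (\<lambda>x. frechet_derivative g (at x) v))"

definition smooth_on :: "'a::real_normed_vector set \<Rightarrow> ('a \<Rightarrow> 'b::real_normed_vector) \<Rightarrow> bool" where
  "smooth_on S g \<longleftrightarrow> (\<forall>k. Ck_on k S g)"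

definition hess :: "('a::real_normed_vector \<Rightarrow> real) \<Rightarrow> 'a \<Rightarrow> 'a \<Rightarrow> real" where
  "hess g a v = frechet_derivative (\<lambda>b. frechet_derivative g (at b) v) (at a) v"

definition grad :: "(real^'n \<Rightarrow> real) \<Rightarrow> real^'n \<Rightarrow> real^'n" where
  "grad g a = (\<chi> i. frechet_derivative g (at a) (axis i 1))"

definition nth_vderiv :: "nat \<Rightarrow> (real \<Rightarrow> 'a::real_normed_vector) \<Rightarrow> real \<Rightarrow> 'a" where
  "nth_vderiv j = (\<lambda>g t. vector_derivative g (at t)) ^^ j"


section \<open>Smooth manifolds\<close>

text \<open>The manifold is the whole type \<^typ>\<open>'m\<close>. Its atlas is indexed by the points: \<open>chart M p\<close> is
  a chart around \<open>p\<close> with domain \<open>chart_dom M p\<close>. The tangent space at \<open>x\<close> is identified with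
  \<open>real^'n\<close> through \<open>chart M x\<close>, the chart attached to \<open>x\<close> itself, and the cotangent space at \<open>x\<close>
  with \<open>real^'n\<close> through the dual basis, so that the duality pairing is the inner product of
  \<open>real^'n\<close>. These identifications do not vary continuously with \<open>x\<close>; every smoothness or
  differentiability condition is therefore stated after passing to one fixed chart.\<close>

record ('m, 'n::finite) charts =
  chart_dom :: "'m \<Rightarrow> 'm set"
  chart :: "'m \<Rightarrow> 'm \<Rightarrow> real^'n"

definition chart_inv :: "('m, 'n::finite, 'z) charts_scheme \<Rightarrow> 'm \<Rightarrow> real^'n \<Rightarrow> 'm" where
  "chart_inv M p = inv_into (chart_dom M p) (chart M p)"

definition smooth_manifold ::
  "('m::{t2_space,second_countable_topology}, 'n::finite, 'z) charts_scheme \<Rightarrow> bool" where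
  "smooth_manifold M \<longleftrightarrow>
     (\<forall>p. p \<in> chart_dom M p \<and> open (chart_dom M p) \<and> open (chart M p ` chart_dom M p) \<and>
          homeomorphism (chart_dom M p) (chart M p ` chart_dom M p) (chart M p) (chart_inv M p)) \<and>
     (\<forall>p q. smooth_on (chart M p ` (chart_dom M p \<inter> chart_dom M q)) (chart M q \<circ> chart_inv M p))"

text \<open>Differential at the point \<open>x\<close> of the transition from \<open>chart M p\<close> to \<open>chart M q\<close>.\<close>

definition chart_change ::
  "('m, 'n::finite, 'z) charts_scheme \<Rightarrow> 'm \<Rightarrow> 'm \<Rightarrow> 'm \<Rightarrow> real^'n \<Rightarrow> real^'n" where
  "chart_change M p q x = frechet_derivative (chart M q \<circ> chart_inv M p) (at (chart M p x))"

text \<open>Components in \<open>chart M p\<close> of a tangent vector \<open>v\<close> at \<open>x\<close>, of a covector \<open>\<eta>\<close> at \<open>x\<close>, and the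
  inverse of the latter map.\<close>

definition tcoord :: "('m, 'n::finite, 'z) charts_scheme \<Rightarrow> 'm \<Rightarrow> 'm \<Rightarrow> real^'n \<Rightarrow> real^'n" where
  "tcoord M p x v = chart_change M x p x v"

definition cocoord :: "('m, 'n::finite, 'z) charts_scheme \<Rightarrow> 'm \<Rightarrow> 'm \<Rightarrow> real^'n \<Rightarrow> real^'n" where
  "cocoord M p x \<eta> = adjoint (chart_change M p x x) \<eta>"

definition of_cocoord :: "('m, 'n::finite, 'z) charts_scheme \<Rightarrow> 'm \<Rightarrow> 'm \<Rightarrow> real^'n \<Rightarrow> real^'n" where
  "of_cocoord M p x \<xi> = adjoint (chart_change M x p x) \<xi>"

definition has_velocity ::
  "('m::t2_space, 'n::finite, 'z) charts_scheme \<Rightarrow> (real \<Rightarrow> 'm) \<Rightarrow> real^'n \<Rightarrow> real \<Rightarrow> real set \<Rightarrow> bool" where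
  "has_velocity M c v t S \<longleftrightarrow> continuous (at t within S) c \<and>
     ((\<lambda>s. chart M (c t) (c s)) has_vector_derivative v) (at t within S)"

definition differential ::
  "('m, 'n::finite, 'z) charts_scheme \<Rightarrow> ('m \<Rightarrow> 'm) \<Rightarrow> 'm \<Rightarrow> real^'n \<Rightarrow> real^'n" where
  "differential M g x = frechet_derivative (\<lambda>y. chart M (g x) (g (chart_inv M x y))) (at (chart M x x))"

definition vf_rep ::
  "('m, 'n::finite, 'z) charts_scheme \<Rightarrow> 'm \<Rightarrow> ('m \<Rightarrow> real^'n) \<Rightarrow> real^'n \<Rightarrow> real^'n" where
  "vf_rep M p X y = tcoord M p (chart_inv M p y) (X (chart_inv M p y))"

definition lie_bracket ::
  "('m, 'n::finite, 'z) charts_scheme \<Rightarrow> ('m \<Rightarrow> real^'n) \<Rightarrow> ('m \<Rightarrow> real^'n) \<Rightarrow> 'm \<Rightarrow> real^'n" where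
  "lie_bracket M X Y x =
     frechet_derivative (vf_rep M x Y) (at (chart M x x)) (X x) -
     frechet_derivative (vf_rep M x X) (at (chart M x x)) (Y x)"

inductive_set iter_brackets ::
  "('m, 'n::finite, 'z) charts_scheme \<Rightarrow> ('m \<Rightarrow> real^'n) set \<Rightarrow> ('m \<Rightarrow> real^'n) set"
  for M :: "('m, 'n, 'z) charts_scheme" and A :: "('m \<Rightarrow> real^'n) set" where
  base: "X \<in> A \<Longrightarrow> X \<in> iter_brackets M A"
| bracket: "X \<in> iter_brackets M A \<Longrightarrow> Y \<in> iter_brackets M A \<Longrightarrow> lie_bracket M X Y \<in> iter_brackets M A"


section \<open>Affine optimal control problems\<close>

text \<open>Each fibre of the bundle of controls is identified, linearly but not continuously in the base
  point, with \<open>real^'r\<close>; the total space is thus \<open>'m \<times> real^'r\<close> as a set. The bundle structure is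
  carried by the local trivializations \<open>triv P q\<close> over \<open>triv_dom P q\<close>, whose transition functions
  are smooth.\<close>

record ('m, 'n::finite, 'r::finite) control_problem = "('m, 'n) charts" +
  triv_dom :: "'m \<Rightarrow> 'm set"
  triv :: "'m \<Rightarrow> 'm \<Rightarrow> real^'r \<Rightarrow> real^'r"
  dyn :: "'m \<Rightarrow> real^'r \<Rightarrow> real^'n"
  lagr :: "'m \<Rightarrow> real^'r \<Rightarrow> real"

definition vector_bundle ::
  "('m::{t2_space,second_countable_topology}, 'n::finite, 'r::finite) control_problem \<Rightarrow> bool" where
  "vector_bundle P \<longleftrightarrow>
     (\<forall>q. q \<in> triv_dom P q \<and> open (triv_dom P q) \<and>
          (\<forall>x\<in>triv_dom P q. linear (triv P q x) \<and> bij (triv P q x))) \<and>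
     (\<forall>p q q' w. smooth_on (chart P p ` (chart_dom P p \<inter> triv_dom P q \<inter> triv_dom P q'))
        (\<lambda>y. triv P q' (chart_inv P p y) (inv (triv P q (chart_inv P p y)) w)))"

definition smooth_section ::
  "('m, 'n::finite, 'r::finite) control_problem \<Rightarrow> ('m \<Rightarrow> real^'r) \<Rightarrow> bool" where
  "smooth_section P \<sigma> \<longleftrightarrow>
     (\<forall>p q. smooth_on (chart P p ` (chart_dom P p \<inter> triv_dom P q))
        (\<lambda>y. triv P q (chart_inv P p y) (\<sigma> (chart_inv P p y))))"

definition drift :: "('m, 'n::finite, 'r::finite) control_problem \<Rightarrow> 'm \<Rightarrow> real^'n" where
  "drift P x = dyn P x 0"

definition lin_part :: "('m, 'n::finite, 'r::finite) control_problem \<Rightarrow> 'm \<Rightarrow> real^'r \<Rightarrow> real^'n" where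
  "lin_part P x u = dyn P x u - drift P x"

definition ctrl_distr :: "('m, 'n::finite, 'r::finite) control_problem \<Rightarrow> 'm \<Rightarrow> (real^'n) set" where
  "ctrl_distr P x = range (lin_part P x)"

definition control_fields ::
  "('m, 'n::finite, 'r::finite) control_problem \<Rightarrow> ('m \<Rightarrow> real^'n) set" where
  "control_fields P = {(\<lambda>x. lin_part P x (\<sigma> x)) | \<sigma>. smooth_section P \<sigma>}"

definition affine_control_problem ::
  "('m::{t2_space,second_countable_topology}, 'n::finite, 'r::finite) control_problem \<Rightarrow> bool" where
  "affine_control_problem P \<longleftrightarrow>
     connected (UNIV :: 'm set) \<and> smooth_manifold P \<and> vector_bundle P \<and>
     (\<forall>x. linear (lin_part P x)) \<and>
     (\<forall>p q. smooth_on ((chart P p ` (chart_dom P p \<inter> triv_dom P q)) \<times> UNIV)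
        (\<lambda>(y, w). tcoord P p (chart_inv P p y)
           (dyn P (chart_inv P p y) (inv (triv P q (chart_inv P p y)) w)))) \<and>
     (\<forall>p q. smooth_on ((chart P p ` (chart_dom P p \<inter> triv_dom P q)) \<times> UNIV)
        (\<lambda>(y, w). lagr P (chart_inv P p y) (inv (triv P q (chart_inv P p y)) w)))"

definition bracket_generating ::
  "('m, 'n::finite, 'r::finite) control_problem \<Rightarrow> bool" where
  "bracket_generating P \<longleftrightarrow>
     (\<forall>x. span ((\<lambda>X. X x) ` iter_brackets P
        {(lie_bracket P (drift P) ^^ i) X | i X. X \<in> control_fields P}) = UNIV)"

definition tonelli :: "('m, 'n::finite, 'r::finite) control_problem \<Rightarrow> bool" where
  "tonelli P \<longleftrightarrow>
     (\<forall>x u v. v \<noteq> 0 \<longrightarrow> 0 < hess (lagr P x) u v) \<and>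
     (\<forall>x. filterlim (\<lambda>u. lagr P x u / norm u) at_top at_infinity)"


section \<open>Hamiltonian and geodesics\<close>

text \<open>For a Tonelli Lagrangian the supremum is attained, at a unique control.\<close>

definition ham :: "('m, 'n::finite, 'r::finite) control_problem \<Rightarrow> 'm \<Rightarrow> real^'n \<Rightarrow> real" where
  "ham P x \<eta> = (SUP u. \<eta> \<bullet> dyn P x u - lagr P x u)"

definition ham_rep ::
  "('m, 'n::finite, 'r::finite) control_problem \<Rightarrow> 'm \<Rightarrow> (real^'n) \<times> (real^'n) \<Rightarrow> real" where
  "ham_rep P p = (\<lambda>(y, \<xi>). ham P (chart_inv P p y) (of_cocoord P p (chart_inv P p y) \<xi>))"

text \<open>Integral curves \<open>(c, \<eta>)\<close>, defined on the whole line, of the Hamiltonian vector field: Hamilton's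
  equations at time \<open>t\<close> in the canonical coordinates induced by the chart attached to \<open>c t\<close>.\<close>

definition ham_curve ::
  "('m::t2_space, 'n::finite, 'r::finite) control_problem \<Rightarrow> (real \<Rightarrow> 'm) \<Rightarrow> (real \<Rightarrow> real^'n) \<Rightarrow> bool" where
  "ham_curve P c \<eta> \<longleftrightarrow>
     (\<forall>t. has_velocity P c (grad (\<lambda>\<xi>. ham_rep P (c t) (chart P (c t) (c t), \<xi>)) (\<eta> t)) t UNIV \<and>
        ((\<lambda>s. cocoord P (c t) (c s) (\<eta> s)) has_vector_derivative
           - grad (\<lambda>y. ham_rep P (c t) (y, \<eta> t)) (chart P (c t) (c t))) (at t))"

definition ham_complete :: "('m::t2_space, 'n::finite, 'r::finite) control_problem \<Rightarrow> bool" where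
  "ham_complete P \<longleftrightarrow> (\<forall>x \<eta>. \<exists>c h. ham_curve P c h \<and> c 0 = x \<and> h 0 = \<eta>)"

definition max_control ::
  "('m, 'n::finite, 'r::finite) control_problem \<Rightarrow> 'm \<Rightarrow> real^'n \<Rightarrow> real^'r" where
  "max_control P x \<eta> = arg_max (\<lambda>u. \<eta> \<bullet> dyn P x u - lagr P x u) (\<lambda>_. True)"


section \<open>Flag of a geodesic\<close>

text \<open>A smooth frame of the bundle of controls near the curve \<open>c\<close> on \<open>[0, T]\<close>: \<open>E t x\<close> sends the
  \<open>i\<close>-th basis vector to the \<open>i\<close>-th frame element at \<open>x\<close>. A trivialization over a neighbourhood of
  the curve is the case where \<open>E\<close> does not depend on \<open>t\<close>; since \<open>c\<close> may intersect itself, such a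
  trivialization need not exist, whereas a frame on a neighbourhood \<open>N\<close> of the graph always does.
  The flag does not depend on the choice of the frame.\<close>

definition frame_along ::
  "('m::{t2_space,second_countable_topology}, 'n::finite, 'r::finite) control_problem \<Rightarrow> real \<Rightarrow>
   (real \<Rightarrow> 'm) \<Rightarrow> (real \<times> 'm) set \<Rightarrow> (real \<Rightarrow> 'm \<Rightarrow> real^'r \<Rightarrow> real^'r) \<Rightarrow> bool" where
  "frame_along P T c N E \<longleftrightarrow>
     open N \<and> (\<forall>t\<in>{0..T}. (t, c t) \<in> N) \<and>
     (\<forall>(t, x)\<in>N. linear (E t x) \<and> bij (E t x)) \<and>
     (\<forall>p q w. smooth_on
        ((\<lambda>(t, x). (t, chart P p x)) ` (N \<inter> UNIV \<times> (chart_dom P p \<inter> triv_dom P q)))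
        (\<lambda>(t, y). triv P q (chart_inv P p y) (E t (chart_inv P p y) w)))"

text \<open>The field \<open>f\<^sub>0 + \<Sum>\<^sub>i u\<^sub>i(t) f\<^sub>i\<close>, where \<open>u\<^sub>i(t)\<close> are the components in the frame \<open>E\<close> of the
  maximizing control along \<open>(c, \<eta>)\<close>.\<close>

definition driving_field ::
  "('m, 'n::finite, 'r::finite) control_problem \<Rightarrow> (real \<Rightarrow> 'm \<Rightarrow> real^'r \<Rightarrow> real^'r) \<Rightarrow>
   (real \<Rightarrow> 'm) \<Rightarrow> (real \<Rightarrow> real^'n) \<Rightarrow> real \<Rightarrow> 'm \<Rightarrow> real^'n" where
  "driving_field P E c \<eta> t x =
     (let a = inv (E t (c t)) (max_control P (c t) (\<eta> t))
      in drift P x + (\<Sum>i\<in>UNIV. (a $ i) *\<^sub>R lin_part P x (E t x (axis i 1))))"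

text \<open>Flow from time \<open>0\<close> to time \<open>t\<close> (of either sign) of a time-dependent field defined on \<open>N\<close>.\<close>

definition flow0 ::
  "('m::t2_space, 'n::finite, 'z) charts_scheme \<Rightarrow> (real \<times> 'm) set \<Rightarrow> (real \<Rightarrow> 'm \<Rightarrow> real^'n) \<Rightarrow>
   real \<Rightarrow> 'm \<Rightarrow> 'm" where
  "flow0 M N X t x = (THE y. \<exists>c. c 0 = x \<and> c t = y \<and>
     (\<forall>s\<in>closed_segment 0 t. (s, c s) \<in> N \<and> has_velocity M c (X s (c s)) s (closed_segment 0 t)))"

definition pulled_field ::
  "('m::t2_space, 'n::finite, 'r::finite) control_problem \<Rightarrow> (real \<times> 'm) set \<Rightarrow>
   (real \<Rightarrow> 'm \<Rightarrow> real^'r \<Rightarrow> real^'r) \<Rightarrow> (real \<Rightarrow> 'm) \<Rightarrow> (real \<Rightarrow> real^'n) \<Rightarrow> 'r \<Rightarrow> real \<Rightarrow> real^'n" where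
  "pulled_field P N E c \<eta> i t =
     inv (differential P (flow0 P N (driving_field P E c \<eta>) t) (c 0))
       (lin_part P (c t) (E t (c t) (axis i 1)))"

definition flag ::
  "('m::t2_space, 'n::finite, 'r::finite) control_problem \<Rightarrow> (real \<times> 'm) set \<Rightarrow>
   (real \<Rightarrow> 'm \<Rightarrow> real^'r \<Rightarrow> real^'r) \<Rightarrow> (real \<Rightarrow> 'm) \<Rightarrow> (real \<Rightarrow> real^'n) \<Rightarrow> nat \<Rightarrow> real \<Rightarrow> (real^'n) set" where
  "flag P N E c \<eta> i t = span {nth_vderiv j (pulled_field P N E c \<eta> l) t | j l. j < i}"

definition growth ::
  "('m::t2_space, 'n::finite, 'r::finite) control_problem \<Rightarrow> (real \<times> 'm) set \<Rightarrow>
   (real \<Rightarrow> 'm \<Rightarrow> real^'r \<Rightarrow> real^'r) \<Rightarrow> (real \<Rightarrow> 'm) \<Rightarrow> (real \<Rightarrow> real^'n) \<Rightarrow> nat \<Rightarrow> real \<Rightarrow> nat" where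
  "growth P N E c \<eta> i t = dim (flag P N E c \<eta> i t)"

definition ample ::
  "('m::t2_space, 'n::finite, 'r::finite) control_problem \<Rightarrow> real \<Rightarrow> (real \<times> 'm) set \<Rightarrow>
   (real \<Rightarrow> 'm \<Rightarrow> real^'r \<Rightarrow> real^'r) \<Rightarrow> (real \<Rightarrow> 'm) \<Rightarrow> (real \<Rightarrow> real^'n) \<Rightarrow> bool" where
  "ample P T N E c \<eta> \<longleftrightarrow> (\<forall>t\<in>{0..T}. \<exists>m. flag P N E c \<eta> m t = UNIV)"

definition equiregular ::
  "('m::t2_space, 'n::finite, 'r::finite) control_problem \<Rightarrow> real \<Rightarrow> (real \<times> 'm) set \<Rightarrow>
   (real \<Rightarrow> 'm \<Rightarrow> real^'r \<Rightarrow> real^'r) \<Rightarrow> (real \<Rightarrow> 'm) \<Rightarrow> (real \<Rightarrow> real^'n) \<Rightarrow> bool" where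
  "equiregular P T N E c \<eta> \<longleftrightarrow>
     (\<forall>i. \<forall>t\<in>{0..T}. \<forall>\<^sub>F s in at t within {0..T}. growth P N E c \<eta> i s = growth P N E c \<eta> i t)"

text \<open>Row lengths of the tableau with column lengths \<open>\<kappa> i - \<kappa> (i - 1)\<close>, for a growth sequence \<open>\<kappa>\<close>
  that is nondecreasing with \<open>\<kappa> 0 = 0\<close> and reaches \<open>n\<close>.\<close>

definition tableau_row :: "(nat \<Rightarrow> nat) \<Rightarrow> nat \<Rightarrow> nat \<Rightarrow> nat" where
  "tableau_row \<kappa> n j = card {i \<in> {1..(LEAST m. \<kappa> m = n)}. \<kappa> i - \<kappa> (i - 1) \<ge> j}"


section \<open>Geodesic cost\<close>

definition admissible ::
  "('m::t2_space, 'n::finite, 'r::finite) control_problem \<Rightarrow> real \<Rightarrow> (real \<Rightarrow> 'm) \<Rightarrow> (real \<Rightarrow> real^'r) \<Rightarrow> bool" where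
  "admissible P T c u \<longleftrightarrow>
     (\<forall>s\<in>{0..T}. \<exists>e>0. \<exists>B p q.
        c ` ({0..T} \<inter> ball s e) \<subseteq> chart_dom P p \<inter> triv_dom P q \<and>
        B-lipschitz_on ({0..T} \<inter> ball s e) (\<lambda>t. chart P p (c t)) \<and>
        (\<lambda>t. triv P q (c t) (u t)) \<in> borel_measurable (lebesgue_on ({0..T} \<inter> ball s e)) \<and>
        (AE t in lebesgue_on ({0..T} \<inter> ball s e). norm (triv P q (c t) (u t)) \<le> B)) \<and>
     (AE t in lebesgue_on {0..T}. has_velocity P c (dyn P (c t) (u t)) t {0..T})"

definition action ::
  "('m, 'n::finite, 'r::finite) control_problem \<Rightarrow> real \<Rightarrow> (real \<Rightarrow> 'm) \<Rightarrow> (real \<Rightarrow> real^'r) \<Rightarrow> real" where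
  "action P T c u = (LINT t|lebesgue_on {0..T}. lagr P (c t) (u t))"

definition value_fun ::
  "('m::t2_space, 'n::finite, 'r::finite) control_problem \<Rightarrow> 'm set \<Rightarrow> real \<Rightarrow> 'm \<Rightarrow> 'm \<Rightarrow> ereal" where
  "value_fun P M' t x y =
     Inf {ereal (action P t c u) | c u. admissible P t c u \<and> c 0 = x \<and> c t = y \<and> c ` {0..t} \<subseteq> M'}"

text \<open>For small \<open>t > 0\<close> and \<open>x\<close> near the initial point of an ample geodesic the value is finite.\<close>

definition geo_cost ::
  "('m::t2_space, 'n::finite, 'r::finite) control_problem \<Rightarrow> 'm set \<Rightarrow> (real \<Rightarrow> 'm) \<Rightarrow> real \<Rightarrow> 'm \<Rightarrow> real" where
  "geo_cost P M' \<gamma> t x = - real_of_ereal (value_fun P M' t x (\<gamma> t))"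

definition cost_dot ::
  "('m::t2_space, 'n::finite, 'r::finite) control_problem \<Rightarrow> 'm set \<Rightarrow> (real \<Rightarrow> 'm) \<Rightarrow> real \<Rightarrow> 'm \<Rightarrow> real" where
  "cost_dot P M' \<gamma> t x = deriv (\<lambda>s. geo_cost P M' \<gamma> s x) t"

text \<open>Second derivative of \<open>cost_dot\<close> at its critical point \<open>\<gamma> 0\<close>.\<close>

definition cost_hess ::
  "('m::t2_space, 'n::finite, 'r::finite) control_problem \<Rightarrow> 'm set \<Rightarrow> (real \<Rightarrow> 'm) \<Rightarrow> real \<Rightarrow> real^'n \<Rightarrow> real" where
  "cost_hess P M' \<gamma> t =
     hess (\<lambda>y. cost_dot P M' \<gamma> t (chart_inv P (\<gamma> 0) y)) (chart P (\<gamma> 0) (\<gamma> 0))"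


section \<open>The asymptotic operator\<close>

text \<open>Second derivative at \<open>l\<close> of the fibre restriction of the Hamiltonian, as a map from the
  cotangent space at \<open>x\<close> to the tangent space at \<open>x\<close>.\<close>

definition ham_hess ::
  "('m, 'n::finite, 'r::finite) control_problem \<Rightarrow> 'm \<Rightarrow> real^'n \<Rightarrow> real^'n \<Rightarrow> real^'n" where
  "ham_hess P x l = frechet_derivative (grad (ham P x)) (at l)"

definition ham_inner ::
  "('m, 'n::finite, 'r::finite) control_problem \<Rightarrow> 'm \<Rightarrow> real^'n \<Rightarrow> real^'n \<Rightarrow> real^'n \<Rightarrow> real" where
  "ham_inner P x l w1 w2 = (THE r. \<exists>\<eta>1 \<eta>2. w1 = ham_hess P x l \<eta>1 \<and> w2 = ham_hess P x l \<eta>2 \<and>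
     r = \<eta>1 \<bullet> ham_hess P x l \<eta>2)"

definition symmetric_on ::
  "'a::real_vector set \<Rightarrow> ('a \<Rightarrow> 'a \<Rightarrow> real) \<Rightarrow> ('a \<Rightarrow> 'a) \<Rightarrow> bool" where
  "symmetric_on D ip A \<longleftrightarrow>
     (\<forall>v\<in>D. A v \<in> D) \<and>
     (\<forall>v\<in>D. \<forall>w\<in>D. \<forall>a b. A (a *\<^sub>R v + b *\<^sub>R w) = a *\<^sub>R A v + b *\<^sub>R A w) \<and>
     (\<forall>v\<in>D. \<forall>w\<in>D. ip (A v) w = ip v (A w))"

text \<open>Operators on \<open>D\<close> are extended by \<open>0\<close> outside \<open>D\<close>, which makes the description unique.\<close>

definition Q_op ::
  "('m::t2_space, 'n::finite, 'r::finite) control_problem \<Rightarrow> 'm set \<Rightarrow> (real \<Rightarrow> 'm) \<Rightarrow> real^'n \<Rightarrow> real \<Rightarrow>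
   real^'n \<Rightarrow> real^'n" where
  "Q_op P M' \<gamma> l t = (THE Q. symmetric_on (ctrl_distr P (\<gamma> 0)) (ham_inner P (\<gamma> 0) l) Q \<and>
     (\<forall>v\<in>ctrl_distr P (\<gamma> 0). cost_hess P M' \<gamma> t v = ham_inner P (\<gamma> 0) l (Q v) v) \<and>
     (\<forall>v. v \<notin> ctrl_distr P (\<gamma> 0) \<longrightarrow> Q v = 0))"

definition I_op ::
  "('m::t2_space, 'n::finite, 'r::finite) control_problem \<Rightarrow> 'm set \<Rightarrow> (real \<Rightarrow> 'm) \<Rightarrow> real^'n \<Rightarrow>
   real^'n \<Rightarrow> real^'n" where
  "I_op P M' \<gamma> l v = Lim (at_right 0) (\<lambda>t. t\<^sup>2 *\<^sub>R Q_op P M' \<gamma> l t v)"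

definition eig_mult :: "(real^'n) set \<Rightarrow> (real^'n \<Rightarrow> real^'n) \<Rightarrow> real \<Rightarrow> nat" where
  "eig_mult D A \<mu> = dim {v \<in> D. A v = \<mu> *\<^sub>R v}"

text \<open>Trace of a linear endomorphism of the subspace \<open>D\<close>, computed in some basis.\<close>

definition trace_on :: "(real^'n) set \<Rightarrow> (real^'n \<Rightarrow> real^'n) \<Rightarrow> real" where
  "trace_on D A =
     (let B = (SOME B. B \<subseteq> D \<and> independent B \<and> span B = D)
      in \<Sum>b\<in>B. representation B (A b) b)"

end

theory Submission
  imports Defs "HOL-Computational_Algebra.Polynomial" "HOL-Library.Multiset"
begin

text \<open>The value function is squeezed between quadratic subsolutions of the Hamilton--Jacobi equation and
  the action of nearby extremals; hence the Hessian of \<open>\<partial>\<^sub>t c\<^sub>t\<close> is read off from the terminal covector of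
  the Jacobi field on \<open>[0, t]\<close> joining \<open>v\<close> to \<open>0\<close>. Pulled back by the flow of the driving field,
  the Jacobi equation is a perturbation of \<open>z' = \<Sum>k. (C k \<bullet> q) C k\<close>, \<open>q' = 0\<close> for a frame adapted to
  the flag. Scaling the component of flag order \<open>j\<close> by \<open>t ^ j\<close> reduces the limit \<open>t \<longlongrightarrow> 0\<close> to a
  Gram problem, which on each row is the representation of evaluation at \<open>0\<close> by a polynomial \<open>p\<close> of
  degree less than the row length \<open>n\<close>; the eigenvalue is \<open>p(1)\<^sup>2 = n\<^sup>2\<close>. The row lengths of the
  frame and those of the tableau agree because a partition is determined by its columns.\<close>

text \<open>No smoothness of the cost is available in advance: the two inequalities on it hold for
  all short durations and are the only information. With the start x fixed and the end point moving
  along the geodesic, lower and upper bound touch at every time, and touching at all nearby times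
  already forces differentiability in time. The derivative found in this way involves only the
  terminal covector of an extremal, so its second derivative in x is a matter for the inverse
  function theorem. That theorem requires short times to be free of conjugate points, which comes
  from the same estimate as the limit: the Gram operator is injective, and an error of size O(t)
  cannot destroy this. Competitors that leave the chart are harmless because the speed is bounded by
  a constant plus the Lagrangian, so that leaving costs a fixed amount while t tends to 0. The rate
  t^2 is explained by the dilations: vectors of flag order 0 are fixed by them, while each of the
  two covectors in the quadratic form carries one factor t.\<close>

abbreviation FD where "FD g x \<equiv> frechet_derivative g (at x)"

abbreviation sum_all :: "('i \<Rightarrow> 'a::comm_monoid_add) \<Rightarrow> 'a" (binder "SU " 10)
  where "sum_all f \<equiv> sum f UNIV"

notation has_vector_derivative (infix "has'_vd" 50) and scaleR (infixr "*R" 75)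
  and inner (infix "<.>" 70) and tendsto (infixr "--->" 55)

section \<open>Calculus of smooth maps\<close>

lemma Ck_on_imp_differentiable: "Ck_on (Suc k) S f ==> x : S ==> f differentiable (at x)" by simp

lemma Ck_on_has_derivative:
 "Ck_on (Suc k) S f ==> x : S ==> (f has_derivative FD f x) (at x)" by (simp add: frechet_derivative_works[symmetric])

lemma Ck_on_Suc_imp: "Ck_on (Suc k) S f ==> Ck_on k S f"
proof (induction k arbitrary: f)
 case 0
 thus ?case by (auto intro!: continuous_at_imp_continuous_on differentiable_imp_continuous_within)
qed (metis Ck_on.simps(2))

lemma Ck_on_le: "j <= k ==> Ck_on k S f ==> Ck_on j S f" by (induction rule: dec_induct) (blast dest: Ck_on_Suc_imp)+

lemma Ck_on_imp_continuous_on: "Ck_on k S f ==> continuous_on S f" using Ck_on_le[of 0 k S f] by simp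

lemma Ck_on_subset: "Ck_on k S f ==> T <= S ==> Ck_on k T f"
 by (induction k arbitrary: f) (auto intro: continuous_on_subset)

text \<open>The derivatives in \<open>Ck_on\<close> are taken over full neighbourhoods, so equality
  of the functions controls them only on an open set.\<close>

lemma Ck_on_cong:
 assumes "open S" "!!x. x : S ==> f x = g x" "Ck_on k S f"
 shows "Ck_on k S g" using assms(2,3)
proof (induction k arbitrary: f g)
 case 0
 thus ?case by (metis Ck_on.simps(1) continuous_on_cong)
next
 case (Suc k)
 have *: "FD f x = FD g x" if "x : S" for x
  using frechet_derivative_transform_within_open[of f x S g] Suc.prems that assms(1) by auto
 have "g differentiable at x" if "x : S" for x using Suc.prems that assms(1) unfolding Ck_on.simps differentiable_def
  by (meson has_derivative_transform_within_open)
 moreover have "Ck_on k S (%x. FD g x v)" for v by (rule Suc.IH[where f = "%x. FD f x v"]) (use Suc.prems * in auto)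
 ultimately show ?case by simp
qed

text \<open>Lets the inductive proofs below name a derivative explicitly; any derivative must equal
  \<open>frechet_derivative\<close>.\<close>

lemma Ck_on_SucI:
 assumes "open S" "!!x. x : S ==> (f has_derivative f' x) (at x)"
  and "!!v. Ck_on k S (%x. f' x v)"
 shows "Ck_on (Suc k) S f"
proof -
 have "f' x = FD f x" if "x : S" for x using assms(2) that by (auto intro: frechet_derivative_at)
 hence "Ck_on k S (%x. FD f x v)" for v by (intro Ck_on_cong[OF assms(1) _ assms(3)[of v]]) simp
 thus ?thesis using assms(2) by (auto simp: differentiable_def)
qed

lemma Ck_on_const [simp]: "Ck_on k S (%x. c)" by (induction k arbitrary: c) auto

lemma Ck_on_bounded_linear: assumes "bounded_linear h" shows "Ck_on k S h"
proof (cases k)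
 case 0
 thus ?thesis using assms by (simp add: linear_continuous_on)
next
 case (Suc j)
 have "FD h x = h" for x using assms bounded_linear_imp_has_derivative frechet_derivative_at by metis
 thus ?thesis using Suc assms by (auto simp: bounded_linear_imp_differentiable)
qed

lemma Ck_on_ident: "Ck_on k S (%x. x)" by (rule Ck_on_bounded_linear) simp

lemma Ck_on_linear_compose:
 assumes "open S" "bounded_linear h" "Ck_on k S f"
 shows "Ck_on k S (%x. h (f x))" using assms(3)
proof (induction k arbitrary: f)
 case 0
 thus ?case using assms by (auto intro: bounded_linear.continuous_on)
next
 case (Suc k)
 show ?case
 proof (rule Ck_on_SucI[OF assms(1)])
  show "((%x. h (f x)) has_derivative (%v. h (FD f x v))) (at x)" if "x : S" for x
   using bounded_linear.has_derivative[OF assms(2)] Ck_on_has_derivative[OF Suc.prems that] by blast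
  show "Ck_on k S (%x. h (FD f x v))" for v using Suc.IH Suc.prems by simp
 qed
qed

lemma Ck_on_add:
 assumes "open S" "Ck_on k S f" "Ck_on k S g"
 shows "Ck_on k S (%x. f x + g x)" using assms(2,3)
proof (induction k arbitrary: f g)
 case 0
 thus ?case by (simp add: continuous_on_add)
next
 case (Suc k)
 show ?case
 proof (rule Ck_on_SucI[OF assms(1)])
  show "((%x. f x + g x) has_derivative
    (%v. FD f x v + FD g x v)) (at x)" if "x : S" for x
   using Ck_on_has_derivative[OF Suc.prems(1) that] Ck_on_has_derivative[OF Suc.prems(2) that]
   by (rule has_derivative_add)
  show "Ck_on k S (%x. FD f x v + FD g x v)" for v using Suc.prems by (intro Suc.IH) auto
 qed
qed

lemma Ck_on_sum:
 assumes "open S" "!!i. i : I ==> Ck_on k S (f i)"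
 shows "Ck_on k S (%x. SUM i:I. f i x)" using assms(2)
proof (induction I rule: infinite_finite_induct)
 case (insert i I)
 have "Ck_on k S (%x. f i x + (SUM i:I. f i x))"
  by (rule Ck_on_add[OF assms(1) insert.prems insert.IH[OF insert.prems]]) simp_all
 thus ?case by (simp add: insert.hyps)
qed simp_all

lemma Ck_on_bilinear:
 assumes "open S" "bounded_bilinear pr" "Ck_on k S f" "Ck_on k S g"
 shows "Ck_on k S (%x. pr (f x) (g x))" using assms(3,4)
proof (induction k arbitrary: f g)
 case 0
 thus ?case using bounded_bilinear.continuous_on[OF assms(2)] by auto
next
 case (Suc k)
 show ?case
 proof (rule Ck_on_SucI[OF assms(1)])
  show "((%x. pr (f x) (g x)) has_derivative
    (%v. pr (f x) (FD g x v) + pr (FD f x v) (g x))) (at x)"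
   if "x : S" for x using Ck_on_has_derivative[OF Suc.prems(1) that] Ck_on_has_derivative[OF Suc.prems(2) that]
   by (rule bounded_bilinear.FDERIV[OF assms(2)])
  show "Ck_on k S (%x. pr (f x) (FD g x v) + pr (FD f x v) (g x))" for v
   using Suc.prems Ck_on_Suc_imp[OF Suc.prems(1)] Ck_on_Suc_imp[OF Suc.prems(2)]
   by (intro Ck_on_add[OF assms(1)] Suc.IH) simp_all
 qed
qed

lemmas Ck_on_scaleR = Ck_on_bilinear[OF _ bounded_bilinear_scaleR]
lemmas Ck_on_mult = Ck_on_bilinear[OF _ bounded_bilinear_mult]
lemmas Ck_on_inner = Ck_on_bilinear[OF _ bounded_bilinear_inner]

lemma Ck_on_uminus: "open S ==> Ck_on k S f ==> Ck_on k S (%x. - f x)"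
 using Ck_on_linear_compose[OF _ bounded_linear_minus[OF bounded_linear_ident]] .

lemma Ck_on_diff: "open S ==> Ck_on k S f ==> Ck_on k S g ==> Ck_on k S (%x. f x - g x)"
 using Ck_on_add[of S k f "%x. - g x"] Ck_on_uminus[of S k g] by simp

lemma Ck_on_prod:
 fixes f :: "'i => 'a::real_normed_vector => real"
 assumes "open S" "!!i. i : I ==> Ck_on k S (f i)"
 shows "Ck_on k S (%x. PROD i:I. f i x)" using assms(2)
proof (induction I rule: infinite_finite_induct)
 case (insert i I)
 have "Ck_on k S (%x. f i x * (PROD i:I. f i x))"
  by (rule Ck_on_mult[OF assms(1) insert.prems insert.IH[OF insert.prems]]) simp_all
 thus ?case by (simp add: insert.hyps)
qed simp_all

lemma Ck_on_Pair:
 assumes "open S" "Ck_on k S f" "Ck_on k S g"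
 shows "Ck_on k S (%x. (f x, g x))"
proof -
 have "bounded_linear (%a::'b. (a, 0::'c))" "bounded_linear (%a::'c. (0::'b, a))"
  by (auto intro: bounded_linear_Pair bounded_linear_ident bounded_linear_zero)
 hence "Ck_on k S (%x. (f x, 0) + (0, g x))"
  using assms by (intro Ck_on_add[OF assms(1)]) (rule Ck_on_linear_compose; assumption)+
 thus ?thesis by simp
qed

lemma linear_eq_sum_Basis:
 fixes h :: "'a::euclidean_space => 'b::real_vector"
 assumes "linear h"
 shows "h v = (SUM b:Basis. (v <.> b) *R h b)"
proof -
 have "h v = h (SUM b:Basis. (v <.> b) *R b)" by (simp add: euclidean_representation)
 thus ?thesis by (simp add: linear_sum[OF assms] linear_scale[OF assms])
qed

text \<open>In the derivative of the composite the direction fed to the derivative of g moves with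
  x, whereas \<open>Ck_on\<close> speaks of fixed directions. Expanding that direction in a basis
  gives finitely many products of functions covered by the induction hypothesis.\<close>

lemma Ck_on_compose:
 fixes f :: "'a::real_normed_vector => 'b::euclidean_space" and g :: "'b => 'c::real_normed_vector"
 assumes "open S" "open T" "Ck_on k S f" "Ck_on k T g" "f ` S <= T"
 shows "Ck_on k S (%x. g (f x))" using assms(3,4)
proof (induction k arbitrary: g)
 case 0
 thus ?case using assms(5) by (auto intro: continuous_on_compose2)
next
 case (Suc k)
 have fk: "Ck_on k S f" using Suc.prems Ck_on_Suc_imp by blast
 let ?D = "%x v. FD f x v"
 show ?case
 proof (rule Ck_on_SucI[OF assms(1)])
  show d: "((%x. g (f x)) has_derivative (%v. FD g (f x) (?D x v))) (at x)"
   if "x : S" for x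
  proof -
   have "f x : T" using that assms(5) by auto
   thus ?thesis using diff_chain_at[OF Ck_on_has_derivative[OF Suc.prems(1) that]
      Ck_on_has_derivative[OF Suc.prems(2)]] by (simp add: o_def)
  qed
  show "Ck_on k S (%x. FD g (f x) (?D x v))" for v
  proof (rule Ck_on_cong[OF assms(1)])
   show "Ck_on k S (%x. SUM b:Basis. (?D x v <.> b) *R FD g (f x) b)"
   proof (intro Ck_on_sum Ck_on_scaleR assms(1) Ck_on_inner)
    show "Ck_on k S (%x. ?D x v)" using Suc.prems by simp
    show "Ck_on k S (%x. FD g (f x) b)" for b using Suc.IH[OF fk, of "%y. FD g y b"] Suc.prems by simp
   qed simp
   show "(SUM b:Basis. (?D x v <.> b) *R FD g (f x) b) =
     FD g (f x) (?D x v)" if "x : S" for x using that assms(5) Ck_on_imp_differentiable[OF Suc.prems(2)]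
    by (intro linear_eq_sum_Basis[symmetric] linear_frechet_derivative) blast
  qed
 qed
qed

text \<open>The same basis expansion, for a derivative taken at a moving point in a moving
  direction: the shape of variational and Jacobi equations.\<close>

lemma Ck_on_frechet_apply:
 fixes f :: "'b::euclidean_space => 'c::real_normed_vector"
 assumes "open T" "open S" "Ck_on (Suc k) S f" "Ck_on k T g" "Ck_on k T h" "g ` T <= S"
 shows "Ck_on k T (%x. FD f (g x) (h x))"
proof (rule Ck_on_cong[OF assms(1)])
 show "Ck_on k T (%x. SUM b:Basis. (h x <.> b) *R FD f (g x) b)"
 proof (intro Ck_on_sum Ck_on_scaleR assms(1) Ck_on_inner assms(5) Ck_on_const)
  fix b :: 'b
  show "Ck_on k T (%x. FD f (g x) b)"
   using Ck_on_compose[OF assms(1,2,4) _ assms(6), of "%y. FD f y b"] assms(3) by simp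
 qed
 show "(SUM b:Basis. (h x <.> b) *R FD f (g x) b) = FD f (g x) (h x)"
  if "x : T" for x using that assms(6) Ck_on_imp_differentiable[OF assms(3)]
  by (intro linear_eq_sum_Basis[symmetric] linear_frechet_derivative) blast
qed

lemma Ck_on_inverse:
 fixes f :: "'a::real_normed_vector => real"
 assumes "open S" "Ck_on k S f" "!!x. x : S ==> f x ~= 0"
 shows "Ck_on k S (%x. inverse (f x))" using assms(2)
proof (induction k)
 case 0
 thus ?case using assms(3) by (auto intro: continuous_on_inverse)
next
 case (Suc k)
 show ?case
 proof (rule Ck_on_SucI[OF assms(1)])
  show "((%x. inverse (f x)) has_derivative
    (%v. - (inverse (f x) * FD f x v * inverse (f x)))) (at x)" if "x : S" for x
   by (rule Deriv.has_derivative_inverse[OF assms(3)[OF that] Ck_on_has_derivative[OF Suc.prems that]])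
  show "Ck_on k S (%x. - (inverse (f x) * FD f x v * inverse (f x)))" for v
   using Suc.prems Ck_on_Suc_imp[OF Suc.prems] by (intro Ck_on_uminus Ck_on_mult assms(1) Suc.IH) simp_all
 qed
qed

lemma Ck_on_component: "open S ==> Ck_on k S f ==> Ck_on k S (%x. (f x :: real^'n) $ i)"
 by (rule Ck_on_linear_compose) (auto simp: bounded_linear_vec_nth)

lemma Ck_on_euclidean:
 fixes f :: "'a::real_normed_vector => 'b::euclidean_space"
 assumes "open S" "!!b. b : Basis ==> Ck_on k S (%x. f x <.> b)"
 shows "Ck_on k S f"
proof -
 have "Ck_on k S (%x. SUM b:Basis. (f x <.> b) *R b)" by (intro Ck_on_sum Ck_on_scaleR assms Ck_on_const)
 thus ?thesis by (simp add: euclidean_representation)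
qed

lemma Ck_on_vec: "open S ==> (!!i. Ck_on k S (%x. (f x :: real^'n) $ i)) ==> Ck_on k S f"
 by (rule Ck_on_euclidean) (auto simp: Basis_vec_def inner_axis)

lemma Ck_on_det:
 fixes A :: "'a::real_normed_vector => real^'n^'n"
 assumes "open S" "!!i j. Ck_on k S (%x. A x $ i $ j)"
 shows "Ck_on k S (%x. det (A x))" unfolding det_def using assms
 by (intro Ck_on_sum Ck_on_mult Ck_on_prod Ck_on_const) auto

text \<open>Cramer's rule. It is stated for each finite k because it serves as a step of bootstraps,
  where d is a derivative whose regularity is still being built up.\<close>

lemma Ck_on_solve:
 fixes A :: "'a::real_normed_vector => real^'n^'n"
 assumes "open S" "!!i j. Ck_on k S (%x. A x $ i $ j)" "Ck_on k S b"
  and "!!x. x : S ==> det (A x) ~= 0" "!!x. x : S ==> A x *v d x = b x"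
 shows "Ck_on k S d"
proof (rule Ck_on_vec[OF assms(1)])
 fix i
 have e: "d x $ i = det (\<chi> i' j. if j = i then b x $ i' else A x $ i' $ j) * inverse (det (A x))" if "x : S" for x
  using cramer[OF assms(4)[OF that], of "d x" "b x"] assms(5)[OF that] by (simp add: divide_inverse)
 show "Ck_on k S (%x. d x $ i)"
 proof (rule Ck_on_cong[OF assms(1) e[symmetric]])
  show "Ck_on k S (%x. det (\<chi> i' j. if j = i then b x $ i' else A x $ i' $ j) * inverse (det (A x)))"
  proof (intro Ck_on_mult Ck_on_inverse Ck_on_det assms(1,2,4))
   fix i' j show "Ck_on k S (%x. (\<chi> i' j. if j = i then b x $ i' else A x $ i' $ j) $ i' $ j)"
    using assms by (cases "j = i") (auto intro: Ck_on_component)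
  qed auto
 qed auto
qed

lemma Ck_on_curveI:
 fixes g :: "real => 'b::real_normed_vector"
 assumes "open I" "!!t. t : I ==> (g has_vd g' t) (at t)" "Ck_on k I g'"
 shows "Ck_on (Suc k) I g" using assms unfolding has_vector_derivative_def
 by (intro Ck_on_SucI[where f' = "%t h. h *R g' t"] Ck_on_scaleR) auto

lemma Ck_on_curveD:
 fixes g :: "real => 'b::real_normed_vector"
 assumes "open I" "Ck_on (Suc k) I g"
 shows "t : I ==> (g has_vd vector_derivative g (at t)) (at t)"
  and "Ck_on k I (%t. vector_derivative g (at t))"
proof -
 have *: "g differentiable at t" if "t : I" for t using assms that by simp
 thus "t : I ==> (g has_vd vector_derivative g (at t)) (at t)" using vector_derivative_works by blast
 have "Ck_on k I (%t. FD g t 1)" using assms by simp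
 thus "Ck_on k I (%t. vector_derivative g (at t))"
  by (rule Ck_on_cong[OF assms(1), rotated]) (simp add: frechet_derivative_eq_vector_derivative[OF *])
qed

text \<open>Bootstrap: if z is C^k, then so is its velocity \<open>X (z t)\<close>, hence z is
  C^(k+1).\<close>

lemma Ck_on_autonomous_solution:
 fixes z :: "real => 'b::euclidean_space"
 assumes "open I" "open S" "!!k. Ck_on k S X" "z ` I <= S"
  and "!!t. t : I ==> (z has_vd X (z t)) (at t)"
 shows "Ck_on k I z"
proof (induction k)
 case 0
 thus ?case using assms(5) by (auto intro!: continuous_at_imp_continuous_on has_vector_derivative_continuous)
next
 case (Suc k)
 thus ?case using assms by (intro Ck_on_curveI[of I z "%t. X (z t)"] Ck_on_compose[of I S k z X])
qed

lemma smooth_onD: "smooth_on S f ==> Ck_on k S f" by (simp add: smooth_on_def)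

lemma smooth_onI: "(!!k. Ck_on k S f) ==> smooth_on S f" by (simp add: smooth_on_def)

lemma smooth_on_has_derivative:
 "smooth_on S f ==> x : S ==> (f has_derivative FD f x) (at x)" by (meson Ck_on_has_derivative smooth_on_def)

lemma smooth_on_deriv: "smooth_on S f ==> smooth_on S (%x. FD f x v)" by (metis Ck_on.simps(2) smooth_on_def)

lemma smooth_on_subset: "smooth_on S f ==> T <= S ==> smooth_on T f" by (meson Ck_on_subset smooth_on_def)

lemma smooth_on_continuous: "smooth_on S f ==> continuous_on S f" by (meson Ck_on_imp_continuous_on smooth_on_def)

lemma smooth_on_cong: "open S ==> (!!x. x : S ==> f x = g x) ==> smooth_on S f ==> smooth_on S g"
 using Ck_on_cong unfolding smooth_on_def by metis

lemma smooth_on_compose: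
 fixes f :: "'a::real_normed_vector => 'b::euclidean_space" and g :: "'b => 'c::real_normed_vector"
 shows "open S ==> open T ==> smooth_on S f ==> smooth_on T g ==> f ` S <= T ==>
  smooth_on S (%x. g (f x))" using Ck_on_compose unfolding smooth_on_def by metis

lemma smooth_on_frechet_apply:
 fixes f :: "'b::euclidean_space => 'c::real_normed_vector"
 assumes "open T" "open S" "smooth_on S f" "smooth_on T g" "smooth_on T h" "g ` T <= S"
 shows "smooth_on T (%x. FD f (g x) (h x))" using assms Ck_on_frechet_apply unfolding smooth_on_def by metis

lemma smooth_on_const: "smooth_on S (%x. c)" by (simp add: smooth_on_def)
lemma smooth_on_bounded_linear: "bounded_linear h ==> smooth_on S h" by (simp add: smooth_on_def Ck_on_bounded_linear)
lemma smooth_on_ident: "smooth_on S (%x. x)" by (simp add: smooth_on_def Ck_on_ident)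
lemma smooth_on_linear_compose:
 "open S ==> bounded_linear h ==> smooth_on S f ==> smooth_on S (%x. h (f x))"
 by (simp add: smooth_on_def Ck_on_linear_compose)
lemma smooth_on_diff: "open S ==> smooth_on S f ==> smooth_on S g ==> smooth_on S (%x. f x - g x)"
 by (simp add: smooth_on_def Ck_on_diff)
lemma smooth_on_uminus: "open S ==> smooth_on S f ==> smooth_on S (%x. - f x)"
 by (simp add: smooth_on_def Ck_on_uminus)
lemma smooth_on_sum: "open S ==> (!!i. i : I ==> smooth_on S (f i)) ==> smooth_on S (%x. SUM i:I. f i x)"
 by (simp add: smooth_on_def Ck_on_sum)
lemma smooth_on_scaleR: "open S ==> smooth_on S f ==> smooth_on S g ==> smooth_on S (%x. f x *R g x)"
 by (simp add: smooth_on_def Ck_on_scaleR)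
lemma smooth_on_inner: "open S ==> smooth_on S f ==> smooth_on S g ==> smooth_on S (%x. f x <.> g x)"
 by (simp add: smooth_on_def Ck_on_inner)
lemma smooth_on_Pair: "open S ==> smooth_on S f ==> smooth_on S g ==> smooth_on S (%x. (f x, g x))"
 by (simp add: smooth_on_def Ck_on_Pair)
lemma smooth_on_component: "open S ==> smooth_on S f ==> smooth_on S (%x. (f x :: real^'n) $ i)"
 by (simp add: smooth_on_def Ck_on_component)
lemma smooth_on_vec: "open S ==> (!!i. smooth_on S (%x. (f x :: real^'n) $ i)) ==> smooth_on S f"
 by (simp add: smooth_on_def Ck_on_vec)
lemma smooth_on_solve:
 fixes A :: "'a::real_normed_vector => real^'n^'n"
 assumes "open S" "!!i j. smooth_on S (%x. A x $ i $ j)" "smooth_on S b"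
  and "!!x. x : S ==> det (A x) ~= 0" "!!x. x : S ==> A x *v d x = b x"
 shows "smooth_on S d" unfolding smooth_on_def
 by (intro allI Ck_on_solve[OF assms(1) _ _ assms(4,5)] smooth_onD assms(2,3))

subsection \<open>Estimates on compact convex sets\<close>

text \<open>\<open>Ck_on\<close> controls derivatives one direction at a time; this turns bounds on
  basis vectors into a bound for the whole linear map.\<close>

lemma linear_norm_le_sum_Basis:
 fixes g :: "'a::euclidean_space => 'b::real_normed_vector"
 assumes "linear g" "!!b. b : Basis ==> norm (g b) <= c b"
 shows "norm (g v) <= (SUM b:Basis. c b) * norm v"
proof -
 have "norm (SUM b:Basis. (v <.> b) *R g b) <= (SUM b:Basis. norm v * c b)"
  by (rule sum_norm_le) (use assms(2) Basis_le_norm in "auto intro!: mult_mono")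
 thus ?thesis by (simp add: linear_eq_sum_Basis[OF assms(1), symmetric] sum_distrib_left mult.commute)
qed

lemma C1_derivative_bound:
 fixes f :: "'a::euclidean_space => 'b::real_normed_vector"
 assumes "Ck_on (Suc 0) S f" "compact K" "K <= S"
 obtains C where "C >= 0" "!!x v. x : K ==> norm (FD f x v) <= C * norm v"
proof -
 have "EX M. ALL x:K. norm (FD f x b) <= M" for b
 proof -
  have "continuous_on K (%x. FD f x b)" using assms by (auto intro: continuous_on_subset)
  hence "bounded ((%x. FD f x b) ` K)" by (intro compact_imp_bounded compact_continuous_image assms(2))
  thus ?thesis unfolding bounded_iff by blast
 qed
 hence "ALL b. EX M. ALL x:K. norm (FD f x b) <= M" by blast
 from choice[OF this] obtain M
  where M: "!!b x. x : K ==> norm (FD f x b) <= M b" by blast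
 show thesis
 proof
  show "0 <= (SUM b:(Basis::'a set). \<bar>M b\<bar>)" by (simp add: sum_nonneg)
  fix x v assume x: "x : K"
  show "norm (FD f x v) <= (SUM b:(Basis::'a set). \<bar>M b\<bar>) * norm v" by (rule linear_norm_le_sum_Basis)
    (use assms x order_trans[OF M[OF x] abs_ge_self] in "auto intro: linear_frechet_derivative")
 qed
qed

lemma C1_lipschitz:
 fixes f :: "'a::euclidean_space => 'b::real_normed_vector"
 assumes "Ck_on (Suc 0) S f" "compact K" "convex K" "K <= S"
 obtains C where "C >= 0" "!!x y. x : K ==> y : K ==> norm (f y - f x) <= C * norm (y - x)"
proof -
 obtain C where C: "C >= 0" "!!x v. x : K ==> norm (FD f x v) <= C * norm v"
  by (rule C1_derivative_bound[OF assms(1,2,4)]) (blast intro: that)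
 show thesis
 proof
  fix x y assume "x : K" "y : K"
  thus "norm (f y - f x) <= C * norm (y - x)"
  proof (intro differentiable_bound[of K f "%x. FD f x" C y x] assms(3))
   fix x assume "x : K"
   thus "(f has_derivative FD f x) (at x within K)"
    using assms Ck_on_has_derivative has_derivative_at_withinI by blast
   show "onorm (FD f x) <= C" using C `x : K` by (intro onorm_bound) auto
  qed
 qed (use C in auto)
qed

lemma C2_derivative_lipschitz:
 fixes f :: "'a::euclidean_space => 'b::real_normed_vector"
 assumes "Ck_on (Suc (Suc 0)) S f" "compact K" "convex K" "K <= S"
 obtains C where "C >= 0" "!!x y v. x : K ==> y : K ==>
  norm (FD f y v - FD f x v) <= C * norm (y - x) * norm v"
proof -
 have "EX C>=0. ALL x:K. ALL y:K. norm (FD f y b - FD f x b) <= C * norm (y - x)" for b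
 proof -
  have "Ck_on (Suc 0) S (%x. FD f x b)" using assms(1) by simp
  thus ?thesis by (rule C1_lipschitz[OF _ assms(2,3,4)]) blast
 qed
 hence "ALL b. EX C. 0 <= C & (ALL x:K. ALL y:K. norm (FD f y b - FD f x b) <= C * norm (y - x))" by blast
 from choice[OF this] obtain M where M0: "!!b. M b >= 0" and M: "!!b x y. x : K ==> y : K ==>
   norm (FD f y b - FD f x b) <= M b * norm (y - x)" by blast
 let ?C = "SUM b:(Basis::'a set). M b"
 have lin: "linear (FD f x)" if "x : K" for x
  using assms that by (meson Ck_on_imp_differentiable linear_frechet_derivative subsetD)
 have D: "norm (FD f y v - FD f x v) <= ?C * norm (y - x) * norm v"
  if "x : K" "y : K" for x y v
  using linear_norm_le_sum_Basis[OF linear_compose_sub[OF lin[OF that(2)] lin[OF that(1)]] M[OF that], of v]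
  by (simp add: sum_distrib_right)
 moreover have "0 <= ?C" by (simp add: sum_nonneg M0)
 ultimately show thesis using that by blast
qed

text \<open>The remainder is an increment along the segment of the map with its linear part at x
  removed, and the derivative of that map is small by the Lipschitz bound.\<close>

lemma C2_taylor_bound:
 fixes f :: "'a::euclidean_space => 'b::real_normed_vector"
 assumes "Ck_on (Suc (Suc 0)) S f" "compact K" "convex K" "K <= S"
 obtains C where "C >= 0"
  "!!x y. x : K ==> y : K ==> norm (f y - f x - FD f x (y - x)) <= C * (norm (y - x))\<^sup>2"
proof -
 obtain C where C0: "C >= 0" and D: "!!x y v. x : K ==> y : K ==>
   norm (FD f y v - FD f x v) <= C * norm (y - x) * norm v"
  by (rule C2_derivative_lipschitz[OF assms]) (blast intro: that)
 show thesis
 proof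
  show "0 <= C" by (rule C0)
  fix x y assume xy: "x : K" "y : K"
  have seg: "closed_segment x y <= K" using xy assms(3) by (simp add: closed_segment_subset)
  have "norm (f y - f x - FD f x (y - x)) <= norm (y - x) * (C * norm (y - x))"
  proof (rule differentiable_bound_linearization[where S = "closed_segment x y" and f' = "%x. FD f x"])
   show "x + t *R (y - x) : closed_segment x y" if "t : {0..1}" for t
    using that by (auto simp: in_segment algebra_simps intro!: exI[of _ t])
   show "(f has_derivative FD f z) (at z within closed_segment x y)" if "z : closed_segment x y" for z
    using assms Ck_on_has_derivative has_derivative_at_withinI that seg by (metis subset_iff)
   fix z assume z: "z : closed_segment x y"
   hence "norm (z - x) <= norm (y - x)" using segment_bound(1)[of z x y] by (simp add: norm_minus_commute)
   hence "C * norm (z - x) * norm v <= C * norm (y - x) * norm v" for v :: 'a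
    using C0 by (intro mult_right_mono mult_left_mono) auto
   thus "onorm (FD f z - FD f x) <= C * norm (y - x)"
    unfolding fun_diff_def using D[OF xy(1) subsetD[OF seg z]] C0 by (intro onorm_bound) (auto intro: order_trans)
  qed auto
  thus "norm (f y - f x - FD f x (y - x)) <= C * (norm (y - x))\<^sup>2" by (simp add: power2_eq_square mult_ac)
 qed
qed

section \<open>Symmetry of second derivatives\<close>

lemma real_mvt_directional:
 fixes f :: "'a::real_normed_vector => real"
 assumes "open S" "!!x. x : S ==> f differentiable (at x)" "0 < h"
  and "!!s. 0 <= s ==> s <= h ==> x + s *R v : S"
 obtains s where "0 < s" "s < h" "f (x + h *R v) - f x = h * FD f (x + s *R v) v"
proof -
 let ?g = "%s. f (x + s *R v)"
 have d: "(?g has_real_derivative FD f (x + s *R v) v) (at s)" if "0 <= s" "s <= h" for s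
 proof -
  let ?D = "FD f (x + s *R v)"
  have f: "(f has_derivative ?D) (at (x + s *R v))"
   using assms(2)[OF assms(4)[OF that]] frechet_derivative_works by blast
  have "((%s. x + s *R v) has_derivative (%t. t *R v)) (at s)" by (auto intro!: derivative_eq_intros)
  from diff_chain_at[OF this f] have "(?g has_derivative (%t. ?D (t *R v))) (at s)" by (simp add: o_def)
  moreover have "?D (t *R v) = ?D v * t" for t using linear_scale[OF has_derivative_linear[OF f]] by simp
  ultimately show ?thesis by (simp add: has_field_derivative_def)
 qed
 have "continuous_on {0..h} ?g" using DERIV_isCont[OF d] by (intro continuous_at_imp_continuous_on) auto
 moreover have "?g differentiable (at s)" if "0 < s" "s < h" for s using d[of s] that real_differentiable_def by auto
 ultimately obtain l s where s: "0 < s" "s < h" "DERIV ?g s :> l" "?g h - ?g 0 = (h - 0) * l"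
  using MVT[of 0 h ?g] assms(3) by blast
 hence "l = FD f (x + s *R v) v" using d[of s] DERIV_unique by fastforce
 thus thesis using that s by auto
qed

text \<open>Both mixed derivatives are limits of the same second difference.\<close>

lemma second_derivative_symmetric_real:
 fixes f :: "'a::real_normed_vector => real"
 assumes S: "open S" and f: "Ck_on (Suc (Suc 0)) S f" and x: "x : S"
 shows "FD (%y. FD f y v) x w =
  FD (%y. FD f y w) x v" (is "?A v w x = ?A w v x")
proof (rule ccontr)
 let ?D = "%v y. FD f y v"
 assume ne: "?A v w x ~= ?A w v x"
 have cont: "continuous_on S (?A v w)" for v w using f by simp
 define e where "e = \<bar>?A v w x - ?A w v x\<bar> / 2"
 have e: "e > 0" using ne by (simp add: e_def)
 have "EX d>0. ALL y. dist y x < d --> y : S & \<bar>?A v w y - ?A v w x\<bar> < e" for v w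
 proof -
  have "isCont (?A v w) x" using cont S x continuous_on_eq_continuous_at by blast
  then obtain d1 where "d1 > 0" "ALL y. dist y x < d1 --> \<bar>?A v w y - ?A v w x\<bar> < e"
   using e unfolding continuous_at_eps_delta dist_real_def by (metis dist_commute)
  moreover obtain d2 where "d2 > 0" "ALL y. dist y x < d2 --> y : S" using S x unfolding open_dist by blast
  ultimately show ?thesis by (intro exI[of _ "min d1 d2"]) auto
 qed
 then obtain d1 d2 where d1: "d1 > 0" "!!y. dist y x < d1 ==> y : S & \<bar>?A v w y - ?A v w x\<bar> < e"
  and d2: "d2 > 0" "!!y. dist y x < d2 ==> y : S & \<bar>?A w v y - ?A w v x\<bar> < e" by metis
 \<comment> \<open>Small enough that the parallelogram spanned by h v and h w lies where both mixed
   derivatives are within e of their values at x; the summand 1 keeps the denominator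
   positive.\<close>
 define h where "h = min d1 d2 / (norm v + norm w + 1)"
 have h: "h > 0" unfolding h_def using d1 d2 by (intro divide_pos_pos) (auto intro: add_nonneg_pos)
 have near: "dist (x + s *R v' + t *R w') x < min d1 d2"
  if "0 <= s" "s <= h" "0 <= t" "t <= h" "norm v' + norm w' = norm v + norm w" for s t v' w'
 proof -
  have "norm (s *R v' + t *R w') <= s * norm v' + t * norm w'"
   using norm_triangle_ineq[of "s *R v'" "t *R w'"] that by simp
  also have "... <= h * (norm v' + norm w')"
   unfolding distrib_left using that by (intro add_mono mult_right_mono) auto
  also have "... < h * (norm v + norm w + 1)" using h that by simp
  also have "... = min d1 d2"
  proof -
   have "norm v + norm w + 1 ~= 0" using norm_ge_zero[of v] norm_ge_zero[of w] by linarith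
   thus ?thesis by (simp add: h_def)
  qed
  finally show ?thesis by (simp add: dist_norm add.assoc)
 qed
 have key: "EX y. dist y x < min d1 d2 & f (x + h *R v' + h *R w') - f (x + h *R v') - (f (x + h *R w') - f x) = h * h * ?A v' w' y"
  if vw: "norm v' + norm w' = norm v + norm w" for v' w'
 proof -
  \<comment> \<open>The increment \<open>?g\<close> is differentiable where a point and its
    translate by h w' both lie in S. One mean value step in direction v' and one in direction w'
    then turn the second difference into a mixed derivative.\<close>
  define S' where "S' = S Int (%y. y + h *R w') -` S"
  have oS': "open S'" unfolding S'_def by (intro open_Int S open_vimage continuous_intros)
  have mem: "x + s *R v' + t *R w' : S" if "0 <= s" "s <= h" "0 <= t" "t <= h" for s t
   using near[OF that vw] d1 by auto
  let ?g = "%y. f (y + h *R w') - f y"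
  have gd: "(?g has_derivative (%u. ?D u (y + h *R w') - ?D u y)) (at y)" if "y : S'" for y
  proof (rule has_derivative_diff)
   show "(f has_derivative (%u. ?D u y)) (at y)" using Ck_on_has_derivative[OF f] that by (simp add: S'_def)
   have "(f has_derivative (%u. ?D u (y + h *R w'))) (at (y + h *R w'))"
    using Ck_on_has_derivative[OF f] that by (simp add: S'_def)
   moreover have "((%y. y + h *R w') has_derivative (%u. u)) (at y)" by (auto intro!: derivative_eq_intros)
   ultimately show "((%y. f (y + h *R w')) has_derivative (%u. ?D u (y + h *R w'))) (at y)"
    using diff_chain_at by (fastforce simp: o_def)
  qed
  obtain s where s: "0 < s" "s < h"
   "?g (x + h *R v') - ?g x = h * FD ?g (x + s *R v') v'"
  proof (rule real_mvt_directional[OF oS' _ h, of ?g x v'])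
   show "?g differentiable (at y)" if "y : S'" for y using gd[OF that] differentiableI by blast
   show "x + s *R v' : S'" if "0 <= s" "s <= h" for s
    using mem[OF that, of 0] mem[OF that, of h] h by (simp add: S'_def)
  qed blast
  have xs: "x + s *R v' : S'" using mem[of s 0] mem[of s h] s h by (simp add: S'_def)
  have eq1: "FD ?g (x + s *R v') v' = ?D v' (x + s *R v' + h *R w') - ?D v' (x + s *R v')"
   using frechet_derivative_at[OF gd[OF xs]] by metis
  obtain t where t: "0 < t" "t < h"
   "?D v' (x + s *R v' + h *R w') - ?D v' (x + s *R v') = h * ?A v' w' (x + s *R v' + t *R w')"
  proof (rule real_mvt_directional[OF S _ h, of "?D v'" "x + s *R v'" w'])
   show "?D v' differentiable (at y)" if "y : S" for y using f that by simp
   show "x + s *R v' + t *R w' : S" if "0 <= t" "t <= h" for t using mem that s by simp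
  qed blast
  show ?thesis using near[of s t v' w'] s t vw eq1 by (intro exI[of _ "x + s *R v' + t *R w'"]) auto
 qed
 obtain y where y: "dist y x < min d1 d2"
  "f (x + h *R v + h *R w) - f (x + h *R v) - (f (x + h *R w) - f x) = h * h * ?A v w y" using key[of v w] by blast
 obtain z where z: "dist z x < min d1 d2"
  "f (x + h *R w + h *R v) - f (x + h *R w) - (f (x + h *R v) - f x) = h * h * ?A w v z" using key[of w v] by auto
 have "f (x + h *R v + h *R w) = f (x + h *R w + h *R v)" by (simp add: add_ac)
 hence "h * h * ?A v w y = h * h * ?A w v z" using y(2) z(2) by linarith
 hence "?A v w y = ?A w v z" using h by simp
 moreover have "\<bar>?A v w y - ?A v w x\<bar> < e" "\<bar>?A w v z - ?A w v x\<bar> < e"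
  using y(1) z(1) d1 d2 by auto
 moreover have "\<bar>a - p\<bar> < \<bar>p - q\<bar> / 2 ==> \<bar>a - q\<bar> < \<bar>p - q\<bar> / 2 ==> False" for a p q :: real
  using abs_triangle_ineq[of "p - a" "a - q"] by (simp add: abs_minus_commute[of p a])
 ultimately show False unfolding e_def by metis
qed

lemma second_derivative_symmetric:
 fixes f :: "'a::real_normed_vector => 'b::euclidean_space"
 assumes S: "open S" and f: "Ck_on (Suc (Suc 0)) S f" and x: "x : S"
 shows "FD (%y. FD f y v) x w =
  FD (%y. FD f y w) x v"
proof (rule euclidean_eqI)
 fix b :: 'b assume "b : Basis"
 let ?fb = "%y. f y <.> b"
 have bl: "bounded_linear (%y::'b. y <.> b)" by (rule bounded_linear_inner_left)
 have fb: "Ck_on (Suc (Suc 0)) S ?fb" by (rule Ck_on_linear_compose[OF S bl f])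
 have d1: "FD ?fb y u = FD f y u <.> b" if "y : S" for y u
  using frechet_derivative_at[OF bounded_linear.has_derivative[OF bl Ck_on_has_derivative[OF f that]]] by metis
 have d2: "FD (%y. FD ?fb y u) x u' =
   FD (%y. FD f y u) x u' <.> b" for u u'
 proof -
  have "Ck_on (Suc 0) S (%y. FD f y u)" using f by simp
  hence "((%y. FD f y u <.> b) has_derivative
    (%u'. FD (%y. FD f y u) x u' <.> b)) (at x)"
   by (intro bounded_linear.has_derivative[OF bl] Ck_on_has_derivative[OF _ x])
  hence "((%y. FD ?fb y u) has_derivative
    (%u'. FD (%y. FD f y u) x u' <.> b)) (at x)"
   by (rule has_derivative_transform_within_open[OF _ S x]) (simp add: d1)
  thus ?thesis using frechet_derivative_at by metis
 qed
 show "FD (%y. FD f y v) x w <.> b =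
  FD (%y. FD f y w) x v <.> b" using second_derivative_symmetric_real[OF S fb x, of v w] by (simp add: d2)
qed

subsection \<open>Increments of Lipschitz functions\<close>

text \<open>The increment is the limit of the integrals of the difference quotients, to which dominated
  convergence applies.\<close>

lemma lipschitz_increment_le_integral:
 fixes f G :: "real => real"
 assumes ab: "a <= b" and lip: "C-lipschitz_on {a..b} f" and G: "integrable (lebesgue_on {a..b}) G"
  and ae: "AE x in lebesgue_on {a..b}. EX d. (f has_vd d) (at x within {a..b}) & d <= G x"
 shows "f b - f a <= (LINT x|lebesgue_on {a..b}. G x)"
proof -
 \<comment> \<open>Constant continuation beyond the end points keeps the difference quotients
   defined near b and the function globally Lipschitz.\<close>
 define F where "F x = f (max a (min b x))" for x
 have cl: "max a (min b x) : {a..b}" for x using ab by auto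
 have C0: "C >= 0" using lip lipschitz_on_nonneg by blast
 have Flip: "\<bar>F x - F y\<bar> <= C * \<bar>x - y\<bar>" for x y
 proof -
  have "\<bar>F x - F y\<bar> <= C * \<bar>max a (min b x) - max a (min b y)\<bar>"
   using lipschitz_onD[OF lip cl cl] by (simp add: F_def dist_real_def)
  also have "... <= C * \<bar>x - y\<bar>" by (intro mult_left_mono C0) (auto simp: max_def min_def)
  finally show ?thesis .
 qed
 have "C-lipschitz_on UNIV F" using Flip C0 by (intro lipschitz_onI) (auto simp: dist_real_def)
 hence Fc: "continuous_on UNIV F" by (rule lipschitz_on_continuous_on)
 hence Fc': "continuous_on S F" for S using continuous_on_subset by blast
 define q where "q n x = real (Suc n) * (F (x + 1 / real (Suc n)) - F x)" for n x
 have qc: "continuous_on S (q n)" for n S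
  unfolding q_def by (intro continuous_intros continuous_on_compose2[OF Fc]) auto
 let ?M = "lebesgue_on {a..b}"
 have qm: "q n : borel_measurable ?M" for n by (intro continuous_imp_measurable_on_sets_lebesgue qc) auto
 define g0 where "g0 x = lim (%n. q n x)" for x
 have g0m: "g0 : borel_measurable ?M" unfolding g0_def by (rule borel_measurable_lim_metric[OF qm])
 \<comment> \<open>At the end points the derivative within the interval is only one-sided; two
   points form a null set.\<close>
 have "AE x in lebesgue_on {a..b}. x ~= a & x ~= b"
 proof -
  have "{a, b} : null_sets lebesgue" by (simp add: negligible_iff_null_sets[symmetric])
  hence "AE x in lebesgue. x ~: {a, b}" by (rule AE_not_in)
  hence "AE x in lebesgue. x : {a..b} --> x ~= a & x ~= b" by eventually_elim auto
  thus ?thesis by (subst AE_restrict_space_iff) simp_all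
 qed
 hence conv: "AE x in ?M. (%n. q n x) \<longlonglongrightarrow> g0 x & g0 x <= G x" using ae AE_space
 proof eventually_elim
  case (elim x)
  hence x: "a < x" "x < b" by auto
  from elim obtain d where d: "(f has_vd d) (at x within {a..b})" "d <= G x" by blast
  have "(f has_real_derivative d) (at x)"
   using d(1) x at_within_Icc_at[of a x b] by (simp add: has_real_derivative_iff_has_vector_derivative)
  moreover have "eventually (%y. f y = F y) (nhds x)"
   using eventually_nhds_in_open[of "{a<..<b}" x] x by (auto elim!: eventually_mono simp: F_def)
  ultimately have FD: "(F has_real_derivative d) (at x)" using DERIV_cong_ev[of x x f F d d] by simp
  have "filterlim (%n. 1 / real (Suc n)) (at 0) sequentially"
   unfolding filterlim_at using LIMSEQ_inverse_real_of_nat by (auto simp: inverse_eq_divide)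
  from filterlim_compose[OF FD[unfolded DERIV_def] this] have lim: "(%n. q n x) \<longlonglongrightarrow> d"
   by (simp add: q_def field_simps)
  thus ?case using d(2) by (simp add: g0_def limI)
 qed
 have qb: "norm (q n x) <= C" for n x
 proof -
  have "\<bar>q n x\<bar> <= real (Suc n) * (C * (1 / real (Suc n)))"
   unfolding q_def abs_mult using Flip[of "x + 1 / real (Suc n)" x] by (intro mult_mono) auto
  thus ?thesis by simp
 qed
 have fm: "finite_measure ?M" by (rule finite_measure_lebesgue_on) (auto simp: lmeasurable_cbox)
 have Ci: "integrable ?M (%x. C)" using fm by (rule finite_measure.integrable_const)
 have "(%n. LINT x|?M. q n x) \<longlonglongrightarrow> (LINT x|?M. g0 x)" "integrable ?M g0"
  using integral_dominated_convergence[OF g0m qm Ci] integrable_dominated_convergence[OF g0m qm Ci] conv qb by auto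
 moreover have "(%n. LINT x|?M. q n x) \<longlonglongrightarrow> f b - f a"
 proof -
  have Fint: "F integrable_on {u..v}" for u v by (intro integrable_continuous_interval Fc')
  define J where "J u = integral {a..u} F" for u
  have J: "(J has_real_derivative F a) (at a within {a..b + 1})"
   unfolding J_def using integral_has_real_derivative[of a "b + 1" F a] Fc' ab by auto
  \<comment> \<open>Translation cancels the bulk of the integral and leaves boundary terms: on the
    right the continued function is the constant f b, on the left there is an average over an
    interval shrinking to a.\<close>
  have eq: "(LINT x|?M. q n x) = f b - real (Suc n) * (J (a + 1 / real (Suc n)) - J a)" for n
  proof -
   let ?h = "1 / real (Suc n)"
   have hp: "?h > 0" by simp
   have "(LINT x|?M. q n x) = integral {a..b} (q n)"
    by (intro lebesgue_integral_eq_integral continuous_imp_integrable_real qc) auto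
   also have "... = real (Suc n) * (integral {a..b} (%x. F (x + ?h)) - integral {a..b} F)" unfolding q_def
    by (subst integral_mult_right, subst Henstock_Kurzweil_Integration.integral_diff)
     (auto intro!: integrable_continuous_interval Fc' continuous_on_compose2[OF Fc] continuous_intros)
   also have "integral {a..b} (%x. F (x + ?h)) = integral {a + ?h..b + ?h} F"
    using integral_shift_Icc_real[of a b F ?h] by (simp add: o_def add.commute)
   also have "... = integral {a..b} F + integral {b..b + ?h} F - integral {a..a + ?h} F"
    using Henstock_Kurzweil_Integration.integral_combine[of a b "b + ?h" F]
     Henstock_Kurzweil_Integration.integral_combine[of a "a + ?h" "b + ?h" F] Fint ab hp by simp
   also have "integral {b..b + ?h} F = ?h * f b"
   proof -
    have "integral {b..b + ?h} F = integral {b..b + ?h} (%x. f b)"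
     using ab by (intro Henstock_Kurzweil_Integration.integral_cong) (auto simp: F_def max_def min_def)
    thus ?thesis using hp by simp
   qed
   also have "real (Suc n) * (integral {a..b} F + ?h * f b - integral {a..a + ?h} F - integral {a..b} F) =
     (real (Suc n) * ?h) * f b - real (Suc n) * integral {a..a + ?h} F" by (simp only: algebra_simps)
   also have "real (Suc n) * ?h = 1" by simp
   finally show ?thesis by (simp add: J_def)
  qed
  have "filterlim (%n. a + 1 / real (Suc n)) (at a within {a..b + 1}) sequentially"
  proof -
   have "(%n. a + 1 / real (Suc n)) \<longlonglongrightarrow> a + 0"
    using LIMSEQ_inverse_real_of_nat by (intro tendsto_add) (auto simp: inverse_eq_divide)
   moreover have "1 / real (Suc n) <= 1" for n by simp
   hence "a + 1 / real (Suc n) <= b + 1" for n using ab by (metis add_mono)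
   ultimately show ?thesis unfolding filterlim_at using ab by auto
  qed
  from filterlim_compose[OF J[unfolded has_field_derivative_iff] this]
  have "(%n. real (Suc n) * (J (a + 1 / real (Suc n)) - J a)) \<longlonglongrightarrow> F a"
   by (simp add: field_simps)
  hence "(%n. f b - real (Suc n) * (J (a + 1 / real (Suc n)) - J a)) \<longlonglongrightarrow> f b - F a"
   by (intro tendsto_intros)
  thus ?thesis unfolding eq using ab by (simp add: F_def)
 qed
 ultimately have "f b - f a = (LINT x|?M. g0 x)" "integrable ?M g0" using LIMSEQ_unique by auto
 moreover have "(LINT x|?M. g0 x) <= (LINT x|?M. G x)"
  using conv by (intro integral_mono_AE `integrable ?M g0` G) auto
 ultimately show ?thesis by simp
qed

text \<open>Touching at t bounds the increment of h from below by that of \<open>b t\<close>;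
  touching at y, with the roles exchanged, bounds it from above by that of \<open>b y\<close>.
  Continuity of B on the diagonal makes the two bounds agree to first order, so no regularity of h
  enters.\<close>

lemma touching_derivative:
 fixes h :: "real => real"
 assumes "open I" "t : I" "is_interval I"
  and b: "!!s s'. s : I ==> s' : I ==> (b s has_real_derivative B s s') (at s')"
  and touch: "!!s s'. s : I ==> s' : I ==> b s s' - b s s <= h s' - h s"
  and cont: "continuous (at (t, t)) (%(s, s'). B s s')"
 shows "(h has_real_derivative B t t) (at t)" unfolding has_field_derivative_def
proof (rule has_derivativeI)
 show "bounded_linear ((*) (B t t))" by (rule bounded_linear_mult_right)
 show "((%y. (h y - h t - B t t * (y - t)) /\<^sub>R norm (y - t)) ---> 0) (at t)"
 proof (rule tendstoI)
  fix e :: real assume e: "e > 0"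
  obtain d where d: "d > 0" "!!s s'. dist (s, s') (t, t) < d ==> \<bar>B s s' - B t t\<bar> < e / 2"
   using cont half_gt_zero[OF e] unfolding continuous_at_eps_delta dist_real_def
   by (metis (mono_tags, lifting) case_prod_conv)
  obtain d' where d': "d' > 0" "ball t d' <= I" using assms(1,2) openE by blast
  have est: "\<bar>b s s2 - b s s1 - B t t * (s2 - s1)\<bar> <= e / 2 * \<bar>s2 - s1\<bar>"
   if "{s, s1, s2} <= ball t (min (d / 2) d')" for s s1 s2
  proof -
   let ?U = "ball t (min (d / 2) d')"
   have "norm ((b s s2 - B t t * s2) - (b s s1 - B t t * s1)) <= (e / 2) * norm (s2 - s1)"
   proof (rule differentiable_bound[of ?U "%s'. b s s' - B t t * s'" "%s'. (*) (B s s' - B t t)"])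
    fix s' assume s': "s' : ?U"
    have "((%s'. b s s' - B t t * s') has_real_derivative (B s s' - B t t)) (at s')"
     using s' that d' by (auto intro!: derivative_eq_intros b)
    thus "((%s'. b s s' - B t t * s') has_derivative (*) (B s s' - B t t)) (at s' within ?U)"
     unfolding has_field_derivative_def by (rule has_derivative_at_withinI)
    have "dist (s, s') (t, t) <= dist s t + dist s' t" by (simp add: dist_Pair_Pair sqrt_sum_squares_le_sum)
    hence "dist (s, s') (t, t) < d" using s' that by (auto simp: dist_commute)
    hence "\<bar>B s s' - B t t\<bar> <= e / 2" using d(2) by (simp add: less_imp_le)
    thus "onorm ((*) (B s s' - B t t)) <= e / 2"
     using e by (intro onorm_bound) (simp, unfold real_norm_def abs_mult, erule mult_right_mono, simp)
   qed (use that in auto)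
   thus ?thesis by (simp add: algebra_simps)
  qed
  have "\<forall>\<^sub>F y in at t. y : ball t (min (d / 2) d') & y ~= t"
   unfolding eventually_at using d d' by (intro exI[of _ "min (d / 2) d'"]) (auto simp: dist_commute)
  thus "\<forall>\<^sub>F y in at t. dist ((h y - h t - B t t * (y - t)) /\<^sub>R norm (y - t)) 0 < e"
  proof eventually_elim
   case (elim y)
   hence y: "y : I" using d' by auto
   have tm: "t : ball t (min (d / 2) d')" using d d' by auto
   have "b t y - b t t <= h y - h t" using touch[OF assms(2) y] by simp
   moreover have "h y - h t <= b y y - b y t" using touch[OF y assms(2)] by simp
   moreover have "\<bar>b t y - b t t - B t t * (y - t)\<bar> <= e / 2 * \<bar>y - t\<bar>"
    "\<bar>b y y - b y t - B t t * (y - t)\<bar> <= e / 2 * \<bar>y - t\<bar>"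
    using est[of t t y] est[of y t y] elim tm by auto
   ultimately have "\<bar>h y - h t - B t t * (y - t)\<bar> <= e / 2 * \<bar>y - t\<bar>" by linarith
   also have "... < e * \<bar>y - t\<bar>" using e elim by simp
   finally show ?case using elim by (simp add: field_simps)
  qed
 qed
qed

section \<open>Local flows\<close>

lemma derivative_increment_bound:
 fixes e :: "real => 'a::real_normed_vector"
 assumes "!!s. s : {a..b} ==> (e has_vd e' s) (at s within {a..b})"
  and "!!s. s : {a..b} ==> norm (e' s) <= B" "s : {a..b}" "t : {a..b}"
 shows "norm (e s - e t) <= B * \<bar>s - t\<bar>"
proof -
 have "norm (e s - e t) <= B * norm (s - t)"
 proof (rule differentiable_bound[of "{a..b}" e "%s h. h *R e' s"])
  show "onorm (%h. h *R e' x) <= B" if "x : {a..b}" for x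
  proof (rule onorm_le)
   show "norm (h *R e' x) <= B * norm h" for h
    using mult_right_mono[OF assms(2)[OF that] abs_ge_zero[of h]] by (simp add: mult.commute)
  qed
 qed (use assms in "auto simp: has_vector_derivative_def")
 thus ?thesis by simp
qed

text \<open>On an interval of length at most \<open>1 / (2 K)\<close> Gronwall's estimate needs no exponential: it
  follows from the mean value inequality at a point of maximal norm.\<close>

lemma short_gronwall:
 fixes e :: "real => 'a::real_normed_vector"
 assumes d: "!!s. s : {a..b} ==> (e has_vd e' s) (at s within {a..b})"
  and bd: "!!s. s : {a..b} ==> norm (e' s) <= K * norm (e s) + de"
  and K: "0 <= K" "0 <= de" "(b - a) * K <= 1 / 2" and t0: "t0 : {a..b}" and s: "s : {a..b}"
 shows "norm (e s) <= 2 * (norm (e t0) + (b - a) * de)"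
proof -
 have "continuous_on {a..b} (%s. norm (e s))"
  using d by (intro continuous_intros) (meson continuous_on_vector_derivative)
 then obtain m where m: "m : {a..b}" "!!s. s : {a..b} ==> norm (e s) <= norm (e m)"
  using continuous_attains_sup[of "{a..b}"] s by (metis atLeastAtMost_iff compact_Icc empty_iff)
 let ?B = "K * norm (e m) + de"
 have "norm (e m - e t0) <= ?B * \<bar>m - t0\<bar>"
 proof (rule derivative_increment_bound[OF d _ m(1) t0])
  show "norm (e' s) <= ?B" if "s : {a..b}" for s using bd[OF that] mult_left_mono[OF m(2)[OF that] K(1)] by linarith
 qed
 also have "... <= ?B * (b - a)" using K m t0 by (intro mult_left_mono) auto
 also have "... = (b - a) * K * norm (e m) + (b - a) * de" by (simp add: algebra_simps)
 also have "... <= 1 / 2 * norm (e m) + (b - a) * de" using K by (intro add_right_mono mult_right_mono) auto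
 finally have "norm (e m - e t0) <= 1 / 2 * norm (e m) + (b - a) * de" .
 moreover have "norm (e m) <= norm (e t0) + norm (e m - e t0)" by (rule norm_triangle_sub)
 ultimately have "norm (e m) <= 2 * (norm (e t0) + (b - a) * de)" by simp
 thus ?thesis using m(2)[OF s] by linarith
qed

text \<open>Contraction on bounded continuous functions on the line; clamping time by
  \<open>cl\<close> makes every candidate total. The integrals start at -ep so that one formula
  serves times of both signs. Two integrals, over lengths at most 2 ep and ep, give the factor 3 ep
  K, at most 3/4.\<close>

lemma picard_global:
 fixes Y :: "real => 'a::euclidean_space => 'a"
 assumes eps: "0 < ep" and K: "0 <= K" "ep * K <= 1 / 4"
  and cont: "continuous_on ({-ep..ep} \<times> UNIV) (%(s, x). Y s x)"
  and lip: "!!s x y. s : {-ep..ep} ==> norm (Y s x - Y s y) <= K * norm (x - y)"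
 obtains y where "y 0 = z" "!!s. s : {-ep..ep} ==> (y has_vd Y s (y s)) (at s within {-ep..ep})"
proof -
 define cl where "cl s = max (-ep) (min ep s)" for s
 have cl: "cl s : {-ep..ep}" "s : {-ep..ep} ==> cl s = s" for s using eps by (auto simp: cl_def)
 have clc: "continuous_on UNIV cl" unfolding cl_def by (intro continuous_intros)
 define h where "h g si = Y si (apply_bcontfun g si)" for g and si :: real
 have hc: "continuous_on {-ep..ep} (h g)" for g
 proof -
  have "continuous_on {-ep..ep} (%si. (si, apply_bcontfun g si))"
   by (intro continuous_intros continuous_on_subset[OF continuous_on_apply_bcontfun]) auto
  hence "continuous_on {-ep..ep} (%si. (%(s, x). Y s x) (si, apply_bcontfun g si))"
   by (rule continuous_on_compose2[OF cont]) auto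
  thus ?thesis by (simp add: h_def[abs_def])
 qed
 have hi: "h g integrable_on {a..b}" if "{a..b} <= {-ep..ep}" for g a b
  by (intro integrable_continuous_interval continuous_on_subset[OF hc that])
 define I where "I g s = z + integral {-ep..s} (h g) - integral {-ep..0} (h g)" for g s
 have Id: "(I g has_vd h g s) (at s within {-ep..ep})" if "s : {-ep..ep}" for g s
  unfolding I_def using integral_has_vector_derivative[OF hc that, of g] by (auto intro!: derivative_eq_intros)
 have Ic: "continuous_on {-ep..ep} (I g)" for g by (rule continuous_on_vector_derivative[OF Id])
 have bc: "(%s. I g (cl s)) : bcontfun" for g
 proof -
  have "continuous_on UNIV (%s. I g (cl s))" by (rule continuous_on_compose2[OF Ic clc]) (use cl in auto)
  moreover have "bounded (range (%s. I g (cl s)))"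
   by (rule bounded_subset[OF compact_imp_bounded[OF compact_continuous_image[OF Ic compact_Icc]]]) (use cl in auto)
  ultimately show ?thesis by (simp add: bcontfun_def)
 qed
 define TT where "TT g = Bcontfun (%s. I g (cl s))" for g
 have TT: "apply_bcontfun (TT g) s = I g (cl s)" for g s unfolding TT_def using bc by (simp add: Bcontfun_inverse)
 have "EX! g. TT g = g"
 proof (rule banach_fix_type[of "3/4"])
  show "ALL g1 g2. dist (TT g1) (TT g2) <= 3 / 4 * dist g1 g2"
  proof (intro allI, rule dist_bound)
   fix g1 g2 and s :: real
   have e: "norm (integral {-ep..u} (h g1) - integral {-ep..u} (h g2)) <= K * dist g1 g2 * (u + ep)"
    if "u : {-ep..ep}" for u
   proof -
    have "norm (integral {-ep..u} (%si. h g1 si - h g2 si)) <= K * dist g1 g2 * (u - -ep)"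
    proof (rule integral_bound)
     show "-ep <= u" using that by simp
     show "continuous_on {-ep..u} (%si. h g1 si - h g2 si)"
      using that by (intro continuous_intros continuous_on_subset[OF hc]) auto
     fix si assume "si : {-ep..u}"
     hence "norm (h g1 si - h g2 si) <= K * norm (apply_bcontfun g1 si - apply_bcontfun g2 si)"
      using lip that by (simp add: h_def)
     also have "... <= K * dist g1 g2"
      using dist_bounded[of g1 si g2] K by (intro mult_left_mono) (auto simp: dist_norm)
     finally show "norm (h g1 si - h g2 si) <= K * dist g1 g2" .
    qed
    thus ?thesis using that hi by (subst (asm) Henstock_Kurzweil_Integration.integral_diff) auto
   qed
   have "norm (I g1 (cl s) - I g2 (cl s)) <= K * dist g1 g2 * (cl s + ep) + K * dist g1 g2 * (0 + ep)"
   proof -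
    have "I g1 (cl s) - I g2 (cl s) = (integral {-ep..cl s} (h g1) - integral {-ep..cl s} (h g2))
      - (integral {-ep..0} (h g1) - integral {-ep..0} (h g2))" by (simp add: I_def)
    also have "norm ... <= K * dist g1 g2 * (cl s + ep) + K * dist g1 g2 * (0 + ep)"
     using e[OF cl(1)] e[of 0] eps by (intro order_trans[OF norm_triangle_ineq4 add_mono]) auto
    finally show ?thesis .
   qed
   also have "... <= K * dist g1 g2 * (ep + ep) + K * dist g1 g2 * (0 + ep)"
    using cl(1)[of s] K by (intro add_mono mult_left_mono) auto
   also have "... = 3 * (ep * K) * dist g1 g2" by (simp add: algebra_simps)
   also have "... <= 3 * (1 / 4) * dist g1 g2" using K(2) by (intro mult_right_mono mult_left_mono) simp_all
   also have "... = 3 / 4 * dist g1 g2" by simp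
   finally show "dist (apply_bcontfun (TT g1) s) (apply_bcontfun (TT g2) s) <= 3 / 4 * dist g1 g2"
    by (simp add: TT dist_norm)
  qed
 qed auto
 then obtain g where g: "TT g = g" by blast
 have gI: "apply_bcontfun g s = I g s" if "s : {-ep..ep}" for s using TT[of g s] cl(2)[OF that] g by simp
 show thesis
 proof (rule that[of "I g"])
  show "I g 0 = z" by (simp add: I_def)
  show "(I g has_vd Y s (I g s)) (at s within {-ep..ep})" if "s : {-ep..ep}" for s
   using Id[OF that, of g] gI[OF that] by (simp add: h_def)
 qed
qed

text \<open>The set of coincidence is closed and, by the short Gronwall estimate near each of its
  points, open in the interval. The field is only locally Lipschitz, so the estimate is applied in a
  ball that both solutions do not leave for a short time.\<close>

lemma ode_unique:
 fixes X :: "'a::euclidean_space => 'a"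
 assumes S: "open S" and X: "Ck_on (Suc 0) S X"
  and y1: "!!s. s : {a..b} ==> y1 s : S & (y1 has_vd X (y1 s)) (at s within {a..b})"
  and y2: "!!s. s : {a..b} ==> y2 s : S & (y2 has_vd X (y2 s)) (at s within {a..b})"
  and t0: "t0 : {a..b}" "y1 t0 = y2 t0" and s: "s : {a..b}"
 shows "y1 s = y2 s"
proof -
 let ?E = "{s : {a..b}. y1 s = y2 s}"
 have c: "continuous_on {a..b} y1" "continuous_on {a..b} y2"
  by (rule continuous_on_vector_derivative; use y1 y2 in blast)+
 have "closedin (top_of_set {a..b}) ?E"
 proof -
  have "closedin (top_of_set {a..b}) {s : {a..b}. y1 s - y2 s = 0}"
   by (intro continuous_closedin_preimage_constant continuous_intros c)
  thus ?thesis by simp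
 qed
 moreover have "openin (top_of_set {a..b}) ?E"
 proof (subst openin_euclidean_subtopology_iff, intro conjI ballI)
  fix u assume u: "u : ?E"
  obtain R where R: "R > 0" "cball (y1 u) R <= S" using S y1 u open_contains_cball by blast
  let ?K = "cball (y1 u) R"
  obtain L where L: "L >= 0" "!!x y. x : ?K ==> y : ?K ==> norm (X y - X x) <= L * norm (y - x)"
   by (rule C1_lipschitz[OF X compact_cball convex_cball R(2)]) (blast intro: that)
  obtain d1 where d1: "d1 > 0" "!!s. s : {a..b} ==> dist s u < d1 ==> dist (y1 s) (y1 u) < R"
   using c(1) u R(1) unfolding continuous_on_iff by blast
  obtain d2 where d2: "d2 > 0" "!!s. s : {a..b} ==> dist s u < d2 ==> dist (y2 s) (y2 u) < R"
   using c(2) u R(1) unfolding continuous_on_iff by blast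
  define d where "d = min (min d1 d2) (1 / (4 * (L + 1)))"
  have d: "d > 0" using d1 d2 L by (simp add: d_def)
  have dL: "d * L <= 1 / 4"
  proof -
   have "1 / (4 * c) * c = 1 / 4" if "c > 0" for c :: real using that by simp
   moreover have "d * L <= 1 / (4 * (L + 1)) * (L + 1)" using L d by (intro mult_mono) (auto simp: d_def)
   moreover have "L + 1 > 0" using L by simp
   ultimately show ?thesis by metis
  qed
  show "EX e>0. ALL x':{a..b}. dist x' u < e --> x' : ?E"
  proof (intro exI[of _ "d / 2"] conjI ballI impI)
   fix x' assume x': "x' : {a..b}" "dist x' u < d / 2"
   let ?a = "max a (u - d / 2)" and ?b = "min b (u + d / 2)"
   have sub: "{?a..?b} <= {a..b}" by auto
   have near: "dist s u < d1" "dist s u < d2" if "s : {?a..?b}" for s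
   proof -
    have "dist s u < d" using that d by (auto simp: dist_real_def abs_less_iff)
    thus "dist s u < d1" "dist s u < d2" by (auto simp: d_def)
   qed
   have K: "y1 s : ?K" "y2 s : ?K" if "s : {?a..?b}" for s
    using d1(2)[of s] d2(2)[of s] near[OF that] that sub u by (auto simp: dist_commute less_imp_le)
   have "norm (y1 x' - y2 x') <= 2 * (norm (y1 u - y2 u) + (?b - ?a) * 0)"
   proof (rule short_gronwall[where K = L and e' = "%s. X (y1 s) - X (y2 s)" and a = ?a and b = ?b])
    show "((%s. y1 s - y2 s) has_vd X (y1 s) - X (y2 s)) (at s within {?a..?b})" if "s : {?a..?b}" for s
     using y1[of s] y2[of s] that sub
     by (intro has_vector_derivative_diff) (auto intro: has_vector_derivative_within_subset[OF _ sub])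
    show "norm (X (y1 s) - X (y2 s)) <= L * norm (y1 s - y2 s) + 0" if "s : {?a..?b}" for s
     using L(2) K[OF that] by simp
    have "(?b - ?a) * L <= d * L" using L by (intro mult_right_mono) auto
    thus "(?b - ?a) * L <= 1 / 2" using dL by linarith
    show "u : {?a..?b}" using u d by auto
    show "x' : {?a..?b}" using x'(1) abs_less_iff[of "x' - u" "d / 2"] x'(2)[unfolded dist_real_def] by auto
   qed (use L in auto)
   thus "x' : ?E" using u x' by simp
  qed (use d in auto)
 qed auto
 moreover have "connected {a..b}" by simp
 moreover have "?E ~= {}" using t0 by auto
 ultimately have "?E = {a..b}" unfolding connected_clopen by blast
 with s have "s : ?E" by (rule eq_refl[THEN subsetD, OF sym, rotated])
 thus ?thesis by simp
qed

text \<open>Composition with the projection onto a closed ball makes the field globally Lipschitz. A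
  solution that starts within a quarter of the radius and moves at speed at most B for time ep stays
  in that ball, where the modification is invisible.\<close>

lemma C1_flow:
 fixes X :: "'a::euclidean_space => 'a"
 assumes S: "open S" "z0 : S" and X: "Ck_on (Suc 0) S X" and e0: "0 < e0"
 obtains r ep ph where "0 < r" "0 < ep" "ep <= e0" "ball z0 r <= S" "!!z. ph 0 z = z"
  "!!s z. s : {-ep..ep} ==> z : ball z0 r ==>
   ph s z : S & ((%s. ph s z) has_vd X (ph s z)) (at s within {-ep..ep})"
  "continuous_on ({-ep..ep} \<times> ball z0 r) (%p. ph (fst p) (snd p))"
  "!!s z z'. s : {-ep..ep} ==> z : ball z0 r ==> z' : ball z0 r ==> norm (ph s z' - ph s z) <= 2 * norm (z' - z)"
proof -
 obtain R where R: "R > 0" "cball z0 R <= S" using S open_contains_cball by blast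
 let ?K = "cball z0 R"
 obtain L where L: "L >= 0" "!!x y. x : ?K ==> y : ?K ==> norm (X y - X x) <= L * norm (y - x)"
  by (rule C1_lipschitz[OF X compact_cball convex_cball R(2)]) (blast intro: that)
 have Xc: "continuous_on S X" by (rule Ck_on_imp_continuous_on[OF X])
 hence "bounded (X ` ?K)"
  using R by (intro compact_imp_bounded compact_continuous_image) (auto intro: continuous_on_subset)
 then obtain B where B: "B > 0" "!!z. z : ?K ==> norm (X z) <= B" unfolding bounded_pos by auto
 define ep where "ep = min e0 (min (1 / (4 * (L + 1))) (R / (4 * B)))"
 have eps: "ep > 0" "ep <= e0" using L R B e0 by (auto simp: ep_def)
 have "ep * L <= 1 / (4 * (L + 1)) * (L + 1)" using L eps by (intro mult_mono) (auto simp: ep_def)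
 moreover have "1 / (4 * c) * c = 1 / 4" if "c > 0" for c :: real using that by simp
 from this[of "L + 1"] have "1 / (4 * (L + 1)) * (L + 1) = 1 / 4" using L(1) by simp
 ultimately have eL: "ep * L <= 1 / 4" by linarith
 have "B * ep <= B * (R / (4 * B))" using B by (intro mult_left_mono) (auto simp: ep_def)
 hence eB: "B * ep <= R / 4" using B by simp
 define r where "r = R / 4"
 let ?J = "{-ep..ep}"
 let ?cp = "closest_point ?K"
 have cpK: "?cp x : ?K" for x using R by (intro closest_point_in_set) auto
 have "EX y. y 0 = z & (ALL s:?J. (y has_vd X (?cp (y s))) (at s within ?J))" for z
 proof (rule picard_global[OF eps(1) L(1) eL, of "%s x. X (?cp x)" z])
  have "continuous_on UNIV ?cp" using R by (intro continuous_on_closest_point) auto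
  hence "continuous_on UNIV (%x. X (?cp x))" using cpK R by (intro continuous_on_compose2[OF Xc]) auto
  thus "continuous_on (?J \<times> UNIV) (%(s, x). X (?cp x))"
   unfolding case_prod_beta by (intro continuous_on_compose2[of UNIV "%x. X (?cp x)" _ snd] continuous_intros) auto
  show "norm (X (?cp x) - X (?cp y)) <= L * norm (x - y)" for x y
   using L(2)[OF cpK cpK] mult_left_mono[OF closest_point_lipschitz[of ?K x y] L(1)] R
   by (fastforce simp: dist_norm intro: order_trans)
 qed blast
 then obtain ph' where ph': "!!z. ph' z 0 = z"
  "!!z s. s : ?J ==> (ph' z has_vd X (?cp (ph' z s))) (at s within ?J)" by metis
 define ph where "ph s z = ph' z s" for s z
 have ph0: "ph 0 z = z" for z using ph' by (simp add: ph_def)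
 have phd: "((%s. ph s z) has_vd X (?cp (ph s z))) (at s within ?J)" if "s : ?J" for s z
  using ph'(2)[OF that] by (simp add: ph_def[abs_def])
 have J0: "0 : ?J" using eps by simp
 have phs: "norm (ph s z - ph s' z) <= B * \<bar>s - s'\<bar>" if "s : ?J" "s' : ?J" for s s' z
  by (rule derivative_increment_bound[OF phd _ that]) (use B cpK in auto)
 have phK: "ph s z : ?K" if "s : ?J" "z : ball z0 r" for s z
 proof -
  have "norm (ph s z - z) <= B * \<bar>s - 0\<bar>" using phs[OF that(1) J0, of z] ph0 by simp
  also have "... <= B * ep" using that B by (intro mult_left_mono) auto
  finally have "dist z (ph s z) <= R / 4" using eB by (simp add: dist_norm norm_minus_commute)
  thus ?thesis using that R dist_triangle[of z0 "ph s z" z] by (simp add: r_def)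
 qed
 have phd': "((%s. ph s z) has_vd X (ph s z)) (at s within ?J)" if "s : ?J" "z : ball z0 r" for s z
  using phd[OF that(1), of z] closest_point_self[OF phK[OF that]] by simp
 have phlip: "norm (ph s z' - ph s z) <= 2 * norm (z' - z)"
  if s: "s : ?J" and z: "z : ball z0 r" "z' : ball z0 r" for s z z'
 proof -
  have "norm (ph s z' - ph s z) <= 2 * (norm (ph 0 z' - ph 0 z) + (ep - -ep) * 0)"
   by (rule short_gronwall[OF has_vector_derivative_diff[OF phd' phd'] _ L(1) _ _ J0 s])
    (use L(2) phK z eL in auto)
  thus ?thesis by (simp add: ph0)
 qed
 show thesis
 proof (rule that[of r ep ph])
  show "ball z0 r <= S" using R by (auto simp: r_def intro!: subsetD[OF R(2)])
  show "continuous_on (?J \<times> ball z0 r) (%p. ph (fst p) (snd p))"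
  proof (rule lipschitz_on_continuous_on[of "B + 2"], rule lipschitz_onI)
   fix p q assume p: "p : ?J \<times> ball z0 r" "q : ?J \<times> ball z0 r"
   obtain s z s' z' where pq: "p = (s, z)" "q = (s', z')" by fastforce
   have "norm (ph s z - ph s' z') <= norm (ph s z - ph s' z) + norm (ph s' z - ph s' z')"
    using norm_triangle_ineq[of "ph s z - ph s' z" "ph s' z - ph s' z'"] by simp
   also have "... <= B * \<bar>s - s'\<bar> + 2 * norm (z - z')"
    using phs[of s s' z] phlip[of s' z' z] p pq by (intro add_mono) auto
   also have "... <= B * dist p q + 2 * dist p q"
    using dist_fst_le[of p q] dist_snd_le[of p q] B pq by (intro add_mono mult_left_mono) (auto simp: dist_norm)
   finally show "dist (ph (fst p) (snd p)) (ph (fst q) (snd q)) <= (B + 2) * dist p q"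
    by (simp add: pq dist_norm algebra_simps)
  qed (use B in auto)
 qed (use eps R ph0 phlip phd' phK in "auto simp: r_def intro!: subsetD[OF R(2)]")
qed

text \<open>\<open>Ph s z\<close> is the differential at z of the time-s map. Times form an open
  interval, so that all time derivatives are two-sided.\<close>

locale flow_box =
 fixes X :: "'a::euclidean_space => 'a" and S z0 r ep ph Ph
 assumes r: "0 < r" and eps: "0 < ep" and ball_S: "ball z0 r <= S"
  and ph0: "!!z. z : ball z0 r ==> ph 0 z = z"
  and phS: "!!s z. s : {-ep<..<ep} ==> z : ball z0 r ==> ph s z : S"
  and phd: "!!s z. s : {-ep<..<ep} ==> z : ball z0 r ==>
   ((%s. ph s z) has_vd X (ph s z)) (at s)"
  and phc: "continuous_on ({-ep<..<ep} \<times> ball z0 r) (%p. ph (fst p) (snd p))"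
  and phD: "!!s z. s : {-ep<..<ep} ==> z : ball z0 r ==> (ph s has_derivative Ph s z) (at z)"
  and Ph0: "!!z v. z : ball z0 r ==> Ph 0 z v = v"
  and Phd: "!!s z v. s : {-ep<..<ep} ==> z : ball z0 r ==>
   ((%s. Ph s z v) has_vd FD X (ph s z) (Ph s z v)) (at s)"
  and Phc: "!!v. continuous_on ({-ep<..<ep} \<times> ball z0 r) (%p. Ph (fst p) (snd p) v)"

text \<open>The flow of the field \<open>(X z, DX z v)\<close> on the tangent bundle provides the solutions of the
  variational equation together with their continuity in the initial point.\<close>

theorem local_flow:
 fixes X :: "'a::euclidean_space => 'a"
 assumes S: "open S" "z0 : S" and X: "Ck_on (Suc (Suc 0)) S X"
 obtains r ep ph Ph where "flow_box X S z0 r ep ph Ph"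
proof -
 let ?o = "(z0, 0 :: 'a)"
 let ?D = "%z. FD X z"
 obtain R where R: "R > 0" "cball z0 R <= S" using S open_contains_cball by blast
 let ?K = "cball z0 R" and ?B = "ball z0 R"
 have BS: "?B <= S" using R by auto
 have X1: "Ck_on (Suc 0) S X" using X Ck_on_Suc_imp by blast
 obtain L where L: "L >= 0" "!!x v. x : ?K ==> norm (?D x v) <= L * norm v"
  by (rule C1_derivative_bound[OF X1 compact_cball R(2)]) (blast intro: that)
 obtain C where C: "C >= 0" "!!x y. x : ?K ==> y : ?K ==> norm (X y - X x - ?D x (y - x)) <= C * (norm (y - x))\<^sup>2"
  by (rule C2_taylor_bound[OF X compact_cball convex_cball R(2)]) (blast intro: that)
 have lin: "linear (?D z)" if "z : ?K" for z
  using that R X1 by (meson Ck_on_imp_differentiable linear_frechet_derivative subsetD)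
 define Y where "Y p = (X (fst p), ?D (fst p) (snd p))" for p
 have oY: "open (?B \<times> (UNIV :: 'a set))" by (intro open_Times) auto
 have Y: "Ck_on (Suc 0) (?B \<times> UNIV) Y"
  unfolding Y_def[abs_def] by (intro Ck_on_Pair oY Ck_on_compose[OF oY S(1) Ck_on_bounded_linear[OF bounded_linear_fst] X1]
   Ck_on_frechet_apply[OF oY S(1) X] Ck_on_bounded_linear bounded_linear_fst bounded_linear_snd) (use BS in auto)
 have z00: "?o : ?B \<times> (UNIV :: 'a set)" using R by simp
 have e0: "0 < 1 / (4 * (L + 1))" using L by simp
 obtain rh ep ps where rh: "0 < rh" and eps: "0 < ep" "ep <= 1 / (4 * (L + 1))" and rhB: "ball ?o rh <= ?B \<times> UNIV"
  and ps0: "!!z. ps 0 z = z" and ps: "!!s z. s : {-ep..ep} ==> z : ball ?o rh ==>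
   ps s z : ?B \<times> UNIV & ((%s. ps s z) has_vd Y (ps s z)) (at s within {-ep..ep})"
  and psc: "continuous_on ({-ep..ep} \<times> ball ?o rh) (%p. ps (fst p) (snd p))"
  and pslip: "!!s z z'. s : {-ep..ep} ==> z : ball ?o rh ==> z' : ball ?o rh ==> norm (ps s z' - ps s z) <= 2 * norm (z' - z)"
  by (rule C1_flow[OF oY z00 Y e0]) (rule that; assumption)
 let ?J = "{-ep..ep}"
 define r where "r = rh / 2"
 have r: "r > 0" using rh by (simp add: r_def)
 let ?c = "r / 2"
 have P: "(z, w) : ball ?o rh" if "z : ball z0 r" "norm w < r" for z w
  using norm_Pair_le[of "z0 - z" "- w"] that by (simp add: r_def dist_norm)
 have P0: "(z, 0) : ball ?o rh" if "z : ball z0 r" for z using P[OF that, of 0] r by simp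
 have Pb: "(z, ?c *R b) : ball ?o rh" if "z : ball z0 r" "b : Basis" for z b
  by (rule P[OF that(1)]) (use r that in simp)
 define ph where "ph s z = fst (ps s (z, 0))" for s z
 \<comment> \<open>The enlarged flow is available only near the zero vector, so basis vectors are
   shrunk by \<open>?c\<close> before flowing and rescaled afterwards. Linearity in v is built
   in.\<close>
 define Ph where "Ph s z v = (SUM b:Basis. (v <.> b) *R (snd (ps s (z, ?c *R b)) /\<^sub>R ?c))" for s z v
 have phK: "ph s z : ?K" if "s : ?J" "z : ball z0 r" for s z
  using ps[OF that(1) P0[OF that(2)]] by (cases "ps s (z, 0)") (auto simp: ph_def less_imp_le)
 have fd: "((%s. fst (ps s p)) has_vd X (fst (ps s p))) (at s within ?J)"
  and sd: "((%s. snd (ps s p)) has_vd ?D (fst (ps s p)) (snd (ps s p))) (at s within ?J)"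
  if "s : ?J" "p : ball ?o rh" for s p
  using bounded_linear.has_vector_derivative[OF bounded_linear_fst conjunct2[OF ps[OF that]]]
   bounded_linear.has_vector_derivative[OF bounded_linear_snd conjunct2[OF ps[OF that]]] by (simp_all add: Y_def)
 \<comment> \<open>The base component of the enlarged flow ignores the fibre component, so all these
   solutions run over the same base curve.\<close>
 have f1: "fst (ps s (z, ?c *R b)) = ph s z" if "s : ?J" "z : ball z0 r" "b : Basis" for s z b unfolding ph_def
 proof (rule ode_unique[OF open_ball Ck_on_subset[OF X1 BS], where a="-ep" and b=ep and ?t0.0=0])
  fix s assume s: "s : ?J"
  show "fst (ps s (z, ?c *R b)) : ?B & ((%s. fst (ps s (z, ?c *R b))) has_vd X (fst (ps s (z, ?c *R b)))) (at s within ?J)"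
   "fst (ps s (z, 0)) : ?B & ((%s. fst (ps s (z, 0))) has_vd X (fst (ps s (z, 0)))) (at s within ?J)"
   using fd[OF s] ps[OF s] P0[OF that(2)] Pb[OF that(2,3)] by (auto simp: mem_Times_iff)
 qed (use that eps ps0 in auto)
 have phd: "((%s. ph s z) has_vd X (ph s z)) (at s within ?J)" if "s : ?J" "z : ball z0 r" for s z
  using fd[OF that(1) P0[OF that(2)]] by (simp add: ph_def)
 have Phd: "((%s. Ph s z v) has_vd ?D (ph s z) (Ph s z v)) (at s within ?J)" if "s : ?J" "z : ball z0 r" for s z v
 proof -
  have "((%s. Ph s z v) has_vd (SUM b:Basis. (v <.> b) *R (?D (ph s z) (snd (ps s (z, ?c *R b))) /\<^sub>R ?c))) (at s within ?J)"
   unfolding Ph_def using sd[OF that(1) Pb[OF that(2)]] f1[OF that]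
   by (intro has_vector_derivative_sum bounded_linear.has_vector_derivative[OF bounded_linear_scaleR_right]) simp
  thus ?thesis by (simp add: Ph_def linear_sum[OF lin[OF phK[OF that]]] linear_scale[OF lin[OF phK[OF that]]])
 qed
 have Ph0: "Ph 0 z v = v" for z v using r by (simp add: Ph_def ps0 euclidean_representation)
 \<comment> \<open>The defect of the linear approximation starts at 0 and solves the linearized
   equation up to a quadratic Taylor remainder; Gronwall keeps it quadratic.\<close>
 have Phder: "norm (ph s z' - ph s z - Ph s z (z' - z)) <= 16 * ep * C * (norm (z' - z))\<^sup>2"
  if s: "s : ?J" and z: "z : ball z0 r" and z': "z' : ball z0 r" for s z z'
 proof -
  let ?v = "z' - z"
  have "ep * L <= 1 / (4 * (L + 1)) * (L + 1)" using L eps by (intro mult_mono) auto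
  moreover have "1 / (4 * c) * c = 1 / 4" if "c > 0" for c :: real using that by simp
  from this[of "L + 1"] have "1 / (4 * (L + 1)) * (L + 1) = 1 / 4" using L(1) by simp
  ultimately have "ep * L <= 1 / 4" by linarith
  hence eL: "(ep - -ep) * L <= 1 / 2" by simp
  have "norm (ph s z' - ph s z - Ph s z ?v) <=
    2 * (norm (ph 0 z' - ph 0 z - Ph 0 z ?v) + (ep - -ep) * (C * (2 * norm ?v)\<^sup>2))"
  proof (rule short_gronwall[OF _ _ L(1) _ _ _ s])
   fix s assume s: "s : ?J"
   show "((%s. ph s z' - ph s z - Ph s z ?v) has_vector_derivative
     X (ph s z') - X (ph s z) - ?D (ph s z) (Ph s z ?v)) (at s within ?J)"
    by (intro has_vector_derivative_diff phd Phd s z z')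
   have "norm (ph s z' - ph s z) <= norm (ps s (z', 0) - ps s (z, 0))"
    unfolding ph_def fst_diff[symmetric] by (metis norm_fst_le prod.collapse)
   also have "... <= 2 * norm ?v" using pslip[OF s P0[OF z] P0[OF z']] by simp
   finally have lip: "norm (ph s z' - ph s z) <= 2 * norm ?v" .
   have "X (ph s z') - X (ph s z) - ?D (ph s z) (Ph s z ?v) =
     ?D (ph s z) (ph s z' - ph s z - Ph s z ?v) + (X (ph s z') - X (ph s z) - ?D (ph s z) (ph s z' - ph s z))"
    using linear_diff[OF lin[OF phK[OF s z]]] by simp
   also have "norm ... <= L * norm (ph s z' - ph s z - Ph s z ?v) + C * (norm (ph s z' - ph s z))\<^sup>2"
    using L(2)[OF phK[OF s z]] C(2)[OF phK[OF s z] phK[OF s z']] by (rule order_trans[OF norm_triangle_ineq add_mono])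
   also have "... <= L * norm (ph s z' - ph s z - Ph s z ?v) + C * (2 * norm ?v)\<^sup>2"
    using lip C by (intro add_left_mono mult_left_mono power_mono) auto
   finally show "norm (X (ph s z') - X (ph s z) - ?D (ph s z) (Ph s z ?v)) <=
    L * norm (ph s z' - ph s z - Ph s z ?v) + C * (2 * norm ?v)\<^sup>2" .
  qed (use C eps eL in auto)
  thus ?thesis by (simp add: ph_def ps0 Ph0 power_mult_distrib mult_ac)
 qed
 let ?I = "{-ep<..<ep}"
 have at_eq: "at s within ?J = at s" "s : ?J" if "s : ?I" for s using that at_within_Icc_at[of "-ep" s ep] by auto
 have cont: "continuous_on (?I \<times> ball z0 r) (%p. ps (fst p) (snd p, w))" if "!!z. z : ball z0 r ==> (z, w) : ball ?o rh" for w
  using continuous_on_compose2[OF psc, of "?I \<times> ball z0 r" "%p. (fst p, (snd p, w))"] that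
  by (force intro!: continuous_intros)
 show thesis
 proof (rule that[of r ep ph Ph], unfold_locales)
  show "ball z0 r <= S" using P0 rhB BS by blast
  fix s z assume s: "s : ?I" and z: "z : ball z0 r"
  note J = at_eq[OF s]
  show "ph s z : S" using phK[OF J(2) z] R by blast
  show "((%s. ph s z) has_vd X (ph s z)) (at s)" using phd[OF J(2) z] unfolding J(1) .
  show "((%s. Ph s z v) has_vd ?D (ph s z) (Ph s z v)) (at s)" for v using Phd[OF J(2) z, of v] unfolding J(1) .
  show "(ph s has_derivative Ph s z) (at z)"
  proof (rule has_derivativeI)
   show "bounded_linear (Ph s z)" unfolding Ph_def[abs_def]
    by (intro bounded_linear_sum bounded_linear_scaleR_left bounded_linear_compose[OF bounded_linear_scaleR_left] bounded_linear_inner_left)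
   let ?c = "16 * ep * C"
   show "((%y. (ph s y - ph s z - Ph s z (y - z)) /\<^sub>R norm (y - z)) ---> 0) (at z)"
   proof (rule Lim_null_comparison)
    have "\<forall>\<^sub>F y in at z. y : ball z0 r & y ~= z"
     using z by (intro eventually_conj eventually_at_in_open'[of "ball z0 r"] eventually_neq_at_within) auto
    thus "\<forall>\<^sub>F y in at z. norm ((ph s y - ph s z - Ph s z (y - z)) /\<^sub>R norm (y - z)) <= ?c * norm (y - z)"
    proof eventually_elim
     case (elim y)
     hence "inverse (norm (y - z)) * norm (ph s y - ph s z - Ph s z (y - z)) <=
       inverse (norm (y - z)) * (?c * (norm (y - z))\<^sup>2)" using Phder[OF J(2) z, of y] by (intro mult_left_mono) auto
     also have "... = ?c * norm (y - z)" using elim by (simp add: power2_eq_square)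
     finally show ?case by simp
    qed
    show "((%y. ?c * norm (y - z)) ---> 0) (at z)" by (auto intro!: tendsto_eq_intros)
   qed
  qed
 next
  show "continuous_on (?I \<times> ball z0 r) (%p. ph (fst p) (snd p))" unfolding ph_def by (intro continuous_intros cont P0)
  show "continuous_on (?I \<times> ball z0 r) (%p. Ph (fst p) (snd p) v)" for v unfolding Ph_def by (intro continuous_intros cont Pb)
 qed (use eps r Ph0 in "auto simp: ph_def ps0")
qed

section \<open>A moment problem for polynomials\<close>

lemma poly_eq_0_if_zero_on_interval:
 fixes p :: "real poly"
 assumes "!!x. x : {0<..1} ==> poly p x = 0"
 shows "p = 0"
proof (rule ccontr)
 assume "p ~= 0"
 hence "finite {x. poly p x = 0}" by (rule poly_roots_finite)
 hence "finite {0<..1::real}" by (rule rev_finite_subset) (use assms in auto)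
 thus False using infinite_Ioc[of 0 "1::real"] by simp
qed

lemma integral_moments_poly:
 fixes p q :: "real poly"
 assumes "degree q < n" "!!i. i < n ==> integral {0..1} (%x. x ^ i * poly p x) = mv i"
 shows "integral {0..1} (%x. poly q x * poly p x) = (\<Sum>i<n. coeff q i * mv i)"
proof -
 have q: "poly q x = (\<Sum>i<n. coeff q i * x ^ i)" for x
 proof -
  have "(SUM i<=degree q. coeff q i * x ^ i) = (\<Sum>i<n. coeff q i * x ^ i)"
   using assms(1) by (intro sum.mono_neutral_left) (auto simp: coeff_eq_0)
  thus ?thesis by (simp add: poly_altdef)
 qed
 have "integral {0..1} (%x. poly q x * poly p x) = integral {0..1} (%x. \<Sum>i<n. coeff q i * (x ^ i * poly p x))"
  by (simp add: q sum_distrib_right mult.assoc)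
 also have "... = (\<Sum>i<n. integral {0..1} (%x. coeff q i * (x ^ i * poly p x)))"
  by (intro integral_sum) (auto intro!: integrable_continuous_interval continuous_intros)
 also have "... = (\<Sum>i<n. coeff q i * mv i)" using assms(2) by simp
 finally show ?thesis .
qed

text \<open>Being orthogonal to all polynomials of degree less than n, r is orthogonal to
  itself.\<close>

lemma poly_eq_0_if_orthogonal:
 fixes r :: "real poly"
 assumes "degree r < n" "!!i. i < n ==> integral {0..1} (%x. x ^ i * poly r x) = 0"
 shows "r = 0"
proof (rule poly_eq_0_if_zero_on_interval)
 have "integral {0..1} (%x. poly r x * poly r x) = 0"
  using integral_moments_poly[OF assms(1), of r "%i. 0"] assms(2) by simp
 hence "ALL x:{0..1}. poly r x * poly r x = 0" by (subst (asm) integral_eq_0_iff) (auto intro!: continuous_intros)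
 thus "poly r x = 0" if "x : {0<..1}" for x using that by auto
qed

text \<open>Let \<open>p\<close> represent evaluation at \<open>0\<close> on the polynomials of degree less than \<open>n\<close>. Then
  \<open>p + x p'\<close> represents \<open>p(1)\<close> times evaluation at \<open>1\<close>, as does \<open>p(1) p(1 - x)\<close>; the leading
  coefficients give \<open>n = \<plusminus> p(1)\<close>.\<close>

lemma evaluation_representer_at_1:
 fixes p :: "real poly"
 assumes deg: "degree p < n"
  and mom: "!!i. i < n ==> integral {0..1} (%x. x ^ i * poly p x) = (if i = 0 then 1 else 0)"
 shows "(poly p 1)\<^sup>2 = (real n)\<^sup>2"
proof -
 have n: "n > 0" using deg by simp
 have rep: "integral {0..1} (%x. poly q x * poly p x) = poly q 0" if "degree q < n" for q
  using integral_moments_poly[OF that mom] n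
  by (simp add: poly_0_coeff_0 if_distrib[of "%x. _ * x"] sum.delta cong: if_cong)
 have p0: "p ~= 0"
 proof
  assume "p = 0" thus False using mom[OF n] by simp
 qed
 \<comment> \<open>If the degree were smaller, x p would be an admissible test polynomial. Its
   pairing with p is its value 0 at the origin, but also the integral of x p^2, which forces p =
   0.\<close>
 have degp: "degree p = n - 1"
 proof (rule ccontr)
  assume "degree p ~= n - 1"
  hence "degree (pCons 0 p) < n" using deg p0 by simp
  from rep[OF this] have "integral {0..1} (%x. x * poly p x * poly p x) = 0" by simp
  hence "ALL x:{0..1}. x * poly p x * poly p x = 0"
   by (subst (asm) integral_eq_0_iff) (auto intro!: continuous_intros simp: mult.assoc)
  hence "x * poly p x * poly p x = 0" if "x : {0<..1}" for x using that by (elim ballE[of _ _ x]) auto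
  hence "poly p x = 0" if "x : {0<..1}" for x using that by simp
  thus False using p0 poly_eq_0_if_zero_on_interval by blast
 qed
 let ?refl = "pcompose p [:1, -1:]"
 define r where "r = p + pCons 0 (pderiv p) - smult (poly p 1) ?refl"
 have degd: "degree (pCons 0 (pderiv p)) < n"
 proof (cases "pderiv p = 0")
  case False
  hence "degree p ~= 0" using pderiv_eq_0_iff by blast
  thus ?thesis using False deg by (simp add: degree_pderiv)
 qed (use n in simp)
 have degr: "degree ?refl < n" using deg by (simp add: degree_pcompose)
 have r0: "r = 0"
 proof (rule poly_eq_0_if_orthogonal)
  show "degree r < n" unfolding r_def using deg degd degr degree_smult_le[of "poly p 1" ?refl]
   by (intro degree_diff_less degree_add_less) auto
  fix i assume i: "i < n"
  define q :: "real poly" where "q = monom 1 i"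
  have q: "poly q x = x ^ i" for x by (simp add: q_def poly_monom)
  have degq: "degree q < n" using i by (simp add: q_def degree_monom_eq)
  \<comment> \<open>Integration by parts of x q p: the boundary term is p(1) q(1), and the term with
    x q' drops out later because x q' vanishes at 0.\<close>
  have "((%x. poly q x * (poly p x + x * poly (pderiv p) x) + x * poly (pderiv q) x * poly p x) has_integral
    1 * poly q 1 * poly p 1 - 0 * poly q 0 * poly p 0) {0..1}"
  proof (rule fundamental_theorem_of_calculus)
   fix x :: real
   have "((%x. x * poly q x * poly p x) has_real_derivative
    poly q x * (poly p x + x * poly (pderiv p) x) + x * poly (pderiv q) x * poly p x) (at x)"
    by (auto intro!: derivative_eq_intros simp: algebra_simps)
   thus "((%x. x * poly q x * poly p x) has_vector_derivative
    poly q x * (poly p x + x * poly (pderiv p) x) + x * poly (pderiv q) x * poly p x) (at x within {0..1})"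
    by (simp add: has_real_derivative_iff_has_vector_derivative has_vector_derivative_at_within)
  qed simp
  hence 1: "integral {0..1} (%x. poly q x * (poly p x + x * poly (pderiv p) x) + x * poly (pderiv q) x * poly p x) =
   poly q 1 * poly p 1" by (simp add: integral_unique)
  have degq': "degree (pCons 0 (pderiv q)) < n"
  proof (cases "pderiv q = 0")
   case False
   hence "degree q ~= 0" using pderiv_eq_0_iff by blast
   thus ?thesis using False degq by (simp add: degree_pderiv)
  qed (use n in simp)
  have 2: "integral {0..1} (%x. x * poly (pderiv q) x * poly p x) = 0" using rep[OF degq'] by simp
  have 3: "integral {0..1} (%x. poly q x * poly ?refl x) = poly q 1"
  proof -
   let ?f = "%x. poly q (1 - x) * poly p x"
   have "integral {0..1} (%x. poly q x * poly ?refl x) = integral {0..1} ((%y. ?f (- y)) \<circ> (+) (- 1))"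
    by (simp add: o_def poly_pcompose algebra_simps)
   also have "... = integral {-1..0} (%y. ?f (- y))" using integral_shift_Icc_real[of 0 1 "%y. ?f (- y)" "-1"] by simp
   also have "... = integral {0..1} ?f" using Henstock_Kurzweil_Integration.integral_reflect_real[of 1 0 ?f] by simp
   also have "... = integral {0..1} (%x. poly (pcompose q [:1, -1:]) x * poly p x)"
    by (simp add: poly_pcompose algebra_simps)
   also have "... = poly q 1" using rep[of "pcompose q [:1, -1:]"] degq by (simp add: degree_pcompose poly_pcompose)
   finally show ?thesis .
  qed
  have "integral {0..1} (%x. poly q x * (poly p x + x * poly (pderiv p) x)) = poly q 1 * poly p 1"
   using 1 2 by (subst (asm) Henstock_Kurzweil_Integration.integral_add)
    (auto intro!: integrable_continuous_interval continuous_intros)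
  moreover have "integral {0..1} (%x. poly q x * poly r x) =
    integral {0..1} (%x. poly q x * (poly p x + x * poly (pderiv p) x) - poly p 1 * (poly q x * poly ?refl x))"
   by (simp add: r_def algebra_simps)
  moreover have "... = integral {0..1} (%x. poly q x * (poly p x + x * poly (pderiv p) x)) - poly p 1 * integral {0..1} (%x. poly q x * poly ?refl x)"
   by (subst Henstock_Kurzweil_Integration.integral_diff)
    (auto intro!: integrable_continuous_interval continuous_intros)
  ultimately show "integral {0..1} (%x. x ^ i * poly r x) = 0" using 3 by (simp add: q)
 qed
 \<comment> \<open>Coefficients of degree n - 1 in r = 0: x p' contributes n - 1 times that of p,
   and the reflection contributes the sign.\<close>
 have "coeff (pCons 0 (pderiv p)) (n - 1) = real (n - 1) * coeff p (n - 1)"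
  by (cases "n - 1") (auto simp: coeff_pderiv)
 moreover have "coeff ?refl (n - 1) = coeff p (n - 1) * (-1) ^ (n - 1)"
  using lead_coeff_comp[of "[:1, -1:]" p] degp by (simp add: degree_pcompose)
 moreover have "coeff r (n - 1) = 0" using r0 by simp
 ultimately have "coeff p (n - 1) * (real (n - 1) + 1 - poly p 1 * (-1) ^ (n - 1)) = 0"
  by (simp add: r_def algebra_simps)
 moreover have "coeff p (n - 1) ~= 0" using p0 degp by (metis leading_coeff_0_iff)
 ultimately have "poly p 1 * (-1) ^ (n - 1) = real n" using n by (simp add: of_nat_diff)
 hence "(poly p 1 * (-1) ^ (n - 1))\<^sup>2 = (real n)\<^sup>2" by simp
 thus ?thesis by (simp add: power_mult_distrib flip: power_mult)
qed

section \<open>Flags of curves of vectors\<close>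

lemma dual_family:
 fixes b :: "'i => 'a::euclidean_space"
 assumes "inj_on b J" "independent (b ` J)"
 obtains w where "!!i j. i : J ==> j : J ==> w i <.> b j = (if i = j then 1 else 0)"
proof -
 have "EX v. ALL j:J. v <.> b j = (if i = j then 1 else 0)" if "i : J" for i
 proof -
  obtain f :: "'a => real" where f: "linear f" "ALL x:b ` J. f x = (if x = b i then 1 else 0)"
   using linear_independent_extend[OF assms(2), of "%x. if x = b i then 1 else 0"] by blast
  have "adjoint f 1 <.> b j = (if i = j then 1 else 0)" if "j : J" for j
   using adjoint_works[OF f(1), of "b j" 1] f(2) that `i : J` assms(1) by (auto simp: inner_commute inj_on_eq_iff)
  thus ?thesis by blast
 qed
 hence "ALL i:J. EX v. ALL j:J. v <.> b j = (if i = j then 1 else 0)" by blast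
 from bchoice[OF this] show thesis using that by blast
qed

text \<open>Lower semicontinuity of the rank. Against functionals dual to the limit vectors, the
  nearby vectors give a matrix close to the identity, hence diagonally dominant; testing a relation
  at its largest coefficient shows that it is trivial.\<close>

lemma independent_family_perturb:
 fixes b :: "'i => 'a::euclidean_space"
 assumes J: "finite J" and b: "inj_on b J" "independent (b ` J)"
  and lim: "!!j. j : J ==> (B j ---> b j) F"
 shows "\<forall>\<^sub>F s in F. card J <= dim ((%j. B j s) ` J)"
proof -
 obtain w where w: "!!i j. i : J ==> j : J ==> w i <.> b j = (if i = j then 1 else 0)"
  by (rule dual_family[OF b]) (blast intro: that)
 \<comment> \<open>Chosen so that \<open>real (card J) * e\<close> is less than 1; the added 1
   covers an empty J.\<close>
 define e where "e = 1 / (2 * (real (card J) + 1))"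
 have e: "e > 0" by (simp add: e_def)
 have "\<forall>\<^sub>F s in F. \<bar>w i <.> B j s - w i <.> b j\<bar> < e" if "i : J" "j : J" for i j
  using tendstoD[OF tendsto_inner[OF tendsto_const lim[OF that(2)]] e, of "w i"] by (simp add: dist_real_def)
 hence "\<forall>\<^sub>F s in F. ALL i:J. ALL j:J. \<bar>w i <.> B j s - w i <.> b j\<bar> < e"
  using J by (simp add: eventually_ball_finite)
 thus ?thesis
 proof eventually_elim
  case (elim s)
  let ?B = "%j. B j s"
  have key: "ALL j:J. c j = 0" if c: "(SUM j:J. c j *R ?B j) = 0" for c
  proof (rule ccontr)
   assume nz: "\<not> (ALL j:J. c j = 0)"
   hence "J ~= {}" by auto
   hence "Max ((%j. \<bar>c j\<bar>) ` J) : (%j. \<bar>c j\<bar>) ` J" using J by (intro Max_in) auto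
   then obtain i where "i : J" "Max ((%j. \<bar>c j\<bar>) ` J) = \<bar>c i\<bar>" by auto
   hence i: "i : J" "!!j. j : J ==> \<bar>c j\<bar> <= \<bar>c i\<bar>"
    using J Max_ge[of "(%j. \<bar>c j\<bar>) ` J"] by auto
   hence ci: "\<bar>c i\<bar> > 0" using nz by force
   have "w i <.> (SUM j:J. c j *R ?B j) = 0" using c by simp
   hence "0 = (SUM j:J. c j * (w i <.> b j)) + (SUM j:J. c j * (w i <.> ?B j - w i <.> b j))"
    by (simp add: inner_sum_right right_diff_distrib sum_subtractf)
   also have "(SUM j:J. c j * (w i <.> b j)) = (SUM j:J. if i = j then c j else 0)" using w i by (intro sum.cong) auto
   also have "... = c i" using i J by simp
   finally have "\<bar>c i\<bar> = \<bar>SUM j:J. c j * (w i <.> ?B j - w i <.> b j)\<bar>" by simp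
   also have "... <= (SUM j:J. \<bar>c i\<bar> * e)"
   proof (rule order_trans[OF sum_abs sum_mono])
    fix j assume j: "j : J"
    show "\<bar>c j * (w i <.> ?B j - w i <.> b j)\<bar> <= \<bar>c i\<bar> * e"
     unfolding abs_mult using elim i j by (intro mult_mono) (auto intro: less_imp_le)
   qed
   also have "... = \<bar>c i\<bar> * (real (card J) * e)" by simp
   also have "... < \<bar>c i\<bar> * 1" using ci by (intro mult_strict_left_mono) (auto simp: e_def field_simps)
   finally show False by simp
  qed
  have inj: "inj_on ?B J"
  proof (rule inj_onI)
   fix i j assume ij: "i : J" "j : J" "?B i = ?B j"
   show "i = j"
   proof (rule ccontr)
    assume ne: "i ~= j"
    let ?c = "%k. if k = i then 1 else if k = j then -1 else (0::real)"
    have "(SUM k:J. ?c k *R ?B k) = (SUM k:{i, j}. ?c k *R ?B k)" using ij J by (intro sum.mono_neutral_right) auto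
    also have "... = 0" using ne ij by simp
    finally show False using key[of ?c] ij by auto
   qed
  qed
  have "independent (?B ` J)"
  proof (rule independent_if_scalars_zero)
   fix f x assume f: "(SUM x:?B ` J. f x *R x) = 0" and x: "x : ?B ` J"
   hence "(SUM j:J. f (?B j) *R ?B j) = 0" by (simp add: sum.reindex[OF inj])
   thus "f x = 0" using key[of "%j. f (?B j)"] x by auto
  qed (use J in auto)
  thus ?case using dim_eq_card_independent[of "?B ` J"] card_image[OF inj] by simp
 qed
qed

lemma independent_subfamily:
 fixes b :: "'i => 'a::euclidean_space"
 assumes "finite A"
 obtains J where "J <= A" "inj_on b J" "independent (b ` J)" "span (b ` J) = span (b ` A)" "card J = dim (b ` A)"
proof -
 obtain B where B: "B <= b ` A" "independent B" "b ` A <= span B" "card B = dim (b ` A)" using basis_exists by blast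
 obtain J where J: "J <= A" "inj_on b J" "b ` J = B" using B(1) subset_image_inj by metis
 have "span B = span (b ` A)" using B by (meson span_eq span_mono span_superset subset_trans)
 thus thesis using that J B card_image[OF J(2)] by metis
qed

text \<open>If v0 were outside, a basis of the limit span together with v0 would stay independent
  nearby and exceed the constant rank by one.\<close>

lemma limit_in_span_of_limits:
 fixes b :: "'i => 'a::euclidean_space"
 assumes A: "finite A" and F: "F ~= bot" and lim: "!!j. j : A ==> (B j ---> b j) F"
  and dimc: "\<forall>\<^sub>F s in F. dim ((%j. B j s) ` A) = dim (b ` A)"
  and v: "\<forall>\<^sub>F s in F. v s : span ((%j. B j s) ` A)" "(v ---> v0) F"
 shows "v0 : span (b ` A)"
proof (rule ccontr)
 assume nv: "v0 ~: span (b ` A)"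
 obtain J where J: "J <= A" "inj_on b J" "independent (b ` J)" "span (b ` J) = span (b ` A)" "card J = dim (b ` A)"
  by (rule independent_subfamily[OF A]) (blast intro: that)
 have Jf: "finite J" using J A finite_subset by blast
 let ?J = "insert None (Some ` J)"
 let ?b = "%x. case x of None => v0 | Some j => b j"
 let ?B = "%x s. case x of None => v s | Some j => B j s"
 have im: "?b ` ?J = insert v0 (b ` J)" by (auto simp: image_iff)
 have vJ: "v0 ~: span (b ` J)" using nv J by simp
 have "inj_on ?b ?J" using J(2) vJ span_base[of _ "b ` J"] by (auto simp: inj_on_def)
 moreover have "independent (?b ` ?J)" unfolding im using J vJ independent_insertI by blast
 moreover have "(?B x ---> ?b x) F" if "x : ?J" for x using that lim v J by (auto split: option.split)
 ultimately have "\<forall>\<^sub>F s in F. card ?J <= dim ((%x. ?B x s) ` ?J)"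
  using Jf by (intro independent_family_perturb[of ?J ?b ?B F]) auto
 hence "\<forall>\<^sub>F s in F. False" using dimc v(1)
 proof eventually_elim
  case (elim s)
  have "(%x. ?B x s) ` ?J <= span ((%j. B j s) ` A)" using elim(3) J(1) by (auto intro!: span_base)
  hence "dim ((%x. ?B x s) ` ?J) <= dim ((%j. B j s) ` A)" by (metis dim_span dim_subset)
  moreover have "card ?J = Suc (card J)" using Jf by (simp add: card_image)
  ultimately show False using elim J(5) by simp
 qed
 thus False using F by (simp add: eventually_False)
qed

section \<open>Iterated derivatives and flags of curves\<close>

lemma nth_vderiv_0 [simp]: "nth_vderiv 0 g = g" by (simp add: nth_vderiv_def)

lemma nth_vderiv_Suc: "nth_vderiv (Suc j) g = (%t. vector_derivative (nth_vderiv j g) (at t))"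
 by (simp add: nth_vderiv_def)

lemma nth_vderiv_smooth: "open I ==> smooth_on I g ==> smooth_on I (nth_vderiv j g)"
proof (induction j)
 case (Suc j)
 thus ?case unfolding nth_vderiv_Suc by (intro smooth_onI Ck_on_curveD(2)) (auto simp: smooth_on_def)
qed simp

lemma nth_vderiv_has_derivative:
 assumes "open I" "smooth_on I g" "t : I"
 shows "(nth_vderiv j g has_vd nth_vderiv (Suc j) g t) (at t)"
 using Ck_on_curveD(1)[OF assms(1) smooth_onD[OF nth_vderiv_smooth[OF assms(1,2)], of "Suc 0" j] assms(3)]
 by (simp add: nth_vderiv_Suc)

text \<open>Computes iterated derivatives from a guessed sequence G. Agreement is propagated on an
  open set because \<open>nth_vderiv\<close> differentiates the lower derivative near t.\<close>

lemma nth_vderiv_unique: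
 assumes "open I" "!!t j. t : I ==> (G j has_vd G (Suc j) t) (at t)" "t : I"
  and "!!t. t : I ==> g t = G 0 t"
 shows "nth_vderiv j g t = G j t" using assms(3)
proof (induction j arbitrary: t)
 case (Suc j)
 have "(nth_vderiv j g has_vd G (Suc j) t) (at t)" using assms(2)[OF Suc.prems, of j] Suc.IH Suc.prems assms(1)
  by (auto intro: has_vector_derivative_transform_within_open)
 thus ?case unfolding nth_vderiv_Suc by (rule vector_derivative_at)
qed (simp add: assms(4))

lemma nth_vderiv_cong:
 assumes "open I" "smooth_on I h" "!!t. t : I ==> g t = h t" "t : I"
 shows "nth_vderiv j g t = nth_vderiv j h t"
 by (rule nth_vderiv_unique[OF assms(1) _ assms(4), of "%j. nth_vderiv j h" g j])
  (simp_all add: assms(3) nth_vderiv_has_derivative[OF assms(1,2)])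

lemma nth_vderiv_sum_scaleR:
 assumes "open I" "!!l. l : A ==> smooth_on I (g l)" "t : I"
 shows "nth_vderiv j (%t. SUM l:A. c l *R g l t) t = (SUM l:A. c l *R nth_vderiv j (g l) t)"
 by (rule nth_vderiv_unique[where G = "%j t. SUM l:A. c l *R nth_vderiv j (g l) t", OF assms(1) _ assms(3)])
  (auto intro!: derivative_eq_intros nth_vderiv_has_derivative[OF assms(1,2)])

definition curve_flag :: "('r => real => 'a::euclidean_space) => nat => real => 'a set" where
 "curve_flag C i t = span {nth_vderiv j (C l) t | j l. j < i}"

lemma curve_flag_image:
 "curve_flag C i t = span ((%p. nth_vderiv (fst p) (C (snd p)) t) ` ({..<i} \<times> UNIV))"
 unfolding curve_flag_def by (rule arg_cong[where f = span]) (auto intro!: rev_image_eqI)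

lemma curve_flag_base: "j < i ==> nth_vderiv j (C l) t : curve_flag C i t"
 unfolding curve_flag_def by (rule span_base) auto

lemma subspace_curve_flag: "subspace (curve_flag C i t)" by (simp add: curve_flag_def subspace_span)

lemma quotient_tendsto_vector_derivative:
 assumes "(y has_vd y') (at 0)" "y 0 = 0"
 shows "((%s. y s /\<^sub>R s) ---> y') (at 0)"
proof -
 have "((%s. norm (y s - s *R y') / norm s) ---> 0) (at 0)"
  using assms unfolding has_vector_derivative_def has_derivative_at by simp
 moreover have "norm (y s - s *R y') / norm s = norm ((y s - s *R y') /\<^sub>R s)" for s
  by (simp add: divide_inverse mult.commute)
 ultimately have "((%s. norm ((y s - s *R y') /\<^sub>R s)) ---> 0) (at 0)" by simp
 hence "((%s. (y s - s *R y') /\<^sub>R s) ---> 0) (at 0)" by (rule tendsto_norm_zero_cancel)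
 hence "((%s. (y s - s *R y') /\<^sub>R s + y') ---> 0 + y') (at 0)" by (rule tendsto_add[OF _ tendsto_const])
 moreover have "\<forall>\<^sub>F s in at 0. (y s - s *R y') /\<^sub>R s + y' = y s /\<^sub>R s"
  by (auto simp: eventually_at_filter scaleR_diff_right)
 ultimately show ?thesis by (subst tendsto_cong[symmetric]) auto
qed

text \<open>Differentiating a relation of order \<open>i\<close> gives one of order \<open>i + 1\<close>; this is the only place
  where the growth has to be constant near \<open>0\<close>.\<close>

lemma curve_flag_derivative:
 fixes C :: "'r::finite => real => 'a::euclidean_space"
 assumes I: "open I" "0 : I" and C: "!!l. smooth_on I (C l)"
  and growth: "\<forall>\<^sub>F s in at_right 0. dim (curve_flag C (Suc i) s) = dim (curve_flag C (Suc i) 0)"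
  and c: "(SU l. c l *R nth_vderiv i (C l) 0) : curve_flag C i 0"
 shows "(SU l. c l *R nth_vderiv (Suc i) (C l) 0) : curve_flag C (Suc i) 0"
proof -
 let ?B = "%p t. nth_vderiv (fst p) (C (snd p)) t"
 let ?A = "{..<i} \<times> (UNIV :: 'r set)"
 have "(SU l. c l *R nth_vderiv i (C l) 0) : span ((%p. ?B p 0) ` ?A)" using c by (simp only: curve_flag_image)
 then obtain u where u: "(SU l. c l *R nth_vderiv i (C l) 0) = (SUM v:(%p. ?B p 0) ` ?A. u v *R v)"
  using span_finite[of "(%p. ?B p 0) ` ?A"] by auto
 \<comment> \<open>Different indices may give the same vector at 0; keeping one index for each
   vector allows the coefficients to be reindexed.\<close>
 obtain J where J: "J <= ?A" "inj_on (%p. ?B p 0) J" "(%p. ?B p 0) ` J = (%p. ?B p 0) ` ?A"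
  using subset_image_inj[THEN iffD1, OF order_refl[of "(%p. ?B p 0) ` ?A"]] by (elim exE conjE) (rule that, auto)
 define a where "a p = u (?B p 0)" for p
 have ua: "(SUM v:(%p. ?B p 0) ` ?A. u v *R v) = (SUM p:J. a p *R ?B p 0)"
  unfolding J(3)[symmetric] by (simp add: sum.reindex[OF J(2)] a_def)
 \<comment> \<open>The relation continued to nearby times with frozen coefficients. It vanishes at
   0, and its quotient by s lies in the flag of order i + 1 at time s; by constancy of the rank the
   limit y' lies in that flag at 0.\<close>
 define y where "y t = (SU l. c l *R nth_vderiv i (C l) t) - (SUM p:J. a p *R ?B p t)" for t
 define y' where "y' = (SU l. c l *R nth_vderiv (Suc i) (C l) 0) - (SUM p:J. a p *R nth_vderiv (Suc (fst p)) (C (snd p)) 0)"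
 have y0: "y 0 = 0" using u ua by (simp add: y_def)
 note D = nth_vderiv_has_derivative[OF I(1) C]
 have "(y has_vd y') (at 0)" unfolding y_def y'_def by (auto intro!: derivative_eq_intros D I(2))
 hence "((%s. y s /\<^sub>R s) ---> y') (at 0)" using y0 by (rule quotient_tendsto_vector_derivative)
 hence lim: "((%s. y s /\<^sub>R s) ---> y') (at_right 0)" by (rule filterlim_mono) (auto simp: at_le)
 have "y' : span ((%p. ?B p 0) ` ({..<Suc i} \<times> UNIV))"
 proof (rule limit_in_span_of_limits[OF _ _ _ _ _ lim])
  show "(?B p ---> ?B p 0) (at_right 0)" for p
  proof -
   have "isCont (?B p) 0" by (rule has_vector_derivative_continuous[OF D[OF I(2)]])
   thus ?thesis unfolding isCont_def by (rule filterlim_mono) (auto simp: at_le)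
  qed
  show "\<forall>\<^sub>F s in at_right 0. dim ((%p. ?B p s) ` ({..<Suc i} \<times> UNIV)) = dim ((%p. ?B p 0) ` ({..<Suc i} \<times> UNIV))"
   using growth by (simp only: curve_flag_image dim_span)
  show "\<forall>\<^sub>F s in at_right 0. y s /\<^sub>R s : span ((%p. ?B p s) ` ({..<Suc i} \<times> UNIV))"
  proof (intro always_eventually allI)
   fix s
   let ?S = "span ((%p. ?B p s) ` ({..<Suc i} \<times> UNIV))"
   have b: "nth_vderiv j (C l) s : ?S" if "j < Suc i" for j l using that by (intro span_base) force
   have "?B p s : ?S" if "p : J" for p using that J(1) by (intro b) auto
   hence "y s : ?S" unfolding y_def using b by (intro span_diff span_sum span_scale) auto
   thus "y s /\<^sub>R s : ?S" by (rule span_scale)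
  qed
 qed auto
 hence "y' : curve_flag C (Suc i) 0" by (simp only: curve_flag_image)
 moreover have "(SUM p:J. a p *R nth_vderiv (Suc (fst p)) (C (snd p)) 0) : curve_flag C (Suc i) 0"
  using J(1) by (intro subspace_sum[OF subspace_curve_flag] subspace_scale[OF subspace_curve_flag] curve_flag_base) auto
 ultimately have "y' + (SUM p:J. a p *R nth_vderiv (Suc (fst p)) (C (snd p)) 0) : curve_flag C (Suc i) 0"
  using subspace_add[OF subspace_curve_flag] by blast
 thus ?thesis by (simp add: y'_def)
qed

section \<open>Adapted frames\<close>

locale positive_form =
 fixes S :: "'a::euclidean_space => 'a => real"
 assumes linear_left: "linear (%v. S v w)"
  and sym: "S v w = S w v"
  and pos: "v ~= 0 ==> 0 < S v v"
begin

definition orthonormal :: "'a set => bool" where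
 "orthonormal B \<longleftrightarrow> (ALL a:B. ALL b:B. S a b = (if a = b then 1 else 0))"

lemma linear_right: "linear (S v)" using linear_left[of v] by (simp add: sym[of _ v])

lemma orthonormal_coefficient:
 assumes "finite B" "orthonormal B" "b : B"
 shows "S (SUM a:B. c a *R a) b = c b"
proof -
 have "S (SUM a:B. c a *R a) b = (SUM a:B. c a * S a b)"
  by (simp add: linear_sum[OF linear_left] linear_scale[OF linear_left])
 also have "... = (SUM a:B. if a = b then c a else 0)" using assms by (intro sum.cong) (auto simp: orthonormal_def)
 also have "... = c b" using assms by simp
 finally show ?thesis .
qed

lemma orthonormal_independent:
 assumes "finite B" "orthonormal B" shows "independent B"
proof (rule independent_if_scalars_zero[OF assms(1)])
 fix f x assume "(SUM x:B. f x *R x) = 0" "x : B"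
 thus "f x = 0" using orthonormal_coefficient[OF assms `x : B`, of f] linear_0[OF linear_left[of x]] by simp
qed

text \<open>Gram-Schmidt, by induction on the number of missing basis vectors.\<close>

lemma orthonormal_extension:
 assumes "subspace V" "B <= V" "finite B" "orthonormal B"
 shows "EX B'. B <= B' & B' <= V & finite B' & orthonormal B' & span B' = V" using assms(2-)
proof (induction "dim V - card B" arbitrary: B rule: less_induct)
 case less
 show ?case
 proof (cases "V <= span B")
  case True
  hence "span B = V" using less.prems(1) assms(1) by (simp add: span_minimal subset_antisym)
  thus ?thesis using less.prems by blast
 next
  case False
  then obtain v where v: "v : V" "v ~: span B" by blast
  define p where "p = (SUM b:B. S v b *R b)"
  have pB: "p : span B" unfolding p_def by (intro span_sum span_scale span_base)
  define w where "w = v - p"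
  have w0: "w ~= 0" using pB v by (auto simp: w_def)
  have wb: "S w b = 0" if "b : B" for b unfolding w_def linear_diff[OF linear_left] p_def
   using orthonormal_coefficient[OF less.prems(2,3) that, of "S v"] by simp
  have "span B <= V" using less.prems(1) assms(1) by (rule span_minimal)
  hence wV: "w : V" unfolding w_def using v pB assms(1) by (auto intro: subspace_diff)
  define e where "e = (1 / sqrt (S w w)) *R w"
  have eb: "S e b = 0" "S b e = 0" if "b : B" for b
   using wb[OF that] sym[of b e] by (simp_all add: e_def linear_scale[OF linear_left])
  have "S e e = (1 / sqrt (S w w)) * ((1 / sqrt (S w w)) * S w w)"
   by (simp only: e_def linear_scale[OF linear_left] linear_scale[OF linear_right] real_scaleR_def)
  also have "... = S w w / (sqrt (S w w))\<^sup>2" by (simp add: power2_eq_square)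
  also have "... = 1" using pos[OF w0] by simp
  finally have ee: "S e e = 1" .
  have eB: "e ~: B" using eb ee by force
  have on: "orthonormal (insert e B)" using less.prems(3) eb ee eB by (auto simp: orthonormal_def)
  have sub: "insert e B <= V" using less.prems(1) wV assms(1) by (auto simp: e_def intro: subspace_scale)
  have fin: "finite (insert e B)" using less.prems by simp
  have "card (insert e B) <= dim V"
   using orthonormal_independent[OF fin on] sub by (metis dim_eq_card_independent dim_subset)
  hence "dim V - card (insert e B) < dim V - card B" using eB less.prems by simp
  from less.hyps[OF this sub fin on] show ?thesis by blast
 qed
qed

text \<open>Extending an orthonormal basis from each member of the chain to the next leaves the
  earlier members spanned by the basis vectors that they contain.\<close>

lemma orthonormal_basis_adapted_to_chain:
 assumes "!!i. subspace (V i)" "!!i. V i <= V (Suc i)" "V m = UNIV"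
 shows "EX B. finite B & orthonormal B & span B = UNIV & (ALL i. V i = span (B Int V i))"
proof -
 have mono: "V i <= V j" if "i <= j" for i j using lift_Suc_mono_le[of V] assms(2) that by blast
 have "EX B. finite B & orthonormal B & span B = V k & (ALL i<=k. V i = span (B Int V i))" for k
 proof (induction k)
  case 0
  have "orthonormal {}" by (simp add: orthonormal_def)
  from orthonormal_extension[OF assms(1) empty_subsetI finite.emptyI this]
  obtain B where "finite B" "orthonormal B" "span B = V 0" "B <= V 0" by blast
  thus ?case by (intro exI[of _ B]) (auto simp: Int_absorb2)
 next
  case (Suc k)
  then obtain B where B: "finite B" "orthonormal B" "span B = V k" "!!i. i <= k ==> V i = span (B Int V i)" by blast
  have "B <= V (Suc k)" using B(3) assms(2) span_superset by blast
  from orthonormal_extension[OF assms(1) this B(1,2)]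
  obtain B' where B': "B <= B'" "B' <= V (Suc k)" "finite B'" "orthonormal B'" "span B' = V (Suc k)" by blast
  have "V i = span (B' Int V i)" if "i <= Suc k" for i
  proof (cases "i = Suc k")
   case True
   thus ?thesis using B' by (simp add: Int_absorb2)
  next
   case False
   hence "V i = span (B Int V i)" using that B(4) by simp
   also have "... <= span (B' Int V i)" using B'(1) by (intro span_mono) auto
   finally show ?thesis using span_minimal[OF _ assms(1), of "B' Int V i" i] by auto
  qed
  thus ?case using B' by blast
 qed
 from this[of m] obtain B where B: "finite B" "orthonormal B" "span B = UNIV" "!!i. i <= m ==> V i = span (B Int V i)"
  using assms(3) by auto
 have "V i = span (B Int V i)" for i
 proof (cases "i <= m")
  case False
  hence "V i = UNIV" using mono[of m i] assms(3) by auto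
  thus ?thesis using B by simp
 qed (use B in simp)
 thus ?thesis using B by blast
qed

end

text \<open>\<open>nw k\<close> is the first index at which the k-th basis vector enters the chain;
  orthonormality lets membership in \<open>V i\<close> be read off the coefficients.\<close>

lemma adapted_frame:
 fixes S :: "real^'r => real^'r => real"
 assumes "positive_form S"
  and V: "!!i. subspace (V i)" "!!i. V i <= V (Suc i)" "V m = UNIV"
 obtains b :: "'r => real^'r" and nw :: "'r => nat"
 where "!!k l. S (b k) (b l) = (if k = l then 1 else 0)" "!!k. nw k <= m"
  "!!i c. (SU k. c k *R b k) : V i \<longleftrightarrow> (ALL k. i < nw k --> c k = 0)"
  "!!v. EX c. v = (SU k. c k *R b k)"
proof -
 interpret positive_form S by fact
 obtain B where B: "finite B" "orthonormal B" "span B = UNIV" "!!i. V i = span (B Int V i)"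
  using orthonormal_basis_adapted_to_chain[OF V] by blast
 have ind: "independent B" by (rule orthonormal_independent[OF B(1,2)])
 have "card B = CARD('r)" using ind B(3) dim_eq_card[of B UNIV] by simp
 then obtain b :: "'r => real^'r" where b: "bij_betw b UNIV B"
  using finite_same_card_bij[of "UNIV :: 'r set" B] B(1) by auto
 hence bB: "range b = B" "inj b" by (auto simp: bij_betw_def)
 define nw where "nw k = (LEAST i. b k : V i)" for k
 have mono: "V i <= V j" if "i <= j" for i j using lift_Suc_mono_le[of V] V(2) that by blast
 have nu: "nw k <= i \<longleftrightarrow> b k : V i" for k i
 proof
  have "b k : V (nw k)" unfolding nw_def by (rule LeastI[of _ m]) (simp add: V)
  thus "nw k <= i ==> b k : V i" using mono by blast
  show "b k : V i ==> nw k <= i" unfolding nw_def by (rule Least_le)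
 qed
 have sumB: "(SU k. c (b k) *R b k) = (SUM x:B. c x *R x)" for c
  using sum.reindex[OF bB(2), of "%x. c x *R x"] bB(1) by simp
 have ex: "EX c. v = (SU k. c k *R b k)" for v
 proof -
  have "v : span B" using B(3) by simp
  then obtain c where "v = (SUM x:B. c x *R x)" using span_finite[OF B(1)] by auto
  thus ?thesis using sumB[of c] by (intro exI[of _ "%k. c (b k)"]) simp
 qed
 have mem: "(SU k. c k *R b k) : V i \<longleftrightarrow> (ALL k. i < nw k --> c k = 0)" for i c
 proof
  assume z: "ALL k. i < nw k --> c k = 0"
  have "c k *R b k : V i" for k
   using z nu[of k i] V(1) by (cases "i < nw k") (auto simp: subspace_0 intro: subspace_scale)
  thus "(SU k. c k *R b k) : V i" by (intro subspace_sum V)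
 next
  assume "(SU k. c k *R b k) : V i"
  hence "(SU k. c k *R b k) : span (B Int V i)" using B(4) by blast
  then obtain d where d: "(SU k. c k *R b k) = (SUM x:B Int V i. d x *R x)"
   using span_finite[of "B Int V i"] B(1) by auto
  let ?c = "%x. c (inv b x)" and ?d = "%x. if x : V i then d x else 0"
  have 1: "(SU k. c k *R b k) = (SUM x:B. ?c x *R x)" using sumB[of ?c] bB(2) by simp
  have 2: "(SUM x:B Int V i. d x *R x) = (SUM x:B. ?d x *R x)" using B(1) by (intro sum.mono_neutral_cong_left) auto
  have "?c x = ?d x" if "x : B" for x
   using orthonormal_coefficient[OF B(1,2) that, of ?c] orthonormal_coefficient[OF B(1,2) that, of ?d] d 1 2 by simp
  hence "c k = (if b k : V i then d (b k) else 0)" for k using bB by (metis inv_f_f rangeI)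
  thus "ALL k. i < nw k --> c k = 0" using nu by (metis not_le)
 qed
 show thesis
 proof (rule that[of b nw])
  show "S (b k) (b l) = (if k = l then 1 else 0)" for k l
   using B(2) bB unfolding orthonormal_def by (metis injD rangeI)
  show "nw k <= m" for k using nu V(3) by simp
 qed (use mem ex in auto)
qed

text \<open>The relations \<open>V i\<close> of order \<open>i\<close> between the \<open>i\<close>-th derivatives, modulo lower ones, form an
  increasing chain; a frame adapted to it splits the flag into rows, the row of \<open>k\<close> having
  length \<open>nw k\<close>.\<close>

lemma adapted_frame_of_flag:
 fixes C :: "'r::finite => real => real^'n"
 assumes "positive_form S" and I: "open I" "0 : I" and C: "!!l. smooth_on I (C l)"
  and growth: "!!i. \<forall>\<^sub>F s in at_right 0. dim (curve_flag C i s) = dim (curve_flag C i 0)"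
  and m: "curve_flag C m 0 = UNIV"
 obtains b :: "'r => real^'r" and nw :: "'r => nat" and D :: "nat => 'r => real^'n"
 where "!!k l. S (b k) (b l) = (if k = l then 1 else 0)"
  "!!v. EX c. v = (SU k. c k *R b k)"
  "!!k. nw k <= m"
  "!!j k. D j k = (SU l. (b k $ l) *R nth_vderiv j (C l) 0)"
  "!!j k. nw k <= j ==> D j k : span ((%(k, j). D j k) ` {(k, j'). j' < nw k & j' < j})"
  "inj_on (%(k, j). D j k) {(k, j). j < nw k}"
  "independent ((%(k, j). D j k) ` {(k, j). j < nw k})"
  "span ((%(k, j). D j k) ` {(k, j). j < nw k}) = UNIV"
  "!!i. dim (curve_flag C i 0) = card {(k, j). j < nw k & j < i}"
proof -
 let ?D = "%j l. nth_vderiv j (C l) 0"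
 let ?F = "%i. curve_flag C i 0"
 define L where "L i c = (SU l. (c $ l) *R ?D i l)" for i and c :: "real^'r"
 have L: "linear (L i)" for i
  unfolding L_def by (intro linearI) (auto simp: algebra_simps sum.distrib scaleR_sum_right)
 define V where "V i = {c. L i c : ?F i}" for i
 have Vs: "subspace (V i)" for i unfolding V_def subspace_def[of "{c. L i c : ?F i}"]
  by (simp add: linear_0[OF L] linear_add[OF L] linear_scale[OF L] subspace_0[OF subspace_curve_flag]
    subspace_add[OF subspace_curve_flag] subspace_scale[OF subspace_curve_flag])
 have VS: "V i <= V (Suc i)" for i unfolding V_def L_def using curve_flag_derivative[OF I C growth] by auto
 have Vm: "V m = UNIV" using m by (simp add: V_def)
 obtain b :: "'r => real^'r" and nw :: "'r => nat"
  where bS: "!!k l. S (b k) (b l) = (if k = l then 1 else 0)" and num: "!!k. nw k <= m"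
   and mem: "!!i c. (SU k. c k *R b k) : V i \<longleftrightarrow> (ALL k. i < nw k --> c k = 0)"
   and ex: "!!v. EX c. v = (SU k. c k *R b k)" by (rule adapted_frame[OF assms(1) Vs VS Vm]) (rule that; assumption)
 define D where "D j k = L j (b k)" for j k
 let ?E = "%(k, j). D j k"
 let ?I = "%i. {(k, j). j < nw k & j < i}"
 have finI: "finite (?I i)" for i by (rule finite_subset[of _ "UNIV \<times> {..<i}"]) auto
 have IS: "?I (Suc i) = ?I i \<union> (%k. (k, i)) ` {k. i < nw k}" for i by auto
 have disj: "?I i Int (%k. (k, i)) ` {k. i < nw k} = {}" for i by auto
 have DF: "D j k : ?F i" if "j < i" for j k i unfolding D_def L_def using that
  by (intro subspace_sum[OF subspace_curve_flag] subspace_scale[OF subspace_curve_flag] curve_flag_base)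
 \<comment> \<open>A derivative of order i in a row of length at most i is redundant: b k then lies
   in \<open>V i\<close>, so \<open>D i k\<close> belongs already to the flag of order i.\<close>
 have sp: "?F i = span (?E ` ?I i)" for i
 proof (rule subset_antisym)
  show "span (?E ` ?I i) <= ?F i" by (rule span_minimal[OF _ subspace_curve_flag]) (auto intro: DF)
  show "?F i <= span (?E ` ?I i)"
  proof (induction i)
   case 0
   thus ?case by (simp add: curve_flag_def)
  next
   case (Suc i)
   have mono: "span (?E ` ?I i) <= span (?E ` ?I (Suc i))" by (intro span_mono image_mono) auto
   have Dk: "D i k : span (?E ` ?I (Suc i))" for k
   proof (cases "i < nw k")
    case True
    thus ?thesis by (intro span_base) force
   next
    case False
    have "(SUM k':UNIV. (if k' = k then 1 else 0) *R b k') : V i" unfolding mem using False by auto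
    hence "b k : V i" by (simp add: if_distrib[of "%x. x *R _"] cong: if_cong)
    hence "D i k : ?F i" by (simp add: V_def D_def)
    thus ?thesis using Suc mono by blast
   qed
   have Dl: "?D i l : span (?E ` ?I (Suc i))" for l
   proof -
    obtain c where c: "axis l 1 = (SU k. c k *R b k)" using ex by blast
    have "?D i l = L i (axis l 1)" by (simp add: L_def axis_def if_distrib[of "%x. x *R _"] cong: if_cong)
    also have "... = (SU k. c k *R D i k)" by (simp add: c linear_sum[OF L] linear_scale[OF L] D_def)
    finally show ?thesis using Dk by (simp add: span_sum span_scale)
   qed
   show ?case
   proof (unfold curve_flag_def, rule span_minimal[OF _ subspace_span], clarify)
    fix j l assume "j < Suc i"
    then consider "j < i" | "j = i" by linarith
    thus "?D j l : span (?E ` ?I (Suc i))"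
    proof cases
     case 1
     thus ?thesis using curve_flag_base[of j i C l 0] Suc mono by blast
    next
     case 2
     thus ?thesis using Dl by simp
    qed
   qed
  qed
 qed
 \<comment> \<open>The terms of top order in a relation equal minus the lower ones and so lie in the
   lower flag. Their coefficients give an element of \<open>V i\<close> supported on rows longer
   than i, which vanishes by adaptedness.\<close>
 have zero: "ALL p:?I i. c p = 0" if "(SUM p:?I i. c p *R ?E p) = 0" for c i using that
 proof (induction i)
  case (Suc i)
  let ?K = "{k. i < nw k}"
  have "(SUM p:?I (Suc i). c p *R ?E p) = (SUM p:?I i. c p *R ?E p) + (SUM p:(%k. (k, i)) ` ?K. c p *R ?E p)"
   unfolding IS by (rule sum.union_disjoint[OF finI _ disj]) simp
  also have "(SUM p:(%k. (k, i)) ` ?K. c p *R ?E p) = (SUM k:?K. c (k, i) *R D i k)"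
   by (subst sum.reindex) (auto intro: inj_onI)
  finally have eq: "(SUM k:?K. c (k, i) *R D i k) = - (SUM p:?I i. c p *R ?E p)"
   using Suc.prems by (simp add: eq_neg_iff_add_eq_0 add.commute)
  let ?c = "%k. if i < nw k then c (k, i) else 0"
  have "(SUM p:?I i. c p *R ?E p) : ?F i" unfolding sp by (intro span_sum span_scale span_base) auto
  hence inF: "(SUM k:?K. c (k, i) *R D i k) : ?F i" unfolding eq by (rule subspace_neg[OF subspace_curve_flag])
  have "L i (SU k. ?c k *R b k) = (SU k. ?c k *R D i k)" by (simp add: linear_sum[OF L] linear_scale[OF L] D_def)
  also have "... = (SUM k:?K. c (k, i) *R D i k)" by (intro sum.mono_neutral_cong_right) auto
  finally have "(SU k. ?c k *R b k) : V i" using inF by (simp add: V_def)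
  hence cz: "c (k, i) = 0" if "i < nw k" for k using that unfolding mem by auto
  hence "(SUM k:?K. c (k, i) *R D i k) = 0" by (intro sum.neutral) auto
  hence "(SUM p:?I i. c p *R ?E p) = 0" using eq by simp
  hence "ALL p:?I i. c p = 0" by (rule Suc.IH)
  thus ?case using cz unfolding IS by auto
 qed auto
 have inj: "inj_on ?E (?I i)" for i
 proof (rule inj_onI)
  fix p q assume pq: "p : ?I i" "q : ?I i" "?E p = ?E q"
  show "p = q"
  proof (rule ccontr)
   assume ne: "p ~= q"
   let ?c = "%x. if x = p then 1 else if x = q then -1 else (0::real)"
   have "(SUM x:?I i. ?c x *R ?E x) = (SUM x:{p, q}. ?c x *R ?E x)"
    using pq(1,2) by (intro sum.mono_neutral_right finI) auto
   also have "... = 0" using ne pq(3) by simp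
   finally show False using zero[of ?c i] pq(1) by force
  qed
 qed
 have ind: "independent (?E ` ?I i)" for i
 proof (rule independent_if_scalars_zero)
  fix f x assume f: "(SUM x:?E ` ?I i. f x *R x) = 0" and x: "x : ?E ` ?I i"
  have "(SUM p:?I i. f (?E p) *R ?E p) = 0" using f by (simp add: sum.reindex[OF inj])
  from zero[OF this] show "f x = 0" using x by blast
 qed (use finI in simp)
 have Im: "{(k, j). j < nw k} = ?I m" using num by (auto intro: less_le_trans)
 show thesis
 proof (rule that[of b nw D])
  show "D j k = (SU l. (b k $ l) *R ?D j l)" for j k by (simp add: D_def L_def)
  show "D j k : span (?E ` {(k, j'). j' < nw k & j' < j})" if "nw k <= j" for j k
  proof -
   have "(SUM k':UNIV. (if k' = k then 1 else 0) *R b k') : V j" unfolding mem using that by auto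
   hence "b k : V j" by (simp add: if_distrib[of "%x. x *R _"] cong: if_cong)
   hence "D j k : ?F j" by (simp add: V_def D_def)
   thus ?thesis by (simp only: sp)
  qed
  show "dim (?F i) = card (?I i)" for i using dim_eq_card_independent[OF ind] card_image[OF inj] by (simp add: sp)
  show "inj_on ?E {(k, j). j < nw k}" "independent (?E ` {(k, j). j < nw k})" "span (?E ` {(k, j). j < nw k}) = UNIV"
   unfolding Im using inj ind sp[of m] m by simp_all
 qed (use bS ex num in auto)
qed

section \<open>Rows of the tableau\<close>

text \<open>\<open>f i\<close>, the number of rows of length at least i, is the length of the i-th
  column. Tableau rows are the conjugate of the columns, and conjugating twice gives back the
  multiset of the \<open>nw k\<close>.\<close>

lemma tableau_row_conjugate:
 fixes nw :: "'r::finite => nat"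
 assumes ka: "!!i. ka i = card {(k, j). j < nw k & j < i}" and N: "N = card {(k, j). j < nw k}"
  and K: "K = card {k. 0 < nw k}"
 shows "image_mset (tableau_row ka N) (mset_set {1..K}) = image_mset nw (mset_set {k. 0 < nw k})"
proof -
 define f where "f i = card {k. i <= nw k}" for i
 have fin: "finite {(k, j). j < nw k & j < i}" for i by (rule finite_subset[of _ "UNIV \<times> {..<i}"]) auto
 have finN: "finite {(k, j). j < nw k}" by (rule finite_subset[of _ "Sigma UNIV (%k. {..<nw k})"]) auto
 have kaS: "ka (Suc i) = ka i + f (Suc i)" for i
 proof -
  have "{(k, j). j < nw k & j < Suc i} = {(k, j). j < nw k & j < i} \<union> (%k. (k, i)) ` {k. Suc i <= nw k}"
   by auto
  hence "ka (Suc i) = card {(k, j). j < nw k & j < i} + card ((%k. (k, i)) ` {k. Suc i <= nw k})"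
   unfolding ka by (subst card_Un_disjoint[symmetric]) (auto simp: fin)
  thus ?thesis unfolding ka f_def by (subst (asm) card_image) (auto intro: inj_onI)
 qed
 have fanti: "f j <= f i" if "i <= j" for i j unfolding f_def using that by (intro card_mono) auto
 have kaN: "ka m = N \<longleftrightarrow> (ALL k. nw k <= m)" for m
 proof
  assume "ka m = N"
  hence "{(k, j). j < nw k & j < m} = {(k, j). j < nw k}" unfolding ka N by (intro card_subset_eq finN) auto
  hence "!!k j. j < nw k ==> j < m" by blast
  thus "ALL k. nw k <= m" by (meson leI less_irrefl)
 next
  assume "ALL k. nw k <= m"
  hence "{(k, j). j < nw k & j < m} = {(k, j). j < nw k}" by (auto intro: less_le_trans)
  thus "ka m = N" by (simp add: ka N)
 qed
 define m where "m = (LEAST m. ka m = N)"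
 have "ka (Max (range nw)) = N" unfolding kaN by simp
 hence "ka m = N" unfolding m_def by (rule LeastI)
 hence num: "nw k <= m" for k unfolding kaN by blast
 have row: "tableau_row ka N j = card {i : {1..m}. j <= f i}" for j
 proof -
  have "ka i - ka (i - 1) = f i" if "i >= 1" for i using kaS[of "i - 1"] that by simp
  hence "{i : {1..m}. ka i - ka (i - 1) >= j} = {i : {1..m}. j <= f i}" by auto
  thus ?thesis by (simp add: tableau_row_def m_def)
 qed
 \<comment> \<open>Column lengths are nonincreasing, so the columns of length at least j are exactly
   the first ones, \<open>tableau_row ka N j\<close> in number.\<close>
 have row_ge: "i <= tableau_row ka N j \<longleftrightarrow> j <= f i" if "i >= 1" "j >= 1" for i j
 proof
  assume "j <= f i"
  hence "i <= m"
  proof (rule_tac ccontr)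
   assume "j <= f i" "\<not> i <= m"
   hence "{k. i <= nw k} = {}" using num by (auto dest: order_trans)
   thus False using `j <= f i` that by (simp add: f_def)
  qed
  moreover have "{1..i} <= {i : {1..m}. j <= f i}" using `i <= m` `j <= f i` fanti by (auto intro: order_trans)
  ultimately show "i <= tableau_row ka N j" unfolding row using card_mono[of "{i : {1..m}. j <= f i}" "{1..i}"] by simp
 next
  assume *: "i <= tableau_row ka N j"
  show "j <= f i"
  proof (rule ccontr)
   assume "\<not> j <= f i"
   hence "{i' : {1..m}. j <= f i'} <= {1..<i}" using fanti by (force simp: not_le)
   hence "tableau_row ka N j <= card {1..<i}" unfolding row by (intro card_mono) auto
   thus False using * that by simp
  qed
 qed
 have K: "K = f 1" by (simp add: K f_def Suc_le_eq)
 have cnt: "card {j : {1..K}. i <= tableau_row ka N j} = f i" if "i >= 1" for i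
 proof -
  have "{j : {1..K}. i <= tableau_row ka N j} = {1..f i}"
   using row_ge[OF that] fanti[OF that] K by (auto intro: order_trans)
  thus ?thesis by simp
 qed
 \<comment> \<open>Entries equal to i are counted as those at least i minus those at least i + 1,
   the counts that the conjugation provides.\<close>
 have split: "card {x : A. g x = i} = card {x : A. i <= g x} - card {x : A. Suc i <= g x}"
  if "finite A" for A :: "'c set" and g :: "'c => nat" and i
 proof -
  have eq: "{x : A. g x = i} = {x : A. i <= g x} - {x : A. Suc i <= g x}" by auto
  show ?thesis unfolding eq by (rule card_Diff_subset) (use that in auto)
 qed
 show ?thesis
 proof (rule multiset_eqI)
  fix i :: nat
  have c: "count (image_mset g (mset_set A)) i = card {x : A. g x = i}" if "finite A" for A :: "'c set" and g
   using that by (simp add: count_image_mset vimage_def Int_def conj_commute cong: conj_cong)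
  show "count (image_mset (tableau_row ka N) (mset_set {1..K})) i = count (image_mset nw (mset_set {k. 0 < nw k})) i"
  proof (cases "i = 0")
   case True
   have "tableau_row ka N j ~= 0" if "j : {1..K}" for j using row_ge[of 1 j] that K by auto
   hence "{x : {1..K}. tableau_row ka N x = i} = {}" "{x : {k. 0 < nw k}. nw x = i} = {}" using True by auto
   thus ?thesis by (subst (1 2) c) (simp_all only: finite finite_atLeastAtMost card.empty)
  next
   case False
   have "card {x : {k. 0 < nw k}. nw x = i} = f i - f (Suc i)"
   proof -
    have "{x : {k. 0 < nw k}. i <= nw x} = {k. i <= nw k}" "{x : {k. 0 < nw k}. Suc i <= nw x} = {k. Suc i <= nw k}"
     using False by auto
    thus ?thesis using split[of "{k. 0 < nw k}" nw i] by (simp only: f_def finite)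
   qed
   thus ?thesis using cnt[of i] cnt[of "Suc i"] split[of "{1..K}" "tableau_row ka N" i] False by (subst (1 2) c) auto
  qed
 qed
qed

section \<open>Spectrum and trace of a diagonal operator\<close>

text \<open>Independence of the basis chosen in \<open>trace_on\<close>: both diagonal sums equal
  one double sum over the two bases, in one case expanding \<open>A b\<close>, in the other the
  basis vector itself.\<close>

lemma trace_on_eq:
 fixes A :: "real^'n => real^'n"
 assumes D: "subspace D" and lin: "!!v w a b. v : D ==> w : D ==> A (a *R v + b *R w) = a *R A v + b *R A w"
  and AD: "!!v. v : D ==> A v : D"
  and B: "B <= D" "independent B" "span B = D"
 shows "trace_on D A = (SUM b:B. representation B (A b) b)"
proof -
 define B' where "B' = (SOME B. B <= D & independent B & span B = D)"
 have B': "B' <= D & independent B' & span B' = D" unfolding B'_def by (rule someI[of _ B]) (use B in simp)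
 have fin: "finite B" "finite B'" using B B' independent_imp_finite by blast+
 have A0: "A 0 = 0" using lin[of 0 0 0 0] subspace_0[OF D] by simp
 have Asum: "A (SUM x:X. c x *R x) = (SUM x:X. c x *R A x)" if "finite X" "X <= D" for X c using that
 proof (induction X rule: finite_induct)
  case (insert x X)
  hence "(SUM x:X. c x *R x) : D" by (intro subspace_sum[OF D] subspace_scale[OF D]) auto
  thus ?case using insert lin[of x "SUM x:X. c x *R x" "c x" 1] by simp
 qed (simp add: A0)
 let ?r = "representation B" and ?r' = "representation B'"
 have "(SUM b:B. ?r (A b) b) = (SUM b:B. SUM b':B'. ?r' (A b) b' * ?r b' b)"
 proof (rule sum.cong)
  fix b assume b: "b : B"
  have "A b = (SUM b':B'. ?r' (A b) b' *R b')" using sum_representation_eq[of B' "A b" B'] B B' fin AD b by auto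
  hence "?r (A b) b = ?r (SUM b':B'. ?r' (A b) b' *R b') b" by simp
  also have "... = (SUM b':B'. ?r (?r' (A b) b' *R b') b)"
   using B B' by (subst representation_sum) (auto intro: span_scale)
  also have "... = (SUM b':B'. ?r' (A b) b' * ?r b' b)"
   using B B' by (intro sum.cong) (auto simp: representation_scale)
  finally show "?r (A b) b = (SUM b':B'. ?r' (A b) b' * ?r b' b)" .
 qed simp
 also have "... = (SUM b':B'. SUM b:B. ?r' (A b) b' * ?r b' b)" by (rule sum.swap)
 also have "... = (SUM b':B'. ?r' (A b') b')"
 proof (rule sum.cong)
  fix b' assume b': "b' : B'"
  have "b' = (SUM b:B. ?r b' b *R b)" using sum_representation_eq[of B b' B] B B' fin b' by auto
  hence "A b' = (SUM b:B. ?r b' b *R A b)" using Asum[OF fin(1) B(1), of "?r b'"] by simp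
  hence "?r' (A b') b' = ?r' (SUM b:B. ?r b' b *R A b) b'" by simp
  also have "... = (SUM b:B. ?r' (?r b' b *R A b) b')"
   using B B' AD by (subst representation_sum) (auto intro!: span_scale)
  also have "... = (SUM b:B. ?r' (A b) b' * ?r b' b)"
   using B B' AD by (intro sum.cong) (auto simp: representation_scale)
  finally show "(SUM b:B. ?r' (A b) b' * ?r b' b) = ?r' (A b') b'" by simp
 qed simp
 finally show ?thesis by (simp add: trace_on_def Let_def B'_def)
qed

lemma diagonal_operator_spectrum:
 fixes A :: "real^'n => real^'n" and v :: "'r::finite => real^'n"
 assumes v: "inj_on v K" "independent (v ` K)" and D: "D = span (v ` K)"
  and lin: "!!v w a b. v : D ==> w : D ==> A (a *R v + b *R w) = a *R A v + b *R A w"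
  and A: "!!k. k : K ==> A (v k) = mv k *R v k"
 shows "eig_mult D A al = card {k : K. mv k = al}" "trace_on D A = (SUM k:K. mv k)"
proof -
 have Ds: "subspace D" by (simp add: D)
 have vD: "v k : D" if "k : K" for k using that by (auto simp: D intro: span_base)
 have A0: "A 0 = 0" using lin[of 0 0 0 0] subspace_0[OF Ds] by simp
 have Asum: "A (SUM k:X. c k *R v k) = (SUM k:X. (c k * mv k) *R v k)" if "finite X" "X <= K" for X c using that
 proof (induction X rule: finite_induct)
  case (insert x X)
  hence "(SUM k:X. c k *R v k) : D" by (intro subspace_sum[OF Ds] subspace_scale[OF Ds] vD) auto
  thus ?case using insert lin[of "v x" "SUM k:X. c k *R v k" "c x" 1] vD A by simp
 qed (simp add: A0)
 have ex: "EX c. w = (SUM k:K. c k *R v k)" if "w : D" for w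
 proof -
  obtain u where "w = (SUM x:v ` K. u x *R x)" using `w : D` span_finite[of "v ` K"] unfolding D by auto
  thus ?thesis by (intro exI[of _ "%k. u (v k)"]) (simp add: sum.reindex[OF v(1)])
 qed
 have AD: "A w : D" if "w : D" for w
 proof -
  obtain c where "w = (SUM k:K. c k *R v k)" using ex[OF `w : D`] by blast
  thus ?thesis using Asum[of K c] by (auto intro!: subspace_sum[OF Ds] subspace_scale[OF Ds] vD)
 qed
 have zero: "c k = 0" if "(SUM k:K. c k *R v k) = 0" "k : K" for c k
 proof -
  have "(SUM x:v ` K. c (the_inv_into K v x) *R x) = 0"
   using that by (simp add: sum.reindex[OF v(1)] the_inv_into_f_f[OF v(1)] cong: sum.cong)
  from independentD[OF v(2) _ _ this, of "v k"] that show ?thesis by (simp add: the_inv_into_f_f[OF v(1)])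
 qed
 let ?K = "{k : K. mv k = al}"
 have "{w : D. A w = al *R w} = span (v ` ?K)"
 proof (intro subset_antisym subsetI)
  fix w assume "w : {w : D. A w = al *R w}"
  hence w: "w : D" "A w = al *R w" by auto
  obtain c where c: "w = (SUM k:K. c k *R v k)" using ex w by blast
  have "(SUM k:K. (c k * mv k - al * c k) *R v k) = 0"
   using w(2) Asum[of K c] unfolding c by (simp add: scaleR_sum_right scaleR_diff_left sum_subtractf)
  hence "c k * mv k - al * c k = 0" if "k : K" for k using zero[of "%k. c k * mv k - al * c k"] that by blast
  hence cz: "c k = 0" if "k : K - ?K" for k using that by (auto simp: algebra_simps)
  have "w = (SUM k:?K. c k *R v k)" unfolding c using cz by (intro sum.mono_neutral_right) auto
  thus "w : span (v ` ?K)" by (auto intro!: span_sum span_scale intro: span_base)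
 next
  fix w assume "w : span (v ` ?K)"
  then obtain u where "w = (SUM x:v ` ?K. u x *R x)" using span_finite[of "v ` ?K"] by auto
  moreover have "inj_on v ?K" using v(1) by (rule inj_on_subset) auto
  ultimately have w: "w = (SUM k:?K. u (v k) *R v k)" by (simp add: sum.reindex)
  have "A w = (SUM k:?K. (u (v k) * mv k) *R v k)" unfolding w by (rule Asum) auto
  also have "... = al *R w" unfolding w scaleR_sum_right by (intro sum.cong) auto
  finally show "w : {w : D. A w = al *R w}" unfolding w by (auto intro!: subspace_sum[OF Ds] subspace_scale[OF Ds] vD)
 qed
 moreover have "independent (v ` ?K)" using v(2) by (rule independent_mono) auto
 moreover have "card (v ` ?K) = card ?K" using v(1) by (intro card_image inj_on_subset[OF v(1)]) auto
 ultimately show "eig_mult D A al = card ?K" by (simp add: eig_mult_def dim_eq_card_independent)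
 have "trace_on D A = (SUM b:v ` K. representation (v ` K) (A b) b)"
  by (rule trace_on_eq[OF Ds lin AD]) (use vD v D in auto)
 also have "... = (SUM k:K. representation (v ` K) (mv k *R v k) (v k))"
  by (simp add: sum.reindex[OF v(1)] A cong: sum.cong)
 also have "... = (SUM k:K. mv k)"
  by (intro sum.cong) (auto simp: representation_scale[OF v(2)] representation_basis[OF v(2)] span_base)
 finally show "trace_on D A = (SUM k:K. mv k)" .
qed

section \<open>Short-time asymptotics of linear Hamiltonian systems\<close>

lemma nth_vderiv_Suc_shift: "nth_vderiv (Suc j) g = nth_vderiv j (%t. vector_derivative g (at t))"
 by (simp add: nth_vderiv_def funpow_swap1 del: funpow.simps add: funpow_Suc_right)

text \<open>Induction on the order: the remainder of g has the remainder of its derivative as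
  derivative, and the mean value inequality adds one power of s.\<close>

lemma taylor_bound_right:
 fixes g :: "real => 'a::euclidean_space"
 assumes I: "open I" "{0..de} <= I" and g: "smooth_on I g" and de: "0 <= de"
 shows "EX c>=0. ALL s:{0..de}. norm (g s - (\<Sum>j<m. (s ^ j / fact j) *R nth_vderiv j g 0)) <= c * s ^ m" using g
proof (induction m arbitrary: g)
 case 0
 have "continuous_on {0..de} g" using smooth_on_continuous[OF 0] I(2) continuous_on_subset by blast
 hence "bounded (g ` {0..de})" by (intro compact_imp_bounded compact_continuous_image) auto
 then obtain c where "c > 0" "ALL x:g ` {0..de}. norm x <= c" unfolding bounded_pos by blast
 thus ?case by (intro exI[of _ c]) auto
next
 case (Suc m)
 let ?g' = "%t. vector_derivative g (at t)"
 have g': "smooth_on I ?g'" using nth_vderiv_smooth[OF I(1) Suc.prems, of 1] by (simp add: nth_vderiv_Suc)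
 obtain c where c: "c >= 0" "!!s. s : {0..de} ==> norm (?g' s - (\<Sum>j<m. (s ^ j / fact j) *R nth_vderiv j ?g' 0)) <= c * s ^ m"
  using Suc.IH[OF g'] by blast
 have "norm (g s - (\<Sum>j<Suc m. (s ^ j / fact j) *R nth_vderiv j g 0)) <= c * s ^ Suc m" if s: "s : {0..de}" for s
 proof -
  let ?R = "%s. g s - (\<Sum>j<Suc m. (s ^ j / fact j) *R nth_vderiv j g 0)"
  let ?R' = "%s. ?g' s - (\<Sum>j<m. (s ^ j / fact j) *R nth_vderiv j ?g' 0)"
  have "norm (?R s - ?R 0) <= (c * s ^ m) * \<bar>s - 0\<bar>"
  proof (rule derivative_increment_bound[of 0 s ?R ?R'])
   fix u assume u: "u : {0..s}"
   have gd: "(g has_vd ?g' u) (at u)"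
    using nth_vderiv_has_derivative[OF I(1) Suc.prems, of u 0] u s subsetD[OF I(2), of u]
    by (simp add: nth_vderiv_Suc)
   have "((%s. g s - (g 0 + (\<Sum>j<m. (s ^ Suc j / fact (Suc j)) *R nth_vderiv (Suc j) g 0)))
     has_vd ?R' u) (at u)"
   proof (intro has_vector_derivative_diff gd)
    have "((%s. g 0 + (\<Sum>j<m. (s ^ Suc j / fact (Suc j)) *R nth_vderiv (Suc j) g 0))
     has_vd 0 + (\<Sum>j<m. (u ^ j / fact j) *R nth_vderiv (Suc j) g 0)) (at u)"
    proof (intro has_vector_derivative_add has_vector_derivative_const has_vector_derivative_sum)
     fix j
     have "((%s. s ^ Suc j / fact (Suc j)) has_real_derivative (real (Suc j) * u ^ j) / fact (Suc j)) (at u)"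
      using DERIV_cdivide[OF DERIV_pow[of "Suc j" u], of "fact (Suc j)"] by simp
     moreover have "(real (Suc j) * u ^ j) / fact (Suc j) = u ^ j / fact j" by (simp add: field_simps del: of_nat_Suc)
     ultimately show "((%s. (s ^ Suc j / fact (Suc j)) *R nth_vderiv (Suc j) g 0) has_vd (u ^ j / fact j) *R nth_vderiv (Suc j) g 0) (at u)"
      using has_vector_derivative_scaleR[OF _ has_vector_derivative_const] by force
    qed
    thus "((%s. g 0 + (\<Sum>j<m. (s ^ Suc j / fact (Suc j)) *R nth_vderiv (Suc j) g 0))
     has_vd (\<Sum>j<m. (u ^ j / fact j) *R nth_vderiv j ?g' 0)) (at u)" by (simp add: nth_vderiv_Suc_shift)
   qed
   moreover have "?R = (%s. g s - (g 0 + (\<Sum>j<m. (s ^ Suc j / fact (Suc j)) *R nth_vderiv (Suc j) g 0)))"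
    unfolding sum.lessThan_Suc_shift by simp
   ultimately show "(?R has_vd ?R' u) (at u within {0..s})" by (simp only: has_vector_derivative_at_within)
   have "norm (?R' u) <= c * u ^ m" using c(2) u s by auto
   also have "... <= c * s ^ m" using u c by (intro mult_left_mono power_mono) auto
   finally show "norm (?R' u) <= c * s ^ m" .
  qed (use s in auto)
  moreover have "?R 0 = 0" unfolding sum.lessThan_Suc_shift by simp
  ultimately have "norm (?R s) <= (c * s ^ m) * \<bar>s - 0\<bar>" by (metis diff_zero)
  also have "... = c * s ^ Suc m" using s by simp
  finally show ?thesis .
 qed
 thus ?case using c(1) by blast
qed

text \<open>Of the curves only their Taylor polynomials at 0 and the row structure of the
  coefficients \<open>D j k\<close> are kept. By \<open>rel\<close>, a coefficient of order j beyond
  its row lies in the span of basis vectors of order less than j.\<close>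

locale adapted_curves =
 fixes C :: "'r::finite => real => 'a::euclidean_space" and nw :: "'r => nat" and m :: nat
  and D :: "nat => 'r => 'a" and de rh :: real
 assumes de: "0 < de" "de <= 1"
  and taylor: "!!k s. s : {0..de} ==> norm (C k s - (\<Sum>j<m. (s ^ j / fact j) *R D j k)) <= rh * s ^ m"
  and nw: "!!k. nw k <= m"
  and rel: "!!j k. nw k <= j ==> D j k : span ((%(k, j). D j k) ` {(k, j'). j' < nw k & j' < j})"
  and inj: "inj_on (%(k, j). D j k) {(k, j). j < nw k}"
  and ind: "independent ((%(k, j). D j k) ` {(k, j). j < nw k})"
  and sp: "span ((%(k, j). D j k) ` {(k, j). j < nw k}) = UNIV"
begin

definition Idx :: "('r \<times> nat) set" where "Idx = {(k, j). j < nw k}"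
definition E :: "'r \<times> nat => 'a" where "E p = D (snd p) (fst p)"
definition w :: "'r \<times> nat => 'a" where
 "w = (SOME w. ALL p:Idx. ALL q:Idx. w p <.> E q = (if p = q then 1 else 0))"

lemma E_eq: "(%(k, j). D j k) = E" by (auto simp: E_def)
lemma finite_Idx: "finite Idx" by (rule finite_subset[of _ "Sigma UNIV (%k. {..<nw k})"]) (auto simp: Idx_def)

lemma wE: "p : Idx ==> q : Idx ==> w p <.> E q = (if p = q then 1 else 0)"
proof -
 have "EX w. ALL p:Idx. ALL q:Idx. w p <.> E q = (if p = q then 1 else 0)"
 proof (rule dual_family[of E Idx])
  show "inj_on E Idx" "independent (E ` Idx)" using inj ind by (simp_all add: E_eq Idx_def)
 qed blast
 from someI_ex[OF this] show "p : Idx ==> q : Idx ==> w p <.> E q = (if p = q then 1 else 0)" unfolding w_def by blast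
qed

lemma w_sum: "p : Idx ==> w p <.> (SUM q:Idx. c q *R E q) = c p"
 using finite_Idx by (simp add: inner_sum_right wE if_distrib[of "%x. _ * x"] cong: if_cong)

lemma E_expand: "(SUM p:Idx. (w p <.> v) *R E p) = v"
proof -
 have "v : span (E ` Idx)" using sp by (simp add: E_eq Idx_def)
 then obtain u where u: "v = (SUM x:E ` Idx. u x *R x)" using span_finite[of "E ` Idx"] finite_Idx by auto
 have "inj_on E Idx" using inj by (simp add: E_eq Idx_def)
 hence v: "v = (SUM p:Idx. u (E p) *R E p)" by (simp add: u sum.reindex)
 have "w p <.> v = u (E p)" if "p : Idx" for p unfolding v by (rule w_sum[OF that])
 thus ?thesis using v by simp
qed

lemma inner_expand: "v <.> q = (SUM p:Idx. (w p <.> v) * (E p <.> q))"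
 by (subst E_expand[of v, symmetric]) (simp add: inner_sum_left)

lemma eq_0_if_orthogonal: "(!!p. p : Idx ==> E p <.> q = 0) ==> q = 0" using inner_expand[of q q] by simp

text \<open>Triangularity: apart from the diagonal entry, \<open>D i k\<close> has components only
  of order less than i. After scaling these carry a positive power of t, so only the diagonal
  survives in the limit.\<close>

lemma w_D:
 assumes "p : Idx" "w p <.> D i k ~= 0"
 shows "p = (k, i) \<or> snd p < i"
proof (cases "i < nw k")
 case True
 hence "(k, i) : Idx" by (simp add: Idx_def)
 thus ?thesis using wE[OF assms(1), of "(k, i)"] assms(2) by (auto simp: E_def split: if_splits)
next
 case False
 show ?thesis
 proof (rule ccontr)
  assume n: "\<not> (p = (k, i) \<or> snd p < i)"
  have "D i k : span (E ` {(k, j'). j' < nw k & j' < i})" using rel[of k i] False by (simp add: E_eq)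
  moreover have "w p <.> x = 0" if "x : span (E ` {(k, j'). j' < nw k & j' < i})" for x using that
  proof (induction rule: span_induct_alt)
   case (step c x y)
   then obtain k' j' where x: "x = E (k', j')" "j' < nw k'" "j' < i" by auto
   hence "(k', j') : Idx" "p ~= (k', j')" using n by (auto simp: Idx_def)
   hence "w p <.> x = 0" using wE[OF assms(1)] x by auto
   thus ?case using step by (simp add: inner_add_right)
  qed simp
  ultimately show False using assms(2) by blast
 qed
qed

section \<open>Anisotropic dilations and the limit curves\<close>

definition dil :: "real => 'a => 'a" where "dil t v = (SUM p:Idx. (t ^ snd p * (w p <.> v)) *R E p)"
definition dil_inv :: "real => 'a => 'a" where "dil_inv t v = (SUM p:Idx. ((w p <.> v) / t ^ snd p) *R E p)"
text \<open>The adjoint of \<open>dil t\<close>; pairing a vector scaled by \<open>dil_inv t\<close>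
  with a covector scaled by \<open>dilT t\<close> restores the original pairing.\<close>

definition dilT :: "real => 'a => 'a" where "dilT t q = (SUM p:Idx. (t ^ snd p * (E p <.> q)) *R w p)"
text \<open>The limit of the scaled curve \<open>ct t k\<close> as t tends to 0: the Taylor
  polynomial of \<open>C k\<close> cut off at the length of its row.\<close>

definition c0 :: "'r => real => 'a" where "c0 k ta = (\<Sum>j<nw k. (ta ^ j / fact j) *R D j k)"
definition ct :: "real => 'r => real => 'a" where "ct t k ta = dil_inv t (C k (t * ta))"

lemma dil_linear: "linear (dil t)" "linear (dil_inv t)" "linear (dilT t)" unfolding dil_def dil_inv_def dilT_def
 by (auto intro!: linearI simp: algebra_simps inner_add_right sum.distrib scaleR_sum_right add_divide_distrib)

lemma dil_dil_inv: "t ~= 0 ==> dil t (dil_inv t v) = v"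
 by (simp add: dil_def w_sum dil_inv_def E_expand cong: sum.cong)

lemma dil_inv_inner_dilT: assumes "t ~= 0" shows "dil_inv t v <.> dilT t q = v <.> q"
proof -
 have "E p <.> dilT t q = t ^ snd p * (E p <.> q)" if "p : Idx" for p using that finite_Idx wE
  by (simp add: dilT_def inner_sum_right inner_commute[of "E p"] if_distrib[of "%x. _ * x"] cong: if_cong)
 hence "dil_inv t v <.> dilT t q = (SUM p:Idx. ((w p <.> v) / t ^ snd p) * (t ^ snd p * (E p <.> q)))"
  by (simp add: dil_inv_def inner_sum_left)
 thus ?thesis using assms by (simp add: inner_expand[of v q])
qed

lemma dilT_eq_0: assumes "t ~= 0" "dilT t q = 0" shows "q = 0"
proof (rule eq_0_if_orthogonal)
 fix p assume "p : Idx"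
 have "E p <.> q = dil_inv t (E p) <.> dilT t q" using dil_inv_inner_dilT[OF assms(1)] by simp
 thus "E p <.> q = 0" using assms(2) by simp
qed

lemma dil_bound: obtains c where "c >= 1" "!!t v. 0 <= t ==> t <= 1 ==> norm (dil t v) <= c * norm v"
 "!!t v. 0 <= t ==> t <= 1 ==> norm (dilT t v) <= c * norm v"
proof
 let ?c = "1 + (SUM p:Idx. norm (w p) * norm (E p))"
 have "(SUM p:Idx. norm (w p) * norm (E p)) >= 0" by (intro sum_nonneg) simp
 thus "?c >= 1" by simp
 fix t :: real and v :: 'a assume t: "0 <= t" "t <= 1"
 have tp: "\<bar>t ^ j\<bar> <= 1" for j using t by (simp add: power_le_one)
 have "norm (dil t v) <= (SUM p:Idx. norm (w p) * norm (E p) * norm v)" unfolding dil_def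
 proof (rule sum_norm_le)
  fix p
  have "\<bar>t ^ snd p\<bar> * \<bar>w p <.> v\<bar> * norm (E p) <= 1 * (norm (w p) * norm v) * norm (E p)"
   by (intro mult_mono tp Cauchy_Schwarz_ineq2) auto
  thus "norm ((t ^ snd p * (w p <.> v)) *R E p) <= norm (w p) * norm (E p) * norm v" by (simp add: abs_mult mult_ac)
 qed
 thus "norm (dil t v) <= ?c * norm v"
  unfolding sum_distrib_right[symmetric] distrib_right by (simp add: add_increasing)
 have "norm (dilT t v) <= (SUM p:Idx. norm (w p) * norm (E p) * norm v)" unfolding dilT_def
 proof (rule sum_norm_le)
  fix p
  have "\<bar>t ^ snd p\<bar> * \<bar>E p <.> v\<bar> * norm (w p) <= 1 * (norm (E p) * norm v) * norm (w p)"
   by (intro mult_mono tp Cauchy_Schwarz_ineq2) auto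
  thus "norm ((t ^ snd p * (E p <.> v)) *R w p) <= norm (w p) * norm (E p) * norm v" by (simp add: abs_mult mult_ac)
 qed
 thus "norm (dilT t v) <= ?c * norm v"
  unfolding sum_distrib_right[symmetric] distrib_right by (simp add: add_increasing)
qed

lemma ct_component:
 assumes p: "p : Idx" and t: "0 < t" "t <= de" and ta: "0 <= ta" "ta <= 1"
 shows "\<bar>(w p <.> C k (t * ta)) / t ^ snd p - (if fst p = k then ta ^ snd p / fact (snd p) else 0)\<bar>
  <= ((\<Sum>i<m. \<bar>w p <.> D i k\<bar>) + norm (w p) * rh) * t"
proof -
 let ?s = "t * ta" and ?j = "snd p" and ?a = "%i. w p <.> D i k"
 have s: "?s : {0..de}" using t ta mult_mono[of t de ta 1] by auto
 have jm: "?j < m" using p nw[of "fst p"] by (auto simp: Idx_def)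
 \<comment> \<open>A term of order i above that of p keeps a factor t after the division; the Taylor
   remainder is of this kind because the order of p is less than m.\<close>
 have tj: "t ^ i / t ^ ?j <= t" if "?j < i" for i
 proof -
  have "t ^ i / t ^ ?j = t ^ (i - ?j)" using that t by (simp add: power_diff)
  also have "... <= t ^ 1" using that t de by (intro power_decreasing) auto
  finally show ?thesis by simp
 qed
 define e where "e = C k ?s - (\<Sum>j<m. (?s ^ j / fact j) *R D j k)"
 have rho: "0 <= rh" using order_trans[OF norm_ge_zero taylor[of de k]] de zero_less_power[OF de(1), of m]
  by (auto simp: zero_le_mult_iff)
 have main: "\<bar>(?s ^ i / fact i) * ?a i / t ^ ?j - (if i = ?j & fst p = k then ta ^ ?j / fact ?j else 0)\<bar> <= \<bar>?a i\<bar> * t" for i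
 proof (cases "?a i = 0")
  case True
  hence "\<not> (i = ?j & fst p = k)" using wE[OF p p] by (auto simp: E_def)
  hence "(if i = ?j & fst p = k then ta ^ ?j / fact ?j else 0) = 0" by (rule if_not_P)
  thus ?thesis using True by simp
 next
  case False
  then consider "p = (k, i)" | "?j < i" using w_D[OF p] by blast
  thus ?thesis
  proof cases
   case 1
   hence "?a i = 1" using wE[OF p p] by (simp add: E_def)
   thus ?thesis using 1 t by (simp add: power_mult_distrib)
  next
   case 2
   have "\<bar>(?s ^ i / fact i) * ?a i / t ^ ?j\<bar> = \<bar>?a i\<bar> * ((t ^ i / t ^ ?j) * (ta ^ i / fact i))"
    using t ta by (simp add: power_mult_distrib abs_mult mult_ac)
   also have "... <= \<bar>?a i\<bar> * (t * 1)"
   proof (intro mult_left_mono mult_mono tj 2)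
    have "ta ^ i <= 1" using ta by (intro power_le_one)
    also have "1 <= (fact i :: real)" by (rule fact_ge_1)
    finally show "ta ^ i / fact i <= 1" by (simp add: divide_le_eq_1)
   qed (use t ta in auto)
   finally show ?thesis using 2 by simp
  qed
 qed
 have e: "\<bar>(w p <.> e) / t ^ ?j\<bar> <= norm (w p) * rh * t"
 proof -
  have "\<bar>w p <.> e\<bar> <= norm (w p) * (rh * ?s ^ m)" using taylor[OF s, of k] unfolding e_def
   by (intro order_trans[OF Cauchy_Schwarz_ineq2] mult_left_mono) auto
  also have "... <= norm (w p) * (rh * t ^ m)"
   using t ta rho by (intro mult_left_mono power_mono) (auto simp: mult_left_le)
  finally have "\<bar>w p <.> e\<bar> / t ^ ?j <= norm (w p) * (rh * t ^ m) / t ^ ?j"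
   using t by (intro divide_right_mono) auto
  also have "... = norm (w p) * rh * (t ^ m / t ^ ?j)" by simp
  also have "... <= norm (w p) * rh * t" using rho by (intro mult_left_mono tj jm) auto
  finally show ?thesis using t by simp
 qed
 have eq: "(w p <.> C k ?s) / t ^ ?j - (if fst p = k then ta ^ ?j / fact ?j else 0) =
   (\<Sum>i<m. (?s ^ i / fact i) * ?a i / t ^ ?j - (if i = ?j & fst p = k then ta ^ ?j / fact ?j else 0)) + (w p <.> e) / t ^ ?j"
 proof -
  have "w p <.> C k ?s = (\<Sum>i<m. (?s ^ i / fact i) * ?a i) + w p <.> e"
   by (simp add: e_def inner_diff_right inner_sum_right)
  moreover have "(\<Sum>i<m. if i = ?j & fst p = k then ta ^ ?j / fact ?j else 0) = (if fst p = k then ta ^ ?j / fact ?j else 0)"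
   using jm by (cases "fst p = k") auto
  ultimately show ?thesis by (simp add: sum_subtractf add_divide_distrib sum_divide_distrib)
 qed
 have "\<bar>(w p <.> C k ?s) / t ^ ?j - (if fst p = k then ta ^ ?j / fact ?j else 0)\<bar> <=
   (\<Sum>i<m. \<bar>?a i\<bar> * t) + norm (w p) * rh * t"
  unfolding eq by (rule order_trans[OF abs_triangle_ineq add_mono[OF order_trans[OF sum_abs sum_mono[OF main]] e]])
 thus ?thesis by (simp add: algebra_simps sum_distrib_left)
qed

lemma c0_expand: "c0 k ta = (SUM p:Idx. (if fst p = k then ta ^ snd p / fact (snd p) else 0) *R E p)"
proof -
 have "(SUM p:Idx. (if fst p = k then ta ^ snd p / fact (snd p) else 0) *R E p)
   = (SUM p:Pair k ` {..<nw k}. (ta ^ snd p / fact (snd p)) *R E p)"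
  by (rule sum.mono_neutral_cong_right[OF finite_Idx]) (auto simp: Idx_def)
 also have "... = c0 k ta" unfolding c0_def by (subst sum.reindex) (auto simp: E_def inj_on_def)
 finally show ?thesis by simp
qed

lemma ct_approx: obtains c where "c >= 1"
 "!!t ta k. 0 < t ==> t <= de ==> 0 <= ta ==> ta <= 1 ==> norm (ct t k ta - c0 k ta) <= c * t"
 "!!t ta k. 0 < t ==> t <= de ==> 0 <= ta ==> ta <= 1 ==> norm (ct t k ta) <= c"
 "!!ta k. 0 <= ta ==> ta <= 1 ==> norm (c0 k ta) <= c"
proof -
 have rho: "0 <= rh" using order_trans[OF norm_ge_zero taylor[of de]] de zero_less_power[OF de(1), of m]
  by (auto simp: zero_le_mult_iff)
 define d where "d k = (SUM p:Idx. ((\<Sum>i<m. \<bar>w p <.> D i k\<bar>) + norm (w p) * rh) * norm (E p))" for k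
 define e where "e = (SUM p:Idx. norm (E p))"
 have d0: "d k >= 0" for k unfolding d_def using rho by (intro sum_nonneg mult_nonneg_nonneg add_nonneg_nonneg) auto
 have e0: "e >= 0" unfolding e_def by (intro sum_nonneg) auto
 have 1: "norm (ct t k ta - c0 k ta) <= d k * t" if "0 < t" "t <= de" "0 <= ta" "ta <= 1" for t ta k
 proof -
  let ?x = "%p. (w p <.> C k (t * ta)) / t ^ snd p - (if fst p = k then ta ^ snd p / fact (snd p) else 0)"
  have "ct t k ta - c0 k ta = (SUM p:Idx. ?x p *R E p)"
   by (simp add: ct_def dil_inv_def c0_expand sum_subtractf scaleR_diff_left)
  also have "norm ... <= (SUM p:Idx. ((\<Sum>i<m. \<bar>w p <.> D i k\<bar>) + norm (w p) * rh) * t * norm (E p))"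
  proof (rule sum_norm_le)
   fix p assume "p : Idx"
   from mult_right_mono[OF ct_component[OF this that, of k] norm_ge_zero[of "E p"]]
   show "norm (?x p *R E p) <= ((\<Sum>i<m. \<bar>w p <.> D i k\<bar>) + norm (w p) * rh) * t * norm (E p)"
    by (simp only: norm_scaleR)
  qed
  also have "... = d k * t" unfolding d_def sum_distrib_right by (rule sum.cong) auto
  finally show ?thesis .
 qed
 have 2: "norm (c0 k ta) <= e" if "0 <= ta" "ta <= 1" for ta k unfolding c0_expand e_def
 proof (rule sum_norm_le)
  fix p :: "'r \<times> nat"
  have "ta ^ snd p <= 1" using that by (intro power_le_one)
  also have "1 <= (fact (snd p) :: real)" by (rule fact_ge_1)
  finally have "ta ^ snd p / fact (snd p) <= 1" by (simp add: divide_le_eq_1)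
  hence "(if fst p = k then ta ^ snd p / fact (snd p) else 0) * norm (E p) <= 1 * norm (E p)"
   by (intro mult_right_mono) auto
  thus "norm ((if fst p = k then ta ^ snd p / fact (snd p) else 0) *R E p) <= norm (E p)" using that by auto
 qed
 let ?d = "SU k. d k"
 have dk: "d k <= ?d" for k using d0 by (intro member_le_sum) auto
 have d0': "?d >= 0" using d0 by (intro sum_nonneg) auto
 show thesis
 proof (rule that[of "1 + ?d + e"])
  show "1 <= 1 + ?d + e" using d0' e0 by simp
  fix t ta k assume *: "0 < t" "t <= de" "0 <= ta" "(ta::real) <= 1"
  have "norm (ct t k ta - c0 k ta) <= d k * t" by (rule 1[OF *])
  also have "... <= ?d * t" using dk * by (intro mult_right_mono) auto
  finally have **: "norm (ct t k ta - c0 k ta) <= ?d * t" .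
  also have "... <= (1 + ?d + e) * t" using e0 * by (intro mult_right_mono) auto
  finally show "norm (ct t k ta - c0 k ta) <= (1 + ?d + e) * t" .
  have "?d * t <= ?d * 1" using * de d0' by (intro mult_left_mono) auto
  moreover have "norm (ct t k ta) <= norm (c0 k ta) + norm (ct t k ta - c0 k ta)" by (rule norm_triangle_sub)
  ultimately show "norm (ct t k ta) <= 1 + ?d + e" using ** 2[OF *(3,4), of k] by linarith
 next
  fix ta k assume *: "0 <= ta" "(ta::real) <= 1"
  show "norm (c0 k ta) <= 1 + ?d + e" using 2[OF *, of k] d0' by linarith
 qed
qed

text \<open>The controllability Gramian of the limit system on the unit interval.\<close>

definition gram :: "'a => 'a" where
 "gram q = integral {0..1} (%ta. SU k. (c0 k ta <.> q) *R c0 k ta)"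

lemma c0_continuous: "continuous_on S (c0 k)" unfolding c0_def by (intro continuous_intros) auto

lemma gram_integrand_continuous: "continuous_on S (%ta. SU k. (c0 k ta <.> q) *R c0 k ta)"
 by (intro continuous_intros c0_continuous)

lemma gram_linear: "linear gram"
proof (rule linearI)
 fix p q :: 'a and c :: real
 note i = integrable_continuous_interval[OF gram_integrand_continuous]
 show "gram (p + q) = gram p + gram q"
  unfolding gram_def by (subst Henstock_Kurzweil_Integration.integral_add[symmetric, OF i i])
   (simp add: inner_add_right scaleR_add_left sum.distrib)
 show "gram (c *R p) = c *R gram p"
  unfolding gram_def by (subst integral_cmul[symmetric]) (simp add: scaleR_sum_right)
qed

text \<open>The control that the constant covector q produces in row k; a polynomial of degree less
  than the length of the row.\<close>

definition prof :: "'r => 'a => real poly" where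
 "prof k q = (\<Sum>j<nw k. monom ((D j k <.> q) / fact j) j)"

lemma poly_prof: "poly (prof k q) ta = c0 k ta <.> q"
 by (simp add: prof_def c0_def poly_sum poly_monom inner_sum_left) (simp add: mult_ac)

lemma degree_prof: "0 < nw k ==> degree (prof k q) < nw k"
 unfolding prof_def by (rule degree_sum_less) (auto intro: le_less_trans[OF degree_monom_le])

text \<open>\<open>w (k, i)\<close> extracts the monomial of degree i from row k of the limit
  curves. So the components of the Gram operator are moments of the row profiles, and the rows
  decouple.\<close>

lemma gram_moments:
 assumes "i < nw k"
 shows "w (k, i) <.> gram q = integral {0..1} (%ta. ta ^ i * poly (prof k q) ta) / fact i"
proof -
 have p: "(k, i) : Idx" using assms by (simp add: Idx_def)
 have c: "w (k, i) <.> c0 k' ta = (if k = k' then ta ^ i / fact i else 0)" for k' ta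
  unfolding c0_expand w_sum[OF p] by simp
 have "w (k, i) <.> gram q = integral {0..1} (%ta. w (k, i) <.> (SU k. (c0 k ta <.> q) *R c0 k ta))"
  unfolding gram_def
  by (rule integral_linear[OF integrable_continuous_interval[OF gram_integrand_continuous] bounded_linear_inner_right, symmetric, unfolded o_def])
 also have "... = integral {0..1} (%ta. (ta ^ i * poly (prof k q) ta) / fact i)"
  by (simp add: inner_sum_right c poly_prof if_distrib[of "%x. _ * x"] mult.commute cong: if_cong)
 finally show ?thesis by simp
qed

lemma prof_eq_0:
 assumes "!!i. i < nw k ==> w (k, i) <.> gram q = 0" shows "prof k q = 0"
proof (cases "nw k = 0")
 case True
 thus ?thesis by (simp add: prof_def)
next
 case False
 show ?thesis
 proof (rule poly_eq_0_if_orthogonal[OF degree_prof])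
  fix i assume "i < nw k"
  thus "integral {0..1} (%x. x ^ i * poly (prof k q) x) = 0" using gram_moments[of i k q] assms by simp
 qed (use False in simp)
qed

text \<open>Vanishing moments make every profile zero, and the coefficients of the profiles are, up
  to factorials, the pairings of q with a basis.\<close>

lemma gram_inj: assumes "gram q = 0" shows "q = 0"
proof (rule eq_0_if_orthogonal)
 fix p assume p: "p : Idx"
 obtain k j where kj: "p = (k, j)" "j < nw k" using p by (auto simp: Idx_def)
 have "coeff (prof k q) j = (D j k <.> q) / fact j" unfolding prof_def coeff_sum using kj by (simp add: coeff_monom)
 moreover have "prof k q = 0" by (rule prof_eq_0) (simp add: assms)
 ultimately show "E p <.> q = 0" by (simp add: kj E_def)
qed

text \<open>The terminal covector steering \<open>E (a, 0)\<close> to the origin in the limit system excites only the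
  row of \<open>a\<close>, with a profile that represents evaluation at \<open>0\<close>.\<close>

lemma gram_preimage_profile:
 assumes a: "0 < nw a" and q: "gram q = D 0 a"
 shows "k ~= a ==> c0 k ta <.> q = 0" "(c0 a 1 <.> q)\<^sup>2 = (real (nw a))\<^sup>2"
proof -
 have a0: "(a, 0) : Idx" using a by (simp add: Idx_def)
 have W: "w (k, i) <.> gram q = (if (k, i) = (a, 0) then 1 else 0)" if "i < nw k" for k i
  using wE[of "(k, i)" "(a, 0)"] a0 that q by (simp add: Idx_def E_def)
 show "c0 k ta <.> q = 0" if "k ~= a" using prof_eq_0[of k q] W that by (simp add: poly_prof[symmetric])
 have "integral {0..1} (%x. x ^ i * poly (prof a q) x) = (if i = 0 then 1 else 0)" if "i < nw a" for i
  using gram_moments[OF that, of q] W[OF that] by (simp split: if_splits)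
 from evaluation_representer_at_1[OF degree_prof[OF a] this]
 show "(c0 a 1 <.> q)\<^sup>2 = (real (nw a))\<^sup>2" by (simp add: poly_prof)
qed

text \<open>The Jacobi equation in a moving frame, with state z vanishing at the final time.
  \<open>g\<close> plays the role of the inverse control metric, \<open>ka\<close> couples state and
  costate, and \<open>R\<close> is the second derivative of the Hamiltonian in the base
  point.\<close>

definition solves :: "('r => real => 'a) => ('r => 'r => real => real) => (real => 'a => 'a) => real =>
  (real => 'a) => (real => 'a) => bool" where
 "solves ka g R t z q \<longleftrightarrow> z t = 0 & (ALL s:{0..t}.
   (z has_vd (SU k. (ka k s <.> z s + (SU l. g k l s * (C l s <.> q s))) *R C k s)) (at s within {0..t}) &
   (q has_vd (- R s (z s) - (SU k. (C k s <.> q s) *R ka k s))) (at s within {0..t}))"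

text \<open>In the scaled variables the system is an \<open>O(t)\<close> perturbation of
  \<open>z' = \<Sum>k. (c0 k \<bullet> q) c0 k\<close>, \<open>q' = 0\<close>.\<close>

lemma scaled_boundary_estimate:
 assumes c1: "!!k s. s : {0..de} ==> norm (ka k s) <= c1"
  "!!s v. s : {0..de} ==> norm (R s v) <= c1 * norm v"
  "!!k l s. s : {0..de} ==> \<bar>g k l s - (if k = l then 1 else 0)\<bar> <= c1 * s"
 obtains c t0 where "c >= 0" "0 < t0" "t0 <= de"
  "!!t z q. 0 < t ==> t <= t0 ==> solves ka g R t z q ==>
   norm (dil_inv t (z 0) + gram (t *R dilT t (q t))) <= c * t * norm (t *R dilT t (q t))"
proof -
 obtain c2 where c2: "c2 >= 1" and ctc0: "!!t ta k. 0 < t ==> t <= de ==> 0 <= ta ==> ta <= 1 ==> norm (ct t k ta - c0 k ta) <= c2 * t"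
  and ctb: "!!t ta k. 0 < t ==> t <= de ==> 0 <= ta ==> ta <= 1 ==> norm (ct t k ta) <= c2"
  and c0b: "!!ta k. 0 <= ta ==> ta <= 1 ==> norm (c0 k ta) <= c2" by (rule ct_approx) (rule that; assumption)
 obtain c3 where c3: "c3 >= 1" and dl: "!!t v. 0 <= t ==> t <= 1 ==> norm (dil t v) <= c3 * norm v"
  and dT: "!!t v. 0 <= t ==> t <= 1 ==> norm (dilT t v) <= c3 * norm v" by (rule dil_bound) (rule that; assumption)
 define b where "b = \<bar>c1\<bar> + c2 + c3"
 have b: "0 <= b" "c1 <= b" "c2 <= b" "c3 <= b" using c2 c3 by (auto simp: b_def)
 define r where "r = real CARD('r)"
 \<comment> \<open>\<open>A\<close> collects the coefficients of all errors of first order in t and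
   \<open>P\<close> bounds the Gram integrand. \<open>t0\<close> is chosen so that A (P + 2) t is at
   most 1/2 and the sup norm can be absorbed.\<close>
 define A where "A = r * ((b * b * b) + r * (b * b * b) + 2 * (b * b)) + b * b * b + r * (b * b * b)"
 define P where "P = r * (b * b)"
 have A0: "A >= 0" and P0: "P >= 0" using b(1) by (auto simp: A_def P_def r_def)
 define t0 where "t0 = min de (1 / (2 * (A * (P + 2) + 1)))"
 have "A * (P + 2) + 1 > 0" using A0 P0 by (simp add: add_nonneg_pos)
 hence t0: "0 < t0" "t0 <= de" using de by (auto simp: t0_def)
 have t0A: "A * (P + 2) * t <= 1 / 2" if "0 < t" "t <= t0" for t
 proof -
  have "(A * (P + 2) + 1) * t <= (A * (P + 2) + 1) * (1 / (2 * (A * (P + 2) + 1)))"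
   using that `A * (P + 2) + 1 > 0` by (intro mult_left_mono) (auto simp: t0_def)
  also have "... = 1 / 2" using `A * (P + 2) + 1 > 0` by simp
  finally show ?thesis using that by (simp add: distrib_right)
 qed
 have ib: "\<bar>x <.> y\<bar> <= p * q" if "norm x <= p" "norm y <= q" for x y :: 'a and p q
  using that order_trans[OF norm_ge_zero that(1)] by (intro order_trans[OF Cauchy_Schwarz_ineq2 mult_mono]) auto
 have sb: "norm (s *R y) <= p * q" if "\<bar>s\<bar> <= p" "norm y <= q" for y :: 'a and p q s
  unfolding norm_scaleR using that by (intro mult_mono) auto
 have nsum: "norm (SU k. h k) <= r * q" if "!!k. norm (h k) <= q" for h :: "'r => 'v::real_normed_vector" and q
  using sum_norm_le[of UNIV h "%k. q"] that by (simp add: r_def)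
 define c where "c = (A + P * A) * (2 * (P + 1))"
 show thesis
 proof (rule that[of c t0])
  show "c >= 0" using A0 P0 by (simp add: c_def)
  fix t z q assume t: "0 < t" "t <= t0" and sol: "solves ka g R t z q"
  have tde: "t <= de" "t <= 1" and tn: "t ~= 0" using t t0 de by auto
  define Z where "Z ta = dil_inv t (z (t * ta))" for ta
  \<comment> \<open>The extra factor t compensates the change of the time variable: the leading part
    of Z' becomes the Gram integrand in \<open>ct\<close>, with no power of t in front.\<close>
  define Q where "Q ta = t *R dilT t (q (t * ta))" for ta
  have st: "t * ta : {0..t}" "t * ta : {0..de}" if "ta : {0..1}" for ta
   using that t tde mult_left_mono[of ta 1 t] by (auto intro: order_trans[of _ t de])
  have zZ: "z (t * ta) = dil t (Z ta)" for ta by (simp add: Z_def dil_dil_inv tn)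
  have CQ: "C k (t * ta) <.> q (t * ta) = (ct t k ta <.> Q ta) / t" for k ta
   using dil_inv_inner_dilT[OF tn] tn by (simp add: ct_def Q_def)
  define Z' where "Z' ta = (SU k. (t * (ka k (t * ta) <.> dil t (Z ta)) + (SU l. g k l (t * ta) * (ct t l ta <.> Q ta))) *R ct t k ta)" for ta
  define Q' where "Q' ta = - (t * t) *R dilT t (R (t * ta) (dil t (Z ta))) - (SU k. (t * (ct t k ta <.> Q ta)) *R dilT t (ka k (t * ta)))" for ta
  have resc: "((%ta. h (f (t * ta))) has_vd h (t *R f')) (at ta within {0..1})"
   if "(f has_vd f') (at (t * ta) within {0..t})" "linear h" for f :: "real => 'a" and h :: "'a => 'a" and f' ta
  proof -
   have "(f has_vd f') (at (t * ta) within (*) t ` {0..1})"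
    by (rule has_vector_derivative_within_subset[OF that(1)]) (use st in auto)
   moreover have "((*) t has_vd t) (at ta within {0..1})" by (auto intro!: derivative_eq_intros)
   ultimately have "((f \<circ> (*) t) has_vd t *R f') (at ta within {0..1})" by (intro vector_diff_chain_within)
   from bounded_linear.has_vector_derivative[OF linear_conv_bounded_linear[THEN iffD1, OF that(2)] this]
   show ?thesis by (simp add: o_def)
  qed
  have Zd: "(Z has_vd Z' ta) (at ta within {0..1})" if ta: "ta : {0..1}" for ta
  proof -
   from sol st(1)[OF ta] have "(z has_vd (SU k. (ka k (t * ta) <.> z (t * ta) +
     (SU l. g k l (t * ta) * (C l (t * ta) <.> q (t * ta)))) *R C k (t * ta))) (at (t * ta) within {0..t})"
    unfolding solves_def by blast
   from resc[OF this dil_linear(2)[of t]] show ?thesis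
    using tn unfolding Z_def[symmetric] by (simp add: linear_scale[OF dil_linear(2)] linear_sum[OF dil_linear(2)] Z'_def CQ zZ
     ct_def[symmetric] scaleR_sum_right distrib_left sum_distrib_left sum_divide_distrib)
  qed
  have Qd: "(Q has_vd Q' ta) (at ta within {0..1})" if ta: "ta : {0..1}" for ta
  proof -
   have l: "linear (%x. t *R dilT t x)" by (intro linear_compose_scale_right dil_linear(3))
   from sol st(1)[OF ta] have "(q has_vd (- R (t * ta) (z (t * ta)) -
     (SU k. (C k (t * ta) <.> q (t * ta)) *R ka k (t * ta)))) (at (t * ta) within {0..t})"
    unfolding solves_def by blast
   from resc[OF this l] show ?thesis
    using tn unfolding Q_def[symmetric] by (simp add: linear_scale[OF dil_linear(3)] linear_diff[OF dil_linear(3)]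
     linear_neg[OF dil_linear(3)] linear_sum[OF dil_linear(3)] Q'_def CQ zZ scaleR_sum_right scaleR_diff_right)
  qed
  have "continuous_on {0..1} (%ta. norm (Z ta))" "continuous_on {0..1} (%ta. norm (Q ta))"
   by (intro continuous_on_norm continuous_on_vector_derivative[OF Zd] continuous_on_vector_derivative[OF Qd]; assumption)+
  then obtain ta1 ta2 where ta: "ta1 : {0..1}" "!!ta. ta : {0..1} ==> norm (Z ta) <= norm (Z ta1)"
   "ta2 : {0..1}" "!!ta. ta : {0..1} ==> norm (Q ta) <= norm (Q ta2)"
   using continuous_attains_sup[OF compact_Icc, of 0 1 "%ta. norm (Z ta)"]
    continuous_attains_sup[OF compact_Icc, of 0 1 "%ta. norm (Q ta)"] by auto
  \<comment> \<open>Z and Q are bounded together. Since Z vanishes at 1 and Q varies little, M is at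
    most half of itself plus a multiple of the terminal norm N of Q.\<close>
  define M where "M = norm (Z ta1) + norm (Q ta2)"
  have M0: "M >= 0" by (simp add: M_def)
  have ZM: "norm (Z ta) <= M" and QM: "norm (Q ta) <= M" if "ta : {0..1}" for ta
   using ta(2,4)[OF that] by (auto simp: M_def intro: add_increasing add_increasing2)
  let ?G = "%ta x. SU k. (c0 k ta <.> x) *R c0 k ta"
  have bnds: "norm (ct t k ta) <= b" "norm (ct t k ta - c0 k ta) <= b * t" "norm (c0 k ta) <= b" "norm (ka k (t * ta)) <= b"
   "norm (dil t (Z ta)) <= b * M" "\<bar>g k l (t * ta) - (if k = l then 1 else 0)\<bar> <= b * t" if ta: "ta : {0..1}" for ta k l
  proof -
   have "c2 * t <= b * t" using b(3) t by (intro mult_right_mono) auto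
   thus "norm (ct t k ta) <= b" "norm (ct t k ta - c0 k ta) <= b * t" "norm (c0 k ta) <= b" "norm (ka k (t * ta)) <= b"
    using ctb[OF t(1) tde(1), of ta k] ctc0[OF t(1) tde(1), of ta k] c0b[of ta k] c1(1)[OF st(2)[OF ta], of k] ta b
    by (auto intro: order_trans)
   have "c3 * norm (Z ta) <= b * M" using b(1,4) ZM[OF ta] by (intro mult_mono) auto
   thus "norm (dil t (Z ta)) <= b * M" using dl[of t "Z ta"] t tde by linarith
   have "c1 * (t * ta) <= b * t" using b(1,2) st(1)[OF ta] by (intro mult_mono) auto
   thus "\<bar>g k l (t * ta) - (if k = l then 1 else 0)\<bar> <= b * t" using c1(3)[OF st(2)[OF ta], of k l] by linarith
  qed
  have dTb: "norm (dilT t v) <= b * x" if "norm v <= x" for v x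
   using dT[of t v] t tde mult_mono[OF b(4) that b(1) norm_ge_zero] by simp
  have Gb: "norm (?G ta x) <= P * y" if "ta : {0..1}" "norm x <= y" for ta x y
   using nsum[OF sb[OF ib[OF bnds(3)[OF that(1)] that(2)] bnds(3)[OF that(1)]]] by (simp add: P_def mult_ac)
  have E: "norm (Z' ta - ?G ta (Q ta)) <= A * t * M" if ta: "ta : {0..1}" for ta
  proof -
   let ?ep = "%k. t * (ka k (t * ta) <.> dil t (Z ta)) + (SU l. (g k l (t * ta) - (if k = l then 1 else 0)) * (ct t l ta <.> Q ta))"
   have gs: "(SU l. g k l (t * ta) * (ct t l ta <.> Q ta)) =
     (SU l. (g k l (t * ta) - (if k = l then 1 else 0)) * (ct t l ta <.> Q ta)) + ct t k ta <.> Q ta" for k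
    by (simp add: left_diff_distrib sum_subtractf if_distrib[of "%x. x * _"] cong: if_cong)
   have eqn: "Z' ta - ?G ta (Q ta) = (SU k. ?ep k *R ct t k ta +
     ((ct t k ta <.> Q ta) *R (ct t k ta - c0 k ta) + ((ct t k ta - c0 k ta) <.> Q ta) *R c0 k ta))"
    unfolding Z'_def gs sum_subtractf[symmetric] by (intro sum.cong) (simp_all add: algebra_simps inner_diff_left)
   have "norm (Z' ta - ?G ta (Q ta)) <= r * ((t * (b * (b * M)) + r * ((b * t) * (b * M))) * b + ((b * M) * (b * t) + ((b * t) * M) * b))"
    unfolding eqn
   proof (rule nsum)
    fix k
    have "\<bar>t * (ka k (t * ta) <.> dil t (Z ta))\<bar> <= t * (b * (b * M))"
     using ib[OF bnds(4,5)[OF ta]] t by (simp add: abs_mult)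
    moreover have "\<bar>(g k l (t * ta) - (if k = l then 1 else 0)) * (ct t l ta <.> Q ta)\<bar> <= (b * t) * (b * M)" for l
     unfolding abs_mult by (rule mult_mono[OF bnds(6)[OF ta] ib[OF bnds(1)[OF ta] QM[OF ta]]]) (use b t in auto)
    hence "\<bar>SU l. (g k l (t * ta) - (if k = l then 1 else 0)) * (ct t l ta <.> Q ta)\<bar> <= r * ((b * t) * (b * M))"
     unfolding real_norm_def[symmetric] by (intro nsum) simp
    ultimately have "\<bar>?ep k\<bar> <= t * (b * (b * M)) + r * ((b * t) * (b * M))" by linarith
    thus "norm (?ep k *R ct t k ta + ((ct t k ta <.> Q ta) *R (ct t k ta - c0 k ta) + ((ct t k ta - c0 k ta) <.> Q ta) *R c0 k ta))
      <= (t * (b * (b * M)) + r * ((b * t) * (b * M))) * b + ((b * M) * (b * t) + ((b * t) * M) * b)"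
     by (rule order_trans[OF norm_triangle_ineq add_mono[OF sb[OF _ bnds(1)[OF ta]] order_trans[OF norm_triangle_ineq
      add_mono[OF sb[OF ib[OF bnds(1)[OF ta] QM[OF ta]] bnds(2)[OF ta]] sb[OF ib[OF bnds(2)[OF ta] QM[OF ta]] bnds(3)[OF ta]]]]]])
   qed
   also have "... = r * ((b * b * b) + r * (b * b * b) + 2 * (b * b)) * (t * M)" by (simp add: algebra_simps)
   also have "... <= A * (t * M)" using b(1) t M0 by (intro mult_right_mono) (auto simp: A_def r_def)
   finally show ?thesis by (simp add: mult.assoc)
  qed
  have Q'b: "norm (Q' ta) <= A * t * M" if ta: "ta : {0..1}" for ta
  proof -
   have "norm (R (t * ta) (dil t (Z ta))) <= b * (b * M)"
    using c1(2)[OF st(2)[OF ta], of "dil t (Z ta)"] mult_mono[OF b(2) bnds(5)[OF ta] b(1) norm_ge_zero] by linarith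
   moreover have "\<bar>- (t * t)\<bar> <= t" using t tde by (simp add: mult_left_le)
   moreover have "\<bar>t * (ct t k ta <.> Q ta)\<bar> <= t * (b * M)" for k
    using ib[OF bnds(1)[OF ta] QM[OF ta]] t by (simp add: abs_mult)
   ultimately have "norm (Q' ta) <= t * (b * (b * (b * M))) + r * ((t * (b * M)) * (b * b))"
    unfolding Q'_def by (intro order_trans[OF norm_triangle_ineq4] add_mono sb nsum dTb bnds(4)[OF ta])
   also have "... = (b * b * b + r * (b * b * b)) * (t * M)" by (simp add: algebra_simps)
   also have "... <= A * (t * M)" using b(1) t M0 by (intro mult_right_mono) (auto simp: A_def r_def)
   finally show ?thesis by (simp add: mult.assoc)
  qed
  have Z1: "Z 1 = 0" using sol by (simp add: Z_def solves_def linear_0[OF dil_linear(2)])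
  define N where "N = norm (Q 1)"
  have inc: "norm (h x - h 1) <= u" if "!!ta. ta : {0..1} ==> (h has_vd h' ta) (at ta within {0..1})"
   "!!ta. ta : {0..1} ==> norm (h' ta) <= u" "x : {0..1}" for h h' :: "real => 'a" and u x
  proof -
   have "0 <= u" using order_trans[OF norm_ge_zero that(2)[of 0]] by simp
   hence "u * \<bar>x - 1\<bar> <= u" using that(3) by (intro mult_left_le) auto
   thus ?thesis using derivative_increment_bound[OF that(1,2,3), of 1] by simp
  qed
  have QN: "norm (Q ta - Q 1) <= A * t * M" if "ta : {0..1}" for ta by (rule inc[OF Qd Q'b that])
  have QN': "norm (Q ta) <= N + A * t * M" if "ta : {0..1}" for ta
   using norm_triangle_sub[of "Q ta" "Q 1"] QN[OF that] by (simp add: N_def)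
  have Z'b: "norm (Z' ta) <= A * t * M + P * (N + A * t * M)" if "ta : {0..1}" for ta
   using norm_triangle_sub[of "Z' ta" "?G ta (Q ta)"] E[OF that] Gb[OF that QN'[OF that]] by linarith
  have "norm (Z ta1) <= A * t * M + P * (N + A * t * M)" using inc[OF Zd Z'b ta(1)] Z1 by simp
  hence "M <= A * (P + 2) * t * M + (P + 1) * N"
   using QN'[OF ta(3)] by (simp add: M_def[symmetric] algebra_simps) (simp add: M_def algebra_simps)
  moreover have "A * (P + 2) * t * M <= 1 / 2 * M" using t0A[OF t] M0 by (rule mult_right_mono)
  ultimately have "M <= 1 / 2 * M + (P + 1) * N" by linarith
  hence MN: "M <= 2 * (P + 1) * N" by (simp add: algebra_simps)
  define y where "y ta = Z ta - integral {0..ta} (%ta. ?G ta (Q 1))" for ta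
  have yd: "(y has_vd Z' ta - ?G ta (Q 1)) (at ta within {0..1})" if "ta : {0..1}" for ta unfolding y_def
   by (rule has_vector_derivative_diff[OF Zd[OF that] integral_has_vector_derivative[OF gram_integrand_continuous that]])
  have yb: "norm (Z' ta - ?G ta (Q 1)) <= c * t * N" if ta: "ta : {0..1}" for ta
  proof -
   have "Z' ta - ?G ta (Q 1) = (Z' ta - ?G ta (Q ta)) + ?G ta (Q ta - Q 1)"
    by (simp add: inner_diff_right scaleR_diff_left sum_subtractf)
   hence "norm (Z' ta - ?G ta (Q 1)) <= A * t * M + P * (A * t * M)"
    using norm_triangle_ineq[of "Z' ta - ?G ta (Q ta)" "?G ta (Q ta - Q 1)"] E[OF ta] Gb[OF ta QN[OF ta]] by (simp only:)
   also have "... = (A + P * A) * t * M" by (simp add: algebra_simps)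
   also have "... <= (A + P * A) * t * (2 * (P + 1) * N)" using MN A0 P0 t by (intro mult_left_mono) auto
   finally show ?thesis by (simp add: c_def mult_ac)
  qed
  have "norm (y 0 - y 1) <= c * t * N" by (rule inc[OF yd yb]) auto
  moreover have "y 0 - y 1 = Z 0 + gram (Q 1)" using Z1 by (simp add: y_def gram_def)
  ultimately show "norm (dil_inv t (z 0) + gram (t *R dilT t (q t))) <= c * t * norm (t *R dilT t (q t))"
   by (simp add: Z_def Q_def N_def)
 qed (use t0 in auto)
qed

end

lemma cancel_double: "x ~= 0 ==> x * (y / (2 * x)) = y / (2::real)" by simp

context adapted_curves begin

lemma gram_lower_bound: obtains mv where "mv > 0" "!!q. mv * norm q <= norm (gram q)"
proof (rule linear_inj_bounded_below_pos[OF gram_linear])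
 show "inj gram" using gram_inj linear_injective_0[OF gram_linear] by blast
qed (rule that)

lemma gram_surj: obtains q where "gram q = v"
proof -
 have "inj gram" using gram_inj linear_injective_0[OF gram_linear] by blast
 hence "surj gram" using linear_injective_imp_surjective[OF gram_linear] by blast
 thus thesis using that by (metis surjD)
qed

text \<open>Vectors of flag order 0 are fixed by the dilations, so the initial vector of the scaled
  boundary problem does not depend on t.\<close>

lemma dil_inv_D0: assumes "0 < nw a" shows "dil_inv t (D 0 a) = D 0 a"
proof -
 have a0: "(a, 0) : Idx" using assms by (simp add: Idx_def)
 have "dil_inv t (E (a, 0)) = (SUM p:Idx. (if p = (a, 0) then 1 else 0) *R E p)"
  unfolding dil_inv_def by (intro sum.cong) (auto simp: wE[OF _ a0])
 also have "... = E (a, 0)" using a0 finite_Idx by (simp add: if_distrib[of "%x. x *R _"] cong: if_cong)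
 finally show ?thesis by (simp add: E_def)
qed

text \<open>Absence of conjugate times: with z 0 = 0 the boundary estimate bounds the Gram image of
  the scaled covector by c t times its norm, which contradicts the lower bound \<open>mv\<close>
  unless the covector is 0.\<close>

lemma terminal_map_injective:
 assumes c1: "!!k s. s : {0..de} ==> norm (ka k s) <= c1"
  "!!s v. s : {0..de} ==> norm (R s v) <= c1 * norm v"
  "!!k l s. s : {0..de} ==> \<bar>g k l s - (if k = l then 1 else 0)\<bar> <= c1 * s"
 obtains t1 where "0 < t1" "!!t z q. 0 < t ==> t <= t1 ==> solves ka g R t z q ==> z 0 = 0 ==> q t = 0"
proof -
 obtain c t0 where c: "c >= 0" and t0: "0 < t0" "t0 <= de" and est: "!!t z q. 0 < t ==> t <= t0 ==> solves ka g R t z q ==>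
   norm (dil_inv t (z 0) + gram (t *R dilT t (q t))) <= c * t * norm (t *R dilT t (q t))"
  by (rule scaled_boundary_estimate[of ka c1 R g, OF c1]) (assumption | (rule that; assumption))+
 obtain mv where mu: "mv > 0" "!!q. mv * norm q <= norm (gram q)" by (rule gram_lower_bound) (rule that; assumption)
 define t1 where "t1 = min t0 (mv / (2 * (c + 1)))"
 have t1: "t1 > 0" using t0 mu c by (simp add: t1_def)
 show thesis
 proof (rule that[OF t1])
  fix t z q assume t: "0 < t" "t <= t1" and sol: "solves ka g R t z q" and z0: "z 0 = 0"
  let ?q = "t *R dilT t (q t)"
  have "norm (gram ?q) <= c * t * norm ?q"
   using est[OF t(1) _ sol] t z0 linear_0[OF dil_linear(2)] by (simp add: t1_def)
  hence "mv * norm ?q <= c * t * norm ?q" using mu(2)[of ?q] by linarith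
  moreover have "c * t < mv"
  proof -
   have "c * t <= (c + 1) * (mv / (2 * (c + 1)))" using t c by (intro mult_mono) (auto simp: t1_def)
   also have "... = mv / 2" using c by (intro cancel_double) simp
   finally show ?thesis using mu by simp
  qed
  ultimately have "norm ?q = 0"
   using mult_strict_right_mono[of "c * t" mv "norm ?q"] by (cases "norm ?q = 0") (auto simp: less_le_not_le)
  hence "dilT t (q t) = 0" using t by simp
  thus "q t = 0" by (rule dilT_eq_0[rotated]) (use t in simp)
 qed
qed

text \<open>The scaled terminal covector tends to minus the Gram preimage of \<open>D 0 a\<close>.
  The form contains two covectors, so t^2 supplies one factor t to each; the limit is a product of
  profiles at 1, diagonal because different rows decouple.\<close>

theorem terminal_cost_asymptotics:
 assumes c1: "!!k s. s : {0..de} ==> norm (ka k s) <= c1"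
  "!!s v. s : {0..de} ==> norm (R s v) <= c1 * norm v"
  "!!k l s. s : {0..de} ==> \<bar>g k l s - (if k = l then 1 else 0)\<bar> <= c1 * s"
  and a: "0 < nw a" and b: "0 < nw b"
  and W: "\<forall>\<^sub>F t in at_right 0. EX z q. solves ka g R t z q & z 0 = D 0 a & q t = W t"
  and W': "\<forall>\<^sub>F t in at_right 0. EX z q. solves ka g R t z q & z 0 = D 0 b & q t = W' t"
 shows "((%t. t\<^sup>2 * (SU k. SU l. g k l t * (C k t <.> W t) * (C l t <.> W' t))) --->
  (if a = b then (real (nw a))\<^sup>2 else 0)) (at_right 0)"
proof -
 obtain c t0 where c: "c >= 0" and t0: "0 < t0" "t0 <= de" and est: "!!t z q. 0 < t ==> t <= t0 ==> solves ka g R t z q ==>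
   norm (dil_inv t (z 0) + gram (t *R dilT t (q t))) <= c * t * norm (t *R dilT t (q t))"
  by (rule scaled_boundary_estimate[of ka c1 R g, OF c1]) (assumption | (rule that; assumption))+
 obtain mv where mu: "mv > 0" "!!q. mv * norm q <= norm (gram q)" by (rule gram_lower_bound) (rule that; assumption)
 obtain c2 where ct2: "!!t ta k. 0 < t ==> t <= de ==> 0 <= ta ==> ta <= 1 ==> norm (ct t k ta - c0 k ta) <= c2 * t"
  by (rule ct_approx) (rule that; assumption)
 obtain qa where qa: "gram qa = D 0 a" by (rule gram_surj) (rule that; assumption)
 obtain qb where qb: "gram qb = D 0 b" by (rule gram_surj) (rule that; assumption)
 have lim_t: "((%t. e * t) ---> 0) (at_right 0)" for e :: real
  using tendsto_mult_right_zero[OF tendsto_ident_at, of e] by simp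
 have near: "\<forall>\<^sub>F t in at_right 0. 0 < t & t <= d" if "d > 0" for d :: real
  using that unfolding eventually_at_right_field by (intro exI[of _ d]) auto
 have q1: "((%t. t *R dilT t (W t)) ---> - q) (at_right 0)"
  if W: "\<forall>\<^sub>F t in at_right 0. EX z p. solves ka g R t z p & z 0 = D 0 a & p t = W t" and a: "0 < nw a" and q: "gram q = D 0 a"
  for W a q
 proof -
  let ?q1 = "%t. t *R dilT t (W t)"
  have "((%t. ?q1 t + q) ---> 0) (at_right 0)"
  proof (rule Lim_null_comparison)
   have d: "min t0 (mv / (2 * (c + 1))) > 0" using t0 mu c by simp
   show "\<forall>\<^sub>F t in at_right 0. norm (?q1 t + q) <= (2 * c / mv * norm q) * t" using W near[OF d]
   proof eventually_elim
    case (elim t)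
    then obtain z p where zp: "solves ka g R t z p" "z 0 = D 0 a" "p t = W t" by blast
    let ?x = "norm (?q1 t + q)"
    have "norm (D 0 a + gram (?q1 t)) <= c * t * norm (?q1 t)"
     using est[OF _ _ zp(1)] elim(2) zp dil_inv_D0[OF a] by simp
    hence "norm (gram (?q1 t + q)) <= c * t * norm (?q1 t)" by (simp add: linear_add[OF gram_linear] q add.commute)
    hence 1: "mv * ?x <= c * t * norm (?q1 t)" using mu(2)[of "?q1 t + q"] by linarith
    have "norm (?q1 t) <= ?x + norm q" using norm_triangle_ineq4[of "?q1 t + q" q] by simp
    hence "c * t * norm (?q1 t) <= c * t * (?x + norm q)" using c elim by (intro mult_left_mono) auto
    moreover have "c * t <= mv / 2"
    proof -
     have "c * t <= (c + 1) * (mv / (2 * (c + 1)))" using elim c by (intro mult_mono) auto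
     also have "... = mv / 2" using c by (intro cancel_double) simp
     finally show ?thesis .
    qed
    hence "c * t * ?x <= mv / 2 * ?x" by (intro mult_right_mono) auto
    ultimately have "mv * ?x <= mv / 2 * ?x + c * t * norm q" using 1 by (simp add: distrib_left)
    hence "mv * ?x <= 2 * c * t * norm q" by simp
    thus ?case using mu(1) by (simp add: field_simps)
   qed
  qed (rule lim_t)
  from tendsto_add[OF this tendsto_const[of "- q"]] show ?thesis by simp
 qed
 have ct1: "((%t. ct t k 1) ---> c0 k 1) (at_right 0)" for k
 proof -
  have "((%t. ct t k 1 - c0 k 1) ---> 0) (at_right 0)"
  proof (rule Lim_null_comparison)
   show "\<forall>\<^sub>F t in at_right 0. norm (ct t k 1 - c0 k 1) <= c2 * t"
    using near[OF de(1)] by eventually_elim (simp add: ct2)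
  qed (rule lim_t)
  thus ?thesis by (simp add: Lim_null[symmetric])
 qed
 have CW: "((%t. t * (C k t <.> W t)) ---> - (c0 k 1 <.> q)) (at_right 0)"
  if "((%t. t *R dilT t (W t)) ---> - q) (at_right 0)" for W q k
 proof -
  have "((%t. ct t k 1 <.> (t *R dilT t (W t))) ---> c0 k 1 <.> (- q)) (at_right 0)"
   by (rule tendsto_inner[OF ct1 that])
  moreover have "\<forall>\<^sub>F t in at_right 0. ct t k 1 <.> (t *R dilT t (W t)) = t * (C k t <.> W t)"
   using near[OF de(1)] by eventually_elim (simp add: ct_def dil_inv_inner_dilT)
  ultimately show ?thesis using Lim_transform_eventually by fastforce
 qed
 have glim: "(g k l ---> (if k = l then 1 else 0)) (at_right 0)" for k l
 proof -
  have "((%t. g k l t - (if k = l then 1 else 0)) ---> 0) (at_right 0)"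
  proof (rule Lim_null_comparison)
   show "\<forall>\<^sub>F t in at_right 0. norm (g k l t - (if k = l then 1 else 0)) <= c1 * t"
    using near[OF de(1)] by eventually_elim (use c1(3)[of _ k l] in auto)
  qed (rule lim_t)
  thus ?thesis by (subst (asm) Lim_null[symmetric])
 qed
 have "((%t. SU k. SU l. g k l t * (t * (C k t <.> W t)) * (t * (C l t <.> W' t))) --->
   (SU k. SU l. (if k = l then 1 else 0) * - (c0 k 1 <.> qa) * - (c0 l 1 <.> qb))) (at_right 0)"
  by (intro tendsto_sum tendsto_mult glim CW q1[OF W a qa] q1[OF W' b qb])
 moreover have "(SU k. SU l. (if k = l then 1 else 0) * - (c0 k 1 <.> qa) * - (c0 l 1 <.> qb)) =
   (if a = b then (real (nw a))\<^sup>2 else 0)"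
 proof -
  have "(SU k. SU l. (if k = l then 1 else 0) * - (c0 k 1 <.> qa) * - (c0 l 1 <.> qb)) =
    (SU k. (c0 k 1 <.> qa) * (c0 k 1 <.> qb))" by (simp add: if_distrib[of "%x. x * _"] cong: if_cong)
  also have "... = (SUM k:{a}. (c0 k 1 <.> qa) * (c0 k 1 <.> qb))"
   by (rule sum.mono_neutral_right) (use gram_preimage_profile(1)[OF a qa] in auto)
  also have "... = (if a = b then (real (nw a))\<^sup>2 else 0)"
  proof (cases "a = b")
   case True
   hence "gram (qa - qb) = 0" using qa qb linear_diff[OF gram_linear] by simp
   hence "qa = qb" using gram_inj by fastforce
   thus ?thesis using True gram_preimage_profile(2)[OF a qa] by (simp add: power2_eq_square)
  next
   case False
   thus ?thesis using gram_preimage_profile(1)[OF b qb, of a] by simp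
  qed
  finally show ?thesis .
 qed
 moreover have "(SU k. SU l. g k l t * (t * (C k t <.> W t)) * (t * (C l t <.> W' t))) =
   t\<^sup>2 * (SU k. SU l. g k l t * (C k t <.> W t) * (C l t <.> W' t))" for t
  by (simp add: sum_distrib_left power2_eq_square mult_ac)
 ultimately show ?thesis by (simp only:)
qed

end

section \<open>The Hamiltonian in local coordinates\<close>

lemma linear_functional_eq_inner:
 fixes g :: "real^'n => real"
 assumes "linear g" shows "g v = v <.> (\<chi> i. g (axis i 1))"
proof -
 have "g v = g (SU i. (v $ i) *R axis i 1)" using basis_expansion[of v] by (simp add: scalar_mult_eq_scaleR)
 also have "... = v <.> (\<chi> i. g (axis i 1))" by (simp add: linear_sum[OF assms] linear_scale[OF assms] inner_vec_def)
 finally show ?thesis .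
qed

lemma open_Times_UNIV: "open S ==> open (S \<times> UNIV)" by (simp add: open_Times)

lemma has_derivative_slice:
 assumes "(g has_derivative g') (at (a, b))"
 shows "((%b. g (a, b)) has_derivative (%v. g' (0, v))) (at b)"
  "((%a. g (a, b)) has_derivative (%v. g' (v, 0))) (at a)"
proof -
 have 1: "((%b. (a, b)) has_derivative (%v. (0, v))) (at b)" "((%a. (a, b)) has_derivative (%v. (v, 0))) (at a)"
  by (auto intro!: derivative_eq_intros)
 show "((%b. g (a, b)) has_derivative (%v. g' (0, v))) (at b)" using diff_chain_at[OF 1(1) assms] by (simp add: o_def)
 show "((%a. g (a, b)) has_derivative (%v. g' (v, 0))) (at a)" using diff_chain_at[OF 1(2) assms] by (simp add: o_def)
qed

lemma has_derivative_vecI: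
 fixes g :: "'a::real_normed_vector => real^'n"
 assumes "!!i. ((%x. g x $ i) has_derivative (%h. g' h $ i)) (at x within S)"
 shows "(g has_derivative g') (at x within S)" unfolding has_derivative_componentwise_within[of g g']
 using assms by (auto simp: Basis_vec_def inner_axis)

locale local_control =
 fixes U :: "(real^'n) set" and f :: "(real^'n) \<times> (real^'r) => real^'n" and L :: "(real^'n) \<times> (real^'r) => real"
 assumes U: "open U"
  and f: "smooth_on (U \<times> UNIV) f" and L: "smooth_on (U \<times> UNIV) L"
  and f_affine: "!!y. y : U ==> linear (%v. f (y, v) - f (y, 0))"
  and L_hess: "!!y u v. y : U ==> v ~= 0 ==> 0 < hess (%w. L (y, w)) u v"
  and L_superlinear: "!!y. y : U ==> filterlim (%w. L (y, w) / norm w) at_top at_infinity"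
begin

abbreviation DL where "DL z \<equiv> FD L z"
abbreviation D2L where "D2L z a \<equiv> FD (%z. DL z a) z"

definition fl :: "real^'n => real^'r => real^'n" where "fl y v = f (y, v) - f (y, 0)"
text \<open>The Legendre map of the fibre over y.\<close>

definition Lw :: "real^'n => real^'r => real^'r" where "Lw y w = (\<chi> i. DL (y, w) (0, axis i 1))"
text \<open>The adjoint of \<open>fl y\<close>: the linear form on controls induced by a
  covector.\<close>

definition pull :: "real^'n => real^'n => real^'r" where "pull y xi = (\<chi> i. xi <.> fl y (axis i 1))"

lemma oU: "open (U \<times> UNIV)" using U by (rule open_Times_UNIV)

lemma DL: "y : U ==> (L has_derivative DL (y, w)) (at (y, w))" by (rule smooth_on_has_derivative[OF L]) simp

lemma D2L: "y : U ==> ((%z. DL z a) has_derivative D2L (y, w) a) (at (y, w))"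
 by (rule smooth_on_has_derivative[OF smooth_on_deriv[OF L]]) simp

lemma fl_linear: "y : U ==> linear (fl y)" unfolding fl_def by (rule f_affine)

lemma Lw_inner: assumes "y : U" shows "v <.> Lw y w = DL (y, w) (0, v)"
proof -
 have "linear (%v. DL (y, w) (0, v))" using has_derivative_linear[OF has_derivative_slice(1)[OF DL[OF assms]]] .
 from linear_functional_eq_inner[OF this, of v] show ?thesis by (simp add: Lw_def)
qed

lemma pull_inner: assumes "y : U" shows "v <.> pull y xi = xi <.> fl y v"
proof -
 have "linear (%v. xi <.> fl y v)"
  using linear_compose[OF fl_linear[OF assms] bounded_linear.linear[OF bounded_linear_inner_right[of xi]]] by (simp add: o_def)
 from linear_functional_eq_inner[OF this, of v] show ?thesis by (simp add: pull_def)
qed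

section \<open>Inversion of the Legendre map on the fibres\<close>

lemma L_pos: assumes y: "y : U" and v: "v ~= 0" shows "0 < D2L (y, w) (0, v) (0, v)"
proof -
 have "FD (%w. L (y, w)) b v = DL (y, b) (0, v)" for b
  using frechet_derivative_at[OF has_derivative_slice(1)[OF DL[OF y]]] by metis
 hence "hess (%w. L (y, w)) w v = FD (%b. DL (y, b) (0, v)) w v" unfolding hess_def by simp
 also have "... = D2L (y, w) (0, v) (0, v)"
  using frechet_derivative_at[OF has_derivative_slice(1)[OF D2L[OF y]]] by metis
 finally show ?thesis using L_hess[OF y v, of w] by simp
qed

text \<open>A positive Hessian makes the derivative in direction w2 - w1 strictly increasing along
  the segment from w1 to w2.\<close>

lemma Lw_inj: assumes y: "y : U" and eq: "Lw y w1 = Lw y w2" shows "w1 = w2"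
proof (rule ccontr)
 assume ne: "w1 ~= w2"
 define v where "v = w2 - w1"
 have v: "v ~= 0" using ne by (simp add: v_def)
 let ?g = "%s. DL (y, w1 + s *R v) (0, v)"
 have inc: "EX d. DERIV ?g s :> d & 0 < d" for s
 proof -
  have "((%s. w1 + s *R v) has_derivative (%t. t *R v)) (at s)" by (auto intro!: derivative_eq_intros)
  from diff_chain_at[OF this has_derivative_slice(1)[OF D2L[OF y]]]
  have "(?g has_derivative (%t. D2L (y, w1 + s *R v) (0, v) (0, t *R v))) (at s)" by (simp add: o_def)
  moreover have "D2L (y, w1 + s *R v) (0, v) (0, t *R v) = D2L (y, w1 + s *R v) (0, v) (0, v) * t" for t
   using linear_scale[OF has_derivative_linear[OF D2L[OF y]], of _ _ t "(0, v)"] by simp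
  ultimately show ?thesis using L_pos[OF y v] by (auto simp: has_field_derivative_def)
 qed
 have "?g 0 < ?g 1" by (rule DERIV_pos_imp_increasing[of 0 1 ?g]) (simp, rule inc)
 moreover have "?g 0 = ?g 1" using eq Lw_inner[OF y, of v w1] Lw_inner[OF y, of v w2] by (simp add: v_def)
 ultimately show False by simp
qed

lemma minimizer_exists: assumes y: "y : U"
 obtains w where "!!w'. L (y, w) - p <.> w <= L (y, w') - p <.> w'"
proof -
 have "\<forall>\<^sub>F w in at_infinity. norm p + 1 <= L (y, w) / norm w"
  using L_superlinear[OF y] by (simp add: filterlim_at_top)
 then obtain R where R: "!!w. R <= norm w ==> norm p + 1 <= L (y, w) / norm w"
  unfolding eventually_at_infinity by auto
 \<comment> \<open>Beyond this radius the function is at least the norm of w, which exceeds its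
   value at 0, so a minimum over the ball is global. The 1 keeps the norm positive where the
   quotient is used.\<close>
 define R' where "R' = max 1 (max R (\<bar>L (y, 0)\<bar> + 1))"
 have out: "L (y, 0) - p <.> 0 < L (y, w) - p <.> w" if "R' <= norm w" for w
 proof -
  have w: "norm w > 0" "R <= norm w" "L (y, 0) < norm w" using that by (auto simp: R'_def)
  have "(norm p + 1) * norm w <= L (y, w)" using R[OF w(2)] w(1) by (simp add: pos_le_divide_eq)
  moreover have "p <.> w <= norm p * norm w" by (rule norm_cauchy_schwarz)
  ultimately have "norm w <= L (y, w) - p <.> w" by (simp add: algebra_simps)
  thus ?thesis using w(3) by simp
 qed
 have "continuous_on (cball 0 R') (%w. L (y, w))"
  by (rule continuous_on_compose2[OF smooth_on_continuous[OF L]]) (auto intro!: continuous_intros simp: y)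
 hence c: "continuous_on (cball 0 R') (%w. L (y, w) - p <.> w)"
  by (intro continuous_on_diff continuous_on_inner continuous_on_const continuous_on_id)
 have "cball 0 R' ~= ({} :: (real^'r) set)" by (auto simp: R'_def)
 then obtain w where w: "w : cball 0 R'" "!!w'. w' : cball 0 R' ==> L (y, w) - p <.> w <= L (y, w') - p <.> w'"
  using continuous_attains_inf[OF compact_cball _ c] by blast
 have "L (y, w) - p <.> w <= L (y, w') - p <.> w'" for w'
 proof (cases "norm w' <= R'")
  case False
  have "(0::real^'r) : cball 0 R'" by (simp add: R'_def)
  from w(2)[OF this] out[of w'] False show ?thesis by simp
 qed (use w in auto)
 thus thesis by (rule that)
qed

lemma minimizer_critical:
 assumes y: "y : U" and min: "!!w'. L (y, w) - p <.> w <= L (y, w') - p <.> w'"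
 shows "Lw y w = p"
proof -
 have "((%w. L (y, w) - p <.> w) has_derivative (%v. DL (y, w) (0, v) - p <.> v)) (at w)"
  by (intro has_derivative_diff has_derivative_slice(1)[OF DL[OF y]] has_derivative_inner_right has_derivative_ident)
 hence "(%v. DL (y, w) (0, v) - p <.> v) = (%v. 0)" by (rule has_derivative_local_min) (simp add: min)
 hence "DL (y, w) (0, v) - p <.> v = 0" for v by (rule fun_cong)
 hence "v <.> Lw y w = v <.> p" for v using Lw_inner[OF y, of v w] by (simp add: inner_commute[of v p])
 thus ?thesis by (rule vector_eq_ldot[THEN iffD1, OF allI])
qed

definition ups :: "(real^'n) \<times> (real^'r) => real^'r" where "ups z = (THE w. Lw (fst z) w = snd z)"

lemma ups: assumes "y : U" shows "Lw y (ups (y, p)) = p" "ups (y, Lw y w) = w"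
  "L (y, ups (y, p)) - p <.> ups (y, p) <= L (y, w') - p <.> w'"
proof -
 obtain w0 where w0: "!!w'. L (y, w0) - p <.> w0 <= L (y, w') - p <.> w'" by (rule minimizer_exists[OF assms]) (rule that)
 hence 1: "Lw y w0 = p" by (rule minimizer_critical[OF assms])
 have u: "ups (y, Lw y w) = w" for w
  unfolding ups_def fst_conv snd_conv using Lw_inj[OF assms] by (intro the_equality) auto
 hence "ups (y, p) = w0" using 1 by blast
 thus "Lw y (ups (y, p)) = p" "L (y, ups (y, p)) - p <.> ups (y, p) <= L (y, w') - p <.> w'" using 1 w0 by simp_all
 show "ups (y, Lw y w) = w" by (rule u)
qed

lemma smooth_Lw: "smooth_on (U \<times> UNIV) (%z. Lw (fst z) (snd z))"
proof (rule smooth_on_vec[OF oU])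
 fix i
 show "smooth_on (U \<times> UNIV) (%z. Lw (fst z) (snd z) $ i)"
  using smooth_on_deriv[OF L, of "(0, axis i 1)"] by (simp add: Lw_def)
qed

definition Lmat :: "(real^'n) \<times> (real^'r) => real^'r^'r" where
 "Lmat z = (\<chi> i j. D2L z (0, axis i 1) (0, axis j 1))"

lemma Lmat_mult: assumes "y : U" shows "v <.> (Lmat (y, w) *v d) = D2L (y, w) (0, v) (0, d)"
proof -
 have l2: "linear (%d. D2L (y, w) a (0, d))" for a
  using has_derivative_linear[OF has_derivative_slice(1)[OF D2L[OF assms]]] .
 have l1: "linear (%v. D2L (y, w) (0, v) c)" for c
  using l2[of c] assms by (simp add: second_derivative_symmetric_real[OF oU smooth_onD[OF L], of "(y, w)" _ c])
 have "(Lmat (y, w) *v d) $ i = D2L (y, w) (0, axis i 1) (0, d)" for i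
  using linear_functional_eq_inner[OF l2[of "(0, axis i 1)"], of d]
  by (simp add: matrix_vector_mult_def Lmat_def inner_vec_def mult.commute)
 hence "Lmat (y, w) *v d = (\<chi> i. D2L (y, w) (0, axis i 1) (0, d))" by (simp add: vec_eq_iff)
 thus ?thesis using linear_functional_eq_inner[OF l1[of "(0, d)"], of v] by simp
qed

lemma Lmat_det: assumes "y : U" shows "det (Lmat (y, w)) ~= 0"
proof -
 have "d = 0" if "Lmat (y, w) *v d = 0" for d
  using L_pos[OF assms, of d w] Lmat_mult[OF assms, of d w d] that by force
 hence "inj ((*v) (Lmat (y, w)))" using linear_injective_0[OF matrix_vector_mul_linear[of "Lmat (y, w)"]] by auto
 thus ?thesis by (simp add: invertible_det_nz[symmetric] invertible_left_inverse matrix_left_invertible_injective)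
qed

text \<open>Inverse function theorem for the fibre-preserving map \<open>T\<close>. Its global
  inverse \<open>G\<close> is already known, so only differentiability is at stake; the formula is
  the derivative of the identity that defines \<open>ups\<close>.\<close>

lemma ups_derivative:
 assumes y: "y : U"
 obtains u' where "(ups has_derivative u') (at (y, p))"
  "!!h k. Lmat (y, ups (y, p)) *v u' (h, k) = k - (\<chi> i. D2L (y, ups (y, p)) (0, axis i 1) (h, 0))"
proof -
 define w where "w = ups (y, p)"
 define T where "T z = (fst z, Lw (fst z) (snd z))" for z
 define G where "G z = (fst z, ups z)" for z
 define T' where "T' c = (fst c, \<chi> i. D2L (y, w) (0, axis i 1) c)" for c
 have Lw': "((%z. Lw (fst z) (snd z)) has_derivative (%c. \<chi> i. D2L (y, w) (0, axis i 1) c)) (at (y, w))"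
 proof -
  have "((%z. Lw (fst z) (snd z) $ i) has_derivative (%c. D2L (y, w) (0, axis i 1) c)) (at (y, w))" for i
   using D2L[OF y, of "(0, axis i 1)" w] by (simp add: Lw_def)
  thus ?thesis by (intro has_derivative_vecI) simp
 qed
 have T: "(T has_derivative T') (at (y, w))"
 proof -
  have "((%z. (fst z, Lw (fst z) (snd z))) has_derivative (%c. (fst c, \<chi> i. D2L (y, w) (0, axis i 1) c))) (at (y, w))"
   by (intro has_derivative_Pair has_derivative_fst has_derivative_ident Lw')
  thus ?thesis by (simp add: T_def[abs_def] T'_def[abs_def])
 qed
 have lT: "linear T'" by (rule has_derivative_linear[OF T])
 have dec: "D2L (y, w) a (h, v) = D2L (y, w) a (h, 0) + D2L (y, w) a (0, v)" for a h v
  using linear_add[OF has_derivative_linear[OF D2L[OF y]], of a w "(h, 0)" "(0, v)"] by simp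
 have Lm: "(\<chi> i. D2L (y, w) (0, axis i 1) (0, v)) = Lmat (y, w) *v v" for v
 proof -
  have "axis i 1 <.> (Lmat (y, w) *v v) = D2L (y, w) (0, axis i 1) (0, v)" for i by (rule Lmat_mult[OF y])
  thus ?thesis by (simp add: vec_eq_iff inner_axis inner_commute[of "axis _ _"])
 qed
 have "inj T'"
 proof (subst linear_injective_0[OF lT], intro allI impI)
  fix c assume c: "T' c = 0"
  obtain h v where hv: "c = (h, v)" by fastforce
  have h: "h = 0" using c by (simp add: hv T'_def zero_prod_def)
  hence "Lmat (y, w) *v v = 0" using c Lm[of v] by (simp add: hv T'_def zero_prod_def)
  hence "v = 0" using L_pos[OF y, of v w] Lmat_mult[OF y, of v w v] by force
  thus "c = 0" using h by (simp add: hv zero_prod_def)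
 qed
 then obtain G' where G': "linear G'" "G' \<circ> T' = id" "T' \<circ> G' = id"
  using linear_injective_isomorphism[OF lT] by (auto simp: fun_eq_iff)
 have "(G has_derivative G') (at (T (y, w)))"
 proof (rule has_derivative_inverse_strong[OF oU _ _ _ T G'(3)])
  show "continuous_on (U \<times> UNIV) T"
   unfolding T_def by (intro continuous_intros smooth_on_continuous[OF smooth_Lw])
  show "G (T z) = z" if "z : U \<times> UNIV" for z using that ups(2) by (cases z) (auto simp: G_def T_def)
 qed (use y in simp)
 moreover have "T (y, w) = (y, p)" using ups(1)[OF y] by (simp add: T_def w_def)
 ultimately have G: "(G has_derivative G') (at (y, p))" by simp
 define u' where "u' c = snd (G' c)" for c
 have "(ups has_derivative u') (at (y, p))"
  using has_derivative_snd[OF G] by (simp add: G_def[abs_def] u'_def[abs_def])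
 moreover have "Lmat (y, w) *v u' (h, k) = k - (\<chi> i. D2L (y, w) (0, axis i 1) (h, 0))" for h k
 proof -
  have "T' (G' (h, k)) = (h, k)" using G'(3) by (metis comp_apply id_apply)
  hence "fst (G' (h, k)) = h" "(\<chi> i. D2L (y, w) (0, axis i 1) (h, u' (h, k))) = k"
   unfolding T'_def u'_def by (metis fst_conv prod.collapse, metis prod.collapse fst_conv snd_conv)
  moreover have "(\<chi> i. D2L (y, w) (0, axis i 1) (h, u' (h, k))) =
    (\<chi> i. D2L (y, w) (0, axis i 1) (h, 0)) + Lmat (y, w) *v u' (h, k)"
   unfolding Lm[symmetric] by (simp add: vec_eq_iff dec[of _ h "u' (h, k)"])
  ultimately show ?thesis by (simp add: algebra_simps)
 qed
 ultimately show thesis using that by (simp add: w_def)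
qed

text \<open>Bootstrap: the derivative solves a linear system whose matrix and right-hand side are
  smooth functions of \<open>ups\<close> itself, so C^k improves to C^(k+1) by Cramer's
  rule.\<close>

lemma smooth_ups: "smooth_on (U \<times> UNIV) ups"
proof (rule smooth_onI)
 fix k
 have D2s: "smooth_on (U \<times> UNIV) (%z. D2L z a b)" for a b by (rule smooth_on_deriv[OF smooth_on_deriv[OF L]])
 show "Ck_on k (U \<times> UNIV) ups"
 proof (induction k)
  case 0
  have "isCont ups z" if "z : U \<times> UNIV" for z
   using that by (cases z) (auto elim!: ups_derivative intro: has_derivative_continuous)
  thus ?case by (simp add: continuous_at_imp_continuous_on)
 next
  case (Suc k)
  have "EX u'. (ups has_derivative u') (at z) &
   (ALL h k. Lmat (fst z, ups z) *v u' (h, k) = k - (\<chi> i. D2L (fst z, ups z) (0, axis i 1) (h, 0)))"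
   if "z : U \<times> UNIV" for z
  proof -
   obtain y p where z: "z = (y, p)" "y : U" using `z : U \<times> UNIV` by (cases z) auto
   show ?thesis by (rule ups_derivative[OF z(2), of p]) (use z in auto)
  qed
  then obtain u' where u': "!!z. z : U \<times> UNIV ==> (ups has_derivative u' z) (at z)"
   "!!z h k. z : U \<times> UNIV ==> Lmat (fst z, ups z) *v u' z (h, k) = k - (\<chi> i. D2L (fst z, ups z) (0, axis i 1) (h, 0))"
   by metis
  have z: "Ck_on k (U \<times> UNIV) (%z. (fst z, ups z))"
   by (intro Ck_on_Pair oU Suc Ck_on_bounded_linear bounded_linear_fst)
  have D2: "Ck_on k (U \<times> UNIV) (%z. D2L (fst z, ups z) a b)" for a b
   by (rule Ck_on_compose[OF oU oU z smooth_onD[OF D2s]]) auto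
  show ?case
  proof (rule Ck_on_SucI[OF oU u'(1)])
   fix v :: "(real^'n) \<times> (real^'r)"
   obtain h q where v: "v = (h, q)" by fastforce
   show "Ck_on k (U \<times> UNIV) (%z. u' z v)"
   proof (rule Ck_on_solve[OF oU, of _ "%z. Lmat (fst z, ups z)" "%z. q - (\<chi> i. D2L (fst z, ups z) (0, axis i 1) (h, 0))"])
    show "Ck_on k (U \<times> UNIV) (%z. Lmat (fst z, ups z) $ i $ j)" for i j using D2 by (simp add: Lmat_def)
    show "Ck_on k (U \<times> UNIV) (%z. q - (\<chi> i. D2L (fst z, ups z) (0, axis i 1) (h, 0)))"
     by (intro Ck_on_diff oU Ck_on_const Ck_on_vec) (use D2 in simp)
   qed (use u'(2) v Lmat_det in auto)
  qed
 qed
qed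

section \<open>Maximizing control, Hamiltonian and Hamiltonian vector field in coordinates\<close>

definition ust :: "(real^'n) \<times> (real^'n) => real^'r" where "ust z = ups (fst z, pull (fst z) (snd z))"
definition H :: "(real^'n) \<times> (real^'n) => real" where
 "H z = snd z <.> f (fst z, ust z) - L (fst z, ust z)"
definition Hp :: "(real^'n) \<times> (real^'n) => real^'n" where "Hp z = f (fst z, ust z)"
definition Hy :: "(real^'n) \<times> (real^'n) => real^'n" where "Hy z = (\<chi> i. FD H z (axis i 1, 0))"
definition XH :: "(real^'n) \<times> (real^'n) => (real^'n) \<times> (real^'n)" where "XH z = (Hp z, - Hy z)"

lemma smooth_fl: "smooth_on (U \<times> UNIV) (%z :: (real^'n) \<times> (real^'n). fl (fst z) v)" unfolding fl_def
 by (intro smooth_on_diff oU smooth_on_compose[OF oU oU _ f] smooth_on_Pair smooth_on_const smooth_on_bounded_linear bounded_linear_fst) auto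

lemma smooth_ust: "smooth_on (U \<times> UNIV) ust"
proof -
 have pl: "smooth_on (U \<times> UNIV) (%z. pull (fst z) (snd z))"
 proof (rule smooth_on_vec[OF oU])
  fix i
  show "smooth_on (U \<times> UNIV) (%z. pull (fst z) (snd z) $ i)" unfolding pull_def vec_lambda_beta
   by (intro smooth_on_inner oU smooth_fl smooth_on_bounded_linear bounded_linear_snd)
 qed
 show ?thesis unfolding ust_def
  by (rule smooth_on_compose[OF oU oU smooth_on_Pair[OF oU smooth_on_bounded_linear[OF bounded_linear_fst] pl] smooth_ups]) auto
qed

lemma smooth_pair_ust: "smooth_on (U \<times> UNIV) (%z. (fst z, ust z))"
 by (intro smooth_on_Pair oU smooth_ust smooth_on_bounded_linear bounded_linear_fst)

lemma smooth_Hp: "smooth_on (U \<times> UNIV) Hp"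
 unfolding Hp_def by (rule smooth_on_compose[OF oU oU smooth_pair_ust f]) auto

lemma smooth_H: "smooth_on (U \<times> UNIV) H" unfolding H_def
 by (intro smooth_on_diff smooth_on_inner oU smooth_on_bounded_linear bounded_linear_snd
   smooth_on_compose[OF oU oU smooth_pair_ust f] smooth_on_compose[OF oU oU smooth_pair_ust L]) auto

lemma smooth_Hy: "smooth_on (U \<times> UNIV) Hy"
proof (rule smooth_on_vec[OF oU])
 show "smooth_on (U \<times> UNIV) (%z. Hy z $ i)" for i
  using smooth_on_deriv[OF smooth_H, of "(axis i 1, 0)"] by (simp add: Hy_def)
qed

lemma smooth_XH: "smooth_on (U \<times> UNIV) XH"
 unfolding XH_def by (intro smooth_on_Pair smooth_on_uminus oU smooth_Hp smooth_Hy)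

lemma f_eq: "f (y, w) = f (y, 0) + fl y w" by (simp add: fl_def)

lemma H_ge: assumes "y : U" shows "xi <.> f (y, w) - L (y, w) <= H (y, xi)"
proof -
 have eq: "xi <.> f (y, w) - L (y, w) = xi <.> f (y, 0) - (L (y, w) - pull y xi <.> w)" for w
  using pull_inner[OF assms, of w xi] by (subst f_eq) (simp add: inner_add_right inner_commute)
 have "H (y, xi) = xi <.> f (y, ups (y, pull y xi)) - L (y, ups (y, pull y xi))" by (simp add: H_def ust_def)
 thus ?thesis using ups(3)[OF assms, of "pull y xi" w] eq[of w] eq[of "ups (y, pull y xi)"] by linarith
qed

lemma ust_unique:
 assumes y: "y : U" and max: "!!w'. xi <.> f (y, w') - L (y, w') <= xi <.> f (y, w) - L (y, w)"
 shows "w = ust (y, xi)"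
proof -
 have eq: "xi <.> f (y, w) - L (y, w) = xi <.> f (y, 0) - (L (y, w) - pull y xi <.> w)" for w
  using pull_inner[OF y, of w xi] by (subst f_eq) (simp add: inner_add_right inner_commute)
 have "Lw y w = pull y xi"
 proof (rule minimizer_critical[OF y])
  show "L (y, w) - pull y xi <.> w <= L (y, w') - pull y xi <.> w'" for w' using max[of w'] unfolding eq by linarith
 qed
 thus ?thesis using ups(2)[OF y, of w] by (simp add: ust_def)
qed

lemma H_sup: assumes "y : U" shows "(SUP w. xi <.> f (y, w) - L (y, w)) = H (y, xi)"
proof (rule cSup_eq_maximum)
 show "H (y, xi) : range (%w. xi <.> f (y, w) - L (y, w))" by (rule range_eqI[of _ _ "ust (y, xi)"]) (simp add: H_def)
 fix x assume "x : range (%w. xi <.> f (y, w) - L (y, w))"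
 then obtain w where "x = xi <.> f (y, w) - L (y, w)" by blast
 thus "x <= H (y, xi)" using H_ge[OF assms] by simp
qed

lemma DH: "y : U ==> (H has_derivative FD H (y, xi)) (at (y, xi))"
 by (rule smooth_on_has_derivative[OF smooth_H]) simp

text \<open>Envelope theorem: the derivative of the maximizer does not contribute.\<close>

lemma DH_p: assumes y: "y : U" shows "FD H (y, xi) (0, k) = k <.> Hp (y, xi)"
proof -
 let ?D = "FD H (y, xi)"
 have "((%xi'. H (y, xi') - (xi' <.> f (y, ust (y, xi)) - L (y, ust (y, xi)))) has_derivative
   (%k. ?D (0, k) - (k <.> f (y, ust (y, xi)) - 0))) (at xi)"
  by (intro has_derivative_diff has_derivative_slice(1)[OF DH[OF y]] has_derivative_inner_left has_derivative_ident has_derivative_const)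
 moreover have "H (y, xi) - (xi <.> f (y, ust (y, xi)) - L (y, ust (y, xi))) <=
   H (y, xi') - (xi' <.> f (y, ust (y, xi)) - L (y, ust (y, xi)))" for xi'
  using H_ge[OF y, of xi' "ust (y, xi)"] by (simp add: H_def)
 ultimately have "(%k. ?D (0, k) - (k <.> f (y, ust (y, xi)) - 0)) = (%k. 0)" by (intro has_derivative_local_min) auto
 hence "?D (0, k) - (k <.> f (y, ust (y, xi)) - 0) = 0" by (rule fun_cong)
 thus ?thesis by (simp add: Hp_def)
qed

lemma DH_y: assumes y: "y : U" shows "FD H (y, xi) (h, 0) = h <.> Hy (y, xi)"
proof -
 have "linear (%h. FD H (y, xi) (h, 0))" by (rule has_derivative_linear[OF has_derivative_slice(2)[OF DH[OF y]]])
 from linear_functional_eq_inner[OF this, of h] show ?thesis by (simp add: Hy_def)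
qed

lemma DH_eq: assumes y: "y : U" shows "FD H (y, xi) (h, k) = h <.> Hy (y, xi) + k <.> Hp (y, xi)"
 using linear_add[OF has_derivative_linear[OF DH[OF y]], of xi "(h, 0)" "(0, k)"] DH_p[OF y] DH_y[OF y] by simp

text \<open>Fenchel's inequality tested with the unit covector in the direction of the velocity; C
  is a bound of H over the unit ball of covectors above K.\<close>

lemma speed_bound: assumes "compact K" "K <= U"
 obtains C where "C >= 0" "!!y w. y : K ==> norm (f (y, w)) <= C + L (y, w)"
proof -
 have "continuous_on (K \<times> cball 0 1) H"
  using smooth_on_continuous[OF smooth_H] by (rule continuous_on_subset) (use assms in auto)
 hence "bounded (H ` (K \<times> cball 0 1))"
  using assms by (intro compact_imp_bounded compact_continuous_image compact_Times) auto
 then obtain C where C: "C > 0" "!!y xi. y : K ==> norm xi <= 1 ==> \<bar>H (y, xi)\<bar> <= C"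
  unfolding bounded_pos by force
 show thesis
 proof
  show "C >= 0" using C by simp
  fix y w assume y: "y : K"
  define e where "e = sgn (f (y, w))"
  have "norm e <= 1" by (simp add: e_def norm_sgn)
  moreover have "e <.> f (y, w) = norm (f (y, w))"
   by (cases "f (y, w) = 0") (simp_all add: e_def sgn_div_norm power2_norm_eq_inner[symmetric] power2_eq_square)
  ultimately show "norm (f (y, w)) <= C + L (y, w)" using H_ge[of y e w] C(2)[OF y, of e] y assms(2) by auto
 qed
qed

end

section \<open>The cost near a geodesic\<close>

lemma has_vector_derivative_shift:
 assumes "(f has_vd f') (at (s - c))"
 shows "((%s. f (s - c)) has_vd f') (at s within S)"
proof -
 have "((%s. s - c) has_vd 1) (at s within S)" by (auto intro!: derivative_eq_intros)
 from vector_diff_chain_within[OF this has_vector_derivative_at_within[OF assms]] show ?thesis by (simp add: o_def)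
qed

text \<open>Two partial derivatives, one of them continuous, make a joint derivative; the continuous
  one here is that in time.\<close>

lemma (in flow_box) joint_derivative:
 assumes s: "s : {-ep<..<ep}" and z: "z : ball z0 r"
  and Xphc: "continuous_on ({-ep<..<ep} \<times> ball z0 r) (%p. X (ph (fst p) (snd p)))"
 shows "((%p. ph (fst p) (snd p)) has_derivative (%v. fst v *R X (ph s z) + Ph s z (snd v))) (at (s, z))"
proof -
 let ?J = "{-ep<..<ep}" and ?B = "ball z0 r"
 have op: "open (?B \<times> ?J)" by (intro open_Times) auto
 have "((%(z, s). ph s z) has_derivative (%(v, h). Ph s z v + blinfun_scaleR_left (X (ph s z)) h)) (at (z, s) within ?B \<times> ?J)"
 proof (rule has_derivative_partialsI)
  show "(ph s has_derivative Ph s z) (at z within ?B)" by (rule has_derivative_at_withinI[OF phD[OF s z]])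
  show "((%s. ph s z) has_derivative blinfun_apply (blinfun_scaleR_left (X (ph s z)))) (at s within ?J)"
   if "z : ?B" "s : ?J" for z s
   using phd[OF that(2,1)] by (simp add: has_vector_derivative_def has_derivative_at_withinI)
  have "continuous_on (?B \<times> ?J) (%p. blinfun_scaleR_left (X (ph (fst (prod.swap p)) (snd (prod.swap p)))))"
   by (intro continuous_intros continuous_on_compose2[OF Xphc]) (auto intro!: continuous_intros)
  thus "continuous (at (z, s) within ?B \<times> ?J) (%(z, s). blinfun_scaleR_left (X (ph s z)))"
   using s z by (simp add: continuous_on_eq_continuous_within case_prod_unfold)
 qed (use s in auto)
 hence "((%(z, s). ph s z) has_derivative (%(v, h). Ph s z v + h *R X (ph s z))) (at (prod.swap (s, z)))"
  using at_within_open[OF _ op, of "(z, s)"] s z by simp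
 moreover have "(prod.swap has_derivative prod.swap) (at (s, z))"
  by (rule bounded_linear_imp_has_derivative) (simp add: prod.swap_def[abs_def] bounded_linear_Pair bounded_linear_fst bounded_linear_snd)
 ultimately show ?thesis using diff_chain_at by (fastforce simp: o_def case_prod_unfold add.commute)
qed

text \<open>Since B vanishes at x, the term with the derivative of A never arises and continuity of
  A suffices. In the application A is the derivative of a terminal covector, known only to be
  continuous.\<close>

lemma has_derivative_inner_zero:
 fixes A B :: "'a::real_normed_vector => 'b::real_inner"
 assumes B: "(B has_derivative B') (at x)" "B x = 0" and A: "isCont A x"
 shows "((%y. A y <.> B y) has_derivative (%v. A x <.> B' v)) (at x)"
proof (rule has_derivativeI)
 interpret B': bounded_linear B' by (rule has_derivative_bounded_linear[OF B(1)])
 show "bounded_linear (%v. A x <.> B' v)"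
  by (rule bounded_linear_compose[OF bounded_linear_inner_right has_derivative_bounded_linear[OF B(1)]])
 let ?R = "%y. (B y - B x - B' (y - x)) /\<^sub>R norm (y - x)"
 have R: "(?R ---> 0) (at x)" using B(1) unfolding has_derivative_at_within by simp
 obtain K where K: "!!v. norm (B' v) <= norm v * K" using B'.bounded by blast
 have AR: "((%y. A y <.> ?R y) ---> A x <.> 0) (at x)" by (rule tendsto_inner[OF A[unfolded isCont_def] R])
 have "((%y. (A y - A x) <.> (B' (y - x) /\<^sub>R norm (y - x))) ---> 0) (at x)"
 proof (rule Lim_null_comparison)
  show "\<forall>\<^sub>F y in at x. norm ((A y - A x) <.> (B' (y - x) /\<^sub>R norm (y - x))) <= norm (A y - A x) * \<bar>K\<bar>"
  proof (rule eventually_at_filter[THEN iffD2], intro always_eventually allI impI)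
   fix y assume "y ~= x"
   hence n: "norm (y - x) > 0" by simp
   have "norm (B' (y - x) /\<^sub>R norm (y - x)) = norm (B' (y - x)) / norm (y - x)"
    by (simp add: divide_inverse mult.commute)
   also have "... <= (norm (y - x) * K) / norm (y - x)" using K[of "y - x"] n by (intro divide_right_mono) auto
   also have "... = K" using n by simp
   also have "... <= \<bar>K\<bar>" by simp
   finally show "norm ((A y - A x) <.> (B' (y - x) /\<^sub>R norm (y - x))) <= norm (A y - A x) * \<bar>K\<bar>"
    unfolding real_norm_def by (intro order_trans[OF Cauchy_Schwarz_ineq2] mult_left_mono) auto
  qed
  have "((%y. A y - A x) ---> 0) (at x)" using A by (simp add: isCont_def Lim_null[symmetric])
  thus "((%y. norm (A y - A x) * \<bar>K\<bar>) ---> 0) (at x)" by (intro tendsto_mult_left_zero tendsto_norm_zero)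
 qed
 from tendsto_add[OF AR this]
 have "((%y. A y <.> ?R y + (A y - A x) <.> (B' (y - x) /\<^sub>R norm (y - x))) ---> 0) (at x)" by simp
 moreover have "A y <.> ?R y + (A y - A x) <.> (B' (y - x) /\<^sub>R norm (y - x)) =
   (A y <.> B y - A x <.> B x - A x <.> B' (y - x)) /\<^sub>R norm (y - x)" for y
  by (simp add: B(2) inner_diff_left inner_diff_right algebra_simps)
 ultimately show "((%y. (A y <.> B y - A x <.> B x - A x <.> B' (y - x)) /\<^sub>R norm (y - x)) ---> 0) (at x)"
  by (simp only:)
qed

context local_control begin

section \<open>Extremals and subsolutions\<close>

definition extremal_within :: "((real^'n) \<times> (real^'n)) set => (real => (real^'n) \<times> (real^'n)) => real => bool" where
 "extremal_within K z t \<longleftrightarrow> (ALL s:{0..t}. z s : K & (z has_vd XH (z s)) (at s within {0..t}))"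

definition ext_action :: "(real => (real^'n) \<times> (real^'n)) => real => real" where
 "ext_action z t = integral {0..t} (%s. snd (z s) <.> Hp (z s) - H (z s))"

text \<open>A quadratic subsolution of the Hamilton--Jacobi equation touching at the extremal \<open>z\<close>.\<close>

definition subsol :: "real => (real => (real^'n) \<times> (real^'n)) => real => real^'n => real" where
 "subsol ka z t y = ext_action z t + snd (z t) <.> (y - fst (z t)) - ka * t / 2 * (norm (y - fst (z t)))\<^sup>2"

text \<open>The total time derivative of \<open>subsol\<close> along a curve that is at y with
  velocity y' while the extremal is at p.\<close>

definition subsol_rate :: "real => (real^'n) \<times> (real^'n) => real => real^'n => real^'n => real" where
 "subsol_rate ka p t y y' = (snd p <.> Hp p - H p) - Hy p <.> (y - fst p) + snd p <.> (y' - Hp p)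
   - ka / 2 * (norm (y - fst p))\<^sup>2 - ka * t * ((y - fst p) <.> (y' - Hp p))"

lemma subsol_along_curve:
 assumes z: "extremal_within K z T" and KU: "K <= U \<times> UNIV" and t: "t : {0..T}"
  and y: "(y has_vd y') (at t within {0..T})"
 shows "((%t. subsol ka z t (y t)) has_real_derivative subsol_rate ka (z t) t (y t) y') (at t within {0..T})"
proof -
 have zd: "(z has_vd XH (z s)) (at s within {0..T})" if "s : {0..T}" for s
  using z that by (simp add: extremal_within_def)
 have X: "((%t. fst (z t)) has_vd Hp (z t)) (at t within {0..T})"
  using bounded_linear.has_vector_derivative[OF bounded_linear_fst zd[OF t]] by (simp add: XH_def)
 have Xi: "((%t. snd (z t)) has_vd - Hy (z t)) (at t within {0..T})"
  using bounded_linear.has_vector_derivative[OF bounded_linear_snd zd[OF t]] by (simp add: XH_def)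
 have zc: "continuous_on {0..T} z" by (rule continuous_on_vector_derivative[OF zd])
 have zK: "z ` {0..T} <= U \<times> UNIV" using z KU by (auto simp: extremal_within_def)
 have "continuous_on {0..T} (%s. snd (z s) <.> Hp (z s) - H (z s))"
  using zK by (intro continuous_intros zc continuous_on_compose2[OF smooth_on_continuous[OF smooth_Hp] zc]
    continuous_on_compose2[OF smooth_on_continuous[OF smooth_H] zc]) auto
 hence A: "(ext_action z has_real_derivative (snd (z t) <.> Hp (z t) - H (z t))) (at t within {0..T})"
  unfolding ext_action_def by (rule integral_has_real_derivative[OF _ t])
 have d: "((%t. y t - fst (z t)) has_vd y' - Hp (z t)) (at t within {0..T})"
  by (rule has_vector_derivative_diff[OF y X])
 have inn: "((%t. p t <.> q t) has_real_derivative (p t <.> q' + p' <.> q t)) (at t within {0..T})"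
  if "(p has_vd p') (at t within {0..T})" "(q has_vd q') (at t within {0..T})"
  for p q :: "real => real^'n" and p' q' using bounded_bilinear.has_vector_derivative[OF bounded_bilinear_inner that]
  by (simp add: has_real_derivative_iff_has_vector_derivative)
 have "((%t. ext_action z t + snd (z t) <.> (y t - fst (z t)) - ka * t / 2 * ((y t - fst (z t)) <.> (y t - fst (z t)))) has_real_derivative
  (snd (z t) <.> Hp (z t) - H (z t)) + (snd (z t) <.> (y' - Hp (z t)) + (- Hy (z t)) <.> (y t - fst (z t))) -
  (ka / 2 * ((y t - fst (z t)) <.> (y t - fst (z t))) + ((y t - fst (z t)) <.> (y' - Hp (z t)) + (y' - Hp (z t)) <.> (y t - fst (z t))) * (ka * t / 2)))
  (at t within {0..T})" by (intro DERIV_diff DERIV_add A inn Xi d DERIV_mult) (auto intro!: derivative_eq_intros)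
 moreover have "(snd (z t) <.> Hp (z t) - H (z t)) + (snd (z t) <.> (y' - Hp (z t)) + (- Hy (z t)) <.> (y t - fst (z t))) -
  (ka / 2 * ((y t - fst (z t)) <.> (y t - fst (z t))) + ((y t - fst (z t)) <.> (y' - Hp (z t)) + (y' - Hp (z t)) <.> (y t - fst (z t))) * (ka * t / 2))
  = subsol_rate ka (z t) t (y t) y'"
  unfolding subsol_rate_def power2_norm_eq_inner inner_commute[of "y' - Hp (z t)"] by (simp add: algebra_simps)
 ultimately show ?thesis unfolding subsol_def power2_norm_eq_inner by simp
qed

text \<open>The gradient of the subsolution at y is the covector of the second point required to lie
  in K. Fenchel's inequality there and the expansion of H at p leave an error of at most 2 C |y -
  fst p|^2, absorbed by the quadratic term with factor ka / 2; hence 4 C <= ka.\<close>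

lemma subsol_rate_le:
 assumes K: "compact K" "convex K" "K <= U \<times> UNIV"
 obtains C where "C >= 0" "!!ka p t y w. 4 * C <= ka ==> 0 <= t ==> ka * t <= 1 ==> p : K ==>
  (y, snd p - (ka * t) *R (y - fst p)) : K ==> subsol_rate ka p t y (f (y, w)) <= L (y, w)"
proof -
 obtain C where C: "C >= 0" "!!p q. p : K ==> q : K ==> norm (H q - H p - FD H p (q - p)) <= C * (norm (q - p))\<^sup>2"
  by (rule C2_taylor_bound[OF smooth_onD[OF smooth_H] K]) (rule that; assumption)
 show thesis
 proof (rule that[OF C(1)])
  fix ka p t y w
  assume ka: "4 * C <= ka" and t: "0 <= t" "ka * t <= 1" and p: "p : K" and q: "(y, snd p - (ka * t) *R (y - fst p)) : K"
  define d where "d = y - fst p"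
  define e where "e = ka * t"
  have e: "0 <= e" "e <= 1" using t ka C(1) by (auto simp: e_def)
  let ?q = "(y, snd p - e *R d)"
  have yU: "y : U" and pU: "fst p : U" using p q K(3) by (cases p; auto)+
  have "?q - p = (d, - e *R d)" by (simp add: d_def prod_eq_iff)
  hence D: "FD H p (?q - p) = d <.> Hy p - e * (d <.> Hp p)" using DH_eq[OF pU, of "snd p" d "- e *R d"] by simp
  have n: "(norm (?q - p))\<^sup>2 <= 2 * (norm d)\<^sup>2"
  proof -
   have "(norm (?q - p))\<^sup>2 = (norm d)\<^sup>2 + (norm (e *R d))\<^sup>2"
    unfolding `?q - p = (d, - e *R d)` norm_Pair by simp
   also have "(norm (e *R d))\<^sup>2 <= (norm d)\<^sup>2"
    using e by (intro power_mono) (auto intro: mult_left_le_one_le)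
   finally show ?thesis by simp
  qed
  have "H ?q <= H p + (d <.> Hy p - e * (d <.> Hp p)) + C * (norm (?q - p))\<^sup>2"
   using C(2)[OF p q[folded d_def e_def]] D by (simp add: abs_le_iff)
  also have "C * (norm (?q - p))\<^sup>2 <= C * (2 * (norm d)\<^sup>2)" using n C(1) by (rule mult_left_mono)
  also have "... <= ka / 2 * (norm d)\<^sup>2" using ka mult_right_mono[of "4 * C" ka "(norm d)\<^sup>2"] by simp
  finally have Hq: "H ?q <= H p + (d <.> Hy p - e * (d <.> Hp p)) + ka / 2 * (norm d)\<^sup>2" by simp
  have "(snd p - e *R d) <.> f (y, w) - L (y, w) <= H ?q" by (rule H_ge[OF yU])
  moreover have "subsol_rate ka p t y (f (y, w)) = (snd p - e *R d) <.> f (y, w) - H p - d <.> Hy p + e * (d <.> Hp p) - ka / 2 * (norm d)\<^sup>2"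
   unfolding subsol_rate_def d_def[symmetric] e_def[symmetric]
   by (simp add: inner_diff_right inner_diff_left algebra_simps inner_commute)
  ultimately show "subsol_rate ka p t y (f (y, w)) <= L (y, w)" using Hq by linarith
 qed
qed

end

text \<open>\<open>S\<close> stands for the cost, known only through these two bounds. In
  \<open>lower\<close> the extremal z carries the subsolution, while z' certifies that the end point
  can be reached, which keeps the infimum finite.\<close>

locale geodesic_cost = local_control U f L
 for U :: "(real^'n) set" and f :: "(real^'n) \<times> (real^'r) => real^'n" and L :: "(real^'n) \<times> (real^'r) => real" +
 fixes ga et :: "real => real^'n" and a :: real and S :: "real => real^'n => real^'n => real"
  and K :: "((real^'n) \<times> (real^'n)) set" and ka ep0 r0 :: real
 assumes a: "0 < a"
  and geo: "!!t. t : {-a<..<a} ==> ga t : U & ((%t. (ga t, et t)) has_vd XH (ga t, et t)) (at t)"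
  and K: "open K" "(ga 0, et 0) : K" "K <= U \<times> UNIV" and ep0: "0 < ep0" and r0: "0 < r0"
  and lower: "!!z z' t. extremal_within K z t ==> extremal_within K z' t ==> fst (z' 0) = fst (z 0) ==>
   t <= ep0 ==> dist (ga 0) (fst (z 0)) < r0 ==> 0 < t ==> dist (ga 0) (fst (z' t)) < r0 ==>
   subsol ka z t (fst (z' t)) <= S t (fst (z 0)) (fst (z' t))"
  and upper: "!!z t. extremal_within K z t ==> t <= ep0 ==> dist (ga 0) (fst (z 0)) < r0 ==> 0 < t ==>
   S t (fst (z 0)) (fst (z t)) <= ext_action z t"
begin

abbreviation gz where "gz t \<equiv> (ga t, et t)"

definition jacobi :: "real => (real => (real^'n) \<times> (real^'n)) => bool" where
 "jacobi t de \<longleftrightarrow> (ALL s:{0..t}. (de has_vd FD XH (gz s) (de s)) (at s within {0..t}))"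

lemma gz_continuous: "continuous_on {-a<..<a} gz"
 by (intro continuous_at_imp_continuous_on ballI has_vector_derivative_continuous[OF conjunct2[OF geo]])

text \<open>Extremals are parametrized by their end: \<open>Ps s xi\<close> is the start of the one
  that is at \<open>ga s\<close> with covector xi at time s. The hypothesis on Jacobi fields makes
  this invertible in xi; the inverse \<open>X s x\<close> is the terminal covector of the extremal
  starting at x, and the time derivative of the cost is explicit in it.\<close>

theorem cost_hessian:
 obtains t1 where "0 < t1" "!!t. 0 < t ==> t < t1 ==>
  ALL de. jacobi t de --> fst (de t) = 0 --> fst (de 0) = 0 --> snd (de t) = 0 ==>
  (ALL v. EX de. jacobi t de & fst (de t) = 0 & fst (de 0) = v &
   hess (%x. deriv (%s. - S s x (ga s)) t) (ga 0) v =
    snd (de t) <.> FD Hp (gz t) (0, snd (de t)))"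
proof -
 obtain r ep ph Ph where fb: "flow_box XH K (gz 0) r ep ph Ph"
  by (rule local_flow[OF K(1,2) Ck_on_subset[OF smooth_onD[OF smooth_XH] K(3)]])
 interpret flow_box XH K "gz 0" r ep ph Ph by (rule fb)
 let ?J = "{-ep<..<ep}" and ?B = "ball (gz 0) r"
 have "isCont gz 0" using gz_continuous a by (simp add: continuous_on_eq_continuous_at)
 from this[unfolded continuous_at_eps_delta, rule_format, of "min r r0"]
 obtain d where d: "d > 0" "!!s. \<bar>s\<bar> < d ==> gz s : ball (gz 0) (min r r0)"
  using r r0 by (auto simp: dist_real_def dist_commute)
 define t1 where "t1 = min (min a d) (min (ep / 2) ep0)"
 have t1: "0 < t1" "t1 <= a" "t1 <= d" "t1 <= ep / 2" "t1 <= ep0" using a d eps ep0 by (auto simp: t1_def)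
 have gB: "gz s : ?B" "dist (ga 0) (ga s) < r0" if "\<bar>s\<bar> < t1" for s
  using d(2)[of s] that t1 dist_fst_le[of "gz 0" "gz s"] by auto
 have gK: "gz s : K" if "\<bar>s\<bar> < t1" for s using gB(1)[OF that] ball_S by blast
 have gd: "(gz has_vd XH (gz s)) (at s)" if "\<bar>s\<bar> < t1" for s
  using geo[of s] that t1 by (simp add: abs_less_iff)
 have gad: "(ga has_vd Hp (gz s)) (at s)" if "\<bar>s\<bar> < t1" for s
  using bounded_linear.has_vector_derivative[OF bounded_linear_fst gd[OF that]] by (simp add: XH_def)
 have gac: "continuous_on {-t1<..<t1} ga"
  by (intro continuous_at_imp_continuous_on ballI has_vector_derivative_continuous[OF gad]) (simp add: abs_less_iff)
 have KU: "z : U \<times> UNIV" if "z : K" for z using that K(3) by blast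
 note Ccont = continuous_on_compose2[OF smooth_on_continuous]
 \<comment> \<open>Flowing backwards from a point of the geodesic retraces it; uniqueness is applied
   with initial time t.\<close>
 have shift: "ph (si - t) (gz t) = gz si" if t: "0 < t" "t < t1" and si: "si : {0..t}" for t si
 proof (rule ode_unique[OF open_Times_UNIV[OF U] smooth_onD[OF smooth_XH], where a = 0 and b = t and ?t0.0 = t])
  fix u assume u: "u : {0..t}"
  have "u - t : ?J" using u t t1 by auto
  from phS[OF this gB(1)[of t]] has_vector_derivative_shift[OF phd[OF this gB(1)[of t]]] t
  show "ph (u - t) (gz t) : U \<times> UNIV & ((%u. ph (u - t) (gz t)) has_vd XH (ph (u - t) (gz t))) (at u within {0..t})"
   using KU by simp
  show "gz u : U \<times> UNIV & (gz has_vd XH (gz u)) (at u within {0..t})"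
   using gd[of u] gK[of u] KU u t by (auto intro: has_vector_derivative_at_within)
 qed (use ph0[OF gB(1)] t si in auto)
 define Ps where "Ps s xi = fst (ph (-s) (ga s, xi))" for s xi
 define W where "W = {p. fst p : {-t1<..<t1} & (ga (fst p), snd p) : ?B}"
 have Wo: "open W"
 proof -
  have "continuous_on ({-t1<..<t1} \<times> UNIV) (%p :: real \<times> (real^'n). (ga (fst p), snd p))"
   by (intro continuous_intros continuous_on_compose2[OF gac]) auto
  hence "open (({-t1<..<t1} \<times> UNIV) Int (%p. (ga (fst p), snd p)) -` ?B)"
   by (intro continuous_open_preimage open_Times) auto
  moreover have "W = ({-t1<..<t1} \<times> UNIV) Int (%p. (ga (fst p), snd p)) -` ?B" by (auto simp: W_def)
  ultimately show ?thesis by simp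
 qed
 have W: "-s : ?J" "s : ?J" "(ga s, xi) : ?B" "\<bar>s\<bar> < t1" if "(s, xi) : W" for s xi
  using that t1 by (auto simp: W_def)
 \<comment> \<open>The time s acts twice, as duration of the backward flow and through the moving
   end point; these are the two contributions of h.\<close>
 define F' where "F' = (%p (h, k). (h, fst (- h *R XH (ph (- fst p) (ga (fst p), snd p)) + Ph (- fst p) (ga (fst p), snd p) (h *R Hp (gz (fst p)), k))))"
 have Xphc: "continuous_on (?J \<times> ?B) (%p. XH (ph (fst p) (snd p)))"
  by (rule Ccont[OF smooth_XH phc]) (intro image_subsetI KU phS; auto)
 have Fd: "((%(s, xi). (s, Ps s xi)) has_derivative F' p) (at p)" if p: "p : W" for p
 proof -
  obtain s xi where sx: "p = (s, xi)" by fastforce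
  note w = W[OF p[unfolded sx]]
  have "(ga has_derivative (%h. h *R Hp (gz s))) (at (fst (s, xi)))"
   using gad[OF w(4)] by (simp add: has_vector_derivative_def)
  from has_derivative_compose[OF has_derivative_fst[OF has_derivative_ident] this]
  have "((%q. (- fst q, (ga (fst q), snd q))) has_derivative (%q. (- fst q, (fst q *R Hp (gz s), snd q)))) (at (s, xi))"
   by (intro has_derivative_Pair has_derivative_minus has_derivative_fst has_derivative_snd has_derivative_ident) simp
  from diff_chain_at[OF this, unfolded fst_conv snd_conv, OF joint_derivative[OF w(1,3) Xphc]]
  show ?thesis unfolding sx Ps_def F'_def case_prod_unfold
   by (intro has_derivative_Pair has_derivative_fst has_derivative_ident) (simp add: o_def)
 qed
 have Phlin: "linear (Ph s z)" if "s : ?J" "z : ?B" for s z by (rule has_derivative_linear[OF phD[OF that]])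
 have map_c: "continuous_on W (%p. (- fst p, (ga (fst p), snd p)))"
  by (intro continuous_intros continuous_on_compose2[OF gac]) (auto simp: W_def)
 have map_im: "(%p. (- fst p, (ga (fst p), snd p))) ` W <= ?J \<times> ?B" using W by force
 have PhcW: "continuous_on W (%p. Ph (- fst p) (ga (fst p), snd p) (w p))" if w: "continuous_on W w" for w
 proof -
  have "continuous_on W (%p. SUM b:Basis. (w p <.> b) *R Ph (- fst p) (ga (fst p), snd p) b)"
   using continuous_on_compose2[OF Phc map_c map_im] by (intro continuous_intros w) simp
  moreover have "(SUM b:Basis. (w p <.> b) *R Ph (- fst p) (ga (fst p), snd p) b) = Ph (- fst p) (ga (fst p), snd p) (w p)" if "p : W" for p
   by (rule linear_eq_sum_Basis[OF Phlin, symmetric]) (use W[of "fst p" "snd p"] that in auto)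
  ultimately show ?thesis by (simp cong: continuous_on_cong)
 qed
 have F'c: "continuous_on W (%p. F' p i)" for i
 proof -
  have 1: "continuous_on W (%p. XH (ph (- fst p) (ga (fst p), snd p)))"
   using continuous_on_compose2[OF Xphc map_c map_im] by simp
  have "continuous_on {-t1<..<t1} (%s. Hp (gz s))"
  proof (rule Ccont[OF smooth_Hp])
   show "continuous_on {-t1<..<t1} gz" by (rule continuous_on_subset[OF gz_continuous]) (use t1 in auto)
   show "gz ` {-t1<..<t1} <= U \<times> UNIV" by (intro image_subsetI KU gK) (simp add: abs_less_iff)
  qed
  hence "continuous_on W (%p. Hp (gz (fst p)))"
   by (rule continuous_on_compose2) (auto simp: W_def intro: continuous_intros)
  thus ?thesis unfolding F'_def case_prod_unfold by (intro continuous_intros 1 PhcW)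
 qed
 have bl: "bounded_linear (F' p)" if "p : W" for p by (rule has_derivative_bounded_linear[OF Fd[OF that]])
 define Fb where "Fb p = Blinfun (F' p)" for p
 have Fb: "blinfun_apply (Fb p) = F' p" if "p : W" for p unfolding Fb_def by (rule bounded_linear_Blinfun_apply[OF bl[OF that]])
 have Fbc: "continuous_on W Fb"
 proof (rule continuous_on_blinfun_componentwise)
  fix i
  show "continuous_on W (%p. blinfun_apply (Fb p) i)" using F'c[of i] Fb by (simp cong: continuous_on_cong)
 qed
 show thesis
 proof (rule that[OF t1(1)], intro allI)
  fix t v assume t: "0 < t" "t < t1"
   and nd: "ALL de. jacobi t de --> fst (de t) = 0 --> fst (de 0) = 0 --> snd (de t) = 0"
  have tJ: "- t : ?J" and tB: "gz t : ?B" using t t1 gB[of t] by auto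
  have jac: "jacobi t (%s. Ph (s - t) (gz t) c)" for c unfolding jacobi_def
  proof
   fix s assume s: "s : {0..t}"
   have "s - t : ?J" using s t t1 by auto
   from has_vector_derivative_shift[OF Phd[OF this tB, of c]]
   show "((%s. Ph (s - t) (gz t) c) has_vd FD XH (gz s) (Ph (s - t) (gz t) c)) (at s within {0..t})"
    using shift[OF t s] by simp
  qed
  \<comment> \<open>Linearization of the starting point in the terminal covector, along the
    geodesic.\<close>
  define M where "M k = fst (Ph (- t) (gz t) (0, k))" for k
  have Minj: "k = 0" if "M k = 0" for k
   using nd[rule_format, OF jac[of "(0, k)"]] Ph0[OF tB] that by (simp add: M_def)
  have pW: "(t, et t) : W" using t tB by (simp add: W_def)
  have Pst: "Ps t (et t) = ga 0" using shift[OF t, of 0] t by (simp add: Ps_def)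
  have F'0: "F' (t, et t) (0, k) = (0, M k)" for k by (simp add: F'_def M_def)
  have "inj (F' (t, et t))"
  proof (subst linear_injective_0[OF has_derivative_linear[OF Fd[OF pW]]], intro allI impI)
   fix q assume q: "F' (t, et t) q = 0"
   hence "fst q = 0" by (simp add: F'_def case_prod_unfold zero_prod_def)
   hence q0: "q = (0, snd q)" by (simp add: prod_eq_iff)
   hence "M (snd q) = 0" using q F'0[of "snd q"] by (metis snd_conv zero_prod_def)
   thus "q = 0" using Minj q0 by (metis zero_prod_def)
  qed
  then obtain G' where G': "linear G'" "!!x. G' (F' (t, et t) x) = x"
   using linear_injective_isomorphism[OF has_derivative_linear[OF Fd[OF pW]]] by blast
  have inv: "Blinfun G' o\<^sub>L Fb (t, et t) = id_blinfun"
   by (rule blinfun_eqI) (use G' pW in "simp add: Fb bounded_linear_Blinfun_apply linear_conv_bounded_linear")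
  obtain U' V g g' where op: "open U'" "open V" and UW: "U' <= W" and inU: "(t, et t) : U'"
   and inV: "(%(s, xi). (s, Ps s xi)) (t, et t) : V"
   and hom: "homeomorphism U' V (%(s, xi). (s, Ps s xi)) g"
   and gd': "!!y. y : V ==> (g has_derivative g' y) (at y)"
   and g'eq: "!!y. y : V ==> g' y = Hilbert_Choice.inv (blinfun_apply (Fb (g y)))"
   and bij: "!!y. y : V ==> bij (blinfun_apply (Fb (g y)))"
  proof (rule inverse_function_theorem[OF Wo _ Fbc pW inv])
   show "((%(s, xi). (s, Ps s xi)) has_derivative blinfun_apply (Fb x)) (at x)" if "x : W" for x
    using Fd[OF that] Fb[OF that] by simp
  qed (rule that; assumption)
  have txV: "(t, ga 0) : V" using inV Pst by simp
  define X where "X s x = snd (g (s, x))" for s x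
  have gX: "g (s, x) = (s, X s x)" "Ps s (X s x) = x" "(s, X s x) : W" if "(s, x) : V" for s x
  proof -
   have 1: "(%(s, xi). (s, Ps s xi)) (g (s, x)) = (s, x)" "g (s, x) : U'"
    using hom that by (auto simp: homeomorphism_def)
   thus gsx: "g (s, x) = (s, X s x)" "Ps s (X s x) = x" by (auto simp: X_def case_prod_unfold prod_eq_iff)
   show "(s, X s x) : W" using 1(2) UW unfolding gsx(1) by blast
  qed
  have Xt: "X t (ga 0) = et t"
  proof -
   have "g ((%(s, xi). (s, Ps s xi)) (t, et t)) = (t, et t)" using hom inU unfolding homeomorphism_def by blast
   thus ?thesis using Pst by (simp add: X_def)
  qed
  have Xc: "continuous_on V (%(s, x). X s x)"
   using homeomorphism_cont2[OF hom] unfolding X_def case_prod_unfold by (intro continuous_intros) auto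
  define e where "e s x si = ph (si - s) (ga s, X s x)" for s x si
  obtain d1 where d1: "d1 > 0" "!!s x. \<bar>s - t\<bar> < d1 ==> dist (ga 0) x < d1 ==> (s, x) : V"
  proof -
   obtain A B where AB: "open A" "open B" "(t, ga 0) : A \<times> B" "A \<times> B <= V"
    by (rule open_prod_elim[OF op(2) txV]) (rule that; assumption)
   obtain a1 where a1: "a1 > 0" "ball t a1 <= A" using openE[OF AB(1), of t] AB(3) by auto
   obtain b1 where b1: "b1 > 0" "ball (ga 0) b1 <= B" using openE[OF AB(2), of "ga 0"] AB(3) by auto
   show ?thesis
   proof (rule that[of "min a1 b1"])
    fix s x assume "\<bar>s - t\<bar> < min a1 b1" "dist (ga 0) x < min a1 b1"
    hence "s : ball t a1" "x : ball (ga 0) b1" by (simp_all add: dist_real_def abs_minus_commute)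
    thus "(s, x) : V" using a1(2) b1(2) AB(4) by blast
   qed (use a1 b1 in simp)
  qed
  define d2 where "d2 = min (min d1 r0) (min t (t1 - t))"
  have d2: "d2 > 0" using d1 r0 t by (simp add: d2_def)
  let ?I = "ball t d2" and ?N = "ball (ga 0) d2"
  have IV: "(s, x) : V" if "s : ?I" "x : ?N" for s x
   using d1(2)[of s x] that by (auto simp: d2_def dist_real_def abs_minus_commute)
  have I0: "0 < s" "s < t1" if "s : ?I" for s using that by (auto simp: d2_def dist_real_def abs_if split: if_splits)
  have eJ: "si - s : ?J" if "s : ?I" "0 <= si" "si < t1" for s si using I0[OF that(1)] that t1 by auto
  have eB: "(ga s, X s x) : ?B" if "s : ?I" "x : ?N" for s x using W(3)[OF gX(3)[OF IV[OF that]]] .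
  have ed: "e s x si : K & ((%si. e s x si) has_vd XH (e s x si)) (at si)"
   if "s : ?I" "x : ?N" "0 <= si" "si < t1" for s x si using phS[OF eJ[OF that(1,3,4)] eB[OF that(1,2)]]
    has_vector_derivative_shift[OF phd[OF eJ[OF that(1,3,4)] eB[OF that(1,2)]], of UNIV] by (simp add: e_def)
  have ext: "extremal_within K (e s x) s'" if "s : ?I" "x : ?N" "s' < t1" for s x s'
   unfolding extremal_within_def using ed[OF that(1,2)] that(3) by (auto intro: has_vector_derivative_at_within)
  have e0: "fst (e s x 0) = x" "e s x s = (ga s, X s x)" if "s : ?I" "x : ?N" for s x
   using gX(2)[OF IV[OF that]] ph0[OF eB[OF that]] by (auto simp: e_def Ps_def)
  have Nr: "dist (ga 0) x < r0" if "x : ?N" for x using that by (auto simp: d2_def)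
  \<comment> \<open>The subsolution built on \<open>e s x\<close> touches the cost at end time s,
    for every s near t, so \<open>touching_derivative\<close> applies. On the diagonal the
    displacement vanishes, which leaves the simple value stated.\<close>
  have cost: "((%s. S s x (ga s)) has_real_derivative (X t x <.> Hp (gz t) - H (ga t, X t x))) (at t)"
   if x: "x : ?N" for x
  proof -
   let ?B = "%s s'. subsol_rate ka (e s x s') s' (ga s') (Hp (gz s'))"
   have tI: "t : ?I" using d2 by simp
   have "((%s. S s x (ga s)) has_real_derivative ?B t t) (at t)"
   proof (rule touching_derivative[where I = ?I and b = "%s s'. subsol ka (e s x) s' (ga s')" and B = ?B])
    show "is_interval ?I" by (simp add: is_interval_convex_1 convex_ball)
    fix s s' assume s: "s : ?I" "s' : ?I"
    define T where "T = (s' + t1) / 2"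
    have T: "s' < T" "T < t1" using I0[OF s(2)] by (auto simp: T_def)
    have "((%s'. subsol ka (e s x) s' (ga s')) has_real_derivative ?B s s') (at s' within {0..T})"
     by (rule subsol_along_curve[OF ext[OF s(1) x T(2)] K(3)])
      (use I0[OF s(2)] T gad[of s'] in "auto intro: has_vector_derivative_at_within")
    thus "((%s'. subsol ka (e s x) s' (ga s')) has_real_derivative ?B s s') (at s')"
     using at_within_Icc_at[of 0 s' T] I0[OF s(2)] T by simp
    have "subsol ka (e s x) s' (ga s') <= S s' x (ga s')"
     using lower[OF ext[OF s(1) x I0(2)[OF s(2)]] ext[OF s(2) x I0(2)[OF s(2)]]] e0[OF s(1) x] e0[OF s(2) x] Nr[OF x] I0[OF s(2)] gB(2)[of s'] t1 by simp
    moreover have "S s x (ga s) <= subsol ka (e s x) s (ga s)"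
     using upper[OF ext[OF s(1) x I0(2)[OF s(1)]]] e0[OF s(1) x] Nr[OF x] I0[OF s(1)] t1 by (simp add: subsol_def)
    ultimately show "subsol ka (e s x) s' (ga s') - subsol ka (e s x) s (ga s) <= S s' x (ga s') - S s x (ga s)" by simp
   next
    have II: "open (?I \<times> ?I)" by (intro open_Times) auto
    have "continuous_on (?I \<times> ?I) (%p. (%(s, x). X s x) (fst p, x))"
    proof (rule continuous_on_compose2[OF Xc])
     show "(%p. (fst p, x)) ` (?I \<times> ?I) <= V" by (intro image_subsetI IV x) auto
    qed (intro continuous_intros)
    hence "continuous_on (?I \<times> ?I) (%p. X (fst p) x)" by simp
    moreover have gI: "continuous_on (?I \<times> ?I) (%p. ga (fst p))" "continuous_on (?I \<times> ?I) (%p. ga (snd p))"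
    proof -
     have "fst ` (?I \<times> ?I) <= {-t1<..<t1}" "snd ` (?I \<times> ?I) <= {-t1<..<t1}" using I0 t1 by fastforce+
     thus "continuous_on (?I \<times> ?I) (%p. ga (fst p))" "continuous_on (?I \<times> ?I) (%p. ga (snd p))"
      by (intro continuous_on_compose2[OF gac _ \<open>fst ` _ <= _\<close>] continuous_on_compose2[OF gac _ \<open>snd ` _ <= _\<close>] continuous_intros)+
    qed
    ultimately have m: "continuous_on (?I \<times> ?I) (%p. (snd p - fst p, (ga (fst p), X (fst p) x)))"
     by (intro continuous_intros)
    have "(%p. (snd p - fst p, (ga (fst p), X (fst p) x))) ` (?I \<times> ?I) <= ?J \<times> ball (gz 0) r"
     using eJ eB[OF _ x] I0 by (intro image_subsetI) (force simp: mem_Times_iff)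
    from continuous_on_compose2[OF phc m this] have ec: "continuous_on (?I \<times> ?I) (%p. e (fst p) x (snd p))"
     by (simp add: e_def)
    have eK: "(%p. e (fst p) x (snd p)) ` (?I \<times> ?I) <= U \<times> UNIV"
     by (intro image_subsetI KU conjunct1[OF ed[OF _ x]])
      (auto simp: mem_Times_iff simp del: mem_ball intro: I0 less_imp_le[OF I0(1)])
    have gzc: "continuous_on (?I \<times> ?I) (%p. gz (snd p))"
    proof (rule continuous_on_compose2[OF gz_continuous])
     show "snd ` (?I \<times> ?I) <= {-a<..<a}" using I0 t1 by fastforce
    qed (intro continuous_intros)
    have gzU: "(%p. gz (snd p)) ` (?I \<times> ?I) <= U \<times> UNIV" using I0 by (intro image_subsetI KU gK) fastforce
    have "continuous_on (?I \<times> ?I) (%p. ?B (fst p) (snd p))" unfolding subsol_rate_def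
     by (intro continuous_intros ec gI Ccont[OF smooth_Hp ec eK] Ccont[OF smooth_H ec eK] Ccont[OF smooth_Hy ec eK] Ccont[OF smooth_Hp gzc gzU])
    hence "continuous (at (t, t)) (%p. ?B (fst p) (snd p))" using II tI by (simp add: continuous_on_eq_continuous_at)
    thus "continuous (at (t, t)) (%(s, s'). ?B s s')" by (simp add: case_prod_unfold)
   qed (use tI in auto)
   moreover have "?B t t = X t x <.> Hp (gz t) - H (ga t, X t x)"
    using e0(2)[OF tI x] by (simp add: subsol_rate_def inner_diff_right)
   ultimately show ?thesis by simp
  qed
  define G where "G x = H (ga t, X t x) - X t x <.> Hp (gz t)" for x
  have Geq: "deriv (%s. - S s x (ga s)) t = G x" if "x : ?N" for x
   using DERIV_imp_deriv[OF DERIV_minus[OF cost[OF that]]] by (simp add: G_def)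
  have tI: "t : ?I" using d2 by simp
  have gzU: "ga t : U" using gK[of t] KU t by fastforce
  define X' where "X' x v = snd (g' (t, x) (0, v))" for x v
  have Xd: "((%x. X t x) has_derivative X' x) (at x)" if "x : ?N" for x
  proof -
   have "(g has_derivative g' (t, x)) (at (t, x))" by (rule gd'[OF IV[OF tI that]])
   from has_derivative_snd[OF has_derivative_slice(1)[OF this]] show ?thesis by (simp add: X_def X'_def[abs_def])
  qed
  define Mx where "Mx x k = fst (Ph (- t) (ga t, X t x) (0, k))" for x k
  have MX: "Mx x (X' x v) = v" and Mxinj: "Mx x k = 0 ==> k = 0" and Mxlin: "linear (Mx x)" if x: "x : ?N" for x v k
  proof -
   let ?p = "(t, X t x)"
   have pV: "(t, x) : V" by (rule IV[OF tI x])
   have pWx: "?p : W" by (rule gX(3)[OF pV])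
   have Fx: "blinfun_apply (Fb (g (t, x))) = F' ?p" using Fb[OF pWx] gX(1)[OF pV] by simp
   have F0: "F' ?p (0, k) = (0, Mx x k)" for k by (simp add: F'_def Mx_def)
   have b: "bij (F' ?p)" using bij[OF pV] Fx by simp
   have "F' ?p (g' (t, x) (0, v)) = (0, v)" using g'eq[OF pV] Fx b by (simp add: bij_is_surj surj_f_inv_f)
   moreover from this have "fst (g' (t, x) (0, v)) = 0" by (simp add: F'_def case_prod_unfold)
   hence "g' (t, x) (0, v) = (0, X' x v)" by (simp add: X'_def prod_eq_iff)
   ultimately show "Mx x (X' x v) = v" using F0 by simp
   show "k = 0" if "Mx x k = 0"
   proof -
    have "F' ?p (0, k) = F' ?p 0" using F0[of k] that linear_0[OF has_derivative_linear[OF Fd[OF pWx]]] by (simp add: zero_prod_def)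
    thus "k = 0" using b by (metis bij_is_inj injD prod.inject zero_prod_def)
   qed
   have "linear (%k :: real^'n. (0 :: real^'n, k))" by (rule linearI) auto
   from linear_compose[OF linear_compose[OF this Phlin[OF tJ eB[OF tI x]]] bounded_linear.linear[OF bounded_linear_fst]]
   show "linear (Mx x)" by (simp add: o_def Mx_def[abs_def])
  qed
  \<comment> \<open>X' solves a linear system with the matrix of \<open>Mx\<close>, so Cramer's rule
    with k = 0 gives continuity; the flow box provides no second derivatives in the initial
    point.\<close>
  have X'c: "continuous_on ?N (%x. X' x v)" for v
  proof -
   have Wc: "continuous_on ?N (%x. (t, X t x))"
    using Xd by (intro continuous_intros) (meson continuous_at_imp_continuous_on has_derivative_continuous)
   have c: "continuous_on ?N (%x. Mx x k)" for k
   proof -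
    have "continuous_on ?N (%x. Ph (- fst (t, X t x)) (ga (fst (t, X t x)), snd (t, X t x)) (0, k))"
     by (rule continuous_on_compose2[OF PhcW[OF continuous_on_const] Wc]) (use gX(3)[OF IV[OF tI]] in auto)
    thus ?thesis unfolding Mx_def by (intro continuous_intros) simp
   qed
   have "Ck_on 0 ?N (%x. X' x v)"
   proof (rule Ck_on_solve[where A = "%x. matrix (Mx x)" and b = "%x. v"])
    show "Ck_on 0 ?N (%x. matrix (Mx x) $ i $ j)" for i j
     unfolding Ck_on.simps matrix_def vec_lambda_beta by (intro continuous_intros c)
    show "det (matrix (Mx x)) ~= 0" if "x : ?N" for x
     using det_nz_iff_inj[OF Mxlin[OF that]] linear_injective_0[OF Mxlin[OF that]] Mxinj[OF that] by blast
    show "matrix (Mx x) *v X' x v = v" if "x : ?N" for x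
     using matrix_works[OF linear_matrix_vector_mul_eq[THEN iffD2, OF Mxlin[OF that]], of "X' x v"] MX[OF that] by simp
   qed auto
   thus ?thesis by simp
  qed
  \<comment> \<open>The covector derivative of H is Hp, so X' is paired with a difference of
    velocities that vanishes at x = ga 0: the situation of
    \<open>has_derivative_inner_zero\<close>.\<close>
  have Gd: "(G has_derivative (%v. X' x v <.> (Hp (ga t, X t x) - Hp (gz t)))) (at x)" if x: "x : ?N" for x
  proof -
   have "((%xi. H (ga t, xi)) has_derivative (%k. k <.> Hp (ga t, X t x))) (at (X t x))"
    using has_derivative_slice(1)[OF DH[OF gzU]] DH_p[OF gzU] by simp
   from diff_chain_at[OF Xd[OF x] this]
   have "((%x. H (ga t, X t x)) has_derivative (%v. X' x v <.> Hp (ga t, X t x))) (at x)" by (simp add: o_def)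
   from has_derivative_diff[OF this has_derivative_inner_left[OF Xd[OF x]]]
   show ?thesis unfolding G_def inner_diff_right .
  qed
  have x0N: "ga 0 : ?N" using d2 by simp
  define de where "de s = Ph (s - t) (gz t) (0, X' (ga 0) v)" for s
  have d0: "de t = (0, X' (ga 0) v)" using Ph0[OF tB] by (simp add: de_def)
  have dv: "fst (de 0) = v" using MX[OF x0N, of v] Xt by (simp add: de_def Mx_def)
  have "FD (%x. deriv (%s. - S s x (ga s)) t) x v = X' x v <.> (Hp (ga t, X t x) - Hp (gz t))"
   if x: "x : ?N" for x
  proof -
   have "((%x. deriv (%s. - S s x (ga s)) t) has_derivative (%v. X' x v <.> (Hp (ga t, X t x) - Hp (gz t)))) (at x)"
    by (rule has_derivative_transform_within_open[OF Gd[OF x] open_ball x]) (simp add: Geq)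
   thus ?thesis by (rule fun_cong[OF frechet_derivative_at, symmetric])
  qed
  note fd = this
  have "((%x. X' x v <.> (Hp (ga t, X t x) - Hp (gz t))) has_derivative
    (%u. X' (ga 0) v <.> FD Hp (gz t) (0, X' (ga 0) u))) (at (ga 0))"
  proof (rule has_derivative_inner_zero)
   have "(Hp has_derivative FD Hp (gz t)) (at (gz t))"
    by (rule smooth_on_has_derivative[OF smooth_Hp]) (use gzU in simp)
   hence "((%xi. Hp (ga t, xi)) has_derivative (%k. FD Hp (gz t) (0, k))) (at (X t (ga 0)))"
    unfolding Xt by (rule has_derivative_slice(1))
   from diff_chain_at[OF Xd[OF x0N] this]
   have "((%x. Hp (ga t, X t x)) has_derivative (%u. FD Hp (gz t) (0, X' (ga 0) u))) (at (ga 0))" by (simp add: o_def)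
   from has_derivative_diff[OF this has_derivative_const[of "Hp (gz t)"]]
   show "((%x. Hp (ga t, X t x) - Hp (gz t)) has_derivative (%u. FD Hp (gz t) (0, X' (ga 0) u))) (at (ga 0))" by simp
   show "isCont (%x. X' x v) (ga 0)" using X'c[of v] x0N by (simp add: continuous_on_eq_continuous_at)
  qed (simp add: Xt)
  hence "((%x. FD (%x. deriv (%s. - S s x (ga s)) t) x v) has_derivative
    (%u. X' (ga 0) v <.> FD Hp (gz t) (0, X' (ga 0) u))) (at (ga 0))"
   by (rule has_derivative_transform_within_open[OF _ open_ball x0N]) (simp add: fd)
  hence "hess (%x. deriv (%s. - S s x (ga s)) t) (ga 0) v = snd (de t) <.> FD Hp (gz t) (0, snd (de t))"
   unfolding hess_def d0 snd_conv by (rule fun_cong[OF frechet_derivative_at, symmetric])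
  moreover have "jacobi t de" unfolding de_def by (rule jac)
  ultimately show "EX de. jacobi t de & fst (de t) = 0 & fst (de 0) = v &
    hess (%x. deriv (%s. - S s x (ga s)) t) (ga 0) v = snd (de t) <.> FD Hp (gz t) (0, snd (de t))"
   using d0 dv by (intro exI[of _ de]) simp
 qed
qed

end

section \<open>Local lower bounds for the action\<close>

lemma lipschitz_on_Icc_if_derivative:
 fixes g :: "real => 'a::real_normed_vector"
 assumes d: "!!s. s : {a..b} ==> (g has_vd g' s) (at s within {a..b})" and c: "continuous_on {a..b} g'"
 obtains C where "C-lipschitz_on {a..b} g"
proof -
 have "bounded (g' ` {a..b})" by (intro compact_imp_bounded compact_continuous_image c) auto
 then obtain C where C: "C > 0" "!!s. s : {a..b} ==> norm (g' s) <= C" unfolding bounded_pos by blast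
 have "C-lipschitz_on {a..b} g"
 proof (rule lipschitz_onI)
  fix s t assume "s : {a..b}" "t : {a..b}"
  hence "norm (g s - g t) <= C * \<bar>s - t\<bar>" by (intro derivative_increment_bound[OF d C(2)])
  thus "dist (g s) (g t) <= C * dist s t" by (simp add: dist_norm)
 qed (use C in simp)
 thus thesis by (rule that)
qed

lemma lipschitz_on_inner:
 fixes p q :: "real => 'a::real_inner"
 assumes "A-lipschitz_on {a..b} p" "B-lipschitz_on {a..b} q"
 obtains C where "C-lipschitz_on {a..b} (%s. p s <.> q s)"
proof -
 have "bounded (p ` {a..b})" "bounded (q ` {a..b})"
  by (intro compact_imp_bounded compact_continuous_image lipschitz_on_continuous_on[OF assms(1)] lipschitz_on_continuous_on[OF assms(2)]; simp)+
 then obtain P Q where P: "P > 0" "!!s. s : {a..b} ==> norm (p s) <= P" and Q: "Q > 0" "!!s. s : {a..b} ==> norm (q s) <= Q"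
  unfolding bounded_pos by blast
 have AB: "A >= 0" "B >= 0" using assms lipschitz_on_nonneg by blast+
 have "(P * B + A * Q)-lipschitz_on {a..b} (%s. p s <.> q s)"
 proof (rule lipschitz_onI)
  fix s t assume st: "s : {a..b}" "t : {a..b}"
  have "p s <.> q s - p t <.> q t = p s <.> (q s - q t) + (p s - p t) <.> q t" by (simp add: inner_diff_left inner_diff_right)
  also have "\<bar>...\<bar> <= P * (B * \<bar>s - t\<bar>) + (A * \<bar>s - t\<bar>) * Q"
  proof (rule order_trans[OF abs_triangle_ineq add_mono])
   have "norm (q s - q t) <= B * \<bar>s - t\<bar>" using lipschitz_onD[OF assms(2) st] by (simp add: dist_norm)
   thus "\<bar>p s <.> (q s - q t)\<bar> <= P * (B * \<bar>s - t\<bar>)"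
    using P(2)[OF st(1)] P(1) by (intro order_trans[OF Cauchy_Schwarz_ineq2] mult_mono) auto
   have "norm (p s - p t) <= A * \<bar>s - t\<bar>" using lipschitz_onD[OF assms(1) st] by (simp add: dist_norm)
   thus "\<bar>(p s - p t) <.> q t\<bar> <= (A * \<bar>s - t\<bar>) * Q"
    using Q(2)[OF st(2)] AB by (intro order_trans[OF Cauchy_Schwarz_ineq2] mult_mono) auto
  qed
  finally show "dist (p s <.> q s) (p t <.> q t) <= (P * B + A * Q) * dist s t" by (simp add: dist_real_def algebra_simps)
 qed (use P Q AB in auto)
 thus thesis by (rule that)
qed

context local_control begin

lemma extremal_lipschitz:
 assumes z: "extremal_within K z t" and KU: "K <= U \<times> UNIV"
 obtains A B where "A-lipschitz_on {0..t} z" "B-lipschitz_on {0..t} (ext_action z)"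
proof -
 have zd: "(z has_vd XH (z s)) (at s within {0..t})" if "s : {0..t}" for s
  using z that by (simp add: extremal_within_def)
 have zc: "continuous_on {0..t} z" by (rule continuous_on_vector_derivative[OF zd])
 have zK: "z ` {0..t} <= U \<times> UNIV" using z KU by (auto simp: extremal_within_def)
 have Xc: "continuous_on {0..t} (%s. XH (z s))"
  by (rule continuous_on_compose2[OF smooth_on_continuous[OF smooth_XH] zc zK])
 obtain A where A: "A-lipschitz_on {0..t} z" by (rule lipschitz_on_Icc_if_derivative[OF zd Xc])
 have Lc: "continuous_on {0..t} (%s. snd (z s) <.> Hp (z s) - H (z s))"
  by (intro continuous_intros zc continuous_on_compose2[OF smooth_on_continuous[OF smooth_Hp] zc zK]
    continuous_on_compose2[OF smooth_on_continuous[OF smooth_H] zc zK])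
 have "(ext_action z has_vd (snd (z s) <.> Hp (z s) - H (z s))) (at s within {0..t})" if "s : {0..t}" for s
  unfolding ext_action_def[abs_def] by (rule integral_has_vector_derivative[OF Lc that])
 then obtain B where "B-lipschitz_on {0..t} (ext_action z)" by (rule lipschitz_on_Icc_if_derivative[OF _ Lc])
 thus thesis using A that by blast
qed

lemma subsol_lipschitz:
 assumes z: "extremal_within K z t" "K <= U \<times> UNIV" and y: "A-lipschitz_on {0..t} y"
 obtains C where "C-lipschitz_on {0..t} (%s. subsol ka z s (y s))"
proof -
 obtain B B' where B: "B-lipschitz_on {0..t} z" "B'-lipschitz_on {0..t} (ext_action z)"
  by (rule extremal_lipschitz[OF z])
 have X: "B-lipschitz_on {0..t} (%s. fst (z s))" "B-lipschitz_on {0..t} (%s. snd (z s))"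
  using B(1) unfolding lipschitz_on_def by (auto intro: order_trans[OF dist_fst_le] order_trans[OF dist_snd_le])
 have d: "(A + B)-lipschitz_on {0..t} (%s. y s - fst (z s))" by (rule lipschitz_on_diff[OF y X(1)])
 obtain C1 where C1: "C1-lipschitz_on {0..t} (%s. snd (z s) <.> (y s - fst (z s)))" by (rule lipschitz_on_inner[OF X(2) d])
 obtain C2 where C2: "C2-lipschitz_on {0..t} (%s. (y s - fst (z s)) <.> (y s - fst (z s)))" by (rule lipschitz_on_inner[OF d d])
 have "(\<bar>ka / 2\<bar>)-lipschitz_on {0..t} (%s. ka * s / 2)"
  by (rule lipschitz_onI) (auto simp: dist_real_def abs_mult right_diff_distrib[symmetric] diff_divide_distrib[symmetric])
 from lipschitz_on_inner[OF this C2] obtain C3 where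
  C3: "C3-lipschitz_on {0..t} (%s. ka * s / 2 * ((y s - fst (z s)) <.> (y s - fst (z s))))" by auto
 have "(B' + C1 + C3)-lipschitz_on {0..t} (%s. subsol ka z s (y s))"
  unfolding subsol_def power2_norm_eq_inner by (intro lipschitz_on_diff lipschitz_on_add B(2) C1 C3)
 thus thesis by (rule that)
qed

lemma subsol_at_0: "y = fst (z 0) ==> subsol ka z 0 y = 0" by (simp add: subsol_def ext_action_def)

text \<open>The increment is projected onto its own direction e, which gives a scalar Lipschitz
  function whose derivative is at most the speed.\<close>

lemma displacement_bound:
 assumes C: "!!x w. x : B ==> norm (f (x, w)) <= C + L (x, w)"
  and t: "0 <= t" and y: "A-lipschitz_on {0..t} y" "y ` {0..t} <= B"
  and ae: "AE s in lebesgue_on {0..t}. (y has_vd f (y s, w s)) (at s within {0..t})"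
  and int: "integrable (lebesgue_on {0..t}) (%s. L (y s, w s))"
 shows "norm (y t - y 0) <= C * t + (LINT s|lebesgue_on {0..t}. L (y s, w s))"
proof -
 define e where "e = sgn (y t - y 0)"
 have e1: "norm e <= 1" by (simp add: e_def norm_sgn)
 have ee: "e <.> (y t - y 0) = norm (y t - y 0)"
  by (cases "y t - y 0 = 0") (simp_all add: e_def sgn_div_norm power2_norm_eq_inner[symmetric] power2_eq_square)
 have fin: "finite_measure (lebesgue_on {0..t})" by (rule finite_measure_lebesgue_on) (auto simp: lmeasurable_cbox)
 have Ci: "integrable (lebesgue_on {0..t}) (%s. C)" by (rule finite_measure.integrable_const[OF fin])
 have "e <.> y t - e <.> y 0 <= (LINT s|lebesgue_on {0..t}. C + L (y s, w s))"
 proof (rule lipschitz_increment_le_integral[OF t])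
  show "A-lipschitz_on {0..t} (%s. e <.> y s)"
  proof (rule lipschitz_onI)
   fix s u assume su: "s : {0..t}" "u : {0..t}"
   have "\<bar>e <.> (y s - y u)\<bar> <= 1 * norm (y s - y u)"
    using e1 by (intro order_trans[OF Cauchy_Schwarz_ineq2] mult_right_mono) auto
   also have "... <= A * dist s u" using lipschitz_onD[OF y(1) su] by (simp add: dist_norm)
   finally show "dist (e <.> y s) (e <.> y u) <= A * dist s u" by (simp add: dist_real_def inner_diff_right)
  qed (use y lipschitz_on_nonneg in blast)
  show "integrable (lebesgue_on {0..t}) (%s. C + L (y s, w s))" by (intro Bochner_Integration.integrable_add Ci int)
  show "AE s in lebesgue_on {0..t}. EX d. ((%s. e <.> y s) has_vd d) (at s within {0..t}) & d <= C + L (y s, w s)"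
   using ae AE_space
  proof eventually_elim
   case (elim s)
   hence "y s : B" using y(2) by auto
   have "e <.> f (y s, w s) <= norm e * norm (f (y s, w s))" by (rule norm_cauchy_schwarz)
   also have "... <= 1 * norm (f (y s, w s))" using e1 by (intro mult_right_mono) auto
   also have "... <= C + L (y s, w s)" using C[OF `y s : B`] by simp
   finally show ?case using bounded_linear.has_vector_derivative[OF bounded_linear_inner_right elim(1)] by blast
  qed
 qed
 also have "... = C * t + (LINT s|lebesgue_on {0..t}. L (y s, w s))"
  using t by (subst Bochner_Integration.integral_add[OF Ci int]) (simp add: measure_restrict_space)
 finally show ?thesis using ee by (simp add: inner_diff_right)
qed

text \<open>The Hamilton-Jacobi inequality integrated along a Lipschitz curve. The curve is
  differentiable only almost everywhere, hence the detour through
  \<open>lipschitz_increment_le_integral\<close>.\<close>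

lemma local_lower_bound:
 assumes z0: "z0 : U \<times> UNIV"
 obtains K rh ka ep where "open K" "z0 : K" "K <= U \<times> UNIV" "bounded K" "closure K <= U \<times> UNIV" "0 < rh" "cball (fst z0) rh <= U" "0 < ep" "0 <= ka"
  "!!z t y w A. extremal_within K z t ==> 0 <= t ==> t <= ep ==> A-lipschitz_on {0..t} y ==> y ` {0..t} <= cball (fst z0) rh ==>
   AE s in lebesgue_on {0..t}. (y has_vd f (y s, w s)) (at s within {0..t}) ==>
   integrable (lebesgue_on {0..t}) (%s. L (y s, w s)) ==>
   subsol ka z t (y t) - subsol ka z 0 (y 0) <= (LINT s|lebesgue_on {0..t}. L (y s, w s))"
proof -
 obtain R where R: "R > 0" "cball z0 R <= U \<times> UNIV" using z0 oU open_contains_cball by blast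
 obtain C where C: "C >= 0" "!!ka p t y w. 4 * C <= ka ==> 0 <= t ==> ka * t <= 1 ==> p : cball z0 R ==>
  (y, snd p - (ka * t) *R (y - fst p)) : cball z0 R ==> subsol_rate ka p t y (f (y, w)) <= L (y, w)"
  by (rule subsol_rate_le[OF compact_cball convex_cball R(2)]) (rule that; assumption)
 define ka where "ka = 4 * C + 1"
 have ka: "ka > 0" "4 * C <= ka" using C(1) by (auto simp: ka_def)
 \<comment> \<open>Extremals stay within R/4 of z0 and curves within R/8 of its base point. As ka t
   is at most 1, the point where Fenchel's inequality is applied is within R/8 + R/4 + 3R/8 of z0,
   inside the ball of validity.\<close>
 let ?K = "ball z0 (R / 4)"
 have KU: "?K <= U \<times> UNIV"
 proof -
  have "?K <= cball z0 R" using R(1) by auto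
  thus ?thesis using R(2) by blast
 qed
 show thesis
 proof (rule that[of ?K "R / 8" "1 / ka" ka])
  have "closure ?K = cball z0 (R / 4)" using R by simp
  also have "... <= cball z0 R" using R(1) by auto
  finally show "closure ?K <= U \<times> UNIV" using R(2) by blast
  show "cball (fst z0) (R / 8) <= U"
  proof
   fix y assume "y : cball (fst z0) (R / 8)"
   hence "(y, snd z0) : cball z0 R" using R(1) by (cases z0) (simp add: dist_Pair_Pair)
   thus "y : U" using R(2) by auto
  qed
  fix z t y w A
  assume z: "extremal_within ?K z t" and t: "0 <= t" "t <= 1 / ka" and y: "A-lipschitz_on {0..t} y" "y ` {0..t} <= cball (fst z0) (R / 8)"
   and ae: "AE s in lebesgue_on {0..t}. (y has_vd f (y s, w s)) (at s within {0..t})"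
   and int: "integrable (lebesgue_on {0..t}) (%s. L (y s, w s))"
  obtain C' where C': "C'-lipschitz_on {0..t} (%s. subsol ka z s (y s))" by (rule subsol_lipschitz[OF z KU y(1)])
  show "subsol ka z t (y t) - subsol ka z 0 (y 0) <= (LINT s|lebesgue_on {0..t}. L (y s, w s))"
  proof (rule lipschitz_increment_le_integral[OF t(1) C' int])
   show "AE s in lebesgue_on {0..t}. EX d. ((%s. subsol ka z s (y s)) has_vd d) (at s within {0..t}) & d <= L (y s, w s)"
    using ae AE_space
   proof eventually_elim
    case (elim s)
    hence s: "s : {0..t}" by simp
    have "ka * s <= ka * (1 / ka)" using s t ka by (intro mult_left_mono) auto
    hence kas: "0 <= ka * s" "ka * s <= 1" using ka s by auto
    have zs: "dist z0 (z s) < R / 4" using z s by (simp add: extremal_within_def)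
    have ys: "dist (fst z0) (y s) <= R / 8" using subsetD[OF y(2) imageI[OF s]] by simp
    have d1: "dist (fst z0) (fst (z s)) < R / 4" "dist (snd z0) (snd (z s)) < R / 4"
     using zs dist_fst_le[of z0 "z s"] dist_snd_le[of z0 "z s"] by auto
    let ?q = "(y s, snd (z s) - (ka * s) *R (y s - fst (z s)))"
    have "norm (y s - fst (z s)) < 3 * R / 8"
     using dist_triangle2[of "y s" "fst (z s)" "fst z0"] ys d1(1) by (simp add: dist_norm[symmetric] dist_commute)
    hence n1: "norm ((ka * s) *R (y s - fst (z s))) < 3 * R / 8"
     using kas mult_left_le_one_le[of "norm (y s - fst (z s))" "ka * s"] by simp
    have n2: "norm (snd z0 - snd (z s)) < R / 4" using d1(2) by (simp add: dist_norm)
    have "snd z0 - snd ?q = (snd z0 - snd (z s)) + (ka * s) *R (y s - fst (z s))" by simp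
    hence "norm (snd z0 - snd ?q) < R / 4 + 3 * R / 8"
     by (simp only:) (rule order.strict_trans1[OF norm_triangle_ineq add_strict_mono[OF n2 n1]])
    hence "dist (snd z0) (snd ?q) < R / 4 + 3 * R / 8" by (simp only: dist_norm)
    moreover have "dist z0 ?q <= dist (fst z0) (fst ?q) + dist (snd z0) (snd ?q)"
     by (cases z0) (simp add: dist_Pair_Pair sqrt_sum_squares_le_sum)
    ultimately have "dist z0 ?q < R / 8 + (R / 4 + 3 * R / 8)" using ys by simp
    moreover have "R / 8 + (R / 4 + 3 * R / 8) <= R" using R(1) by simp
    ultimately have q: "?q : cball z0 R" by (simp only: mem_cball)
    have "subsol_rate ka (z s) s (y s) (f (y s, w s)) <= L (y s, w s)"
     using C(2)[OF ka(2) _ kas(2) _ q] s zs R(1) by simp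
    thus ?case
     using subsol_along_curve[OF z KU s elim(1), of ka] by (auto simp: has_real_derivative_iff_has_vector_derivative)
   qed
  qed
 qed (use R ka KU in auto)
qed

end

section \<open>Charts\<close>

locale charted =
 fixes M :: "('m::{t2_space,second_countable_topology}, 'n::finite, 'z) charts_scheme"
 assumes manifold: "smooth_manifold M"
begin

lemma chart_dom: "p : chart_dom M p" "open (chart_dom M p)"
 and chart_homeomorphism: "homeomorphism (chart_dom M p) (chart M p ` chart_dom M p) (chart M p) (chart_inv M p)"
 and chart_image_open: "open (chart M p ` chart_dom M p)" using manifold by (auto simp: smooth_manifold_def)

lemma chart_inv_chart [simp]: "x : chart_dom M p ==> chart_inv M p (chart M p x) = x"
 using chart_homeomorphism by (auto simp: homeomorphism_def)

lemma chart_chart_inv [simp]: "y : chart M p ` chart_dom M p ==> chart M p (chart_inv M p y) = y"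
 using chart_homeomorphism by (auto simp: homeomorphism_def)

lemma chart_inv_dom: "y : chart M p ` chart_dom M p ==> chart_inv M p y : chart_dom M p" by auto

lemma continuous_chart: "continuous_on (chart_dom M p) (chart M p)"
 and continuous_chart_inv: "continuous_on (chart M p ` chart_dom M p) (chart_inv M p)"
 using chart_homeomorphism by (auto simp: homeomorphism_def)

lemma chart_image_eq: "A <= chart_dom M p ==> chart M p ` A = chart M p ` chart_dom M p Int chart_inv M p -` A"
 by force

lemma chart_image_open_subset:
 assumes "open A" "A <= chart_dom M p" shows "open (chart M p ` A)" unfolding chart_image_eq[OF assms(2)]
 using continuous_on_open_vimage[OF chart_image_open] continuous_chart_inv assms(1) by (metis Int_commute)

lemma isCont_chart_inv: "y : chart M p ` chart_dom M p ==> isCont (chart_inv M p) y"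
 using continuous_chart_inv chart_image_open continuous_on_eq_continuous_at by blast

lemma transition_smooth: "smooth_on (chart M p ` (chart_dom M p Int chart_dom M q)) (chart M q \<circ> chart_inv M p)"
 and transition_open: "open (chart M p ` (chart_dom M p Int chart_dom M q))"
 using manifold by (auto simp: smooth_manifold_def intro: chart_image_open_subset chart_dom(2))

lemma transition_derivative:
 assumes "x : chart_dom M p" "x : chart_dom M q"
 shows "(chart M q \<circ> chart_inv M p has_derivative chart_change M p q x) (at (chart M p x))"
 unfolding chart_change_def by (rule smooth_on_has_derivative[OF transition_smooth[of p q]]) (use assms in auto)

lemma chart_change_linear:
 assumes "x : chart_dom M p" "x : chart_dom M q" shows "linear (chart_change M p q x)"
 using transition_derivative[OF assms] has_derivative_linear by blast

lemma chart_change_self: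
 assumes "x : chart_dom M p" shows "chart_change M p p x = (%v. v)"
proof -
 have "(chart M p \<circ> chart_inv M p has_derivative (%v. v)) (at (chart M p x))"
  by (rule has_derivative_transform_within_open[OF has_derivative_ident chart_image_open]) (use assms in auto)
 thus ?thesis using has_derivative_unique[OF transition_derivative[OF assms assms]] by blast
qed

lemma chart_change_chart_change:
 assumes "x : chart_dom M p" "x : chart_dom M q" "x : chart_dom M r"
 shows "chart_change M q r x (chart_change M p q x v) = chart_change M p r x v"
proof -
 have "((chart M r \<circ> chart_inv M q) \<circ> (chart M q \<circ> chart_inv M p) has_derivative
   chart_change M q r x \<circ> chart_change M p q x) (at (chart M p x))"
  using transition_derivative[OF assms(1,2)] transition_derivative[OF assms(2,3)] assms by (intro diff_chain_at) auto
 hence "(chart M r \<circ> chart_inv M p has_derivative chart_change M q r x \<circ> chart_change M p q x) (at (chart M p x))"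
  by (rule has_derivative_transform_within_open[OF _ transition_open[of p q]]) (use assms in auto)
 hence "chart_change M q r x \<circ> chart_change M p q x = chart_change M p r x"
  by (rule has_derivative_unique[OF _ transition_derivative[OF assms(1,3)]])
 thus ?thesis by (metis comp_apply)
qed

lemma tcoord_linear: "x : chart_dom M p ==> linear (tcoord M p x)"
 using chart_change_linear[OF chart_dom(1)] by (simp add: tcoord_def[abs_def])

lemma tcoord_inverse:
 assumes "x : chart_dom M p"
 shows "chart_change M p x x (tcoord M p x v) = v" "tcoord M p x (chart_change M p x x v) = v"
 using assms chart_dom(1) by (simp_all add: tcoord_def chart_change_chart_change chart_change_self)

lemma tcoord_self: "tcoord M x x = (%v. v)" using chart_dom(1) by (simp add: tcoord_def[abs_def] chart_change_self)

lemma tcoord_change: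
 assumes "x : chart_dom M p" "x : chart_dom M q"
 shows "chart_change M p q x (tcoord M p x v) = tcoord M q x v"
 using assms chart_dom(1) by (simp add: tcoord_def chart_change_chart_change)

lemma of_cocoord_inner: "x : chart_dom M p ==> of_cocoord M p x xi <.> v = xi <.> tcoord M p x v"
 unfolding of_cocoord_def tcoord_def
 using adjoint_works[OF chart_change_linear[OF chart_dom(1)], of x p v xi] by (metis inner_commute)

lemma cocoord_inner: "x : chart_dom M p ==> cocoord M p x et <.> v = et <.> chart_change M p x x v"
 unfolding cocoord_def
 using adjoint_works[OF chart_change_linear[OF _ chart_dom(1)], of x p v et] by (metis inner_commute)

lemma cocoord_of_cocoord: "x : chart_dom M p ==> cocoord M p x (of_cocoord M p x xi) = xi"
 and of_cocoord_cocoord: "x : chart_dom M p ==> of_cocoord M p x (cocoord M p x et) = et"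
 by (auto simp: vector_eq_rdot[symmetric] of_cocoord_inner cocoord_inner tcoord_inverse)

lemma cocoord_self: "cocoord M x x et = et"
 by (auto simp: vector_eq_rdot[symmetric] cocoord_inner chart_dom(1) chart_change_self)

lemma of_cocoord_self: "of_cocoord M x x et = et"
 by (auto simp: vector_eq_rdot[symmetric] of_cocoord_inner chart_dom(1) tcoord_self)

section \<open>Velocities of curves in a fixed chart\<close>

lemma curve_change_of_chart:
 assumes c: "continuous (at t within S) c" "c t : chart_dom M p" "c t : chart_dom M q" and t: "t : S"
  and v: "((%s. chart M p (c s)) has_vd v) (at t within S)"
 shows "((%s. chart M q (c s)) has_vd chart_change M p q (c t) v) (at t within S)"
proof -
 have ev: "eventually (%s. c s : chart_dom M p) (at t within S)"
  using c(1) unfolding continuous_within by (rule topological_tendstoD[OF _ chart_dom(2) c(2)])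
 have "((chart M q \<circ> chart_inv M p) \<circ> (%s. chart M p (c s)) has_derivative
   chart_change M p q (c t) \<circ> (%h. h *R v)) (at t within S)"
  using v transition_derivative[OF c(2,3)] unfolding has_vector_derivative_def
  by (intro diff_chain_within) (auto intro: has_derivative_at_withinI)
 hence "((%s. chart M q (c s)) has_derivative chart_change M p q (c t) \<circ> (%h. h *R v)) (at t within S)"
  by (rule has_derivative_transform_eventually) (use ev c t in "auto elim!: eventually_mono")
 thus ?thesis by (simp add: has_vector_derivative_def o_def linear_scale[OF chart_change_linear[OF c(2,3)]])
qed

text \<open>A velocity is defined in the chart attached to the moving point; this expresses it in
  one fixed chart, where differential equations can be solved.\<close>

lemma has_velocity_iff:
 assumes "c t : chart_dom M p" "t : S"
 shows "has_velocity M c v t S \<longleftrightarrow> continuous (at t within S) c &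
  ((%s. chart M p (c s)) has_vd tcoord M p (c t) v) (at t within S)"
 using curve_change_of_chart[where c=c and v=v and p="c t" and q=p, OF _ chart_dom(1) assms]
  curve_change_of_chart[where c=c and v="tcoord M p (c t) v" and p=p and q="c t", OF _ assms(1) chart_dom(1) assms(2)]
 unfolding has_velocity_def by (auto simp: tcoord_def[symmetric] tcoord_inverse assms(1))

lemma continuous_of_chart:
 assumes "continuous (at t within S) (%s. chart M p (c s))" "eventually (%s. c s : chart_dom M p) (at t within S)"
  "c t : chart_dom M p"
 shows "continuous (at t within S) c"
proof -
 have "((%s. chart_inv M p (chart M p (c s))) ---> chart_inv M p (chart M p (c t))) (at t within S)"
  using assms(1,3) unfolding continuous_within by (intro isCont_tendsto_compose[OF isCont_chart_inv]) auto
 hence "((%s. chart_inv M p (chart M p (c s))) ---> c t) (at t within S)" using assms(3) by simp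
 thus ?thesis unfolding continuous_within
  by (rule Lim_transform_eventually) (use assms(2) in "auto elim!: eventually_mono")
qed

lemma has_velocity_chart_inv:
 assumes y: "(y has_vd v) (at t within S)" "!!s. s : S ==> y s : chart M p ` chart_dom M p" "t : S"
 shows "has_velocity M (%s. chart_inv M p (y s)) (chart_change M p (chart_inv M p (y t)) (chart_inv M p (y t)) v) t S"
proof -
 have d: "chart_inv M p (y t) : chart_dom M p" using y(2,3) by (blast intro: chart_inv_dom)
 have "continuous (at t within S) (%s. chart_inv M p (y s))" unfolding continuous_within
  using isCont_tendsto_compose[OF isCont_chart_inv has_vector_derivative_continuous[OF y(1), unfolded continuous_within]] y(2,3) by blast
 moreover have "((%s. chart M p (chart_inv M p (y s))) has_vd v) (at t within S)"
  by (rule has_vector_derivative_transform[OF y(3) _ y(1)]) (use y(2) in simp)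
 ultimately show ?thesis by (simp add: has_velocity_iff[where p=p] d y(3) tcoord_inverse)
qed

end

section \<open>Control problems in charts\<close>

lemma smooth_on_linear: "linear (A :: 'a::euclidean_space => 'b::real_normed_vector) ==> smooth_on S A"
 by (rule smooth_on_bounded_linear) (simp add: linear_conv_bounded_linear)

lemma hess_linear_compose:
 fixes g :: "'b::euclidean_space => real" and A :: "'a::euclidean_space => 'b"
 assumes g: "smooth_on UNIV g" and A: "linear A"
 shows "hess (%w. g (A w)) u v = hess g (A u) (A v)"
proof -
 have bA: "bounded_linear A" using A by (simp add: linear_conv_bounded_linear)
 have chain: "FD (%w. h (A w)) b v = FD h (A b) (A v)"
  if h: "smooth_on UNIV h" for h :: "'b => real" and b
 proof -
  have "(h has_derivative FD h (A b)) (at (A b))" by (rule smooth_on_has_derivative[OF h]) simp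
  from diff_chain_at[OF bounded_linear_imp_has_derivative[OF bA] this]
  have "((%w. h (A w)) has_derivative (%v. FD h (A b) (A v))) (at b)" by (simp add: o_def)
  thus ?thesis by (rule fun_cong[OF frechet_derivative_at, symmetric])
 qed
 show ?thesis unfolding hess_def chain[OF g] by (rule chain[OF smooth_on_deriv[OF g]])
qed

text \<open>The norm of A w is at least c times that of w, so growth at rate |Z| / c in u = A w
  gives growth at rate |Z| in w.\<close>

lemma superlinear_linear_compose:
 fixes g :: "'b::euclidean_space => real" and A :: "'a::euclidean_space => 'b"
 assumes g: "filterlim (%u. g u / norm u) at_top at_infinity" and A: "linear A" "inj A"
 shows "filterlim (%w. g (A w) / norm w) at_top at_infinity" unfolding filterlim_at_top
proof
 fix Z :: real
 obtain c where c: "c > 0" "!!w. c * norm w <= norm (A w)" using linear_inj_bounded_below_pos[OF A] by metis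
 obtain R where R: "!!u. R <= norm u ==> \<bar>Z\<bar> / c <= g u / norm u"
  using g unfolding filterlim_at_top eventually_at_infinity by meson
 show "\<forall>\<^sub>F w in at_infinity. Z <= g (A w) / norm w" unfolding eventually_at_infinity
 proof (intro exI[of _ "(\<bar>R\<bar> + 1) / c"] allI impI)
  fix w :: 'a assume w: "(\<bar>R\<bar> + 1) / c <= norm w"
  hence cw: "\<bar>R\<bar> + 1 <= c * norm w" using c(1) by (simp add: field_simps)
  hence w0: "norm w > 0" using c(1) by (metis abs_ge_zero add_nonneg_pos less_le_trans zero_less_mult_pos zero_less_one)
  have Aw: "norm (A w) > 0" "R <= norm (A w)" using cw c(2)[of w] by linarith+
  have "\<bar>Z\<bar> * norm w = \<bar>Z\<bar> / c * (c * norm w)" using c(1) by simp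
  also have "... <= \<bar>Z\<bar> / c * norm (A w)" using c by (intro mult_left_mono) auto
  also have "... <= g (A w) / norm (A w) * norm (A w)" using R[OF Aw(2)] by (intro mult_right_mono) auto
  also have "... = g (A w)" using Aw by simp
  finally have "\<bar>Z\<bar> <= g (A w) / norm w" using w0 by (simp add: field_simps)
  thus "Z <= g (A w) / norm w" by simp
 qed
qed

locale control_system =
 fixes P :: "('m::{t2_space,second_countable_topology}, 'n::finite, 'r::finite) control_problem"
 assumes affine: "affine_control_problem P" and tonelli: "tonelli P"
begin

sublocale charted P by unfold_locales (use affine in "simp add: affine_control_problem_def")

section \<open>The control problem in the chart and trivialization attached to a point\<close>

definition nbd :: "'m => 'm set" where "nbd p = chart_dom P p Int triv_dom P p"
definition cU :: "'m => (real^'n) set" where "cU p = chart P p ` nbd p"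
definition ctl :: "'m => 'm => real^'r => real^'r" where "ctl p x = inv (triv P p x)"
definition cf :: "'m => (real^'n) \<times> (real^'r) => real^'n" where
 "cf p = (%(y, w). tcoord P p (chart_inv P p y) (dyn P (chart_inv P p y) (ctl p (chart_inv P p y) w)))"
definition cL :: "'m => (real^'n) \<times> (real^'r) => real" where
 "cL p = (%(y, w). lagr P (chart_inv P p y) (ctl p (chart_inv P p y) w))"

lemma triv: "p : triv_dom P p" "open (triv_dom P p)"
 "x : triv_dom P p ==> linear (triv P p x)" "x : triv_dom P p ==> bij (triv P p x)"
 using affine by (auto simp: affine_control_problem_def vector_bundle_def)

lemma nbd: "p : nbd p" "open (nbd p)" "nbd p <= chart_dom P p" "nbd p <= triv_dom P p"
 by (auto simp: nbd_def chart_dom triv)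

lemma nbdD: "x : nbd p ==> x : chart_dom P p" "x : nbd p ==> x : triv_dom P p" by (auto simp: nbd_def)

lemma cU_open: "open (cU p)" unfolding cU_def by (rule chart_image_open_subset[OF nbd(2,3)])

lemma chart_cU: "x : nbd p ==> chart P p x : cU p" by (auto simp: cU_def)

lemma cU_inv: "y : cU p ==> chart_inv P p y : nbd p" "y : cU p ==> chart P p (chart_inv P p y) = y"
 by (auto simp: cU_def nbd_def)

lemma ctl:
 assumes "x : nbd p"
 shows "linear (ctl p x)" "bij (ctl p x)" "triv P p x (ctl p x w) = w" "ctl p x (triv P p x u) = u"
proof -
 have b: "bij (triv P p x)" and l: "linear (triv P p x)" using triv(3,4) nbdD(2)[OF assms] by auto
 show "bij (ctl p x)" unfolding ctl_def by (rule bij_imp_bij_inv[OF b])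
 show i: "triv P p x (ctl p x w) = w" "ctl p x (triv P p x u) = u" for w u
  using b by (simp_all add: ctl_def bij_is_surj surj_f_inv_f bij_is_inj)
 obtain g where g: "linear g" "g \<circ> triv P p x = id" using linear_injective_left_inverse[OF l bij_is_inj[OF b]] by blast
 hence "ctl p x = g" using i(1) by (metis comp_apply id_apply ext)
 thus "linear (ctl p x)" using g by simp
qed

lemma dyn_eq: "dyn P x u = drift P x + lin_part P x u" by (simp add: lin_part_def)

lemma lin_part_linear: "linear (lin_part P x)" using affine by (simp add: affine_control_problem_def)

lemma cf_chart: "x : nbd p ==> cf p (chart P p x, w) = tcoord P p x (dyn P x (ctl p x w))"
 and cL_chart: "x : nbd p ==> cL p (chart P p x, w) = lagr P x (ctl p x w)" by (auto simp: cf_def cL_def nbdD)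

lemma smooth_cf: "smooth_on (cU p \<times> UNIV) (cf p)" and smooth_cL: "smooth_on (cU p \<times> UNIV) (cL p)"
 using affine unfolding affine_control_problem_def cU_def nbd_def cf_def cL_def ctl_def by blast+

lemma cf_lin_part:
 assumes "x : nbd p" shows "cf p (chart P p x, w) - cf p (chart P p x, 0) = tcoord P p x (lin_part P x (ctl p x w))"
proof -
 note l = linear_0[OF ctl(1)[OF assms]] linear_add[OF tcoord_linear[OF nbdD(1)[OF assms]]] linear_0[OF lin_part_linear] linear_0[OF tcoord_linear[OF nbdD(1)[OF assms]]]
 show ?thesis unfolding cf_chart[OF assms] dyn_eq l by simp
qed

lemma smooth_lagr: "smooth_on UNIV (lagr P x)"
proof -
 have "smooth_on UNIV (%u. cL x (chart P x x, triv P x x u))"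
  by (rule smooth_on_compose[OF open_UNIV open_Times_UNIV[OF cU_open] _ smooth_cL])
   (use chart_cU[OF nbd(1)] in "auto intro!: smooth_on_Pair[OF open_UNIV smooth_on_const smooth_on_linear] triv")
 thus ?thesis by (simp add: cL_chart nbd(1) ctl)
qed

text \<open>Every point p brings coordinates of its own; the prefix C with argument p refers to the
  problem read in them.\<close>

sublocale C: local_control "cU p" "cf p" "cL p" for p
proof (rule local_control.intro)
 show "open (cU p)" by (rule cU_open)
 show "smooth_on (cU p \<times> UNIV) (cf p)" "smooth_on (cU p \<times> UNIV) (cL p)" by (rule smooth_cf smooth_cL)+
 fix y assume "y : cU p"
 then obtain x where x: "x : nbd p" "y = chart P p x" by (auto simp: cU_def)
 show "linear (%v. cf p (y, v) - cf p (y, 0))" unfolding x(2) cf_lin_part[OF x(1)]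
  using linear_compose[OF linear_compose[OF ctl(1)[OF x(1)] lin_part_linear[of x]] tcoord_linear[OF nbdD(1)[OF x(1)]]]
  by (simp add: o_def)
 show "0 < hess (%w. cL p (y, w)) u v" if "v ~= 0" for u v
 proof -
  have "ctl p x v ~= 0" using ctl(1-3)[OF x(1)] that by (metis bij_is_inj injD linear_0)
  thus ?thesis
   using tonelli unfolding x(2) cL_chart[OF x(1)] hess_linear_compose[OF smooth_lagr ctl(1)[OF x(1)]] tonelli_def by blast
 qed
 show "filterlim (%w. cL p (y, w) / norm w) at_top at_infinity" unfolding x(2) cL_chart[OF x(1)]
  by (rule superlinear_linear_compose[OF _ ctl(1)[OF x(1)] bij_is_inj[OF ctl(2)[OF x(1)]]])
   (use tonelli in "simp add: tonelli_def")
qed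

text \<open>The supremum over the fibre becomes one over control coordinates because
  \<open>ctl p x\<close> is onto.\<close>

lemma ham_of_cocoord:
 assumes x: "x : nbd p" shows "ham P x (of_cocoord P p x xi) = C.H p (chart P p x, xi)"
proof -
 have "ham P x (of_cocoord P p x xi) = (SUP u\<in>range (ctl p x). of_cocoord P p x xi <.> dyn P x u - lagr P x u)"
  using bij_is_surj[OF ctl(2)[OF x]] by (simp add: ham_def)
 also have "... = (SUP w. xi <.> cf p (chart P p x, w) - cL p (chart P p x, w))"
  by (simp add: image_image cf_chart cL_chart x of_cocoord_inner nbdD)
 also have "... = C.H p (chart P p x, xi)" by (rule C.H_sup[OF chart_cU[OF x]])
 finally show ?thesis .
qed

lemma ham_rep_eq: "y : cU p ==> ham_rep P p (y, xi) = C.H p (y, xi)"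
 using ham_of_cocoord[OF cU_inv(1)] cU_inv(2) by (simp add: ham_rep_def)

text \<open>Both sides are the intrinsic Hamiltonian at one covector. The identity is later
  differentiated in both variables to compare Hamilton's equations in two charts.\<close>

lemma H_change:
 assumes x: "x : nbd p" "x : nbd q"
 shows "C.H p (chart P p x, \<chi> i. ze <.> chart_change P p q x (axis i 1)) = C.H q (chart P q x, ze)"
proof -
 note cl = chart_change_linear[OF nbdD(1)[OF x(1)] nbdD(1)[OF x(2)]]
 have eq: "ze <.> chart_change P p q x v = v <.> (\<chi> i. ze <.> chart_change P p q x (axis i 1))" for v
  by (rule linear_functional_eq_inner[of "%v. ze <.> chart_change P p q x v"])
   (intro linearI; simp add: linear_add[OF cl] linear_scale[OF cl] inner_add_right)
 have "of_cocoord P p x (\<chi> i. ze <.> chart_change P p q x (axis i 1)) = of_cocoord P q x ze"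
  using x by (auto simp: vector_eq_rdot[symmetric] of_cocoord_inner nbdD eq[symmetric] inner_commute[of "vec_lambda _"] tcoord_change)
 thus ?thesis using ham_of_cocoord[OF x(1)] ham_of_cocoord[OF x(2), of ze] by metis
qed

end

lemma vec_inner_axis: "(\<chi> i. axis i 1 <.> (v :: real^'n)) = v" by (simp add: vec_eq_iff inner_axis')

lemma has_vector_derivative_vecI:
 fixes g :: "real => real^'n"
 assumes "!!i. ((%s. g s $ i) has_vd v $ i) (at t within S)"
 shows "(g has_vd v) (at t within S)"
 using assms unfolding has_vector_derivative_def by (intro has_derivative_vecI) simp

context control_system begin

lemma grad_ham_rep:
 assumes y: "y : cU q"
 shows "grad (%xi. ham_rep P q (y, xi)) xi = C.Hp q (y, xi)"
  "grad (%y. ham_rep P q (y, xi)) y = C.Hy q (y, xi)"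
proof -
 have "FD (%xi. C.H q (y, xi)) xi k = k <.> C.Hp q (y, xi)" for k unfolding C.DH_p[OF y, symmetric]
  by (rule fun_cong[OF frechet_derivative_at[OF has_derivative_slice(1)[OF C.DH[OF y]]], symmetric])
 thus "grad (%xi. ham_rep P q (y, xi)) xi = C.Hp q (y, xi)" by (simp add: grad_def ham_rep_eq[OF y] vec_inner_axis)
 have "((%y. ham_rep P q (y, xi)) has_derivative (%h. h <.> C.Hy q (y, xi))) (at y)" unfolding C.DH_y[OF y, symmetric]
  by (rule has_derivative_transform_within_open[OF has_derivative_slice(2)[OF C.DH[OF y]] cU_open y])
   (simp add: ham_rep_eq)
 hence "FD (%y. ham_rep P q (y, xi)) y h = h <.> C.Hy q (y, xi)" for h
  by (rule fun_cong[OF frechet_derivative_at, symmetric])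
 thus "grad (%y. ham_rep P q (y, xi)) y = C.Hy q (y, xi)" by (simp add: grad_def vec_inner_axis)
qed

text \<open>The cotangent lift of a transition map is symplectic,
  by the symmetry of its second derivative.\<close>

lemma ham_curve_in_chart:
 assumes c: "ham_curve P c et" and tp: "c t : nbd p"
 shows "((%s. (chart P p (c s), cocoord P p (c s) (et s))) has_vector_derivative
  C.XH p (chart P p (c t), cocoord P p (c t) (et t))) (at t)"
proof -
 define q where "q = c t"
 define ps where "ps = chart P q \<circ> chart_inv P p"
 define W where "W = chart P p ` (nbd p Int nbd q)"
 define D where "D e y = FD ps y e" for e y
 define y where "y s = chart P p (c s)" for s
 define ze where "ze s = cocoord P q (c s) (et s)" for s
 \<comment> \<open>The covector in chart p, expressed by its components \<open>ze\<close> in the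
   chart attached to the point, for which \<open>ham_curve\<close> provides the derivative.\<close>
 define xi where "xi = (\<chi> i. ze t <.> D (axis i 1) (y t))"
 have q: "q : nbd p" "q : nbd q" "c t = q" using tp nbd(1) by (auto simp: q_def)
 note qd = nbdD(1)[OF q(1)] nbdD(1)[OF q(2)]
 have W: "open W" "y t : W" unfolding W_def y_def using q by (auto intro!: chart_image_open_subset nbd nbdD open_Int)
 have WU: "W <= cU p" by (auto simp: W_def cU_def)
 have yU: "y t : cU p" using W(2) WU by blast
 have qU: "chart P q q : cU q" by (rule chart_cU[OF q(2)])
 have pss: "smooth_on W ps" unfolding ps_def W_def
  by (rule smooth_on_subset[OF transition_smooth[of p q]]) (auto simp: nbd_def)
 have Ds: "smooth_on W (D e)" for e unfolding D_def[abs_def] by (rule smooth_on_deriv[OF pss])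
 have D_cc: "D e (chart P p x) = chart_change P p q x e" for e x by (simp add: D_def chart_change_def ps_def)
 define D2 where "D2 e h = FD (D e) (y t) h" for e h
 have D2: "(D e has_derivative D2 e) (at (y t))" for e
  using smooth_on_has_derivative[OF Ds W(2)] by (simp add: D2_def[abs_def])
 have sym: "D2 e h = D2 h e" for e h
  unfolding D2_def D_def[abs_def] by (rule second_derivative_symmetric[OF W(1) smooth_onD[OF pss] W(2)])
 have zet: "ze t = et t" unfolding ze_def q(3) by (rule cocoord_self)
 define a b where "a = C.Hp q (chart P q q, ze t)" and "b = C.Hy q (chart P q q, ze t)"
 have vel: "has_velocity P c a t UNIV" "(ze has_vd - b) (at t)"
 proof -
  have "has_velocity P c (grad (%xi. ham_rep P (c t) (chart P (c t) (c t), xi)) (et t)) t UNIV"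
   "((%s. cocoord P (c t) (c s) (et s)) has_vd - grad (%y. ham_rep P (c t) (y, et t)) (chart P (c t) (c t))) (at t)"
   using c unfolding ham_curve_def by blast+
  thus "has_velocity P c a t UNIV" "(ze has_vd - b) (at t)"
   unfolding q(3) grad_ham_rep[OF qU] zet[symmetric] a_def b_def ze_def[symmetric, abs_def] by simp_all
 qed
 have yd: "(y has_vd tcoord P p q a) (at t)" and cc: "continuous (at t) c"
  using vel(1) has_velocity_iff[of c t p UNIV a] qd q(3) by (auto simp: y_def[abs_def])
 have Hcov: "C.H p (y, \<chi> i. ze <.> D (axis i 1) y) = C.H q (ps y, ze)" if yW: "y : W" for y ze
 proof -
  obtain x where x: "x : nbd p" "x : nbd q" "y = chart P p x" using yW by (auto simp: W_def)
  thus ?thesis using H_change[OF x(1,2), of ze] by (simp add: D_cc ps_def nbdD)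
 qed
 have pst: "ps (y t) = chart P q q" by (simp add: ps_def y_def q(3) qd)
 have Dlin: "linear (%e. D e (y t))" unfolding D_def
  by (rule has_derivative_linear[OF smooth_on_has_derivative[OF pss W(2)]])
 have D_inner: "z <.> D e (y t) = e <.> (\<chi> i. z <.> D (axis i 1) (y t))" for z e
  by (rule linear_functional_eq_inner[of "%e. z <.> D e (y t)"])
   (intro linearI; simp add: linear_add[OF Dlin] linear_scale[OF Dlin] inner_add_right)
 have D2_inner: "z <.> D2 e h = h <.> (\<chi> i. z <.> D2 e (axis i 1))" for z e h
  by (rule linear_functional_eq_inner[of "%h. z <.> D2 e h"])
   (intro linearI; simp add: linear_add[OF has_derivative_linear[OF D2]] linear_scale[OF has_derivative_linear[OF D2]] inner_add_right)
 \<comment> \<open>Differentiates the invariance \<open>Hcov\<close> in the covector.\<close>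
 have Hp: "C.Hp p (y t, xi) = tcoord P p q a"
 proof -
  have "h <.> D (C.Hp p (y t, xi)) (y t) = h <.> a" for h
  proof -
   have "((%z. (y t, \<chi> i. z <.> D (axis i 1) (y t))) has_derivative (%h. (0, \<chi> i. h <.> D (axis i 1) (y t)))) (at (ze t))"
    by (intro has_derivative_Pair has_derivative_const has_derivative_vecI) (auto intro!: derivative_eq_intros)
   from diff_chain_at[OF this, unfolded xi_def[symmetric], OF C.DH[OF yU]]
   have "((%z. C.H q (ps (y t), z)) has_derivative (%h. (\<chi> i. h <.> D (axis i 1) (y t)) <.> C.Hp p (y t, xi))) (at (ze t))"
    by (simp add: o_def Hcov[OF W(2)] C.DH_p[OF yU])
   moreover have "((%z. C.H q (ps (y t), z)) has_derivative (%h. h <.> a)) (at (ze t))"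
    using has_derivative_slice(1)[OF C.DH[OF qU]] unfolding pst a_def C.DH_p[OF qU] .
   ultimately have "(\<chi> i. h <.> D (axis i 1) (y t)) <.> C.Hp p (y t, xi) = h <.> a"
    using fun_cong[OF has_derivative_unique] by blast
   thus ?thesis using D_inner[of h "C.Hp p (y t, xi)"] by (simp add: inner_commute)
  qed
  hence "D (C.Hp p (y t, xi)) (y t) = a" using vector_eq_ldot by blast
  hence "chart_change P p q q (C.Hp p (y t, xi)) = a" by (simp add: y_def q(3) D_cc)
  thus ?thesis using tcoord_inverse(2)[OF qd(1)] by metis
 qed
 \<comment> \<open>Differentiates \<open>Hcov\<close> in the base point with \<open>ze\<close>
   fixed. The covector in chart p then varies through D and produces a second derivative of the
   transition map; \<open>sym\<close> identifies it with the derivative of D along the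
   curve.\<close>
 have Hy: "- b <.> D (axis i 1) (y t) + ze t <.> D2 (axis i 1) (tcoord P p q a) = - C.Hy p (y t, xi) $ i" for i
 proof -
  have "((%y. (y, \<chi> i. ze t <.> D (axis i 1) y)) has_derivative (%h. (h, \<chi> i. ze t <.> D2 (axis i 1) h))) (at (y t))"
   by (intro has_derivative_Pair has_derivative_ident has_derivative_vecI) (auto intro!: derivative_eq_intros D2)
  from diff_chain_at[OF this, unfolded xi_def[symmetric], OF C.DH[OF yU]]
  have "((%y. C.H p (y, \<chi> i. ze t <.> D (axis i 1) y)) has_derivative
    (%h. h <.> C.Hy p (y t, xi) + (\<chi> i. ze t <.> D2 (axis i 1) h) <.> C.Hp p (y t, xi))) (at (y t))"
   by (simp add: o_def C.DH_eq[OF yU])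
  hence "((%y. C.H q (ps y, ze t)) has_derivative
    (%h. h <.> C.Hy p (y t, xi) + (\<chi> i. ze t <.> D2 (axis i 1) h) <.> C.Hp p (y t, xi))) (at (y t))"
   by (rule has_derivative_transform_within_open[OF _ W]) (rule Hcov)
  moreover have "((%y. C.H q (ps y, ze t)) has_derivative (%h. D h (y t) <.> b)) (at (y t))"
   using diff_chain_at[OF smooth_on_has_derivative[OF pss W(2)], unfolded pst, OF has_derivative_slice(2)[OF C.DH[OF qU, of "ze t"]]]
   unfolding C.DH_y[OF qU] by (simp add: o_def D_def b_def)
  ultimately have "axis i 1 <.> C.Hy p (y t, xi) + (\<chi> j. ze t <.> D2 (axis j 1) (axis i 1)) <.> C.Hp p (y t, xi) = D (axis i 1) (y t) <.> b"
   using fun_cong[OF has_derivative_unique] by blast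
  thus ?thesis using D2_inner[of "ze t" "axis i 1" "C.Hp p (y t, xi)"] sym[of _ "axis i 1"]
   by (simp add: Hp inner_axis' inner_commute algebra_simps)
 qed
 have ev: "\<forall>\<^sub>F s in at t. c s : nbd p Int nbd q" using cc q unfolding continuous_within
  by (intro topological_tendstoD[where l="c t"]) (auto intro: nbd open_Int)
 have xieq: "cocoord P p x h = (\<chi> i. cocoord P q x h <.> D (axis i 1) (chart P p x))" if "x : nbd p Int nbd q" for x h
  using that nbdD chart_dom(1)
  by (auto simp: vec_eq_iff D_cc cocoord_inner chart_change_chart_change cart_eq_inner_axis[of "cocoord P p x h"])
 have "((%s. \<chi> i. ze s <.> D (axis i 1) (y s)) has_vd - C.Hy p (y t, xi)) (at t)"
 proof (rule has_vector_derivative_vecI)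
  fix i
  have "((%s. D (axis i 1) (y s)) has_vd D2 (axis i 1) (tcoord P p q a)) (at t)"
   using diff_chain_at[OF yd[unfolded has_vector_derivative_def] D2[of "axis i 1"]]
   by (simp add: has_vector_derivative_def o_def linear_scale[OF has_derivative_linear[OF D2]])
  from bounded_bilinear.has_vector_derivative[OF bounded_bilinear_inner vel(2) this]
  have "((%s. ze s <.> D (axis i 1) (y s)) has_vector_derivative
    ze t <.> D2 (axis i 1) (tcoord P p q a) + - b <.> D (axis i 1) (y t)) (at t)" .
  thus "((%s. (\<chi> i. ze s <.> D (axis i 1) (y s)) $ i) has_vd (- C.Hy p (y t, xi)) $ i) (at t)"
   using Hy[of i] by (simp add: add.commute)
 qed
 hence "((%s. cocoord P p (c s) (et s)) has_vd - C.Hy p (y t, xi)) (at t)" unfolding has_vector_derivative_def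
  by (rule has_derivative_transform_eventually)
   (use ev q(1,2) q(3) xieq in "auto elim!: eventually_mono simp: y_def ze_def")
 moreover have "(y t, xi) = (chart P p (c t), cocoord P p (c t) (et t))"
  using xieq[of "c t" "et t"] q by (simp add: xi_def y_def ze_def)
 ultimately show ?thesis using has_vector_derivative_Pair[OF yd] Hp by (simp add: C.XH_def y_def)
qed

end

section \<open>Admissible curves in charts\<close>

text \<open>Bisection. Admissible curves are described locally, chart by chart; their Lipschitz
  bounds and integrability are assembled in this way.\<close>

lemma Icc_local_to_global:
 assumes ab: "a <= (b::real)"
  and trans: "!!u w v. a <= u ==> u <= w ==> w <= v ==> v <= b ==> Q u w ==> Q w v ==> Q u v"
  and loc: "!!x. x : {a..b} ==> EX d>0. ALL u v. u <= x --> x <= v --> {u..v} <= {a..b} Int ball x d --> Q u v"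
 shows "Q a b"
proof -
 have "a <= a & b <= b --> Q a b"
 proof (rule Bolzano[where P="%u v. a <= u & v <= b --> Q u v", OF ab])
  show "a <= u & v <= b --> Q u v" if "a <= u & w <= b --> Q u w" "a <= w & v <= b --> Q w v" "u <= w" "w <= v" for u w v
   using that trans[of u w v] by linarith
  fix x assume "a <= x" "x <= b"
  then obtain d where d: "d > 0" "!!u v. u <= x ==> x <= v ==> {u..v} <= {a..b} Int ball x d ==> Q u v"
   using loc[of x] by auto
  show "EX d>0. ALL u v. u <= x & x <= v & v - u < d --> a <= u & v <= b --> Q u v"
  proof (intro exI[of _ d] conjI allI impI d)
   fix u v assume "u <= x & x <= v & v - u < d" "a <= u & v <= b"
   thus "u <= x" "x <= v" "{u..v} <= {a..b} Int ball x d" by (auto simp: dist_real_def)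
  qed
 qed
 thus ?thesis by simp
qed

lemma local_lipschitz_on_Icc:
 fixes y :: "real => 'a::metric_space"
 assumes "a <= b" "!!x. x : {a..b} ==> EX d>0. EX B. B-lipschitz_on ({a..b} Int ball x d) y"
 obtains B where "B-lipschitz_on {a..b} y"
proof -
 have "EX B. B-lipschitz_on {a..b} y"
 proof (rule Icc_local_to_global[OF assms(1)])
  show "EX B. B-lipschitz_on {u..v} y" if "EX B. B-lipschitz_on {u..w} y" "EX B. B-lipschitz_on {w..v} y" for u w v
   using that lipschitz_on_concat_max[of _ u w y _ v y] by auto
  show "EX d>0. ALL u v. u <= x --> x <= v --> {u..v} <= {a..b} Int ball x d --> (EX B. B-lipschitz_on {u..v} y)"
   if "x : {a..b}" for x using assms(2)[OF that] lipschitz_on_subset by meson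
 qed
 thus thesis using that by blast
qed

lemma local_integrable_on_Icc:
 fixes g :: "real => real"
 assumes "a <= b" "!!x. x : {a..b} ==> EX d>0. integrable (lebesgue_on ({a..b} Int ball x d)) g"
 shows "integrable (lebesgue_on {a..b}) g"
proof -
 have eq: "integrable (lebesgue_on A) g \<longleftrightarrow> set_integrable lebesgue A g" if "A : sets lebesgue" for A
  using that by (simp add: integrable_restrict_space set_integrable_def)
 have "set_integrable lebesgue {a..b} g"
 proof (rule Icc_local_to_global[OF assms(1)])
  show "set_integrable lebesgue {u..v} g" if "set_integrable lebesgue {u..w} g" "set_integrable lebesgue {w..v} g" "u <= w" "w <= v" for u w v
   using set_integrable_Un[OF that(1,2)] that(3,4) by (simp add: ivl_disj_un_two_touch)
  show "EX d>0. ALL u v. u <= x --> x <= v --> {u..v} <= {a..b} Int ball x d --> set_integrable lebesgue {u..v} g"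
   if x: "x : {a..b}" for x
  proof -
   obtain d where d: "d > 0" "set_integrable lebesgue ({a..b} Int ball x d) g" using assms(2)[OF x] eq by auto
   show ?thesis by (intro exI[of _ d] conjI d(1) allI impI set_integrable_subset[OF d(2)]) auto
  qed
 qed
 thus ?thesis by (simp add: eq)
qed

text \<open>Extending g by 0 outside its open domain gives a Borel function, hence measurability;
  compactness of C and the bound on w give boundedness.\<close>

lemma integrable_continuous_compose:
 fixes y :: "real => 'a::euclidean_space" and w :: "real => 'b::euclidean_space" and g :: "'a \<times> 'b => real"
 assumes J: "J : lmeasurable" and g: "continuous_on (U \<times> UNIV) g" and U: "open U"
  and y: "continuous_on J y" and C: "compact C" "C <= U" "y ` J <= C"
  and w: "w : borel_measurable (lebesgue_on J)" "AE t in lebesgue_on J. norm (w t) <= B"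
 shows "integrable (lebesgue_on J) (%t. g (y t, w t))"
proof -
 have Js: "J : sets lebesgue" using J by auto
 have ym: "y : borel_measurable (lebesgue_on J)" by (rule continuous_imp_measurable_on_sets_lebesgue[OF y Js])
 have "(%z. indicator (U \<times> UNIV) z *R g z) : borel_measurable borel"
  by (rule borel_measurable_continuous_on_indicator) (auto intro: g borel_open open_Times U)
 hence "(%t. indicator (U \<times> UNIV) (y t, w t) *R g (y t, w t)) : borel_measurable (lebesgue_on J)"
  by (rule measurable_compose[rotated]) (intro borel_measurable_Pair ym w)
 also have "?this \<longleftrightarrow> (%t. g (y t, w t)) : borel_measurable (lebesgue_on J)"
 proof (rule measurable_cong)
  fix t assume "t : space (lebesgue_on J)"
  hence "y t : U" using C by (auto simp: space_restrict_space)
  thus "indicator (U \<times> UNIV) (y t, w t) *R g (y t, w t) = g (y t, w t)" by simp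
 qed
 finally have m: "(%t. g (y t, w t)) : borel_measurable (lebesgue_on J)" .
 have "bounded (g ` (C \<times> cball 0 B))"
  by (intro compact_imp_bounded compact_continuous_image continuous_on_subset[OF g] compact_Times C compact_cball) (use C in auto)
 then obtain b where b: "!!z. z : C \<times> cball 0 B ==> norm (g z) <= b" unfolding bounded_iff by auto
 show ?thesis
 proof (rule finite_measure.integrable_const_bound[where B=b])
  show "finite_measure (lebesgue_on J)" by (rule finite_measure_lebesgue_on[OF J])
  show "AE t in lebesgue_on J. norm (g (y t, w t)) <= b" using w(2) AE_space
  proof eventually_elim
   case (elim t)
   thus ?case using C by (intro b) (auto simp: space_restrict_space)
  qed
 qed (rule m)
qed

context control_system begin

lemma admissible_integrable:
 assumes adm: "admissible P T c u" and T: "0 <= T"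
 shows "integrable (lebesgue_on {0..T}) (%s. lagr P (c s) (u s))"
proof (rule local_integrable_on_Icc[OF T])
 fix s assume s: "s : {0..T}"
 then obtain e B p q where e: "e > 0" and cd: "c ` ({0..T} Int ball s e) <= chart_dom P p Int triv_dom P q"
  and lip: "B-lipschitz_on ({0..T} Int ball s e) (%t. chart P p (c t))"
  and m: "(%t. triv P q (c t) (u t)) : borel_measurable (lebesgue_on ({0..T} Int ball s e))"
  and bd: "AE t in lebesgue_on ({0..T} Int ball s e). norm (triv P q (c t) (u t)) <= B"
  using adm unfolding admissible_def by blast
 \<comment> \<open>Halving the radius places the curve in the compact image of a closed
   subinterval.\<close>
 let ?I = "{0..T} Int ball s e" and ?J = "{0..T} Int ball s (e/2)" and ?y = "%t. chart P p (c t)" and ?w = "%t. triv P q (c t) (u t)"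
 let ?U = "chart P p ` (chart_dom P p Int triv_dom P q)"
 have JI: "?J <= ?I" using e by auto
 have IJ: "{0..T} Int cball s (e/2) <= ?I" using e by auto
 have yc: "continuous_on ?I ?y" by (rule lipschitz_on_continuous_on[OF lip])
 have "integrable (lebesgue_on ?J) (%t. (%(y, w). lagr P (chart_inv P p y) (inv (triv P q (chart_inv P p y)) w)) (?y t, ?w t))"
 proof (rule integrable_continuous_compose[where U="?U" and C="?y ` ({0..T} Int cball s (e/2))" and B=B])
  show "?J : lmeasurable" by (intro bounded_set_imp_lmeasurable) (auto intro: bounded_subset[OF bounded_closed_interval])
  show "continuous_on (?U \<times> UNIV) (%(y, w). lagr P (chart_inv P p y) (inv (triv P q (chart_inv P p y)) w))"
   by (rule smooth_on_continuous) (use affine in "simp add: affine_control_problem_def")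
  show "open ?U" by (intro chart_image_open_subset open_Int chart_dom triv) auto
  show "continuous_on ?J ?y" by (rule continuous_on_subset[OF yc JI])
  show "compact (?y ` ({0..T} Int cball s (e/2)))"
   by (intro compact_continuous_image continuous_on_subset[OF yc IJ] compact_Int_closed) auto
  show "?y ` ({0..T} Int cball s (e/2)) <= ?U" using cd IJ by blast
  show "?y ` ?J <= ?y ` ({0..T} Int cball s (e/2))" by (intro image_mono) auto
  show "?w : borel_measurable (lebesgue_on ?J)" using measurable_restrict_mono[OF m JI] by simp
  show "AE t in lebesgue_on ?J. norm (?w t) <= B"
   using bd JI by (auto simp: AE_restrict_space_iff elim!: eventually_mono)
 qed
 also have "?this \<longleftrightarrow> integrable (lebesgue_on ?J) (%t. lagr P (c t) (u t))"
 proof (rule Bochner_Integration.integrable_cong[OF refl])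
  fix t assume "t : space (lebesgue_on ?J)"
  hence "t : ?I" using JI by (auto simp: space_restrict_space)
  hence "c t : chart_dom P p" "c t : triv_dom P q" using cd by auto
  thus "(%(y, w). lagr P (chart_inv P p y) (inv (triv P q (chart_inv P p y)) w)) (?y t, ?w t) = lagr P (c t) (u t)"
   using triv(4) by (simp add: inv_f_f bij_is_inj)
 qed
 finally show "EX d>0. integrable (lebesgue_on ({0..T} Int ball s d)) (%s. lagr P (c s) (u s))"
  using e by (intro exI[of _ "e/2"]) auto
qed

lemma admissible_continuous:
 assumes adm: "admissible P T c u" shows "continuous_on {0..T} c" unfolding continuous_on_eq_continuous_within
proof
 fix s assume s: "s : {0..T}"
 then obtain e B p q where e: "e > 0" and cd: "c ` ({0..T} Int ball s e) <= chart_dom P p Int triv_dom P q"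
  and lip: "B-lipschitz_on ({0..T} Int ball s e) (%t. chart P p (c t))" using adm unfolding admissible_def by blast
 have "continuous (at s within ({0..T} Int ball s e)) (%t. chart P p (c t))"
  using lipschitz_on_continuous_on[OF lip] s e by (simp add: continuous_on_eq_continuous_within)
 moreover have nb: "at s within ({0..T} Int ball s e) = at s within {0..T}"
  using e by (intro at_within_nhd[where S="ball s e"]) auto
 ultimately have "continuous (at s within {0..T}) (%t. chart P p (c t))" by (simp only:)
 moreover have "eventually (%t. c t : chart_dom P p) (at s within {0..T})"
  unfolding nb[symmetric] eventually_at_filter using cd by (intro always_eventually) auto
 ultimately show "continuous (at s within {0..T}) c" by (rule continuous_of_chart) (use cd s e in auto)
qed

text \<open>Admissibility bounds the curve in charts that vary with time; a transition map is
  Lipschitz on a small ball and carries each bound to the fixed chart p.\<close>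

lemma admissible_lipschitz:
 assumes adm: "admissible P T c u" and t: "0 <= t" "t <= T" and cp: "c ` {0..t} <= chart_dom P p"
 obtains A where "A-lipschitz_on {0..t} (%s. chart P p (c s))"
proof (rule local_lipschitz_on_Icc[OF t(1)])
 fix s assume s: "s : {0..t}"
 hence sT: "s : {0..T}" using t by auto
 then obtain e B q q' where e: "e > 0" and cd: "c ` ({0..T} Int ball s e) <= chart_dom P q Int triv_dom P q'"
  and lip: "B-lipschitz_on ({0..T} Int ball s e) (%t. chart P q (c t))" using adm unfolding admissible_def by blast
 let ?W = "chart P q ` (chart_dom P q Int chart_dom P p)" and ?y = "%t. chart P q (c t)"
 have "s : {0..T} Int ball s e" using sT e by simp
 hence "c s : chart_dom P q Int chart_dom P p" using cd cp s by blast
 hence "?y s : ?W" by (rule imageI)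
 then obtain r where r: "r > 0" "cball (?y s) r <= ?W" using transition_open[of q p] open_contains_cball by blast
 obtain C where C: "C >= 0" "!!x y. x : cball (?y s) r ==> y : cball (?y s) r ==>
   norm ((chart P p \<circ> chart_inv P q) y - (chart P p \<circ> chart_inv P q) x) <= C * norm (y - x)"
  by (rule C1_lipschitz[OF smooth_onD[OF transition_smooth] compact_cball convex_cball r(2)]) (rule that; assumption)
 have "continuous (at s within ({0..T} Int ball s e)) ?y"
  using lipschitz_on_continuous_on[OF lip] sT e by (simp add: continuous_on_eq_continuous_within)
 then obtain d where d: "d > 0" "!!t. t : {0..T} Int ball s e ==> dist t s < d ==> dist (?y t) (?y s) < r"
  using r(1) unfolding continuous_within_eps_delta by blast
 have "(C * B)-lipschitz_on ({0..t} Int ball s (min d e)) (%s. chart P p (c s))"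
 proof (rule lipschitz_onI)
  fix x x' assume x: "x : {0..t} Int ball s (min d e)" "x' : {0..t} Int ball s (min d e)"
  hence xI: "x : {0..T} Int ball s e" "x' : {0..T} Int ball s e" using t by auto
  have y: "?y x : cball (?y s) r" "?y x' : cball (?y s) r"
   using d(2)[OF xI(1)] d(2)[OF xI(2)] x by (auto simp: dist_commute)
  have eq: "(chart P p \<circ> chart_inv P q) (?y x) = chart P p (c x)" "(chart P p \<circ> chart_inv P q) (?y x') = chart P p (c x')"
   using subsetD[OF cd imageI[OF xI(1)]] subsetD[OF cd imageI[OF xI(2)]] by auto
  have "norm (chart P p (c x) - chart P p (c x')) <= C * norm (?y x - ?y x')" using C(2)[OF y(2,1)] unfolding eq .
  also have "... <= C * (B * dist x x')"
   using lipschitz_onD[OF lip xI] C(1) by (intro mult_left_mono) (auto simp: dist_norm)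
  finally show "dist (chart P p (c x)) (chart P p (c x')) <= C * B * dist x x'" by (simp add: dist_norm)
 qed (use C(1) lipschitz_on_nonneg[OF lip] in simp)
 thus "EX d>0. EX B. B-lipschitz_on ({0..t} Int ball s d) (%s. chart P p (c s))"
  using d(1) e by (intro exI[of _ "min d e"]) auto
qed (rule that)

lemma admissible_in_chart:
 assumes adm: "admissible P T c u" and t: "0 <= t" "t <= T" and cp: "c ` {0..t} <= nbd p"
 defines "w \<equiv> %s. triv P p (c s) (u s)"
 shows "AE s in lebesgue_on {0..t}. ((%s. chart P p (c s)) has_vd cf p (chart P p (c s), w s)) (at s within {0..t})"
  and "s : {0..t} ==> cL p (chart P p (c s), w s) = lagr P (c s) (u s)"
proof -
 have AE: "AE s in lebesgue. s : {0..T} --> has_velocity P c (dyn P (c s) (u s)) s {0..T}"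
  using adm unfolding admissible_def by (simp add: AE_restrict_space_iff)
 have "AE s in lebesgue. s : {0..t} --> ((%s. chart P p (c s)) has_vd cf p (chart P p (c s), w s)) (at s within {0..t})"
  using AE
 proof eventually_elim
  case (elim s)
  show ?case
  proof
   assume s: "s : {0..t}"
   hence sT: "s : {0..T}" and cs: "c s : nbd p" using t cp by auto
   have "((%s. chart P p (c s)) has_vd tcoord P p (c s) (dyn P (c s) (u s))) (at s within {0..T})"
    using elim sT has_velocity_iff[where c=c and t=s and p=p, OF nbdD(1)[OF cs] sT] by simp
   thus "((%s. chart P p (c s)) has_vd cf p (chart P p (c s), w s)) (at s within {0..t})"
    unfolding w_def cf_chart[OF cs] ctl(4)[OF cs] by (rule has_vector_derivative_within_subset) (use t in auto)
  qed
 qed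
 thus "AE s in lebesgue_on {0..t}. ((%s. chart P p (c s)) has_vd cf p (chart P p (c s), w s)) (at s within {0..t})"
  by (simp add: AE_restrict_space_iff)
 show "cL p (chart P p (c s), w s) = lagr P (c s) (u s)" if "s : {0..t}"
 proof -
  have "c s : nbd p" using cp that by blast
  thus ?thesis by (simp add: w_def cL_chart ctl)
 qed
qed

text \<open>Fenchel's inequality with the zero covector: -L is at most the Hamiltonian at 0, a
  continuous function of the base point alone.\<close>

lemma lagr_bounded_below:
 assumes "compact K" obtains B where "B >= 0" "!!x u. x : K ==> - B <= lagr P x u"
proof -
 have h: "ham P x 0 = C.H p (chart P p x, 0)" if "x : nbd p" for x p
 proof -
  have "of_cocoord P p x 0 = 0" using of_cocoord_inner[OF nbdD(1)[OF that], of 0] by (metis inner_zero_left vector_eq_rdot)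
  thus ?thesis using ham_of_cocoord[OF that, of 0] by simp
 qed
 have "isCont (%x. ham P x 0) p" for p
 proof -
  have "continuous_on (nbd p) (%x. C.H p (chart P p x, 0))"
   by (intro continuous_on_compose2[OF smooth_on_continuous[OF C.smooth_H]] continuous_intros
     continuous_on_subset[OF continuous_chart nbd(3)]) (auto simp: cU_def)
  hence "continuous_on (nbd p) (%x. ham P x 0)" by (simp add: h cong: continuous_on_cong)
  thus ?thesis using nbd(1,2) continuous_on_eq_continuous_at by blast
 qed
 hence "continuous_on K (%x. ham P x 0)" by (simp add: continuous_at_imp_continuous_on)
 hence "bounded ((%x. ham P x 0) ` K)" by (intro compact_imp_bounded compact_continuous_image assms)
 then obtain B where B: "B > 0" "!!x. x : K ==> norm (ham P x 0) <= B" unfolding bounded_pos by blast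
 have "- B <= lagr P x u" if "x : K" for x u
 proof -
  have "0 <.> cf x (chart P x x, triv P x x u) - cL x (chart P x x, triv P x x u) <= C.H x (chart P x x, 0)"
   by (rule C.H_ge[OF chart_cU[OF nbd(1)]])
  thus ?thesis using h[OF nbd(1), of x] B(2)[OF that] by (simp add: cL_chart nbd(1) ctl)
 qed
 thus thesis using that[of B] B(1) by simp
qed

end

section \<open>The value function near a geodesic\<close>

context control_system begin

text \<open>The competitor for the upper bound; by the choice of the maximizing control, L along it
  is the covector paired with the velocity, minus H.\<close>

lemma extremal_admissible:
 fixes p :: 'm and z :: "real => (real^'n) \<times> (real^'n)"
 assumes z: "C.extremal_within p K z t" and KU: "K <= cU p \<times> UNIV" and t: "0 <= t"
 defines "c \<equiv> %s. chart_inv P p (fst (z s))"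
 defines "u \<equiv> %s. ctl p (c s) (C.ust p (z s))"
 shows "admissible P t c u" "action P t c u = C.ext_action p z t"
proof -
 have zK: "z s : K" and zd: "(z has_vd C.XH p (z s)) (at s within {0..t})" if "s : {0..t}" for s
  using z that by (auto simp: C.extremal_within_def)
 have zU: "fst (z s) : cU p" if "s : {0..t}" for s using zK[OF that] KU by auto
 have cn: "c s : nbd p" "chart P p (c s) = fst (z s)" if "s : {0..t}" for s
  using cU_inv[OF zU[OF that]] by (auto simp: c_def)
 have zc: "continuous_on {0..t} z" by (rule continuous_on_vector_derivative[OF zd])
 have zKU: "z ` {0..t} <= cU p \<times> UNIV" using zK KU by blast
 have uc: "continuous_on {0..t} (%s. C.ust p (z s))"
  by (rule continuous_on_compose2[OF smooth_on_continuous[OF C.smooth_ust] zc zKU])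
 obtain A0 B0 where A0: "A0-lipschitz_on {0..t} z" by (rule C.extremal_lipschitz[OF z KU])
 have "bounded ((%s. C.ust p (z s)) ` {0..t})" by (intro compact_imp_bounded compact_continuous_image uc) auto
 then obtain B1 where B1: "!!s. s : {0..t} ==> norm (C.ust p (z s)) <= B1" unfolding bounded_iff by blast
 have tu: "triv P p (c s) (u s) = C.ust p (z s)" if "s : {0..t}" for s using cn(1)[OF that] by (simp add: u_def ctl)
 have uw: "triv P p (c s) (u s) = C.ust p (z s)" "dyn P (c s) (u s) = chart_change P p (c s) (c s) (C.Hp p (z s))"
  "lagr P (c s) (u s) = snd (z s) <.> C.Hp p (z s) - C.H p (z s)" if s: "s : {0..t}" for s
 proof -
  show "triv P p (c s) (u s) = C.ust p (z s)" by (rule tu[OF s])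
  have "C.Hp p (z s) = tcoord P p (c s) (dyn P (c s) (u s))"
   unfolding C.Hp_def cn(2)[OF s, symmetric] cf_chart[OF cn(1)[OF s]] u_def ..
  thus "dyn P (c s) (u s) = chart_change P p (c s) (c s) (C.Hp p (z s))"
   using tcoord_inverse(1)[OF nbdD(1)[OF cn(1)[OF s]]] by simp
  have "lagr P (c s) (u s) = cL p (fst (z s), C.ust p (z s))"
   unfolding cn(2)[OF s, symmetric] cL_chart[OF cn(1)[OF s]] u_def ..
  thus "lagr P (c s) (u s) = snd (z s) <.> C.Hp p (z s) - C.H p (z s)" by (simp add: C.H_def C.Hp_def)
 qed
 show "admissible P t c u" unfolding admissible_def
 proof (intro conjI ballI)
  fix s assume "s : {0..t}"
  let ?B = "max A0 B1" and ?J = "{0..t} Int ball s 1"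
  have "A0-lipschitz_on ?J (%s. fst (z s))"
   using A0 unfolding lipschitz_on_def by (auto intro: order_trans[OF dist_fst_le])
  hence "?B-lipschitz_on ?J (%s. fst (z s))" by (rule lipschitz_on_mono) auto
  hence 1: "?B-lipschitz_on ?J (%s. chart P p (c s))" by (rule lipschitz_on_transform) (simp add: cn)
  have "(%s. C.ust p (z s)) : borel_measurable (lebesgue_on ?J)"
   by (rule continuous_imp_measurable_on_sets_lebesgue[OF continuous_on_subset[OF uc]]) auto
  also have "?this \<longleftrightarrow> (%s. triv P p (c s) (u s)) : borel_measurable (lebesgue_on ?J)"
   by (rule measurable_cong) (simp add: tu space_restrict_space)
  finally have 2: "(%s. triv P p (c s) (u s)) : borel_measurable (lebesgue_on ?J)" .
  have 3: "AE s in lebesgue_on ?J. norm (triv P p (c s) (u s)) <= ?B"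
   by (rule AE_I2) (use B1 in "auto simp: tu space_restrict_space le_max_iff_disj")
  have "c ` ?J <= chart_dom P p Int triv_dom P p" using cn(1) by (auto simp: nbd_def)
  with 1 2 3 show "EX e>0. EX B p q. c ` ({0..t} Int ball s e) <= chart_dom P p Int triv_dom P q &
    B-lipschitz_on ({0..t} Int ball s e) (%t. chart P p (c t)) &
    (%t. triv P q (c t) (u t)) : borel_measurable (lebesgue_on ({0..t} Int ball s e)) &
    (AE t in lebesgue_on ({0..t} Int ball s e). norm (triv P q (c t) (u t)) <= B)"
   by (intro exI[of _ "1::real"] exI[of _ ?B] exI[of _ p] conjI) auto
 next
  show "AE s in lebesgue_on {0..t}. has_velocity P c (dyn P (c s) (u s)) s {0..t}"
  proof (rule AE_I2)
   fix s assume "s : space (lebesgue_on {0..t})"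
   hence s: "s : {0..t}" by (simp add: space_restrict_space)
   have d: "((%s. fst (z s)) has_vd C.Hp p (z s)) (at s within {0..t})"
    using bounded_linear.has_vector_derivative[OF bounded_linear_fst zd[OF s]] by (simp add: C.XH_def)
   have "fst (z s) : chart P p ` chart_dom P p" if "s : {0..t}" for s using zU[OF that] by (auto simp: cU_def nbd_def)
   thus "has_velocity P c (dyn P (c s) (u s)) s {0..t}"
    unfolding uw(2)[OF s] unfolding c_def by (intro has_velocity_chart_inv[OF d _ s])
  qed
 qed
 let ?g = "%s. snd (z s) <.> C.Hp p (z s) - C.H p (z s)"
 have gc: "continuous_on {0..t} ?g"
  by (intro continuous_intros zc continuous_on_compose2[OF smooth_on_continuous[OF C.smooth_Hp] zc zKU]
    continuous_on_compose2[OF smooth_on_continuous[OF C.smooth_H] zc zKU])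
 have "action P t c u = (LINT s|lebesgue_on {0..t}. ?g s)"
  unfolding action_def by (rule Bochner_Integration.integral_cong[OF refl]) (simp add: uw space_restrict_space)
 also have "... = integral {0..t} ?g"
  by (rule lebesgue_integral_eq_integral[OF continuous_imp_integrable_real[OF gc]]) simp
 finally show "action P t c u = C.ext_action p z t" by (simp add: C.ext_action_def)
qed

text \<open>The tail of a curve contributes at least -B per unit of time and is discarded at that
  price; used for curves stopped when they leave the chart.\<close>

lemma action_split:
 fixes g :: "real => real"
 assumes g: "integrable (lebesgue_on {0..t}) g" and s: "0 <= s" "s <= t" and B: "!!ta. ta : {0..t} ==> - B <= g ta"
 shows "(LINT ta|lebesgue_on {0..s}. g ta) - B * (t - s) <= (LINT ta|lebesgue_on {0..t}. (g ta))"
  "integrable (lebesgue_on {0..s}) g"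
proof -
 have sub: "integrable (lebesgue_on J) g" if "J <= {0..t}" "J : sets lebesgue" for J
 proof -
  have "set_integrable lebesgue {0..t} g" using g by (simp add: integrable_restrict_space set_integrable_def)
  hence "set_integrable lebesgue J g" by (rule set_integrable_subset) (use that in auto)
  thus ?thesis using that by (simp add: integrable_restrict_space set_integrable_def)
 qed
 have i: "integrable (lebesgue_on {0..s}) g" "integrable (lebesgue_on {s..t}) g" using s by (auto intro!: sub)
 have "g integrable_on {0..t}" by (rule integrable_on_lebesgue_on[OF g]) simp
 hence "integral {0..s} g + integral {s..t} g = integral {0..t} g"
  by (rule Henstock_Kurzweil_Integration.integral_combine[OF s])
 hence eq: "(LINT ta|lebesgue_on {0..t}. g ta) = (LINT ta|lebesgue_on {0..s}. g ta) + (LINT ta|lebesgue_on {s..t}. g ta)"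
  using lebesgue_integral_eq_integral[OF g] lebesgue_integral_eq_integral[OF i(1)] lebesgue_integral_eq_integral[OF i(2)] by simp
 have fin: "finite_measure (lebesgue_on {s..t})" by (rule finite_measure_lebesgue_on) (auto simp: lmeasurable_cbox)
 have "(LINT ta|lebesgue_on {s..t}. - B) <= (LINT ta|lebesgue_on {s..t}. g ta)"
  by (rule integral_mono[OF finite_measure.integrable_const[OF fin] i(2)]) (use B s in "auto simp: space_restrict_space")
 thus "(LINT ta|lebesgue_on {0..s}. g ta) - B * (t - s) <= (LINT ta|lebesgue_on {0..t}. g ta)"
  using s by (simp add: eq measure_restrict_space mult.commute)
 show "integrable (lebesgue_on {0..s}) g" by (rule i)
qed

text \<open>In the manifold the open coordinate ball is open and the closed one is compact, hence
  closed. At the infimum of the times outside the former the curve still lies in the latter, so the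
  distance is exactly rh.\<close>

lemma first_exit:
 fixes c :: "real => 'm"
 assumes c: "continuous_on {0..t} c" and t: "0 <= t" and rh: "cball y0 rh <= cU p"
  and c0: "c 0 : nbd p" "dist y0 (chart P p (c 0)) < rh"
 obtains "c ` {0..t} <= nbd p" "(%s. chart P p (c s)) ` {0..t} <= cball y0 rh"
 | s where "0 < s" "s <= t" "c ` {0..s} <= nbd p" "(%s. chart P p (c s)) ` {0..s} <= cball y0 rh" "dist y0 (chart P p (c s)) = rh"
proof -
 let ?V = "chart_inv P p ` ball y0 rh" and ?K = "chart_inv P p ` cball y0 rh"
 have cb: "cball y0 rh <= chart P p ` chart_dom P p" using rh by (auto simp: cU_def nbd_def)
 have "compact ?K" by (intro compact_continuous_image continuous_on_subset[OF continuous_chart_inv cb] compact_cball)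
 hence Kcl: "closed ?K" by (rule compact_imp_closed)
 have "?V = {x : nbd p. chart P p x : ball y0 rh}"
 proof (intro equalityI subsetI)
  fix x assume "x : ?V"
  thus "x : {x : nbd p. chart P p x : ball y0 rh}" using rh cU_inv[of _ p] by (auto simp: subset_iff)
 next
  fix x assume "x : {x : nbd p. chart P p x : ball y0 rh}"
  thus "x : ?V" using nbdD(1) by (intro image_eqI[of _ _ "chart P p x"]) auto
 qed
 note V = this
 have K: "x : nbd p" "chart P p x : cball y0 rh" if "x : ?K" for x
  using that rh cU_inv[of _ p] by (auto simp: subset_iff)
 have Vo: "open ?V"
 proof -
  have "open (chart P p -` ball y0 rh Int nbd p)"
   using continuous_on_open_vimage[OF nbd(2)] continuous_on_subset[OF continuous_chart nbd(3)] by blast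
  also have "chart P p -` ball y0 rh Int nbd p = ?V" unfolding V by auto
  finally show ?thesis .
 qed
 show thesis
 proof (cases "c ` {0..t} <= ?V")
  case True
  thus thesis using V by (intro that(1)) auto
 next
  case False
  define E where "E = {s : {0..t}. c s ~: ?V}"
  have "E = {0..t} Int c -` (- ?V)" by (auto simp: E_def)
  moreover have "closed ({0..t} Int c -` (- ?V))" using Vo by (intro continuous_closed_preimage c) auto
  ultimately have Ecl: "closed E" by simp
  have Ene: "E ~= {}" using False by (auto simp: E_def)
  have Ebd: "bdd_below E" by (auto simp: E_def intro!: bdd_belowI[of _ 0])
  define s where "s = Inf E"
  have sE: "s : E" unfolding s_def by (rule closed_contains_Inf[OF Ene Ebd Ecl])
  have lt: "c ta : ?V" if "0 <= ta" "ta < s" for ta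
  proof (rule ccontr)
   assume "c ta ~: ?V"
   hence "ta : E" using that sE unfolding E_def by simp
   thus False using cInf_lower[OF _ Ebd, of ta] that by (simp add: s_def)
  qed
  have c0V: "c 0 : ?V" unfolding V using c0 by simp
  hence s0: "0 < s" "s <= t" using sE by (auto simp: E_def less_le)
  have "c s : ?K"
  proof (rule ccontr)
   assume "c s ~: ?K"
   moreover have "continuous (at s within {0..t}) c" using c s0 by (simp add: continuous_on_eq_continuous_within)
   ultimately have "\<forall>\<^sub>F ta in at s within {0..t}. c ta : - ?K"
    unfolding continuous_within using Kcl by (intro topological_tendstoD[where l="c s"]) auto
   then obtain d where d: "d > 0" "!!ta. ta : {0..t} ==> ta ~= s ==> dist ta s < d ==> c ta ~: ?K"
    unfolding eventually_at by auto
   define ta where "ta = max 0 (s - d / 2)"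
   have "ta : {0..t}" "ta < s" "dist ta s < d" using s0 d(1) by (auto simp: ta_def dist_real_def)
   hence "c ta ~: ?K" "c ta : ?V" using d(2) lt by auto
   thus False using ball_subset_cball by blast
  qed
  hence cs: "c s : nbd p" "dist y0 (chart P p (c s)) <= rh" using K by auto
  have "c s ~: ?V" using sE by (simp add: E_def)
  hence eq: "dist y0 (chart P p (c s)) = rh" using cs unfolding V by auto
  have in1: "c ta : nbd p" "chart P p (c ta) : cball y0 rh" if "ta : {0..s}" for ta
  proof -
   have "c ta : ?V \<or> ta = s" using lt[of ta] that by auto
   thus "c ta : nbd p" "chart P p (c ta) : cball y0 rh" using cs unfolding V by auto
  qed
  show thesis by (rule that(2)[OF s0 _ _ eq]) (use in1 in blast)+
 qed
qed

end

context local_control begin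

text \<open>A crude bound linear in t, to be compared with the cost of leaving the chart, which
  stays bounded below as t tends to 0.\<close>

lemma subsol_upper_bound:
 assumes z: "extremal_within K z t" "extremal_within K z' t" "fst (z' 0) = fst (z 0)" and t: "0 <= t" and ka: "0 <= ka"
  and KU: "K <= U \<times> UNIV"
  and b: "!!q. q : K ==> norm (XH q) <= b" "!!q. q : K ==> \<bar>snd q <.> Hp q - H q\<bar> <= b" "!!q. q : K ==> norm (snd q) <= b"
 shows "subsol ka z t (fst (z' t)) <= (b + 2 * b * b) * t"
proof -
 have disp: "norm (fst (z t) - fst (z 0)) <= b * t" if z: "extremal_within K z t" for z
 proof -
  have "norm (z t - z 0) <= b * \<bar>t - 0\<bar>"
   by (rule derivative_increment_bound[where e'="%s. XH (z s)"]) (use z t in "auto simp: extremal_within_def intro!: b(1)")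
  thus ?thesis using dist_fst_le[of "z t" "z 0"] t by (simp add: dist_norm)
 qed
 have zd: "(z has_vd XH (z s)) (at s within {0..t})" and zK: "z s : K" if "s : {0..t}" for s
  using z that by (auto simp: extremal_within_def)
 have zc: "continuous_on {0..t} z" by (rule continuous_on_vector_derivative[OF zd])
 have zKU: "z ` {0..t} <= U \<times> UNIV" using zK KU by blast
 have "norm (integral {0..t} (%s. snd (z s) <.> Hp (z s) - H (z s))) <= b * (t - 0)" by (rule integral_bound[OF t])
   (use zK in "auto intro!: b(2) continuous_intros zc continuous_on_compose2[OF smooth_on_continuous[OF smooth_Hp] zc zKU]
    continuous_on_compose2[OF smooth_on_continuous[OF smooth_H] zc zKU]")
 hence 1: "ext_action z t <= b * t" by (simp add: ext_action_def)
 have "norm (fst (z' t) - fst (z t)) <= norm (fst (z' t) - fst (z' 0)) + norm (fst (z t) - fst (z 0))"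
  unfolding z(3) by (metis dist_norm dist_triangle2)
 hence 2: "norm (fst (z' t) - fst (z t)) <= 2 * b * t" using disp[OF z(1)] disp[OF z(2)] by linarith
 have tt: "t : {0..t}" using t by simp
 have b0: "0 <= b" using b(3)[OF zK[OF tt]] norm_ge_zero by (rule order_trans[rotated])
 have "snd (z t) <.> (fst (z' t) - fst (z t)) <= norm (snd (z t)) * norm (fst (z' t) - fst (z t))" by (rule norm_cauchy_schwarz)
 also have "... <= b * (2 * b * t)" by (intro mult_mono b(3)[OF zK[OF tt]] 2 b0) auto
 finally have 3: "snd (z t) <.> (fst (z' t) - fst (z t)) <= b * (2 * b * t)" .
 have "0 <= ka * t / 2 * (norm (fst (z' t) - fst (z t)))\<^sup>2" using ka t by simp
 thus ?thesis using 1 3 unfolding subsol_def by (simp add: algebra_simps)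
qed

end

context control_system begin

text \<open>A competitor either stays in the coordinate ball, where the subsolution inequality
  applies, or leaves it, and then its action exceeds the subsolution merely because t is
  small.\<close>

lemma chart_geodesic_cost:
 fixes ga :: "real => 'm" and M' :: "'m set"
 assumes M': "open M'" "compact (closure M')" and ga: "ham_curve P ga et" and x0: "ga 0 = x0" "x0 : M'"
 obtains a K ka ep r where
  "geodesic_cost (cU x0) (cf x0) (cL x0) (%t. chart P x0 (ga t)) (%t. cocoord P x0 (ga t) (et t)) a
   (%t x y. real_of_ereal (value_fun P M' t (chart_inv P x0 x) (chart_inv P x0 y))) K ka ep r"
  "!!t. t : {-a<..<a} ==> ga t : nbd x0"
proof -
 define y0 where "y0 = chart P x0 x0"
 define z0 where "z0 = (y0, et 0)"
 have z0U: "z0 : cU x0 \<times> UNIV" by (simp add: z0_def y0_def chart_cU nbd(1))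
 obtain K0 rh ka ep where K0: "open K0" "z0 : K0" "K0 <= cU x0 \<times> UNIV" "bounded K0" "closure K0 <= cU x0 \<times> UNIV"
  and rh: "0 < rh" "cball (fst z0) rh <= cU x0" and ep: "0 < ep" and ka: "0 <= ka"
  and low: "!!z t y w A. C.extremal_within x0 K0 z t ==> 0 <= t ==> t <= ep ==> A-lipschitz_on {0..t} y ==> y ` {0..t} <= cball (fst z0) rh ==>
   AE s in lebesgue_on {0..t}. (y has_vd cf x0 (y s, w s)) (at s within {0..t}) ==>
   integrable (lebesgue_on {0..t}) (%s. cL x0 (y s, w s)) ==>
   C.subsol x0 ka z t (y t) - C.subsol x0 ka z 0 (y 0) <= (LINT s|lebesgue_on {0..t}. cL x0 (y s, w s))"
  by (rule C.local_lower_bound[OF z0U]) (rule that; assumption)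
 have rhU: "cball y0 rh <= cU x0" using rh(2) by (simp add: z0_def)
 define M1 where "M1 = chart P x0 ` (nbd x0 Int M')"
 have M1: "open M1" "y0 : M1" "M1 <= cU x0"
  unfolding M1_def y0_def cU_def using nbd x0 M' by (auto intro!: chart_image_open_subset simp: nbd_def)
 have M1M': "chart_inv P x0 y : M'" if "y : M1" for y using that by (auto simp: M1_def nbdD)
 \<comment> \<open>Extremals are confined also to the part of the chart over \<open>M'\<close>,
   since they have to be competitors for the cost.\<close>
 define K where "K = K0 Int M1 \<times> UNIV"
 have K: "open K" "z0 : K" "K <= cU x0 \<times> UNIV" using K0 M1 by (auto simp: K_def z0_def intro: open_Times)
 have KK0: "C.extremal_within x0 K0 z t" if "C.extremal_within x0 K z t" for z t
  using that by (auto simp: C.extremal_within_def K_def)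
 have Kc: "compact (closure K0)" using K0(4) by (simp add: compact_closure)
 have bb: "EX b>0. ALL q:K0. norm (g q) <= b" if "continuous_on (cU x0 \<times> UNIV) g" for g :: "_ => 'q::real_normed_vector"
 proof -
  have "bounded (g ` closure K0)" by (intro compact_imp_bounded compact_continuous_image Kc continuous_on_subset[OF that K0(5)])
  thus ?thesis unfolding bounded_pos using closure_subset by blast
 qed
 obtain b1 where b1: "b1 > 0" "ALL q:K0. norm (C.XH x0 q) <= b1" using bb[OF smooth_on_continuous[OF C.smooth_XH]] by blast
 have "continuous_on (cU x0 \<times> UNIV) (%q. snd q <.> C.Hp x0 q - C.H x0 q)"
  by (intro continuous_intros smooth_on_continuous[OF C.smooth_Hp] smooth_on_continuous[OF C.smooth_H])
 from bb[OF this] obtain b2 where b2: "b2 > 0" "ALL q:K0. norm (snd q <.> C.Hp x0 q - C.H x0 q) <= b2" by blast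
 have "continuous_on (cU x0 \<times> UNIV) (snd :: (real^'n) \<times> (real^'n) => _)" by (intro continuous_intros)
 from bb[OF this] obtain b3 where b3: "b3 > 0" "ALL q:K0. norm (snd q) <= b3" by blast
 define b where "b = b1 + b2 + b3"
 have b: "b > 0" "!!q. q : K0 ==> norm (C.XH x0 q) <= b" "!!q. q : K0 ==> \<bar>snd q <.> C.Hp x0 q - C.H x0 q\<bar> <= b" "!!q. q : K0 ==> norm (snd q) <= b"
  using b1 b2 b3 unfolding b_def by (auto simp: add_increasing2 add_increasing)
 obtain C where C: "C >= 0" "!!y w. y : cball y0 rh ==> norm (cf x0 (y, w)) <= C + cL x0 (y, w)"
  by (rule C.speed_bound[OF compact_cball rhU]) (rule that; assumption)
 obtain B where B: "B >= 0" "!!x u. x : closure M' ==> - B <= lagr P x u"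
  by (rule lagr_bounded_below[OF M'(2)]) (rule that; assumption)
 \<comment> \<open>The sum of all rates to be beaten: growth of the subsolution, speed bound and
   discarded tail. \<open>ep'\<close> keeps their total effect within rh / 2, a lower bound for the
   distance from an allowed start to the sphere of radius rh.\<close>
 define Q where "Q = b + 2 * b * b + C + B"
 have Q: "Q > 0" using b(1) C(1) B(1) by (simp add: Q_def add_pos_nonneg)
 define ep' where "ep' = min ep (rh / 2 / Q)"
 have ep': "0 < ep'" "ep' <= ep" using ep rh(1) Q by (auto simp: ep'_def)
 have Qt: "Q * t <= rh / 2" if "t <= ep'" for t
 proof -
  have "Q * t <= Q * (rh / 2 / Q)" using that Q by (intro mult_left_mono) (auto simp: ep'_def)
  thus ?thesis using Q by simp
 qed
 have lower: "C.subsol x0 ka z t (fst (z' t)) <= action P t c u"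
  if z: "C.extremal_within x0 K z t" "C.extremal_within x0 K z' t" "fst (z' 0) = fst (z 0)" and t: "t <= ep'" "0 < t"
   and d: "dist y0 (fst (z 0)) < rh / 2"
   and c: "admissible P t c u" "c 0 = chart_inv P x0 (fst (z 0))" "c t = chart_inv P x0 (fst (z' t))" "c ` {0..t} <= M'"
  for z z' t c u
 proof -
  have t0: "0 <= t" using t by simp
  have zU: "fst (z 0) : cU x0" "fst (z' t) : cU x0" using z(1,2) K(3) t0 by (force simp: C.extremal_within_def)+
  have ce: "c 0 : nbd x0" "chart P x0 (c 0) = fst (z 0)" "chart P x0 (c t) = fst (z' t)"
   using cU_inv[OF zU(1)] cU_inv[OF zU(2)] c by auto
  let ?y = "%s. chart P x0 (c s)" and ?w = "%s. triv P x0 (c s) (u s)" and ?l = "%s. lagr P (c s) (u s)"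
  have li: "integrable (lebesgue_on {0..t}) ?l" by (rule admissible_integrable[OF c(1) t0])
  have lB: "- B <= ?l s" if "s : {0..t}" for s using c(4) that closure_subset by (intro B(2)) blast
  have sub: "integrable (lebesgue_on {0..s}) (%s. cL x0 (?y s, ?w s))"
   "(LINT ta|lebesgue_on {0..s}. cL x0 (?y ta, ?w ta)) - B * (t - s) <= action P t c u"
   if s: "0 <= s" "s <= t" and cs: "c ` {0..s} <= nbd x0" for s
  proof -
   have eq: "cL x0 (?y ta, ?w ta) = ?l ta" if "ta : space (lebesgue_on {0..s})" for ta
    using admissible_in_chart(2)[OF c(1) s cs] that by (simp add: space_restrict_space)
   show "integrable (lebesgue_on {0..s}) (%s. cL x0 (?y s, ?w s))"
   proof -
    have "integrable (lebesgue_on {0..s}) ?l" by (rule action_split(2)[OF li s lB])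
    also have "?this \<longleftrightarrow> ?thesis" by (rule Bochner_Integration.integrable_cong[OF refl eq[symmetric]])
    finally show ?thesis .
   qed
   show "(LINT ta|lebesgue_on {0..s}. cL x0 (?y ta, ?w ta)) - B * (t - s) <= action P t c u"
   proof -
    have "(LINT ta|lebesgue_on {0..s}. cL x0 (?y ta, ?w ta)) = (LINT ta|lebesgue_on {0..s}. ?l ta)"
     by (rule Bochner_Integration.integral_cong[OF refl eq])
    thus ?thesis using action_split(1)[OF li s lB] unfolding action_def by simp
   qed
  qed
  show ?thesis
  proof (rule first_exit[OF admissible_continuous[OF c(1)] t0 rhU ce(1)])
   show "dist y0 (chart P x0 (c 0)) < rh" using d rh(1) ce by simp
  next
   assume cn: "c ` {0..t} <= nbd x0" "?y ` {0..t} <= cball y0 rh"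
   hence "c ` {0..t} <= chart_dom P x0" using nbd(3) by blast
   then obtain A where A: "A-lipschitz_on {0..t} ?y" by (rule admissible_lipschitz[OF c(1) t0 order_refl])
   have "C.subsol x0 ka z t (?y t) - C.subsol x0 ka z 0 (?y 0) <= (LINT s|lebesgue_on {0..t}. cL x0 (?y s, ?w s))"
    by (rule low[OF KK0[OF z(1)] t0 _ A _ admissible_in_chart(1)[OF c(1) t0 order_refl cn(1)] sub(1)[OF t0 order_refl cn(1)]])
     (use t ep' cn in "auto simp: z0_def")
   thus ?thesis using sub(2)[OF t0 order_refl cn(1)] C.subsol_at_0[where y="chart P x0 (c 0)" and z=z and ka=ka, OF ce(2)] by (simp add: ce(3))
  next
   fix s assume s: "0 < s" "s <= t" and cn: "c ` {0..s} <= nbd x0" "?y ` {0..s} <= cball y0 rh" "dist y0 (?y s) = rh"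
   hence s0: "0 <= s" by simp
   have "c ` {0..s} <= chart_dom P x0" using nbd(3) cn by blast
   then obtain A where A: "A-lipschitz_on {0..s} ?y" by (rule admissible_lipschitz[OF c(1) s0 s(2)])
   have "norm (?y s - ?y 0) <= C * s + (LINT s|lebesgue_on {0..s}. cL x0 (?y s, ?w s))"
    by (rule C.displacement_bound[OF C(2) s0 A cn(2) admissible_in_chart(1)[OF c(1) s0 s(2) cn(1)] sub(1)[OF s0 s(2) cn(1)]])
   moreover have "rh / 2 <= norm (?y s - ?y 0)"
    using dist_triangle2[of y0 "?y s" "?y 0"] d cn(3) by (simp add: ce dist_norm[symmetric] dist_commute)
   ultimately have "rh / 2 - C * s - B * (t - s) <= action P t c u" using sub(2)[OF s0 s(2) cn(1)] by linarith
   moreover have "C * s <= C * t" "B * (t - s) <= B * t" using C(1) B(1) s by (auto intro: mult_left_mono)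
   moreover have "C.subsol x0 ka z t (fst (z' t)) <= (b + 2 * b * b) * t"
    by (rule C.subsol_upper_bound[OF KK0[OF z(1)] KK0[OF z(2)] z(3) t0 ka K0(3)]) (rule b; assumption)+
   moreover have "(b + 2 * b * b) * t + C * t + B * t <= rh / 2" using Qt[OF t(1)] by (simp add: Q_def algebra_simps)
   ultimately show ?thesis by linarith
  qed
 qed
 have extr: "admissible P t (%s. chart_inv P x0 (fst (z s))) (%s. ctl x0 (chart_inv P x0 (fst (z s))) (C.ust x0 (z s)))"
  "action P t (%s. chart_inv P x0 (fst (z s))) (%s. ctl x0 (chart_inv P x0 (fst (z s))) (C.ust x0 (z s))) = C.ext_action x0 z t"
  "(%s. chart_inv P x0 (fst (z s))) ` {0..t} <= M'"
  if z: "C.extremal_within x0 K z t" and t: "0 < t" for z t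
 proof -
  show "(%s. chart_inv P x0 (fst (z s))) ` {0..t} <= M'"
   using z by (force simp: C.extremal_within_def K_def intro: M1M')
 qed (use extremal_admissible[OF z K(3)] t in auto)
 let ?V = "%t x y. value_fun P M' t (chart_inv P x0 x) (chart_inv P x0 y)"
 have vlow: "ereal (C.subsol x0 ka z t (fst (z' t))) <= ?V t (fst (z 0)) (fst (z' t))"
  if "C.extremal_within x0 K z t" "C.extremal_within x0 K z' t" "fst (z' 0) = fst (z 0)" "t <= ep'" "0 < t" "dist y0 (fst (z 0)) < rh / 2" for z z' t
  unfolding value_fun_def by (rule Inf_greatest) (use lower[OF that] in auto)
 have vup: "?V t (fst (z 0)) (fst (z t)) <= ereal (C.ext_action x0 z t)" if "C.extremal_within x0 K z t" "0 < t" for z t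
  unfolding value_fun_def extr(2)[OF that, symmetric]
  by (rule Inf_lower, rule CollectI, rule exI[of _ "%s. chart_inv P x0 (fst (z s))"],
    rule exI[of _ "%s. ctl x0 (chart_inv P x0 (fst (z s))) (C.ust x0 (z s))"]) (simp add: extr[OF that])
 \<comment> \<open>Finite bounds on both sides keep \<open>real_of_ereal\<close> away from the
   infinities, where its value is the default 0.\<close>
 have re: "s <= real_of_ereal v & real_of_ereal v <= r" if "ereal s <= v" "v <= ereal r" for s v r
  using that by (cases v) auto
 have "continuous (at 0) ga" using ga by (simp add: ham_curve_def has_velocity_def)
 hence "\<forall>\<^sub>F s in at 0. ga s : nbd x0" unfolding continuous_within
  by (rule topological_tendstoD) (use nbd x0 in auto)
 then obtain a where a: "a > 0" "!!s. s ~= 0 ==> \<bar>s\<bar> < a ==> ga s : nbd x0" unfolding eventually_at by (auto simp: dist_real_def)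
 have gan: "ga s : nbd x0" if "s : {-a<..<a}" for s using a(2)[of s] that nbd(1) x0 by (cases "s = 0") auto
 have "geodesic_cost (cU x0) (cf x0) (cL x0) (%t. chart P x0 (ga t)) (%t. cocoord P x0 (ga t) (et t)) a
   (%t x y. real_of_ereal (?V t x y)) K ka ep' (rh / 2)"
 proof (rule geodesic_cost.intro[OF _ geodesic_cost_axioms.intro])
  show "local_control (cU x0) (cf x0) (cL x0)" by (rule C.local_control_axioms)
  show "chart P x0 (ga t) : cU x0 & ((%t. (chart P x0 (ga t), cocoord P x0 (ga t) (et t))) has_vector_derivative
    C.XH x0 (chart P x0 (ga t), cocoord P x0 (ga t) (et t))) (at t)" if "t : {-a<..<a}" for t
   using ham_curve_in_chart[OF ga gan[OF that]] chart_cU[OF gan[OF that]] by simp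
  show "(chart P x0 (ga 0), cocoord P x0 (ga 0) (et 0)) : K" using K(2) by (simp add: z0_def y0_def x0 cocoord_self)
  show "C.subsol x0 ka z t (fst (z' t)) <= real_of_ereal (?V t (fst (z 0)) (fst (z' t)))"
   if z: "C.extremal_within x0 K z t" "C.extremal_within x0 K z' t" "fst (z' 0) = fst (z 0)" "t <= ep'"
    "dist (chart P x0 (ga 0)) (fst (z 0)) < rh / 2" "0 < t" for z z' t
   using re[OF vlow[OF z(1-4) z(6)]] vup[OF z(2) z(6)] z(3,5) by (simp add: x0 y0_def)
  show "real_of_ereal (?V t (fst (z 0)) (fst (z t))) <= C.ext_action x0 z t"
   if z: "C.extremal_within x0 K z t" "t <= ep'" "dist (chart P x0 (ga 0)) (fst (z 0)) < rh / 2" "0 < t" for z t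
   using re[OF vlow[OF z(1,1) refl z(2,4)] vup[OF z(1,4)]] z(3) by (simp add: x0 y0_def)
 qed (use a K ep' rh in auto)
 thus thesis by (rule that) (rule gan)
qed

end

section \<open>Linearization along a geodesic\<close>

text \<open>Product rule for a moving linear map whose derivative is known on fixed vectors only;
  the basis expansion reduces it to scalar products.\<close>

lemma linear_apply_has_vector_derivative:
 fixes G :: "real => 'a::euclidean_space => 'b::real_normed_vector"
 assumes lin: "!!s. s : S ==> linear (G s)" and lin': "linear G'" and t: "t : S"
  and G: "!!b. ((%s. G s b) has_vd G' b) (at t within S)"
  and x: "(x has_vd x') (at t within S)"
 shows "((%s. G s (x s)) has_vd G' (x t) + G t x') (at t within S)"
proof -
 have xb: "((%s. x s <.> b) has_vd x' <.> b) (at t within S)" for b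
  by (rule bounded_linear.has_vector_derivative[OF bounded_linear_inner_left x])
 have "((%s. SUM b:Basis. (x s <.> b) *R G s b) has_vd (SUM b:Basis. (x t <.> b) *R G' b + (x' <.> b) *R G t b)) (at t within S)"
  by (intro has_vector_derivative_sum bounded_bilinear.has_vector_derivative[OF bounded_bilinear_scaleR xb G])
 moreover have "(SUM b:Basis. (x t <.> b) *R G' b + (x' <.> b) *R G t b) = G' (x t) + G t x'"
  by (simp add: sum.distrib linear_eq_sum_Basis[OF lin', symmetric] linear_eq_sum_Basis[OF lin[OF t], symmetric])
 ultimately have "((%s. SUM b:Basis. (x s <.> b) *R G s b) has_vd G' (x t) + G t x') (at t within S)" by (simp only:)
 thus ?thesis
  by (rule has_vector_derivative_transform[OF t, rotated]) (simp add: linear_eq_sum_Basis[OF lin, symmetric])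
qed

lemma smooth_on_linear_apply:
 fixes G :: "'c::real_normed_vector => 'a::euclidean_space => 'b::real_normed_vector"
 assumes I: "open I" and lin: "!!s. s : I ==> linear (G s)" and G: "!!b. smooth_on I (%s. G s b)" and x: "smooth_on I x"
 shows "smooth_on I (%s. G s (x s))"
proof -
 have "smooth_on I (%s. SUM b:Basis. (x s <.> b) *R G s b)"
  by (intro smooth_on_sum smooth_on_scaleR smooth_on_inner I x G smooth_on_const)
 thus ?thesis by (rule smooth_on_cong[OF I, rotated]) (simp add: linear_eq_sum_Basis[OF lin, symmetric])
qed

lemma linear_inv_eq:
 fixes g :: "real^'n => real^'n"
 assumes "linear g" "inj g" shows "linear (inv g)" "g (inv g v) = v" "inv g (g v) = v"
proof -
 have s: "surj g" using assms linear_injective_imp_surjective by blast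
 show "g (inv g v) = v" "inv g (g v) = v" using s assms(2) by (auto simp: surj_f_inv_f)
 obtain g' where "linear g'" "g' \<circ> g = id" using linear_injective_left_inverse[OF assms] by blast
 hence "inv g = g'" using s by (metis comp_apply id_apply ext surj_f_inv_f)
 thus "linear (inv g)" using `linear g'` by simp
qed

lemma smooth_on_inv_apply:
 fixes G :: "'c::real_normed_vector => real^'n => real^'n"
 assumes I: "open I" and lin: "!!s. s : I ==> linear (G s)" "!!s. s : I ==> inj (G s)"
  and G: "!!b. smooth_on I (%s. G s b)" and x: "smooth_on I x"
 shows "smooth_on I (%s. inv (G s) (x s))"
proof (rule smooth_on_solve[OF I _ x])
 show "smooth_on I (%s. matrix (G s) $ i $ j)" for i j unfolding matrix_def by (simp add: smooth_on_component[OF I G])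
 show "det (matrix (G s)) ~= 0" if "s : I" for s using lin(1,2)[OF that] det_nz_iff_inj by blast
 show "matrix (G s) *v inv (G s) (x s) = x s" if "s : I" for s
  using fun_cong[OF matrix_vector_mul(2)[OF lin(1)[OF that]], of "inv (G s) (x s)"] linear_inv_eq(2)[OF lin(1,2)[OF that]] by simp
qed

lemma smooth_on_components_vec:
 "open I ==> (!!i. smooth_on I (%s. g i s)) ==> smooth_on I (%s. \<chi> i. (g i s :: real))"
 using smooth_on_vec[of I "%s. \<chi> i. g i s"] by simp

lemma axis_expansion: fixes v :: "real^'r" shows "v = (SU l. (v $ l) *R axis l 1)"
 using basis_expansion[of v] by (simp add: scalar_mult_eq_scaleR)

text \<open>\<open>w\<close> is a feedback control that agrees with the maximizer along the
  geodesic, and \<open>Ph\<close> is the linearization along the geodesic of the flow driven by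
  \<open>w\<close>. The control frame \<open>e\<close> is needed along the geodesic only.\<close>

locale framed_geodesic = local_control U f L
 for U :: "(real^'n) set" and f :: "(real^'n) \<times> (real^'r) => real^'n" and L :: "(real^'n) \<times> (real^'r) => real" +
 fixes ga et :: "real => real^'n" and ta :: real and N :: "(real \<times> (real^'n)) set"
  and w :: "real \<times> (real^'n) => real^'r" and Ph :: "real => real^'n => real^'n" and e :: "real => real^'r => real^'r"
 assumes ta: "0 < ta"
  and geo: "!!t. t : {-ta<..<ta} ==> ga t : U & ((%t. (ga t, et t)) has_vd XH (ga t, et t)) (at t)"
  and N: "open N" "N <= UNIV \<times> U" "!!t. t : {-ta<..<ta} ==> (t, ga t) : N"
  and w: "smooth_on N w" "!!t. t : {-ta<..<ta} ==> w (t, ga t) = ust (ga t, et t)"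
  and Ph: "!!t v. t : {-ta<..<ta} ==>
   ((%t. Ph t v) has_vd FD (%(t, y). f (y, w (t, y))) (t, ga t) (0, Ph t v)) (at t)"
  and Ph0: "!!v. Ph 0 v = v" and Ph_linear: "!!t. t : {-ta<..<ta} ==> linear (Ph t)"
  and e: "!!t. t : {-ta<..<ta} ==> linear (e t)" "!!t. t : {-ta<..<ta} ==> inj (e t)" "!!b. smooth_on {-ta<..<ta} (%t. e t b)"
begin

abbreviation I where "I \<equiv> {-ta<..<ta}"
abbreviation gz where "gz t \<equiv> (ga t, et t)"

definition F :: "real \<times> (real^'n) => real^'n" where "F = (%(t, y). f (y, w (t, y)))"
definition A :: "real => real^'n => real^'n" where "A t v = FD F (t, ga t) (0, v)"
definition Cc :: "'r => real => real^'n" where "Cc l t = inv (Ph t) (fl (ga t) (e t (axis l 1)))"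
definition W :: "real => real^'r => real^'r" where "W s = inv ((*v) (Lmat (ga s, ust (gz s))))"
text \<open>The dual control frame: inner product with \<open>hv s m\<close> gives the m-th frame
  component.\<close>

definition hv :: "real => 'r => real^'r" where "hv s m = (\<chi> j. inv (e s) (axis j 1) $ m)"
text \<open>The inverse of the fibre Hessian of L, in frame components.\<close>

definition gg :: "'r => 'r => real => real" where "gg l m s = inv (e s) (W s (hv s m)) $ l"
text \<open>How the maximizing control and the feedback \<open>w\<close> separate under a
  displacement of the base point: the part of the linearized dynamics that \<open>Ph\<close> does
  not absorb.\<close>

definition kt :: "real => real^'n => real^'r" where
 "kt s x = FD ust (gz s) (x, 0) - FD w (s, ga s) (0, x)"
definition kk :: "'r => real => real^'n" where "kk l s = (\<chi> i. inv (e s) (kt s (Ph s (axis i 1))) $ l)"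
text \<open>The second derivative of the Hamiltonian in the base point, pulled back by
  \<open>Ph\<close>.\<close>

definition RR :: "real => real^'n => real^'n" where
 "RR s z = (\<chi> i. Ph s (axis i 1) <.> FD Hy (gz s) (Ph s z, 0))"

section \<open>Smoothness of the data along the geodesic\<close>

lemma gU: "s : I ==> ga s : U" "s : I ==> gz s : U \<times> UNIV" using geo by auto

lemma smooth_gz: "smooth_on I gz"
 by (rule smooth_onI, rule Ck_on_autonomous_solution[OF _ oU smooth_onD[OF smooth_XH]]) (use geo in auto)

lemma smooth_along: "smooth_on (U \<times> UNIV) g ==> smooth_on I (%s. g (gz s))"
 by (rule smooth_on_compose[OF _ oU smooth_gz]) (use gU in auto)

lemma smooth_ga: "smooth_on I ga" using smooth_on_linear_compose[OF _ bounded_linear_fst smooth_gz] by simp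

lemma smooth_graph: "smooth_on I (%t. (t, ga t))" by (intro smooth_on_Pair smooth_on_ident smooth_ga) simp

lemma smooth_F: "smooth_on N F"
proof -
 have "smooth_on N (%z. f (snd z, w z))" by (rule smooth_on_compose[OF N(1) oU _ f])
   (use N(2) in "auto intro!: smooth_on_Pair[OF N(1) smooth_on_bounded_linear[OF bounded_linear_snd] w(1)]")
 thus ?thesis by (simp add: F_def case_prod_unfold)
qed

lemma A_linear: "s : I ==> linear (A s)"
 unfolding A_def[abs_def] by (rule has_derivative_linear[OF has_derivative_slice(1)[OF smooth_on_has_derivative[OF smooth_F N(3)]]])

lemma Ph_deriv: "s : I ==> ((%t. Ph t v) has_vd A s (Ph s v)) (at s)" using Ph by (simp add: A_def F_def)

lemma Ck_A_apply: "Ck_on k I x ==> Ck_on k I (%s. A s (x s))" unfolding A_def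
 by (rule Ck_on_frechet_apply[OF _ N(1)]) (use N smooth_onD[OF smooth_graph] smooth_onD[OF smooth_F] in "auto intro!: Ck_on_Pair simp: smooth_onD[OF smooth_on_const]")

lemma smooth_Ph: "smooth_on I (%s. Ph s v)"
proof (rule smooth_onI)
 fix k show "Ck_on k I (%s. Ph s v)"
 proof (induction k)
  case 0
  show ?case unfolding Ck_on.simps
   by (intro continuous_at_imp_continuous_on ballI has_vector_derivative_continuous[OF Ph_deriv])
 next
  case (Suc k)
  show ?case by (rule Ck_on_curveI[OF _ Ph_deriv Ck_A_apply[OF Suc]]) auto
 qed
qed

text \<open>With time adjoined the linear equation for \<open>Ph\<close> is autonomous; uniqueness
  started at s carries a zero back to time 0, where \<open>Ph\<close> is the identity.\<close>

lemma Ph_inj: assumes s: "s : I" shows "inj (Ph s)"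
proof -
 have "v = 0" if v: "Ph s v = 0" for v
 proof -
  let ?X = "%z :: real \<times> (real^'n). (1 :: real, A (fst z) (snd z))"
  have "smooth_on (I \<times> UNIV) (%z :: real \<times> (real^'n). A (fst z) (snd z))" unfolding A_def
   by (rule smooth_on_frechet_apply[OF _ N(1) smooth_F])
    (auto intro!: open_Times_UNIV N(3) smooth_on_compose[OF _ open_greaterThanLessThan _ smooth_graph]
     smooth_on_Pair[OF _ smooth_on_const smooth_on_bounded_linear[OF bounded_linear_snd]] smooth_on_bounded_linear[OF bounded_linear_fst])
  hence "smooth_on (I \<times> UNIV) ?X" by (intro smooth_on_Pair smooth_on_const open_Times_UNIV) auto
  hence X: "Ck_on (Suc 0) (I \<times> UNIV) ?X" by (rule smooth_onD)
  have IS: "{min 0 s..max 0 s} <= I" using s ta by auto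
  have d: "((%t. (t, Ph t u)) has_vd ?X (t, Ph t u)) (at t within J)" if "t : I" for t u J
   using has_vector_derivative_Pair[OF has_vector_derivative_id[of "at t"] Ph_deriv[OF that, of u]]
   by (auto intro: has_vector_derivative_at_within)
  have "(0 :: real, Ph 0 v) = (0, Ph 0 0)"
   by (rule ode_unique[where S="I \<times> UNIV" and X="?X" and a="min 0 s" and b="max 0 s" and ?t0.0=s and s=0 and ?y1.0="%t. (t, Ph t v)" and ?y2.0="%t. (t, Ph t 0)"])
    (use X IS d v linear_0[OF Ph_linear[OF s]] in "auto intro: open_Times_UNIV")
  thus "v = 0" by (simp add: Ph0)
 qed
 thus ?thesis using linear_injective_0[OF Ph_linear[OF s]] by auto
qed

lemmas Ph_inv = linear_inv_eq[OF Ph_linear Ph_inj]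
lemmas e_inv = linear_inv_eq[OF e(1,2)]

lemma smooth_Ph_inv: "smooth_on I x ==> smooth_on I (%s. inv (Ph s) (x s))"
 by (rule smooth_on_inv_apply[OF _ Ph_linear Ph_inj smooth_Ph]) auto

lemma smooth_e_inv: "smooth_on I x ==> smooth_on I (%s. inv (e s) (x s))" by (rule smooth_on_inv_apply[OF _ e]) auto

lemma smooth_Cc: "smooth_on I (Cc l)"
proof -
 have "smooth_on I (%s. fl (ga s) (e s (axis l 1)))"
 proof (rule smooth_on_linear_apply[OF _ _ _ e(3)])
  show "smooth_on I (%s. fl (ga s) b)" for b using smooth_along[OF smooth_fl[of b]] by simp
 qed (use fl_linear gU in auto)
 from smooth_Ph_inv[OF this] show ?thesis by (simp add: Cc_def[abs_def])
qed

lemma W_props: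
 assumes s: "s : I"
 shows "linear (W s)" "W s (Lmat (ga s, ust (gz s)) *v v) = v" "Lmat (ga s, ust (gz s)) *v W s v = v"
proof -
 have "inj ((*v) (Lmat (ga s, ust (gz s))))" using Lmat_det[OF gU(1)[OF s]] by (simp add: inj_matrix_vector_mult invertible_det_nz)
 from linear_inv_eq[OF matrix_vector_mul_linear this]
 show "linear (W s)" "W s (Lmat (ga s, ust (gz s)) *v v) = v" "Lmat (ga s, ust (gz s)) *v W s v = v"
  by (simp_all add: W_def)
qed

lemma smooth_W: assumes x: "smooth_on I x" shows "smooth_on I (%s. W s (x s))" unfolding W_def
proof (rule smooth_on_inv_apply[OF _ matrix_vector_mul_linear _ _ x])
 show "inj ((*v) (Lmat (ga s, ust (gz s))))" if "s : I" for s
  using Lmat_det[OF gU(1)[OF that]] by (simp add: inj_matrix_vector_mult invertible_det_nz)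
 have u: "smooth_on I (%s. (ga s, ust (gz s)))" using smooth_along[OF smooth_pair_ust] by simp
 have "smooth_on I (%s. D2L (ga s, ust (gz s)) a b)" for a b
  by (rule smooth_on_compose[OF _ oU u smooth_on_deriv[OF smooth_on_deriv[OF L]]]) (use gU in auto)
 thus "smooth_on I (%s. Lmat (ga s, ust (gz s)) *v b)" for b unfolding Lmat_def matrix_vector_mult_def
  by (intro smooth_on_components_vec) (auto intro!: smooth_on_sum smooth_on_scaleR[where 'b=real, simplified] smooth_on_const)
qed auto

lemma hv_inner: assumes s: "s : I" shows "hv s m <.> v = inv (e s) v $ m"
proof -
 have "linear (%v. inv (e s) v $ m)" using e_inv(1)[OF s s] by (intro linearI) (simp_all add: linear_add linear_scale)
 from linear_functional_eq_inner[OF this, of v] show ?thesis by (simp add: hv_def inner_commute)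
qed


section \<open>Linearized dynamics in components of the frame\<close>

lemma fl_expand: assumes s: "s : I" shows "fl (ga s) v = Ph s (SU l. (inv (e s) v $ l) *R Cc l s)"
proof -
 note lf = fl_linear[OF gU(1)[OF s]]
 have "v = e s (SU l. (inv (e s) v $ l) *R axis l 1)"
  using e_inv(2)[OF s s, of v] axis_expansion[of "inv (e s) v"] by simp
 hence "fl (ga s) v = fl (ga s) (e s (SU l. (inv (e s) v $ l) *R axis l 1))" by simp
 also have "... = (SU l. (inv (e s) v $ l) *R fl (ga s) (e s (axis l 1)))"
  by (simp add: linear_sum[OF e(1)[OF s]] linear_scale[OF e(1)[OF s]] linear_sum[OF lf] linear_scale[OF lf])
 also have "... = Ph s (SU l. (inv (e s) v $ l) *R Cc l s)"
  by (simp add: linear_sum[OF Ph_linear[OF s]] linear_scale[OF Ph_linear[OF s]] Cc_def Ph_inv(2)[OF s s])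
 finally show ?thesis .
qed

definition coad :: "real => real^'n => real^'n" where "coad s p = (\<chi> i. Ph s (axis i 1) <.> p)"

lemma coad_inner: assumes s: "s : I" shows "coad s p <.> u = p <.> Ph s u"
proof -
 have "linear (%u. p <.> Ph s u)"
  using linear_compose[OF Ph_linear[OF s] bounded_linear.linear[OF bounded_linear_inner_right[of p]]] by (simp add: o_def)
 from linear_functional_eq_inner[OF this, of u] show ?thesis by (simp add: coad_def inner_commute)
qed

lemma pull_expand: assumes s: "s : I"
 shows "pull (ga s) p = (SU m. (Cc m s <.> coad s p) *R hv s m)"
proof -
 have "pull (ga s) p <.> v = (SU m. (Cc m s <.> coad s p) *R hv s m) <.> v" for v
 proof -
  have "pull (ga s) p <.> v = coad s p <.> (SU l. (inv (e s) v $ l) *R Cc l s)"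
   using pull_inner[OF gU(1)[OF s], of v p] by (simp add: inner_commute fl_expand[OF s] coad_inner[OF s])
  thus ?thesis by (simp add: inner_sum_left inner_sum_right hv_inner[OF s] mult.commute inner_commute[of "coad s p"])
 qed
 thus ?thesis using vector_eq_rdot by blast
qed

lemma W_expand: assumes s: "s : I"
 shows "inv (e s) (W s (pull (ga s) p)) $ l = (SU m. gg l m s * (Cc m s <.> coad s p))" unfolding pull_expand[OF s]
 by (simp add: linear_sum[OF W_props(1)[OF s]] linear_scale[OF W_props(1)[OF s]] linear_sum[OF e_inv(1)[OF s s]]
   linear_scale[OF e_inv(1)[OF s s]] gg_def mult.commute)

lemma ust_deriv_fibre: assumes s: "s : I"
 shows "FD ust (gz s) (0, p) = W s (pull (ga s) p)"
proof -
 let ?y = "ga s" and ?xi = "et s"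
 have y: "?y : U" by (rule gU(1)[OF s])
 obtain u' where u': "(ups has_derivative u') (at (?y, pull ?y ?xi))"
  "!!h k. Lmat (?y, ups (?y, pull ?y ?xi)) *v u' (h, k) = k - (\<chi> i. D2L (?y, ups (?y, pull ?y ?xi)) (0, axis i 1) (h, 0))"
  by (rule ups_derivative[OF y]) (rule that; assumption)
 have "linear (pull ?y)" unfolding pull_def by (intro linearI) (simp_all add: vec_eq_iff inner_add_left)
 hence "(pull ?y has_derivative pull ?y) (at ?xi)"
  by (simp add: bounded_linear_imp_has_derivative linear_conv_bounded_linear)
 from diff_chain_at[OF this has_derivative_slice(1)[OF u'(1)]]
 have "((%xi. ust (?y, xi)) has_derivative (%p. u' (0, pull ?y p))) (at ?xi)" by (simp add: o_def ust_def)
 moreover have "((%xi. ust (?y, xi)) has_derivative (%p. FD ust (gz s) (0, p))) (at ?xi)"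
  by (rule has_derivative_slice(1)[OF smooth_on_has_derivative[OF smooth_ust gU(2)[OF s]]])
 ultimately have eq: "FD ust (gz s) (0, p) = u' (0, pull ?y p)" by (rule fun_cong[OF has_derivative_unique[rotated]])
 have "D2L (?y, ups (?y, pull ?y ?xi)) (0, axis i 1) (0, 0) = 0" for i
  using linear_0[OF has_derivative_linear[OF D2L[OF y]]] by (simp add: zero_prod_def)
 hence "Lmat (?y, ust (gz s)) *v u' (0, pull ?y p) = pull ?y p" using u'(2)[of 0 "pull ?y p"] by (simp add: ust_def zero_vec_def[symmetric])
 thus ?thesis unfolding eq using W_props(2)[OF s, of "u' (0, pull ?y p)"] by simp
qed

text \<open>\<open>Hp\<close> and the feedback field \<open>F\<close> are both f composed with a
  control, so their linearizations differ only by the response of that control: \<open>kt\<close> to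
  the base point, the inverse Hessian to the covector.\<close>

lemma Hp_deriv: assumes s: "s : I"
 shows "FD Hp (gz s) (x, p) = A s x + fl (ga s) (kt s x) + fl (ga s) (W s (pull (ga s) p))"
proof -
 let ?w = "ust (gz s)"
 have y: "ga s : U" by (rule gU(1)[OF s])
 let ?f' = "FD f (ga s, ?w)"
 have f': "(f has_derivative ?f') (at (ga s, ?w))" by (rule smooth_on_has_derivative[OF f]) (use y in simp)
 note lf' = has_derivative_linear[OF f']
 have f0: "?f' (0, v) = fl (ga s) v" for v
 proof -
  have "((%w. f (ga s, 0) + fl (ga s) w) has_derivative (%v. fl (ga s) v)) (at ?w)"
   using bounded_linear_imp_has_derivative fl_linear[OF y] by (auto intro!: derivative_eq_intros simp: linear_conv_bounded_linear)
  hence "((%w. f (ga s, w)) has_derivative (%v. fl (ga s) v)) (at ?w)" by (simp add: fl_def)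
  thus ?thesis by (rule fun_cong[OF has_derivative_unique[OF has_derivative_slice(1)[OF f']]])
 qed
 have fs: "?f' (a, v) = ?f' (a, 0) + fl (ga s) v" for a v
  using linear_add[OF lf', of "(a, 0)" "(0, v)"] by (simp add: f0)
 have u': "(ust has_derivative FD ust (gz s)) (at (gz s))"
  by (rule smooth_on_has_derivative[OF smooth_ust gU(2)[OF s]])
 have "((%z. (fst z, ust z)) has_derivative (%h. (fst h, FD ust (gz s) h))) (at (gz s))"
  by (intro has_derivative_Pair u' has_derivative_fst has_derivative_ident)
 from diff_chain_at[OF this] f' have "(Hp has_derivative (%h. ?f' (fst h, FD ust (gz s) h))) (at (gz s))"
  by (simp add: Hp_def[abs_def] o_def)
 hence 1: "FD Hp (gz s) (x, p) = ?f' (x, FD ust (gz s) (x, p))"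
  using fun_cong[OF frechet_derivative_at[symmetric]] by fastforce
 have w': "(w has_derivative FD w (s, ga s)) (at (s, ga s))" by (rule smooth_on_has_derivative[OF w(1) N(3)[OF s]])
 have "((%z. (snd z, w z)) has_derivative (%h. (snd h, FD w (s, ga s) h))) (at (s, ga s))"
  by (intro has_derivative_Pair w' has_derivative_snd has_derivative_ident)
 from diff_chain_at[OF this] f' w(2)[OF s]
 have "(F has_derivative (%h. ?f' (snd h, FD w (s, ga s) h))) (at (s, ga s))"
  by (simp add: F_def o_def case_prod_unfold)
 hence 2: "A s x = ?f' (x, FD w (s, ga s) (0, x))"
  unfolding A_def using fun_cong[OF frechet_derivative_at[symmetric]] by fastforce
 have "FD ust (gz s) (x, p) = FD ust (gz s) (x, 0) + W s (pull (ga s) p)"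
  using linear_add[OF has_derivative_linear[OF u'], of "(x, 0)" "(0, p)"] by (simp add: ust_deriv_fibre[OF s])
 thus ?thesis unfolding 1 2 fs[of x "FD ust (gz s) (x, p)"] fs[of x "FD w (s, ga s) (0, x)"] kt_def
  by (simp add: linear_add[OF fl_linear[OF y]] linear_diff[OF fl_linear[OF y]])
qed

text \<open>Symmetry of the second derivative of H: the covector derivative of \<open>Hy\<close> is
  the transpose of the base derivative of \<open>Hp\<close>.\<close>

lemma Hy_deriv: assumes s: "s : I"
 shows "a <.> FD Hy (gz s) (x, p) = a <.> FD Hy (gz s) (x, 0) + p <.> (A s a + fl (ga s) (kt s a))"
proof -
 let ?DH = "%v z. FD H z v" and ?z = "gz s"
 have z: "?z : U \<times> UNIV" by (rule gU(2)[OF s])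
 have Hy': "(Hy has_derivative FD Hy ?z) (at ?z)" by (rule smooth_on_has_derivative[OF smooth_Hy z])
 have Hp': "(Hp has_derivative FD Hp ?z) (at ?z)" by (rule smooth_on_has_derivative[OF smooth_Hp z])
 have DD: "FD (?DH (a, 0)) ?z h = a <.> FD Hy ?z h"
  "FD (?DH (0, p)) ?z h = p <.> FD Hp ?z h" for h by (rule fun_cong[OF frechet_derivative_at, symmetric];
   rule has_derivative_transform_within_open[OF has_derivative_inner_right[OF Hy'] oU z]
    has_derivative_transform_within_open[OF has_derivative_inner_right[OF Hp'] oU z];
   auto simp: DH_y DH_p)+
 have "a <.> FD Hy ?z (0, p) = p <.> FD Hp ?z (a, 0)"
  using second_derivative_symmetric_real[OF oU smooth_onD[OF smooth_H] z, of "(a, 0)" "(0, p)"] by (simp add: DD)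
 moreover have "pull (ga s) 0 = 0" by (simp add: pull_def vec_eq_iff)
 ultimately have "a <.> FD Hy ?z (0, p) = p <.> (A s a + fl (ga s) (kt s a))"
  by (simp add: Hp_deriv[OF s] linear_0[OF W_props(1)[OF s]] linear_0[OF fl_linear[OF gU(1)[OF s]]])
 thus ?thesis using linear_add[OF has_derivative_linear[OF Hy'], of "(x, 0)" "(0, p)"] by (simp add: inner_add_right)
qed

lemma kt_linear: "s : I ==> linear (kt s)" unfolding kt_def[abs_def]
 using has_derivative_linear[OF has_derivative_slice(2)[OF smooth_on_has_derivative[OF smooth_ust gU(2)]]]
  has_derivative_linear[OF has_derivative_slice(1)[OF smooth_on_has_derivative[OF w(1) N(3)]]]
 by (intro linear_compose_sub) auto

lemma kk_inner: assumes s: "s : I" shows "kk l s <.> z = inv (e s) (kt s (Ph s z)) $ l"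
proof -
 have "linear (%z. inv (e s) (kt s (Ph s z)) $ l)"
  using e_inv(1)[OF s s] kt_linear[OF s] Ph_linear[OF s] by (intro linearI) (simp_all add: linear_add linear_scale)
 from linear_functional_eq_inner[OF this, of z] show ?thesis by (simp add: kk_def inner_commute)
qed

text \<open>Differentiates the constant \<open>Ph s (inv (Ph s) u)\<close>; that the inverse is
  differentiable is known beforehand from Cramer's rule.\<close>

lemma Ph_inv_deriv: assumes s: "s : I"
 shows "((%s. inv (Ph s) u) has_vd - inv (Ph s) (A s u)) (at s)"
proof -
 have oI: "open I" by simp
 have k1: "Ck_on (Suc 0) I (%s. inv (Ph s) u)" by (rule smooth_onD[OF smooth_Ph_inv[OF smooth_on_const]])
 define d where "d = vector_derivative (%s. inv (Ph s) u) (at s)"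
 have d: "((%s. inv (Ph s) u) has_vd d) (at s)" unfolding d_def by (rule Ck_on_curveD(1)[OF oI k1 s])
 have at: "at s within I = at s" by (rule at_within_open[OF s oI])
 have "linear (%v. A s (Ph s v))" using linear_compose[OF Ph_linear A_linear, OF s s] by (simp add: o_def)
 from linear_apply_has_vector_derivative[OF Ph_linear this s Ph_deriv[OF s, folded at] d[folded at]]
 have "((%s. Ph s (inv (Ph s) u)) has_vd A s u + Ph s d) (at s within I)" by (simp add: Ph_inv(2)[OF s s])
 hence "((%s. u) has_vd A s u + Ph s d) (at s within I)"
  by (rule has_vector_derivative_transform[OF s, rotated]) (simp add: Ph_inv(2))
 hence "A s u + Ph s d = 0" unfolding at by (rule vector_derivative_unique_at[OF _ has_vector_derivative_const])
 hence "Ph s d = - A s u" by (simp add: eq_neg_iff_add_eq_0 add.commute)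
 hence "d = inv (Ph s) (- A s u)" using Ph_inv(3)[OF s s, of d] by simp
 thus ?thesis using d by (simp add: linear_neg[OF Ph_inv(1)[OF s s]])
qed

text \<open>Jacobi fields in the moving frame given by \<open>Ph\<close>: the state variable is pulled back by \<open>Ph\<close>,
  the costate pushed forward by its adjoint.\<close>

lemma jacobi_in_frame:
 assumes s: "s : S" and S: "S <= I"
  and de: "(de has_vd FD XH (gz s) (de s)) (at s within S)"
 defines "z \<equiv> %s. inv (Ph s) (fst (de s))" and "q \<equiv> %s. coad s (snd (de s))"
 shows "(z has_vd (SU k. (kk k s <.> z s + (SU l. gg k l s * (Cc l s <.> q s))) *R Cc k s)) (at s within S)"
  and "(q has_vd (- RR s (z s) - (SU k. (Cc k s <.> q s) *R kk k s))) (at s within S)"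
proof -
 have sI: "s : I" using s S by blast
 let ?x = "fst (de s)" and ?p = "snd (de s)"
 have zU: "gz s : U \<times> UNIV" by (rule gU(2)[OF sI])
 have XH': "FD XH (gz s) h = (FD Hp (gz s) h, - FD Hy (gz s) h)" for h
 proof -
  have "(XH has_derivative (%h. (FD Hp (gz s) h, - FD Hy (gz s) h))) (at (gz s))" unfolding XH_def[abs_def]
   by (intro has_derivative_Pair has_derivative_minus smooth_on_has_derivative[OF smooth_Hp zU] smooth_on_has_derivative[OF smooth_Hy zU])
  thus ?thesis by (rule fun_cong[OF frechet_derivative_at, symmetric])
 qed
 let ?x' = "FD Hp (gz s) (?x, ?p)" and ?p' = "- FD Hy (gz s) (?x, ?p)"
 have xd: "((%s. fst (de s)) has_vd ?x') (at s within S)"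
  using bounded_linear.has_vector_derivative[OF bounded_linear_fst de] by (simp add: XH')
 have pd: "((%s. snd (de s)) has_vd ?p') (at s within S)"
  using bounded_linear.has_vector_derivative[OF bounded_linear_snd de] by (simp add: XH')
 have Phz: "Ph s (z s) = ?x" by (simp add: z_def Ph_inv(2)[OF sI sI])
 have "(z has_vd - inv (Ph s) (A s ?x) + inv (Ph s) ?x') (at s within S)" unfolding z_def
 proof (rule linear_apply_has_vector_derivative[OF _ _ s _ xd])
  show "linear (inv (Ph s))" if "s : S" for s using Ph_inv(1) that S by blast
  show "linear (%u. - inv (Ph s) (A s u))"
   using linear_compose_neg[OF linear_compose[OF A_linear[OF sI] Ph_inv(1)[OF sI sI]]] by (simp add: o_def)
  show "((%s. inv (Ph s) b) has_vd - inv (Ph s) (A s b)) (at s within S)" for b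
   by (rule has_vector_derivative_at_within[OF Ph_inv_deriv[OF sI]])
 qed
 \<comment> \<open>The term with \<open>A s\<close> cancels against the derivative of the inverse of
   \<open>Ph\<close>; what remains is the coupling and the control response.\<close>
 moreover have "- inv (Ph s) (A s ?x) + inv (Ph s) ?x' = inv (Ph s) (fl (ga s) (kt s ?x) + fl (ga s) (W s (pull (ga s) ?p)))"
  unfolding Hp_deriv[OF sI] by (simp add: linear_add[OF Ph_inv(1)[OF sI sI]] add.assoc)
 moreover have "... = (SU k. (kk k s <.> z s + (SU l. gg k l s * (Cc l s <.> q s))) *R Cc k s)"
  by (simp add: fl_expand[OF sI] linear_add[OF Ph_inv(1)[OF sI sI]] Ph_inv(3)[OF sI sI] W_expand[OF sI] kk_inner[OF sI] Phz q_def
    scaleR_add_left sum.distrib)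
 ultimately show "(z has_vd (SU k. (kk k s <.> z s + (SU l. gg k l s * (Cc l s <.> q s))) *R Cc k s)) (at s within S)"
  by (simp only:)
 show "(q has_vd (- RR s (z s) - (SU k. (Cc k s <.> q s) *R kk k s))) (at s within S)"
 proof (rule has_vector_derivative_vecI)
  fix i
  let ?a = "Ph s (axis i 1)"
  have "((%s. Ph s (axis i 1) <.> snd (de s)) has_vd ?a <.> ?p' + A s ?a <.> ?p) (at s within S)"
   by (rule bounded_bilinear.has_vector_derivative[OF bounded_bilinear_inner has_vector_derivative_at_within[OF Ph_deriv[OF sI]] pd])
  moreover have "?a <.> ?p' + A s ?a <.> ?p = - (RR s (z s) $ i) - ?p <.> fl (ga s) (kt s ?a)"
   using Hy_deriv[OF sI, of ?a ?x ?p] by (simp add: RR_def Phz inner_add_right inner_commute)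
  moreover have "?p <.> fl (ga s) (kt s ?a) = (SU k. (Cc k s <.> q s) * kk k s $ i)"
   by (simp add: fl_expand[OF sI] coad_inner[OF sI, symmetric] q_def inner_sum_right kk_def inner_commute mult.commute)
  ultimately show "((%s. q s $ i) has_vd (- RR s (z s) - (SU k. (Cc k s <.> q s) *R kk k s)) $ i) (at s within S)"
   by (simp add: q_def coad_def)
 qed
qed

lemma Hp_quadratic: assumes s: "s : I"
 shows "p <.> FD Hp (gz s) (0, p) =
  (SU k. SU l. gg k l s * (Cc k s <.> coad s p) * (Cc l s <.> coad s p))"
proof -
 have "p <.> FD Hp (gz s) (0, p) = p <.> fl (ga s) (W s (pull (ga s) p))"
  by (simp add: Hp_deriv[OF s] linear_0[OF A_linear[OF s]] linear_0[OF kt_linear[OF s]] linear_0[OF fl_linear[OF gU(1)[OF s]]])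
 also have "... = (SU k. SU l. gg k l s * (Cc k s <.> coad s p) * (Cc l s <.> coad s p))"
  by (simp add: fl_expand[OF s] coad_inner[OF s, symmetric] inner_sum_right W_expand[OF s] sum_distrib_left sum_distrib_right
    inner_commute[of "coad s p"] mult_ac)
 finally show ?thesis .
qed

text \<open>For a frame orthonormal in the Hessian of L, the dual frame is the image of the frame
  under the Hessian, so the inverse metric is the identity.\<close>

lemma gg_at_0:
 assumes "!!l m. e 0 (axis l 1) <.> (Lmat (ga 0, ust (gz 0)) *v e 0 (axis m 1)) = (if l = m then 1 else 0)"
 shows "gg l m 0 = (if l = m then 1 else 0)"
proof -
 have s: "0 : I" using ta by simp
 let ?h = "Lmat (ga 0, ust (gz 0)) *v e 0 (axis m 1)"
 have "hv 0 m <.> v = ?h <.> v" for v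
 proof -
  have "v = e 0 (SU l. (inv (e 0) v $ l) *R axis l 1)"
   using e_inv(2)[OF s s, of v] axis_expansion[of "inv (e 0) v"] by simp
  hence "?h <.> v = ?h <.> (SU l. (inv (e 0) v $ l) *R e 0 (axis l 1))"
   by (simp add: linear_sum[OF e(1)[OF s]] linear_scale[OF e(1)[OF s]])
  also have "... = inv (e 0) v $ m" by (simp add: inner_sum_right inner_commute[of ?h] assms if_distrib cong: if_cong)
  finally show ?thesis by (simp add: hv_inner[OF s])
 qed
 hence "hv 0 m = ?h" using vector_eq_rdot by blast
 hence "gg l m 0 = inv (e 0) (e 0 (axis m 1)) $ l" by (simp add: gg_def W_props(2)[OF s])
 thus ?thesis by (simp add: e_inv(3)[OF s s] axis_def)
qed

text \<open>Compactness of a closed subinterval; the third bound is the Lipschitz bound of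
  \<open>gg\<close> started from its value at 0.\<close>

lemma frame_coefficients_bound:
 assumes "!!l m. gg l m 0 = (if l = m then 1 else 0)" and de: "0 < de" "de < ta"
 obtains c where "!!k s. s : {0..de} ==> norm (kk k s) <= c"
  "!!s v. s : {0..de} ==> norm (RR s v) <= c * norm v"
  "!!k l s. s : {0..de} ==> \<bar>gg k l s - (if k = l then 1 else 0)\<bar> <= c * s"
proof -
 have oI: "open I" by simp
 have J: "{0..de} <= I" using de by auto
 have bnd: "EX c>=0. ALL s:{0..de}. norm (g s) <= c" if "smooth_on I g" for g :: "real => 'q::real_normed_vector"
 proof -
  have "bounded (g ` {0..de})"
   by (intro compact_imp_bounded compact_continuous_image continuous_on_subset[OF smooth_on_continuous[OF that] J]) simp
  then obtain c where "c > 0" "ALL s:{0..de}. norm (g s) <= c" unfolding bounded_pos by blast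
  thus ?thesis by (intro exI[of _ c]) auto
 qed
 have kts: "smooth_on I (%s. kt s (x s))" if x: "smooth_on I x" for x unfolding kt_def
  by (intro smooth_on_diff oI smooth_on_frechet_apply[OF oI oU smooth_ust smooth_gz] smooth_on_frechet_apply[OF oI N(1) w(1) smooth_graph]
    smooth_on_Pair smooth_on_const x) (use gU N(3) in auto)
 have kks: "smooth_on I (kk k)" for k unfolding kk_def[abs_def]
  by (intro smooth_on_components_vec oI smooth_on_component smooth_e_inv kts smooth_Ph)
 have RRs: "smooth_on I (%s. RR s v)" for v unfolding RR_def
  by (intro smooth_on_components_vec oI smooth_on_inner smooth_Ph smooth_on_frechet_apply[OF oI oU smooth_Hy smooth_gz] smooth_on_Pair smooth_on_const)
   (use gU in auto)
 have hvs: "smooth_on I (%s. hv s m)" for m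
  unfolding hv_def by (intro smooth_on_components_vec oI smooth_on_component smooth_e_inv smooth_on_const)
 have ggs: "smooth_on I (gg k l)" for k l
  unfolding gg_def[abs_def] by (intro oI smooth_on_component smooth_e_inv smooth_W hvs)
 have "ALL k. EX c>=0. ALL s:{0..de}. norm (kk k s) <= c" using bnd[OF kks] by blast
 then obtain ck where ck: "!!k. ck k >= 0" "!!k s. s : {0..de} ==> norm (kk k s) <= ck k" by metis
 have "ALL b. EX c>=0. ALL s:{0..de}. norm (RR s b) <= c" using bnd[OF RRs] by blast
 then obtain cr where cr: "!!b. cr b >= 0" "!!b s. s : {0..de} ==> norm (RR s b) <= cr b" by metis
 have "EX c>=0. ALL s:{0..de}. \<bar>gg k l s - (if k = l then 1 else 0)\<bar> <= c * s" for k l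
 proof -
  obtain c where c: "c >= 0" "!!x y. x : {0..de} ==> y : {0..de} ==> norm (gg k l y - gg k l x) <= c * norm (y - x)"
   by (rule C1_lipschitz[OF smooth_onD[OF ggs[of k l]] _ _ J]) (auto intro: that)
  have "\<bar>gg k l s - (if k = l then 1 else 0)\<bar> <= c * s" if "s : {0..de}" for s
   using c(2)[of 0 s] that de by (simp add: assms(1))
  thus ?thesis using c(1) by blast
 qed
 hence "ALL k l. EX c>=0. ALL s:{0..de}. \<bar>gg k l s - (if k = l then 1 else 0)\<bar> <= c * s" by blast
 then obtain cg where cg: "!!k l. cg k l >= 0" "!!k l s. s : {0..de} ==> \<bar>gg k l s - (if k = l then 1 else 0)\<bar> <= cg k l * s" by metis
 define c where "c = (SU k. ck k) + (SUM b:Basis. cr b) + (SU k. SU l. cg k l)"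
 have sums: "(SU k. ck k) >= 0" "(SUM b:Basis. cr b) >= 0" "(SU k. SU l. cg k l) >= 0"
  by (auto intro!: sum_nonneg ck cr cg)
 have RRl: "linear (RR s)" if "s : I" for s
 proof -
  have l: "linear (%z. FD Hy (gz s) (Ph s z, 0))"
   using linear_compose[OF Ph_linear[OF that] has_derivative_linear[OF has_derivative_slice(2)[OF smooth_on_has_derivative[OF smooth_Hy gU(2)[OF that]]]]]
   by (simp add: o_def)
  show ?thesis
   unfolding RR_def[abs_def] by (intro linearI) (simp_all add: vec_eq_iff linear_add[OF l] linear_scale[OF l] inner_add_right)
 qed
 show thesis
 proof (rule that[of c])
  fix k s assume s: "s : {0..de}"
  have "ck k <= (SU k. ck k)" by (rule member_le_sum) (auto intro: ck)
  thus "norm (kk k s) <= c" using ck(2)[OF s, of k] sums unfolding c_def by linarith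
 next
  fix s v assume s: "s : {0..de}"
  have "norm (RR s v) <= (SUM b:Basis. cr b) * norm v"
   by (rule linear_norm_le_sum_Basis[OF RRl cr(2)[OF s]]) (use s J in auto)
  also have "... <= c * norm v" using sums by (intro mult_right_mono) (auto simp: c_def)
  finally show "norm (RR s v) <= c * norm v" .
 next
  fix k l s assume s: "s : {0..de}"
  have "cg k l <= (SU l. cg k l)" by (rule member_le_sum) (auto intro: cg)
  also have "... <= (SU k. SU l. cg k l)" by (rule member_le_sum) (auto intro!: cg sum_nonneg)
  finally have "cg k l <= c" using sums by (simp add: c_def)
  hence "cg k l * s <= c * s" using s by (intro mult_right_mono) auto
  thus "\<bar>gg k l s - (if k = l then 1 else 0)\<bar> <= c * s" using cg(2)[OF s, of k l] by linarith
 qed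
qed

end

section \<open>The quadratic form of the cost in an adapted frame\<close>

context framed_geodesic begin

lemma coad_linear: "linear (coad s)" unfolding coad_def by (intro linearI) (simp_all add: vec_eq_iff inner_add_right)

lemma coad_eq_0: assumes s: "s : I" and 0: "coad s p = 0" shows "p = 0"
proof -
 have "p <.> u = 0" for u using coad_inner[OF s, of p "inv (Ph s) u"] 0 by (simp add: Ph_inv(2)[OF s s])
 thus ?thesis by (metis inner_eq_zero_iff)
qed

text \<open>The Hessian of L at the initial control in frame components, the inner product in which
  the adapted frame is made orthonormal.\<close>

lemma control_form: "positive_form (%b b'. e 0 b <.> (Lmat (ga 0, ust (gz 0)) *v e 0 b'))"
proof -
 have s: "0 : I" using ta by simp
 have y: "ga 0 : U" by (rule gU(1)[OF s])
 show ?thesis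
 proof (rule positive_form.intro)
  show "linear (%v. e 0 v <.> (Lmat (ga 0, ust (gz 0)) *v e 0 w))" for w
   by (intro linearI) (simp_all add: linear_add[OF e(1)[OF s]] linear_scale[OF e(1)[OF s]] inner_add_left)
  show "e 0 v <.> (Lmat (ga 0, ust (gz 0)) *v e 0 w) = e 0 w <.> (Lmat (ga 0, ust (gz 0)) *v e 0 v)" for v w
   unfolding Lmat_mult[OF y] by (rule second_derivative_symmetric_real[OF oU smooth_onD[OF L]]) (use y in simp)
  show "0 < e 0 v <.> (Lmat (ga 0, ust (gz 0)) *v e 0 v)" if "v ~= 0" for v unfolding Lmat_mult[OF y]
   using that e(1,2)[OF s] by (intro L_pos[OF y]) (metis injD linear_0)
 qed
qed

text \<open>A constant change of basis of the control space, by which the adapted basis replaces the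
  standard one.\<close>

lemma reframed:
 assumes B: "linear B" "inj B"
 shows "framed_geodesic U f L ga et ta N w Ph (%t b. e t (B b))"
proof (rule framed_geodesic.intro[OF local_control_axioms framed_geodesic_axioms.intro])
 show "linear (%b. e t (B b))" if "t : I" for t using linear_compose[OF B(1) e(1)[OF that]] by (simp add: o_def)
 show "inj (%b. e t (B b))" if "t : I" for t using inj_compose[OF e(2)[OF that] B(2)] by (simp add: o_def)
 show "smooth_on I (%t. e t (B b))" for b by (rule e(3))
qed (use ta geo N w Ph Ph0 Ph_linear in auto)

text \<open>The vectors \<open>v k\<close> of nonempty rows are the order 0 part of the adapted
  basis. They span the distribution, are orthonormal for the inner product given by the Hessian of
  H, and diagonalize the limit form.\<close>

theorem cost_form_asymptotics:
 assumes "geodesic_cost U f L ga et a S K ka ep r"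
  and growth: "!!i. \<forall>\<^sub>F s in at_right 0. dim (curve_flag Cc i s) = dim (curve_flag Cc i 0)"
  and m: "curve_flag Cc m 0 = UNIV"
 obtains nw :: "'r => nat" and v :: "'r => real^'n" and bt :: "real => 'r => 'r => real"
 where "inj_on v {k. 0 < nw k}" "independent (v ` {k. 0 < nw k})"
  "!!p. FD Hp (gz 0) (0, p) = (\<Sum>k | 0 < nw k. (v k <.> p) *R v k)"
  "range (fl (ga 0)) = span (v ` {k. 0 < nw k})"
  "!!i. dim (curve_flag Cc i 0) = card {(k, j). j < nw k & j < i}"
  "card {(k, j). j < nw k} = CARD('n)"
  "!!t k l. bt t k l = bt t l k"
  "\<forall>\<^sub>F t in at_right 0. ALL c. hess (%x. deriv (%s. - S s x (ga s)) t) (ga 0) (\<Sum>k | 0 < nw k. c k *R v k) =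
   (\<Sum>k | 0 < nw k. \<Sum>l | 0 < nw l. c k * c l * bt t k l)"
  "!!k l. 0 < nw k ==> 0 < nw l ==> ((%t. t\<^sup>2 * bt t k l) ---> (if k = l then (real (nw k))\<^sup>2 else 0)) (at_right 0)"
proof -
 interpret G: geodesic_cost U f L ga et a S K ka ep r by fact
 have s0: "0 : I" using ta by simp
 have oI: "open I" by simp
 obtain b :: "'r => real^'r" and nw :: "'r => nat" and D :: "nat => 'r => real^'n" where
  on: "!!k l. e 0 (b k) <.> (Lmat (ga 0, ust (gz 0)) *v e 0 (b l)) = (if k = l then 1 else 0)"
  and all: "!!v. EX c. v = (SU k. c k *R b k)"
  and nwm: "!!k. nw k <= m"
  and D: "!!j k. D j k = (SU l. (b k $ l) *R nth_vderiv j (Cc l) 0)"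
  and rel: "!!j k. nw k <= j ==> D j k : span ((%(k, j). D j k) ` {(k, j'). j' < nw k & j' < j})"
  and inj: "inj_on (%(k, j). D j k) {(k, j). j < nw k}"
  and ind: "independent ((%(k, j). D j k) ` {(k, j). j < nw k})"
  and sp: "span ((%(k, j). D j k) ` {(k, j). j < nw k}) = UNIV"
  and dims: "!!i. dim (curve_flag Cc i 0) = card {(k, j). j < nw k & j < i}"
  by (rule adapted_frame_of_flag[OF control_form oI s0 smooth_Cc growth m]) (rule that; assumption)
 define B where "B c = (SU k. (c $ k) *R b k)" for c :: "real^'r"
 have Bl: "linear B" unfolding B_def by (intro linearI) (simp_all add: scaleR_add_left sum.distrib scaleR_sum_right)
 have "surj B"
 proof (rule surjI)
  show "B (\<chi> k. (SOME c. v = (SU k. c k *R b k)) k) = v" for v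
   unfolding B_def using someI_ex[OF all[of v]] by simp
 qed
 hence Bi: "inj B" using Bl linear_surjective_imp_injective by blast
 have Bax: "B (axis k 1) = b k" for k by (simp add: B_def axis_def if_distrib[of "%x. x *R _"] cong: if_cong)
 interpret E: framed_geodesic U f L ga et ta N w Ph "%t c. e t (B c)" by (rule reframed[OF Bl Bi])
 have Ccb: "E.Cc k t = (SU l. (b k $ l) *R Cc l t)" if t: "t : I" for k t
 proof -
  have "e t (b k) = (SU l. (b k $ l) *R e t (axis l 1))"
   by (subst axis_expansion[of "b k"]) (simp add: linear_sum[OF e(1)[OF t]] linear_scale[OF e(1)[OF t]])
  thus ?thesis using fl_linear[OF gU(1)[OF t]] Ph_inv(1)[OF t t]
   by (simp add: E.Cc_def Cc_def Bax linear_sum linear_scale)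
 qed
 \<comment> \<open>The frame was adapted through combinations of derivatives of the old curves;
   these are the derivatives of the curves of the new frame.\<close>
 have Dn: "D j k = nth_vderiv j (E.Cc k) 0" for j k
 proof -
  have "nth_vderiv j (E.Cc k) 0 = nth_vderiv j (%t. SU l. (b k $ l) *R Cc l t) 0"
   by (rule nth_vderiv_cong[OF oI _ Ccb s0]) (intro smooth_on_sum smooth_on_scaleR oI smooth_on_const smooth_Cc)
  also have "... = D j k" unfolding D by (rule nth_vderiv_sum_scaleR[OF oI smooth_Cc s0])
  finally show ?thesis by simp
 qed
 have Cc0: "E.Cc k 0 = D 0 k" for k by (simp add: Dn)
 define de where "de = min 1 (ta / 2)"
 have de: "0 < de" "de <= 1" "de < ta" using ta by (auto simp: de_def)
 have "ALL k. EX rh>=0. ALL s:{0..de}. norm (E.Cc k s - (\<Sum>j<m. (s ^ j / fact j) *R D j k)) <= rh * s ^ m"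
  unfolding Dn by (intro allI taylor_bound_right[OF oI _ E.smooth_Cc]) (use de in auto)
 from choice[OF this] obtain rhf where "ALL k. rhf k >= 0 & (ALL s:{0..de}. norm (E.Cc k s - (\<Sum>j<m. (s ^ j / fact j) *R D j k)) <= rhf k * s ^ m)" ..
 hence rhf: "rhf k >= 0" "s : {0..de} ==> norm (E.Cc k s - (\<Sum>j<m. (s ^ j / fact j) *R D j k)) <= rhf k * s ^ m" for k s
  by auto
 define rh where "rh = (SU k. rhf k)"
 interpret Q: adapted_curves E.Cc nw m D de rh
 proof
  fix k s assume s: "s : {0..de}"
  have "rhf k <= rh" unfolding rh_def by (rule member_le_sum) (auto intro: rhf)
  hence "rhf k * s ^ m <= rh * s ^ m" using s by (intro mult_right_mono) auto
  thus "norm (E.Cc k s - (\<Sum>j<m. (s ^ j / fact j) *R D j k)) <= rh * s ^ m" using rhf(2)[OF s, of k] by linarith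
 qed (use de nwm rel inj ind sp in auto)
 have gg0: "E.gg l m 0 = (if l = m then 1 else 0)" for l m by (rule E.gg_at_0) (simp add: Bax on)
 obtain c1 where c1: "!!k s. s : {0..de} ==> norm (E.kk k s) <= c1"
  "!!s v. s : {0..de} ==> norm (E.RR s v) <= c1 * norm v"
  "!!k l s. s : {0..de} ==> \<bar>E.gg k l s - (if k = l then 1 else 0)\<bar> <= c1 * s"
  by (rule E.frame_coefficients_bound[OF gg0 de(1,3)]) (rule that; assumption)
 define K0 where "K0 = {k. 0 < nw k}"
 define v where "v = D 0"
 \<comment> \<open>For an empty row \<open>rel\<close> places the vector in the span of the empty
   set.\<close>
 have v0: "v k = 0" if "k ~: K0" for k using rel[of k 0] that by (simp add: K0_def v_def)
 have emb: "v k = (%(k, j). D j k) (k, 0)" "k : K0 \<longleftrightarrow> (k, 0) : {(k, j). j < nw k}" for k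
  by (auto simp: v_def K0_def)
 have vinj: "inj_on v K0"
 proof (rule inj_onI)
  fix k l assume "k : K0" "l : K0" "v k = v l"
  hence "(k, 0 :: nat) = (l, 0)" using inj_onD[OF inj, of "(k, 0)" "(l, 0)"] by (simp add: v_def K0_def)
  thus "k = l" by simp
 qed
 have vind: "independent (v ` K0)" by (rule independent_mono[OF ind]) (use emb in "auto simp: v_def K0_def")
 have coad0: "E.coad 0 p = p" for p by (simp add: E.coad_def Ph0 vec_eq_iff inner_axis')
 have sumK0: "(SU k. g k *R v k) = (SUM k:K0. g k *R v k)" for g :: "'r => real"
  by (rule sum.mono_neutral_right) (auto simp: v0)
 have fle: "fl (ga 0) x = (SU l. (inv (%c. e 0 (B c)) x $ l) *R v l)" for x
  using E.fl_expand[OF s0, of x] by (simp add: Ph0 Cc0 v_def)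
 have hp: "FD Hp (gz 0) (0, p) = (SUM k:K0. (v k <.> p) *R v k)" for p
 proof -
  have "FD Hp (gz 0) (0, p) = fl (ga 0) (E.W 0 (pull (ga 0) p))"
   by (simp add: E.Hp_deriv[OF s0] linear_0[OF E.A_linear[OF s0]] linear_0[OF E.kt_linear[OF s0]] linear_0[OF fl_linear[OF gU(1)[OF s0]]])
  also have "... = (SU k. (v k <.> p) *R v k)"
   by (simp add: fle E.W_expand[OF s0] gg0 coad0 Cc0 v_def[symmetric] if_distrib[of "%x. x * _"] cong: if_cong)
  finally show ?thesis by (simp add: sumK0)
 qed
 have rng: "range (fl (ga 0)) = span (v ` K0)"
 proof
  show "range (fl (ga 0)) <= span (v ` K0)"
  proof
   fix y assume "y : range (fl (ga 0))"
   then obtain x where "y = fl (ga 0) x" by blast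
   hence "y = (SUM l:K0. (inv (%c. e 0 (B c)) x $ l) *R v l)" by (simp add: fle sumK0)
   thus "y : span (v ` K0)" by (simp add: span_sum span_scale span_base)
  qed
  have "v k : range (fl (ga 0))" for k
  proof
   have "fl (ga 0) (e 0 (b k)) = E.Cc k 0"
    using Ph_inv(2)[OF s0 s0, of "fl (ga 0) (e 0 (b k))"] by (simp add: E.Cc_def Bax Ph0)
   thus "v k = fl (ga 0) (e 0 (b k))" by (simp add: Cc0 v_def)
  qed simp
  thus "span (v ` K0) <= range (fl (ga 0))"
   by (intro span_minimal linear_subspace_image[OF fl_linear[OF gU(1)[OF s0]]]) auto
 qed
 have card: "card {(k, j). j < nw k} = CARD('n)"
 proof -
  have "CARD('n) = dim (UNIV :: (real^'n) set)" by simp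
  also have "... = card ((%(k, j). D j k) ` {(k, j). j < nw k})" using dim_span_eq_card_independent[OF ind] sp by simp
  also have "... = card {(k, j). j < nw k}" by (rule card_image[OF inj])
  finally show ?thesis by simp
 qed
 let ?hess = "%t v. hess (%x. deriv (%s. - S s x (ga s)) t) (ga 0) v"
 let ?Q = "%t x. EX de. G.jacobi t de & fst (de t) = 0 & fst (de 0) = x &
   ?hess t x = snd (de t) <.> FD Hp (gz t) (0, snd (de t))"
 obtain t1 where t1: "0 < t1" "!!t. 0 < t ==> t < t1 ==>
  ALL de. G.jacobi t de --> fst (de t) = 0 --> fst (de 0) = 0 --> snd (de t) = 0 ==> ALL x. ?Q t x"
  by (rule G.cost_hessian) (rule that; assumption)
 obtain t2 where t2: "0 < t2" "!!t z q. 0 < t ==> t <= t2 ==> Q.solves E.kk E.gg E.RR t z q ==> z 0 = 0 ==> q t = 0"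
  by (rule Q.terminal_map_injective[of E.kk c1 E.RR E.gg, OF c1]) (assumption | (rule that; assumption))+
 define t3 where "t3 = min (min t1 t2) ta"
 have t3: "0 < t3" "t3 <= t1" "t3 <= t2" "t3 <= ta" using t1 t2 ta by (auto simp: t3_def)
 have tI: "t : I" "{0..t} <= I" if "0 < t" "t < t3" for t using that t3 by auto
 have sol: "Q.solves E.kk E.gg E.RR t (%s. inv (Ph s) (fst (de s))) (%s. E.coad s (snd (de s)))"
  if t: "0 < t" "t < t3" and j: "G.jacobi t de" and e0: "fst (de t) = 0" for t de unfolding Q.solves_def
 proof (intro conjI ballI)
  show "inv (Ph t) (fst (de t)) = 0" using linear_0[OF Ph_inv(1)[OF tI(1) tI(1)]] t e0 by simp
  fix s assume s: "s : {0..t}"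
  have d: "(de has_vd FD XH (gz s) (de s)) (at s within {0..t})" using j s by (simp add: G.jacobi_def)
  show "((%s. inv (Ph s) (fst (de s))) has_vector_derivative
    (SU k. (E.kk k s <.> inv (Ph s) (fst (de s)) + (SU l. E.gg k l s * (E.Cc l s <.> E.coad s (snd (de s))))) *R E.Cc k s)) (at s within {0..t})"
   by (rule E.jacobi_in_frame(1)[OF s tI(2)[OF t] d])
  show "((%s. E.coad s (snd (de s))) has_vector_derivative
    (- E.RR s (inv (Ph s) (fst (de s))) - (SU k. (E.Cc k s <.> E.coad s (snd (de s))) *R E.kk k s))) (at s within {0..t})"
   by (rule E.jacobi_in_frame(2)[OF s tI(2)[OF t] d])
 qed
 \<comment> \<open>The Gram estimate excludes conjugate times, which is the hypothesis of
   \<open>cost_hessian\<close>.\<close>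
 have nondeg: "snd (de t) = 0" if t: "0 < t" "t < t3" and j: "G.jacobi t de" "fst (de t) = 0" "fst (de 0) = 0" for t de
 proof -
  have "E.coad t (snd (de t)) = 0"
   using t2(2)[OF t(1) _ sol[OF t j(1,2)]] t t3 j(3) linear_0[OF Ph_inv(1)[OF s0 s0]] by simp
  thus ?thesis by (rule E.coad_eq_0[OF tI(1)[OF t]])
 qed
 have ex: "?Q t x" if t: "0 < t" "t < t3" for t x by (rule t1(2)[THEN spec]) (use t t3 nondeg[OF t] in auto)
 define J where "J t x = (SOME de. G.jacobi t de & fst (de t) = 0 & fst (de 0) = x &
   ?hess t x = snd (de t) <.> FD Hp (gz t) (0, snd (de t)))" for t x
 have J: "G.jacobi t (J t x)" "fst (J t x t) = 0" "fst (J t x 0) = x"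
  "?hess t x = snd (J t x t) <.> FD Hp (gz t) (0, snd (J t x t))" if "0 < t" "t < t3" for t x
  using someI_ex[OF ex[OF that, of x], folded J_def] by auto
 define Wf where "Wf k t = E.coad t (snd (J t (v k) t))" for k t
 define bt0 where "bt0 t k l = (SU i. SU j. E.gg i j t * (E.Cc i t <.> Wf k t) * (E.Cc j t <.> Wf l t))" for t k l
 \<comment> \<open>\<open>bt0\<close> rests on a choice of Jacobi fields and its symmetry is not
   evident; symmetrizing leaves the quadratic form unchanged.\<close>
 define bt where "bt t k l = (bt0 t k l + bt0 t l k) / 2" for t k l
 have Wsol: "\<forall>\<^sub>F t in at_right 0. EX z q. Q.solves E.kk E.gg E.RR t z q & z 0 = D 0 k & q t = Wf k t" for k
  unfolding eventually_at_right_field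
 proof (intro exI[of _ t3] conjI t3(1) allI impI)
  fix t assume t: "0 < t" "t < t3"
  have "inv (Ph 0) x = x" for x using Ph_inv(3)[OF s0 s0, of x] by (simp add: Ph0)
  thus "EX z q. Q.solves E.kk E.gg E.RR t z q & z 0 = D 0 k & q t = Wf k t" using sol[OF t J(1,2)[OF t], of "v k"]
   by (intro exI[of _ "%s. inv (Ph s) (fst (J t (v k) s))"] exI[of _ "%s. E.coad s (snd (J t (v k) s))"])
    (simp add: J(3)[OF t] Wf_def v_def)
 qed
 have lim0: "((%t. t\<^sup>2 * bt0 t k l) ---> (if k = l then (real (nw k))\<^sup>2 else 0)) (at_right 0)" if "0 < nw k" "0 < nw l" for k l
  unfolding bt0_def by (rule Q.terminal_cost_asymptotics[of E.kk c1 E.RR E.gg, OF c1 that Wsol Wsol])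
 have lim: "((%t. t\<^sup>2 * bt t k l) ---> (if k = l then (real (nw k))\<^sup>2 else 0)) (at_right 0)" if "0 < nw k" "0 < nw l" for k l
  using tendsto_divide[OF tendsto_add[OF lim0[OF that] lim0[OF that(2,1)]] tendsto_const[of "2 :: real"]]
  by (auto simp: bt_def add_divide_distrib distrib_left split: if_splits)
 have quad: "?hess t (SUM k:K0. c k *R v k) = (SUM k:K0. SUM l:K0. c k * c l * bt t k l)" if t: "0 < t" "t < t3" for t c
 proof -
  let ?x = "SUM k:K0. c k *R v k"
  \<comment> \<open>The field chosen for a combination differs from the combination of the chosen
    fields by a Jacobi field whose base component vanishes at both ends, so terminal covectors are
    linear in c.\<close>
  let ?de = "%s. J t ?x s - (SUM k:K0. c k *R J t (v k) s)"
  have Jl: "linear (FD XH (gz s))" if "s : {0..t}" for s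
   using has_derivative_linear[OF smooth_on_has_derivative[OF smooth_XH gU(2)]] that tI(2)[OF t] by blast
  have "G.jacobi t ?de" unfolding G.jacobi_def
  proof
   fix s assume s: "s : {0..t}"
   have d: "(J t x has_vd FD XH (gz s) (J t x s)) (at s within {0..t})" for x
    using J(1)[OF t, of x] s by (simp add: G.jacobi_def)
   have "(?de has_vd FD XH (gz s) (J t ?x s) -
     (SUM k:K0. c k *R FD XH (gz s) (J t (v k) s))) (at s within {0..t})"
    by (intro has_vector_derivative_diff has_vector_derivative_sum d bounded_linear.has_vector_derivative[OF bounded_linear_scaleR_right d])
   thus "(?de has_vd FD XH (gz s) (?de s)) (at s within {0..t})"
    by (simp add: linear_diff[OF Jl[OF s]] linear_sum[OF Jl[OF s]] linear_scale[OF Jl[OF s]])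
  qed
  moreover have "fst (?de t) = 0" "fst (?de 0) = 0" by (simp_all add: fst_sum J(2,3)[OF t])
  ultimately have "snd (?de t) = 0" by (rule nondeg[OF t])
  hence q: "E.coad t (snd (J t ?x t)) = (SUM k:K0. c k *R Wf k t)"
   by (simp add: snd_sum Wf_def linear_sum[OF E.coad_linear] linear_scale[OF E.coad_linear])
  have "?hess t ?x = (SU i. SU j. E.gg i j t * (E.Cc i t <.> (SUM k:K0. c k *R Wf k t)) * (E.Cc j t <.> (SUM k:K0. c k *R Wf k t)))"
   unfolding J(4)[OF t] E.Hp_quadratic[OF tI(1)[OF t]] q ..
  also have "... = (SU i. SU j. SUM k:K0. SUM l:K0. c k * c l * (E.gg i j t * (E.Cc i t <.> Wf k t) * (E.Cc j t <.> Wf l t)))"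
  proof (intro sum.cong refl)
   fix i j
   have "(E.Cc i t <.> (SUM k:K0. c k *R Wf k t)) * (E.Cc j t <.> (SUM k:K0. c k *R Wf k t)) =
     (SUM k:K0. SUM l:K0. (c k * (E.Cc i t <.> Wf k t)) * (c l * (E.Cc j t <.> Wf l t)))"
    by (simp only: inner_sum_right inner_scaleR_right sum_product)
   thus "E.gg i j t * (E.Cc i t <.> (SUM k:K0. c k *R Wf k t)) * (E.Cc j t <.> (SUM k:K0. c k *R Wf k t)) =
     (SUM k:K0. SUM l:K0. c k * c l * (E.gg i j t * (E.Cc i t <.> Wf k t) * (E.Cc j t <.> Wf l t)))"
    by (simp add: mult.assoc sum_distrib_left) (simp add: mult_ac)
  qed
  also have "... = (SUM k:K0. SUM l:K0. SU i. SU j. c k * c l * (E.gg i j t * (E.Cc i t <.> Wf k t) * (E.Cc j t <.> Wf l t)))"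
   by (simp only: sum.swap[of _ UNIV K0])
  also have "... = (SUM k:K0. SUM l:K0. c k * c l * bt0 t k l)" by (simp only: bt0_def sum_distrib_left)
  finally have 1: "?hess t ?x = (SUM k:K0. SUM l:K0. c k * c l * bt0 t k l)" .
  also have 2: "... = (SUM k:K0. SUM l:K0. c k * c l * bt0 t l k)"
   by (subst sum.swap) (simp only: mult.commute[of "c _" "c _"])
  have "2 * (SUM k:K0. SUM l:K0. c k * c l * bt t k l) = (SUM k:K0. SUM l:K0. c k * c l * bt0 t k l) + (SUM k:K0. SUM l:K0. c k * c l * bt0 t l k)"
  proof -
   have "2 * (c k * c l * bt t k l) = c k * c l * bt0 t k l + c k * c l * bt0 t l k" for k l
    by (simp add: bt_def field_simps)
   thus ?thesis by (simp only: sum_distrib_left sum.distrib)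
  qed
  thus ?thesis using 1 2 by linarith
 qed
 show thesis
 proof (rule that[of v nw bt, folded K0_def])
  show "inj_on v K0" "independent (v ` K0)" "range (fl (ga 0)) = span (v ` K0)" by fact+
  show "bt t k l = bt t l k" for t k l by (simp add: bt_def add.commute)
  show "\<forall>\<^sub>F t in at_right 0. ALL c. ?hess t (SUM k:K0. c k *R v k) = (SUM k:K0. SUM l:K0. c k * c l * bt t k l)"
   unfolding eventually_at_right_field using quad t3(1) by blast
 qed (use hp dims card lim in auto)
qed

end

section \<open>The flow of the driving field\<close>

context control_system begin

lemma frame_chart:
 fixes ga :: "real => 'm" and p :: 'm
 assumes "frame_along P T ga N E"
 defines "N1 \<equiv> {(t, y). y : cU p & (t, chart_inv P p y) : N}"
  and "ev \<equiv> %t y b. triv P p (chart_inv P p y) (E t (chart_inv P p y) b)"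
 shows "open N1" "smooth_on N1 (%z. ev (fst z) (snd z) b)"
  "z : N1 ==> linear (ev (fst z) (snd z))" "z : N1 ==> inj (ev (fst z) (snd z))"
proof -
 have N: "open N" and E: "!!t x. (t, x) : N ==> linear (E t x) & bij (E t x)"
  and sm: "smooth_on ((%(t, x). (t, chart P p x)) ` (N Int UNIV \<times> (chart_dom P p Int triv_dom P p)))
    (%(t, y). triv P p (chart_inv P p y) (E t (chart_inv P p y) b))" using assms unfolding frame_along_def by blast+
 have "cU p <= chart P p ` chart_dom P p" by (auto simp: cU_def nbd_def)
 hence c: "continuous_on (UNIV \<times> cU p) (%z :: real \<times> _. (fst z, chart_inv P p (snd z)))"
  by (intro continuous_intros continuous_on_compose2[OF continuous_chart_inv]) auto
 have "open ((%z. (fst z, chart_inv P p (snd z))) -` N Int UNIV \<times> cU p)"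
  using continuous_on_open_vimage[OF open_Times[OF open_UNIV cU_open]] c N by blast
 also have "(%z. (fst z, chart_inv P p (snd z))) -` N Int UNIV \<times> cU p = N1" by (auto simp: N1_def)
 finally show "open N1" .
 have "(%(t, x). (t, chart P p x)) ` (N Int UNIV \<times> (chart_dom P p Int triv_dom P p)) = N1"
 proof (intro equalityI subsetI)
  fix z assume "z : N1"
  thus "z : (%(t, x). (t, chart P p x)) ` (N Int UNIV \<times> (chart_dom P p Int triv_dom P p))"
   using cU_inv[of "snd z" p] nbdD by (intro image_eqI[of _ _ "(fst z, chart_inv P p (snd z))"]) (auto simp: N1_def)
 next
  fix z assume "z : (%(t, x). (t, chart P p x)) ` (N Int UNIV \<times> (chart_dom P p Int triv_dom P p))"
  thus "z : N1" by (auto simp: N1_def cU_def nbd_def)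
 qed
 thus "smooth_on N1 (%z. ev (fst z) (snd z) b)" using sm by (simp add: ev_def case_prod_unfold)
 assume "z : N1"
 hence z: "(fst z, chart_inv P p (snd z)) : N" "chart_inv P p (snd z) : triv_dom P p"
  using cU_inv(1)[of "snd z" p] nbdD(2) by (auto simp: N1_def)
 show "linear (ev (fst z) (snd z))"
  using linear_compose[OF conjunct1[OF E[OF z(1)]] triv(3)[OF z(2)]] by (simp add: ev_def o_def)
 show "inj (ev (fst z) (snd z))"
  using inj_compose[OF bij_is_inj[OF triv(4)[OF z(2)]] bij_is_inj[OF conjunct2[OF E[OF z(1)]]]] by (simp add: ev_def o_def)
qed

text \<open>\<open>arg_max\<close> is a choice: it is a maximizer because one exists, and the
  maximizer is unique in coordinates.\<close>

lemma max_control_eq: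
 assumes x: "x : nbd p" shows "triv P p x (max_control P x et) = C.ust p (chart P p x, cocoord P p x et)"
proof -
 let ?g = "%u. et <.> dyn P x u - lagr P x u" and ?xi = "cocoord P p x et"
 have y: "chart P p x : cU p" by (rule chart_cU[OF x])
 have eq: "?g (ctl p x w) = ?xi <.> cf p (chart P p x, w) - cL p (chart P p x, w)" for w
  using of_cocoord_inner[OF nbdD(1)[OF x], of ?xi "dyn P x (ctl p x w)"]
  by (simp add: cf_chart[OF x] cL_chart[OF x] of_cocoord_cocoord[OF nbdD(1)[OF x]])
 have eq': "?g u = ?xi <.> cf p (chart P p x, triv P p x u) - cL p (chart P p x, triv P p x u)" for u
  using eq[of "triv P p x u"] by (simp add: ctl(4)[OF x])
 have "is_arg_max ?g (%_. True) (ctl p x (C.ust p (chart P p x, ?xi)))"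
  unfolding is_arg_max_linorder using C.H_ge[OF y, of ?xi] by (simp add: eq' ctl(3)[OF x] C.H_def)
 hence "is_arg_max ?g (%_. True) (max_control P x et)" unfolding max_control_def arg_max_def by (rule someI)
 hence "?g (ctl p x w) <= ?g (max_control P x et)" for w by (simp add: is_arg_max_linorder)
 thus ?thesis
  using C.ust_unique[OF y, of ?xi "triv P p x (max_control P x et)"] unfolding eq eq' ctl(3)[OF x] by blast
qed

text \<open>A competitor cannot leave the coordinate ball
  that contains the reference solution.\<close>

lemma integral_curve_unique:
 fixes c :: "real => 'm" and ps :: "real => real^'n" and X :: "real => 'm => real^'n" and F :: "real \<times> (real^'n) => real^'n"
 assumes S: "open S" "smooth_on S F" and rh: "cball y0 rh <= cU p"
  and X: "!!s x. x : nbd p ==> s : closed_segment 0 t ==> (s, x) : N ==> (s, chart P p x) : S & tcoord P p x (X s x) = F (s, chart P p x)"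
  and ps: "!!s. s : closed_segment 0 t ==> (s, ps s) : S & (ps has_vd F (s, ps s)) (at s within closed_segment 0 t)"
  and psb: "!!s. s : closed_segment 0 t ==> dist y0 (ps s) < rh"
  and c: "!!s. s : closed_segment 0 t ==> (s, c s) : N & has_velocity P c (X s (c s)) s (closed_segment 0 t)"
  and c0: "c 0 = chart_inv P p (ps 0)"
 shows "c t = chart_inv P p (ps t)"
proof -
 \<comment> \<open>The sign of t. Reversing negative times lets initial segments and exit times be
   used for either sign.\<close>
 define si :: real where "si = (if 0 <= t then 1 else -1)"
 have seg: "closed_segment 0 t = (%s. si * s) ` {0..\<bar>t\<bar>}"
 proof (cases "0 <= t")
  case True thus ?thesis by (auto simp: si_def closed_segment_eq_real_ivl)
 next
  case False
  hence "x : (%s. - s) ` {0..- t}" if "t <= x" "x <= 0" for x using that by (intro image_eqI[of _ _ "- x"]) auto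
  thus ?thesis using False by (auto simp: si_def closed_segment_eq_real_ivl)
 qed
 have st: "si * \<bar>t\<bar> = t" by (simp add: si_def)
 have mem: "si * s : closed_segment 0 t" if "s : {0..\<bar>t\<bar>}" for s using that unfolding seg by blast
 have chain: "((%s. g (si * s)) has_vd si *R g') (at s within {0..\<bar>t\<bar>})"
  if "(g has_vd g') (at (si * s) within closed_segment 0 t)" for g :: "real => real^'n" and g' s
 proof -
  have "((%s. si * s) has_vd si) (at s within {0..\<bar>t\<bar>})"
   by (auto intro!: derivative_eq_intros simp: has_real_derivative_iff_has_vector_derivative[symmetric])
  from vector_diff_chain_within[OF this that[unfolded seg]] show ?thesis by (simp add: o_def)
 qed
 let ?c = "%s. c (si * s)" and ?Y = "%z :: real \<times> (real^'n). si *R (1 :: real, F z)"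
 have agree: "chart P p (?c s) = ps (si * s)" if s: "0 <= s" "s <= \<bar>t\<bar>" and cn: "?c ` {0..s} <= nbd p" for s
 proof -
  have sub: "{0..s} <= {0..\<bar>t\<bar>}" using s by auto
  have pair: "((%s. (si * s, g (si * s))) has_vd ?Y (si * s', g (si * s'))) (at s' within {0..s})"
   if "(g has_vd F (si * s', g (si * s'))) (at (si * s') within closed_segment 0 t)" for g :: "real => real^'n" and s'
  proof -
   have "((%s. si * s) has_vd si *R 1) (at s' within {0..s})"
    by (auto intro!: derivative_eq_intros simp: has_real_derivative_iff_has_vector_derivative[symmetric])
   from has_vector_derivative_Pair[OF this has_vector_derivative_within_subset[OF chain[OF that] sub]]
   show ?thesis by (simp add: scaleR_Pair)
  qed
  have "(si * s, chart P p (?c s)) = (si * s, ps (si * s))"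
  proof (rule ode_unique[where X="?Y" and S=S and a=0 and b=s and ?t0.0=0
    and ?y1.0="%s. (si * s, chart P p (?c s))" and ?y2.0="%s. (si * s, ps (si * s))"])
   show "Ck_on (Suc 0) S ?Y" by (rule smooth_onD) (intro smooth_on_scaleR smooth_on_Pair smooth_on_const S)
   fix s' assume s': "s' : {0..s}"
   have m: "si * s' : closed_segment 0 t" using s' sub by (intro mem) auto
   have n: "?c s' : nbd p" using cn s' by blast
   have cN: "(si * s', ?c s') : N" and vel: "has_velocity P c (X (si * s') (?c s')) (si * s') (closed_segment 0 t)"
    using c[OF m] by auto
   note Xs = X[OF n m cN]
   have "((%s. chart P p (c s)) has_vd F (si * s', chart P p (?c s'))) (at (si * s') within closed_segment 0 t)"
    using vel has_velocity_iff[where c=c and t="si * s'" and p=p, OF nbdD(1)[OF n] m] Xs by simp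
   from pair[OF this] Xs
   show "(si * s', chart P p (?c s')) : S & ((%s. (si * s, chart P p (?c s))) has_vd ?Y (si * s', chart P p (?c s'))) (at s' within {0..s})"
    by simp
   show "(si * s', ps (si * s')) : S & ((%s. (si * s, ps (si * s))) has_vd ?Y (si * s', ps (si * s'))) (at s' within {0..s})"
    using ps[OF m] pair[of ps s'] by simp
  next
   have "ps 0 : cU p" using psb[of 0] rh by (auto simp: subset_iff)
   thus "(si * 0, chart P p (?c 0)) = (si * 0, ps (si * 0))" by (simp add: c0 cU_inv)
  qed (use S s in auto)
  thus ?thesis by simp
 qed
 have ps0: "ps 0 : cU p" "dist y0 (ps 0) < rh" using psb[of 0] rh by (auto simp: subset_iff)
 have cc: "continuous_on {0..\<bar>t\<bar>} ?c"
 proof (rule continuous_on_compose2[where g=c and t="closed_segment 0 t"])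
  show "continuous_on (closed_segment 0 t) c"
   using c by (auto simp: continuous_on_eq_continuous_within has_velocity_def)
 qed (use mem in "auto intro!: continuous_intros")
 show ?thesis
 proof (rule first_exit[OF cc _ rh])
  show "?c 0 : nbd p" "dist y0 (chart P p (?c 0)) < rh" using cU_inv[OF ps0(1)] ps0(2) by (simp_all add: c0)
 next
  assume cn: "?c ` {0..\<bar>t\<bar>} <= nbd p"
  hence "c t : nbd p" using st by (metis abs_ge_zero atLeastAtMost_iff image_subset_iff order_refl)
  thus "c t = chart_inv P p (ps t)" using agree[OF _ _ cn] st by (metis abs_ge_zero chart_inv_chart nbdD(1) order_refl)
 next
  \<comment> \<open>Up to the exit the two curves agree, so the reference solution would be at
    distance rh, although it stays strictly inside.\<close>
  fix s assume s: "0 < s" "s <= \<bar>t\<bar>" and cn: "?c ` {0..s} <= nbd p" and eq: "dist y0 (chart P p (?c s)) = rh"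
  have "dist y0 (ps (si * s)) < rh" by (rule psb[OF mem]) (use s in auto)
  thus "c t = chart_inv P p (ps t)" using agree[OF _ s(2) cn] s(1) eq by simp
 qed simp
qed


text \<open>Translates the flag, defined by a flow on the manifold, into the data of
  \<open>framed_geodesic\<close>. The flow is given by a definite description, so near the geodesic
  both existence and uniqueness of integral curves in N are required.\<close>

lemma pulled_field_in_chart:
 fixes ga :: "real => 'm" and N :: "(real \<times> 'm) set" and E :: "real => 'm => real^'r => real^'r"
 assumes fr: "frame_along P T ga N E" and T: "0 < T" and ga: "ham_curve P ga et"
 defines "p \<equiv> ga 0"
 obtains ta N' w Ph e where
  "framed_geodesic (cU p) (cf p) (cL p) (%t. chart P p (ga t)) (%t. cocoord P p (ga t) (et t)) ta N' w Ph e"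
  "!!t l. t : {-ta<..<ta} ==> pulled_field P N E ga et l t = inv (Ph t) (C.fl p (chart P p (ga t)) (e t (axis l 1)))"
proof -
 let ?ci = "chart_inv P p"
 define g where "g t = chart P p (ga t)" for t
 define h where "h t = cocoord P p (ga t) (et t)" for t
 define N1 where "N1 = {(t, y). y : cU p & (t, ?ci y) : N}"
 define ev where "ev t y b = triv P p (?ci y) (E t (?ci y) b)" for t y b
 have oN1: "open N1" unfolding N1_def by (rule frame_chart(1)[OF fr])
 have evs: "smooth_on N1 (%z. ev (fst z) (snd z) b)" for b
  unfolding N1_def ev_def[abs_def] by (rule frame_chart(2)[OF fr])
 have evl: "linear (ev (fst z) (snd z))" "inj (ev (fst z) (snd z))" if "z : N1" for z
  using frame_chart(3,4)[OF fr, where p=p and z=z] that unfolding N1_def ev_def[abs_def] by blast+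
 have oN: "open N" and N0: "(0, ga 0) : N" and El: "!!t x. (t, x) : N ==> linear (E t x) & bij (E t x)"
  using fr T unfolding frame_along_def by auto
 have "continuous (at 0) ga" using ga by (simp add: ham_curve_def has_velocity_def)
 hence lim: "(ga ---> ga 0) (at 0)" by (simp add: continuous_within)
 have "((%t. (t, ga t)) ---> (0, ga 0)) (at 0)" by (intro tendsto_Pair tendsto_ident_at lim)
 hence "\<forall>\<^sub>F t in at 0. (t, ga t) : N" by (rule topological_tendstoD[OF _ oN N0])
 moreover have "\<forall>\<^sub>F t in at 0. ga t : nbd p" by (rule topological_tendstoD[OF lim nbd(2)]) (simp add: p_def nbd(1))
 ultimately have "\<forall>\<^sub>F t in at 0. (t, ga t) : N & ga t : nbd p" by (rule eventually_conj)
 then obtain ta0 where ta0: "ta0 > 0" and near: "!!t. t ~= 0 ==> \<bar>t\<bar> < ta0 ==> (t, ga t) : N & ga t : nbd p"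
  unfolding eventually_at by (auto simp: dist_real_def)
 let ?I = "{-ta0<..<ta0}"
 have gaN: "(t, ga t) : N" "ga t : nbd p" if "t : ?I" for t
  using near[of t] that N0 nbd(1)[of p] by (cases "t = 0"; auto simp: p_def)+
 have gi: "?ci (g t) = ga t" "g t : cU p" if "t : ?I" for t using gaN(2)[OF that] by (auto simp: g_def nbdD chart_cU)
 have gN1: "(t, g t) : N1" if "t : ?I" for t using gi[OF that] gaN(1)[OF that] by (simp add: N1_def)
 have geo: "((%t. (g t, h t)) has_vd C.XH p (g t, h t)) (at t)" if "t : ?I" for t
  unfolding g_def h_def by (rule ham_curve_in_chart[OF ga gaN(2)[OF that]])
 have oI: "open ?I" by simp
 have gzs: "smooth_on ?I (%t. (g t, h t))"
  by (rule smooth_onI, rule Ck_on_autonomous_solution[OF oI C.oU smooth_onD[OF C.smooth_XH] _ geo]) (use gi in auto)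
 have gs: "smooth_on ?I g" using smooth_on_linear_compose[OF oI bounded_linear_fst gzs] by simp
 have graph: "smooth_on ?I (%t. (t, g t))" by (intro smooth_on_Pair oI smooth_on_ident gs)
 define e where "e t b = ev t (g t) b" for t b
 have es: "smooth_on ?I (%t. e t b)" for b
 proof -
  have "(%t. (t, g t)) ` ?I <= N1" using gN1 by blast
  from smooth_on_compose[OF oI oN1 graph evs[of b] this] show ?thesis by (simp add: e_def)
 qed
 have el: "linear (e t)" "inj (e t)" if "t : ?I" for t using evl[OF gN1[OF that]] by (simp_all add: e_def[abs_def])
 \<comment> \<open>Frame components of the maximizing control. They depend on time only; combined
   with the frame at other points they give the feedback \<open>w\<close>, the control behind the
   driving field.\<close>
 define al where "al t = inv (e t) (C.ust p (g t, h t))" for t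
 have us: "smooth_on ?I (%t. C.ust p (g t, h t))"
  by (rule smooth_on_compose[OF oI C.oU gzs C.smooth_ust]) (use gi in auto)
 have als: "smooth_on ?I al" unfolding al_def[abs_def] by (rule smooth_on_inv_apply[OF oI el es us])
 have eal: "e t (al t) = C.ust p (g t, h t)" if "t : ?I" for t
  unfolding al_def by (rule linear_inv_eq(2)[OF el[OF that]])
 define w where "w z = ev (fst z) (snd z) (al (fst z))" for z
 define N2 where "N2 = N1 Int ?I \<times> UNIV"
 have oN2: "open N2" unfolding N2_def by (intro open_Int oN1 open_Times_UNIV oI)
 have ws: "smooth_on N2 w" unfolding w_def[abs_def]
 proof (rule smooth_on_linear_apply[OF oN2, where G="%z. ev (fst z) (snd z)" and x="%z. al (fst z)"])
  show "linear (ev (fst z) (snd z))" if "z : N2" for z using evl(1)[of z] that by (simp add: N2_def)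
  show "smooth_on N2 (%z. ev (fst z) (snd z) b)" for b by (rule smooth_on_subset[OF evs]) (simp add: N2_def)
  show "smooth_on N2 (%z. al (fst z))"
   by (rule smooth_on_compose[OF oN2 oI smooth_on_bounded_linear[OF bounded_linear_fst] als]) (auto simp: N2_def)
 qed
 have N2U: "N2 <= UNIV \<times> cU p" by (auto simp: N2_def N1_def)
 define F where "F = (%(t, y). cf p (y, w (t, y)))"
 have Fs: "smooth_on N2 F"
 proof -
  have "smooth_on N2 (%z. cf p (snd z, w z))"
   by (rule smooth_on_compose[OF oN2 C.oU smooth_on_Pair[OF oN2 smooth_on_bounded_linear[OF bounded_linear_snd] ws] smooth_cf])
    (use N2U in auto)
  thus ?thesis by (simp add: F_def case_prod_unfold)
 qed
 obtain rh where rh: "rh > 0" "cball (g 0) rh <= cU p"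
 proof -
  have "g 0 : cU p" using gi(2)[of 0] ta0 by simp
  thus thesis using open_contains_cball[THEN iffD1, OF cU_open] that by blast
 qed
 define S where "S = N2 Int UNIV \<times> ball (g 0) rh"
 have oS: "open S" unfolding S_def by (intro open_Int oN2 open_Times) auto
 have z0S: "(0, g 0) : S" using gN1[of 0] ta0 rh by (simp add: S_def N2_def)
 \<comment> \<open>Time is adjoined as a coordinate of unit speed, so that the autonomous flow
   theorem applies.\<close>
 define X where "X z = (1 :: real, F z)" for z
 have Xs: "smooth_on S X"
  unfolding X_def[abs_def] by (intro smooth_on_Pair oS smooth_on_const smooth_on_subset[OF Fs]) (simp add: S_def)
 obtain r ep ph Ps where fb: "flow_box X S (0, g 0) r ep ph Ps" by (rule local_flow[OF oS z0S smooth_onD[OF Xs]])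
 interpret F: flow_box X S "(0, g 0)" r ep ph Ps by (rule fb)
 note r = F.r and eps = F.eps and ph0 = F.ph0 and phS = F.phS and phd = F.phd and phD = F.phD and Ps0 = F.Ph0 and Psd = F.Phd
 have const: "k s = k 0" if "s : {-ep<..<ep}" "!!s. s : {-ep<..<ep} ==> (k has_vd 0) (at s)" for k :: "real => real" and s
 proof -
  have "EX c. ALL x:{-ep<..<ep}. k x = c"
   by (rule has_derivative_zero_constant) (use that(2) in "auto simp: has_vector_derivative_def intro: has_derivative_at_withinI")
  thus ?thesis using that(1) eps by auto
 qed
 have phfst: "fst (ph s z) = fst z + s" if s: "s : {-ep<..<ep}" and z: "z : ball (0, g 0) r" for s z
 proof -
  have "fst (ph s z) - s = fst (ph 0 z) - 0"
  proof (rule const[OF s, of "%s. fst (ph s z) - s"])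
   fix s assume s: "s : {-ep<..<ep}"
   have "((%s. fst (ph s z)) has_vd 1) (at s)"
    using bounded_linear.has_vector_derivative[OF bounded_linear_fst phd[OF s z]] by (simp add: X_def)
   from has_vector_derivative_diff[OF this has_vector_derivative_id]
   show "((%s. fst (ph s z) - s) has_vd 0) (at s)" by simp
  qed
  thus ?thesis by (simp add: ph0[OF z])
 qed
 define ps where "ps s y = snd (ph s (0, y))" for s y
 have B: "(0, y) : ball (0, g 0) r" if "y : ball (g 0) r" for y :: "real^'n" using that by (simp add: dist_Pair_Pair)
 have pheq: "ph s (0, y) = (s, ps s y)" if "s : {-ep<..<ep}" "y : ball (g 0) r" for s y
  using phfst[OF that(1) B[OF that(2)]] by (simp add: ps_def prod_eq_iff)
 have psS: "(s, ps s y) : S" and psd: "((%s. ps s y) has_vd F (s, ps s y)) (at s)"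
  if s: "s : {-ep<..<ep}" and y: "y : ball (g 0) r" for s y
 proof -
  show "(s, ps s y) : S" using phS[OF s B[OF y]] by (simp add: pheq[OF s y])
  show "((%s. ps s y) has_vd F (s, ps s y)) (at s)"
   using bounded_linear.has_vector_derivative[OF bounded_linear_snd phd[OF s B[OF y]]]
   unfolding ps_def[symmetric] X_def snd_conv pheq[OF s y] .
 qed
 have ps0: "ps 0 y = y" if "y : ball (g 0) r" for y using ph0[OF B[OF that]] by (simp add: ps_def)
 have g0B: "g 0 : ball (g 0) r" using r by simp
 define Ph where "Ph t v = snd (Ps t (0, g 0) (0, v))" for t v
 have isC: "isCont g 0" using smooth_on_continuous[OF gs] ta0 oI by (simp add: continuous_on_eq_continuous_at)
 from this[unfolded continuous_at_eps_delta, rule_format, OF rh(1)]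
 obtain d where d: "d > 0" "!!s. \<bar>s\<bar> < d ==> g s : ball (g 0) rh" by (auto simp: dist_real_def dist_commute)
 define ta where "ta = min (min ta0 ep) d"
 have ta: "0 < ta" "ta <= ta0" "ta <= ep" "ta <= d" using ta0 eps d by (auto simp: ta_def)
 have tI: "t : ?I" "t : {-ep<..<ep}" if "t : {-ta<..<ta}" for t using that ta by auto
 have gF: "(g has_vd F (t, g t)) (at t)" if "t : {-ta<..<ta}" for t
  using bounded_linear.has_vector_derivative[OF bounded_linear_fst geo[OF tI(1)[OF that]]] eal[OF tI(1)[OF that]]
  by (simp add: C.XH_def C.Hp_def F_def w_def e_def)
 have gS: "(t, g t) : S" if "t : {-ta<..<ta}" for t
 proof -
  have "\<bar>t\<bar> < d" using that ta by (simp add: abs_less_iff)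
  thus ?thesis using gN1[OF tI(1)[OF that]] tI(1)[OF that] d(2)[of t] by (simp add: S_def N2_def)
 qed
 \<comment> \<open>The geodesic is an integral curve of the driving field because \<open>w\<close>
   agrees with the maximizing control on it.\<close>
 have psg: "ps t (g 0) = g t" if t: "t : {-ta<..<ta}" for t
 proof -
  have sub: "s : {-ta<..<ta}" if "s : {min 0 t..max 0 t}" for s using that t by auto
  have pair: "((%s. (s, k s)) has_vd X (s, k s)) (at s within J)"
   if "(k has_vd F (s, k s)) (at s)" for k s J
   using has_vector_derivative_Pair[OF has_vector_derivative_id that] by (auto simp: X_def intro: has_vector_derivative_at_within)
  have "(t, ps t (g 0)) = (t, g t)"
  proof (rule ode_unique[OF oS smooth_onD[OF Xs], where a="min 0 t" and b="max 0 t" and ?t0.0=0 and s=t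
    and ?y1.0="%s. (s, ps s (g 0))" and ?y2.0="%s. (s, g s)"])
   fix s assume "s : {min 0 t..max 0 t}"
   hence s: "s : {-ta<..<ta}" by (rule sub)
   show "(s, ps s (g 0)) : S & ((%s. (s, ps s (g 0))) has_vd X (s, ps s (g 0))) (at s within {min 0 t..max 0 t})"
    using psS[OF tI(2)[OF s] g0B] pair[OF psd[OF tI(2)[OF s] g0B]] by blast
   show "(s, g s) : S & ((%s. (s, g s)) has_vd X (s, g s)) (at s within {min 0 t..max 0 t})"
    using gS[OF s] pair[OF gF[OF s]] by blast
  qed (use ps0[OF g0B] in auto)
  thus ?thesis by simp
 qed
 have Psfst: "Ps t (0, g 0) (0, v) = (0, Ph t v)" and Phd: "((%t. Ph t v) has_vd FD F (t, g t) (0, Ph t v)) (at t)"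
  if t: "t : {-ta<..<ta}" for t v
 proof -
  have XF: "FD X z u = (0, FD F z u)" if "z : S" for z u
  proof -
   have "(F has_derivative FD F z) (at z)" by (rule smooth_on_has_derivative[OF Fs]) (use that in "simp add: S_def")
   hence "(X has_derivative (%u. (0, FD F z u))) (at z)"
    unfolding X_def[abs_def] by (intro has_derivative_Pair has_derivative_const)
   thus ?thesis by (rule fun_cong[OF frechet_derivative_at, symmetric])
  qed
  have d: "((%s. Ps s (0, g 0) (0, v)) has_vd (0, FD F (ph s (0, g 0)) (Ps s (0, g 0) (0, v)))) (at s)"
   if s: "s : {-ep<..<ep}" for s using Psd[OF s B[OF g0B], of "(0, v)"] XF[OF phS[OF s B[OF g0B]]] by simp
  have "fst (Ps t (0, g 0) (0, v)) = fst (Ps 0 (0, g 0) (0, v))"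
   by (rule const[OF tI(2)[OF t]]) (use bounded_linear.has_vector_derivative[OF bounded_linear_fst d] in simp)
  thus eq: "Ps t (0, g 0) (0, v) = (0, Ph t v)" by (simp add: Ps0[OF B[OF g0B]] Ph_def prod_eq_iff)
  show "((%t. Ph t v) has_vd FD F (t, g t) (0, Ph t v)) (at t)"
   using bounded_linear.has_vector_derivative[OF bounded_linear_snd d[OF tI(2)[OF t]]]
   by (simp add: Ph_def[symmetric] eq pheq[OF tI(2)[OF t] g0B] psg[OF t])
 qed
 have psD: "(ps t has_derivative Ph t) (at (g 0))" if t: "t : {-ta<..<ta}" for t
 proof -
  have "((%y. (0 :: real, y)) has_derivative (%v. (0, v))) (at (g 0))" by (auto intro!: derivative_eq_intros)
  from diff_chain_at[OF this phD[OF tI(2)[OF t] B[OF g0B]]]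
  have "((%y. ph t (0, y)) has_derivative (%v. Ps t (0, g 0) (0, v))) (at (g 0))" by (simp add: o_def)
  from has_derivative_snd[OF this] show ?thesis by (simp add: ps_def[abs_def] Ph_def[abs_def])
 qed
 have fg: "framed_geodesic (cU p) (cf p) (cL p) g h ta N2 w Ph e"
 proof (rule framed_geodesic.intro[OF C.local_control_axioms framed_geodesic_axioms.intro])
  show "0 < ta" "open N2" "N2 <= UNIV \<times> cU p" "smooth_on N2 w" by fact+
  fix t assume t: "t : {-ta<..<ta}"
  show "g t : cU p & ((%t. (g t, h t)) has_vd C.XH p (g t, h t)) (at t)" using gi geo tI(1)[OF t] by blast
  show "(t, g t) : N2" using gS[OF t] by (simp add: S_def)
  show "w (t, g t) = C.ust p (g t, h t)" using eal[OF tI(1)[OF t]] by (simp add: w_def e_def)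
  show "((%t. Ph t v) has_vd FD (%(t, y). cf p (y, w (t, y))) (t, g t) (0, Ph t v)) (at t)" for v
   using Phd[OF t, of v] by (simp only: F_def)
  show "linear (Ph t)" by (rule has_derivative_linear[OF psD[OF t]])
  show "linear (e t)" "inj (e t)" by (rule el[OF tI(1)[OF t]])+
 next
  show "Ph 0 v = v" for v by (simp add: Ph_def Ps0[OF B[OF g0B]])
  show "smooth_on {-ta<..<ta} (%t. e t b)" for b by (rule smooth_on_subset[OF es]) (use ta in auto)
 qed
 let ?D = "driving_field P E ga et"
 have drive: "tcoord P p x (?D s x) = F (s, chart P p x)" if s: "s : ?I" and x: "x : nbd p" "(s, x) : N" for s x
 proof -
  let ?a = "inv (E s (ga s)) (max_control P (ga s) (et s))"
  have E1: "linear (E s (ga s))" "bij (E s (ga s))" using El[OF gaN(1)[OF s]] by auto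
  have "e s ?a = triv P p (ga s) (max_control P (ga s) (et s))"
   by (simp add: e_def ev_def gi(1)[OF s] surj_f_inv_f[OF bij_is_surj[OF E1(2)]])
  also have "... = e s (al s)" unfolding eal[OF s] max_control_eq[OF gaN(2)[OF s]] g_def h_def ..
  finally have a: "?a = al s" using el(2)[OF s] by (simp add: inj_eq)
  have E2: "linear (E s x)" using El[OF x(2)] by simp
  have "?D s x = dyn P x (E s x (al s))"
  proof -
   have "(SU i. (al s $ i) *R lin_part P x (E s x (axis i 1))) = lin_part P x (E s x (al s))"
   proof -
    have "E s x (al s) = E s x (SU i. (al s $ i) *R axis i 1)" by (rule arg_cong[OF axis_expansion])
    thus ?thesis
     by (simp add: linear_sum[OF E2] linear_scale[OF E2] linear_sum[OF lin_part_linear] linear_scale[OF lin_part_linear])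
   qed
   thus ?thesis by (simp add: driving_field_def Let_def a dyn_eq[of x "E s x (al s)"])
  qed
  also have "tcoord P p x ... = cf p (chart P p x, triv P p x (E s x (al s)))" by (simp add: cf_chart[OF x(1)] ctl(4)[OF x(1)])
  also have "... = F (s, chart P p x)" using nbdD(1)[OF x(1)] by (simp add: F_def w_def ev_def)
  finally show ?thesis .
 qed
 \<comment> \<open>The description is resolved for all starting points in a ball, not only for that
   of the geodesic, since the flow is differentiated in space afterwards.\<close>
 have flow: "flow0 P N ?D t (?ci y) = ?ci (ps t y)" if t: "t : {-ta<..<ta}" and y: "y : ball (g 0) r" for t y
 proof -
  have seg: "s : {-ta<..<ta}" if "s : closed_segment 0 t" for s
   using that t by (auto simp: closed_segment_eq_real_ivl split: if_splits)
  have psU: "ps s y : cU p" "(s, ?ci (ps s y)) : N" "dist (g 0) (ps s y) < rh" if "s : closed_segment 0 t" for s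
   using psS[OF tI(2)[OF seg[OF that]] y] by (auto simp: S_def N2_def N1_def)
  have psw: "((%s. ps s y) has_vd F (s, ps s y)) (at s within closed_segment 0 t)" if "s : closed_segment 0 t" for s
   by (rule has_vector_derivative_at_within[OF psd[OF tI(2)[OF seg[OF that]] y]])
  have vel: "has_velocity P (%s. ?ci (ps s y)) (?D s (?ci (ps s y))) s (closed_segment 0 t)" if s: "s : closed_segment 0 t" for s
  proof -
   let ?x = "?ci (ps s y)"
   have x: "?x : nbd p" "chart P p ?x = ps s y" using cU_inv[OF psU(1)[OF s]] by auto
   have "ps s y : chart P p ` chart_dom P p" if "s : closed_segment 0 t" for s
    using psU(1)[OF that] by (auto simp: cU_def nbd_def)
   hence "has_velocity P (%s. ?ci (ps s y)) (chart_change P p ?x ?x (F (s, ps s y))) s (closed_segment 0 t)"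
    by (intro has_velocity_chart_inv[OF psw[OF s] _ s])
   moreover have "chart_change P p ?x ?x (F (s, ps s y)) = ?D s ?x"
    using drive[OF tI(1)[OF seg[OF s]] x(1) psU(2)[OF s]] tcoord_inverse(1)[OF nbdD(1)[OF x(1)]] by (metis x(2))
   ultimately show ?thesis by simp
  qed
  show ?thesis unfolding flow0_def
  proof (rule the_equality)
   show "EX c. c 0 = ?ci y & c t = ?ci (ps t y) & (ALL s:closed_segment 0 t. (s, c s) : N & has_velocity P c (?D s (c s)) s (closed_segment 0 t))"
    using psU(2) vel ps0[OF y] by (intro exI[of _ "%s. ?ci (ps s y)"]) auto
  next
   fix y' assume "EX c. c 0 = ?ci y & c t = y' & (ALL s:closed_segment 0 t. (s, c s) : N & has_velocity P c (?D s (c s)) s (closed_segment 0 t))"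
   then obtain c where c: "c 0 = ?ci y" "c t = y'" "!!s. s : closed_segment 0 t ==> (s, c s) : N & has_velocity P c (?D s (c s)) s (closed_segment 0 t)"
    by blast
   have "c t = ?ci (ps t y)"
   proof (rule integral_curve_unique[OF oN2 Fs rh(2), where X="?D" and N=N and t=t and c=c and ps="%s. ps s y"])
    fix s x assume "x : nbd p" "s : closed_segment 0 t" "(s, x) : N"
    thus "(s, chart P p x) : N2 & tcoord P p x (?D s x) = F (s, chart P p x)"
     using drive[OF tI(1)[OF seg]] tI(1)[OF seg] by (auto simp: N2_def N1_def chart_cU nbdD)
   next
    show "(s, ps s y) : N2 & ((%s. ps s y) has_vd F (s, ps s y)) (at s within closed_segment 0 t)" if "s : closed_segment 0 t" for s
     using psS[OF tI(2)[OF seg[OF that]] y] psw[OF that] by (simp add: S_def)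
    show "c 0 = ?ci (ps 0 y)" using c(1) ps0[OF y] by simp
   qed (use psU(3) c(3) in auto)
   thus "y' = ?ci (ps t y)" using c(2) by simp
  qed
 qed
 have pulled: "pulled_field P N E ga et l t = inv (Ph t) (C.fl p (g t) (e t (axis l 1)))" if t: "t : {-ta<..<ta}" for t l
 proof -
  interpret G: framed_geodesic "cU p" "cf p" "cL p" g h ta N2 w Ph e by (rule fg)
  let ?x = "ga t" and ?G = "flow0 P N ?D t"
  have x: "?x : nbd p" by (rule gaN(2)[OF tI(1)[OF t]])
  have xd: "?x : chart_dom P p" "?x : chart_dom P ?x" using nbdD(1)[OF x] chart_dom(1) by auto
  have 0: "chart P p p = g 0" "?ci (g 0) = p" using gi(1)[of 0] ta0 by (simp_all add: g_def p_def)
  have Gx: "?G p = ?x" using flow[OF t g0B] psg[OF t] gi(1)[OF tI(1)[OF t]] 0 by simp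
  have "(chart P ?x \<circ> ?ci has_derivative chart_change P p ?x ?x) (at (ps t (g 0)))"
   using transition_derivative[OF xd] by (simp only: psg[OF t]) (simp only: g_def)
  from diff_chain_at[OF psD[OF t] this]
  have "((%y. chart P ?x (?ci (ps t y))) has_derivative (%v. chart_change P p ?x ?x (Ph t v))) (at (g 0))" by (simp add: o_def)
  hence "((%y. chart P (?G p) (?G (?ci y))) has_derivative (%v. chart_change P p ?x ?x (Ph t v))) (at (g 0))"
   by (rule has_derivative_transform_within_open[OF _ open_ball g0B]) (simp add: flow[OF t] Gx)
  hence diff: "differential P ?G p = (%v. chart_change P p ?x ?x (Ph t v))"
   unfolding differential_def 0(1) by (rule frechet_derivative_at[symmetric])
  have inj: "inj (%v. chart_change P p ?x ?x (Ph t v))"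
  proof (rule injI)
   fix u v assume "chart_change P p ?x ?x (Ph t u) = chart_change P p ?x ?x (Ph t v)"
   hence "Ph t u = Ph t v" using tcoord_inverse(2)[OF xd(1)] by metis
   thus "u = v" using G.Ph_inj[OF t] by (simp add: inj_eq)
  qed
  let ?u = "E t ?x (axis l 1)"
  have "C.fl p (g t) (e t (axis l 1)) = tcoord P p ?x (lin_part P ?x ?u)"
   unfolding C.fl_def g_def cf_lin_part[OF x] using ctl(4)[OF x] gi(1)[OF tI(1)[OF t]] by (simp add: e_def ev_def)
  hence "chart_change P p ?x ?x (Ph t (inv (Ph t) (C.fl p (g t) (e t (axis l 1))))) = lin_part P ?x ?u"
   by (simp add: G.Ph_inv(2)[OF t t] tcoord_inverse(1)[OF xd(1)])
  thus ?thesis unfolding pulled_field_def p_def[symmetric] diff by (intro inv_f_eq[OF inj])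
 qed
 show thesis
  by (rule that[of ta N2 w Ph e]) (use fg pulled in "simp_all add: g_def[abs_def] h_def[abs_def]")
qed

end

section \<open>The asymptotic operator\<close>

locale dual_basis =
 fixes v u :: "'r::finite => real^'n" and K :: "'r set" and D :: "(real^'n) set"
 assumes D: "D = span (v ` K)"
  and dual: "!!k l. k : K ==> l : K ==> u k <.> v l = (if k = l then 1 else 0)"
begin

text \<open>Extension by 0 outside D follows the convention of \<open>Q_op\<close>, so that equality
  of functions can be proved.\<close>

definition op :: "('r => 'r => real) => real^'n => real^'n" where
 "op bt x = (if x : D then SUM a:K. (SUM b:K. bt a b * (u b <.> x)) *R v a else 0)"

lemma comb_in_D: "(SUM a:K. c a *R v a) : D" unfolding D by (intro span_sum span_scale span_base) auto

lemma coord_comb: "k : K ==> u k <.> (SUM a:K. c a *R v a) = c k"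
 by (simp add: inner_sum_right dual if_distrib cong: if_cong)

lemma expand: assumes "x : D" shows "x = (SUM a:K. (u a <.> x) *R v a)"
proof -
 have "x : range (%c. SUM y:v ` K. c y *R y)" using assms by (simp add: D span_finite)
 then obtain c where c: "x = (SUM y:v ` K. c y *R y)" by blast
 have "inj_on v K" using dual by (intro inj_onI) (metis zero_neq_one)
 hence "x = (SUM a:K. c (v a) *R v a)" unfolding c by (simp add: sum.reindex)
 thus ?thesis using coord_comb[of _ "%a. c (v a)"] by simp
qed

lemma D_subspace: "subspace D" by (simp add: D)

lemma op_coord: "x : D ==> k : K ==> u k <.> op bt x = (SUM b:K. bt k b * (u b <.> x))"
 by (simp add: op_def coord_comb)

lemma op_in_D: "op bt x : D" using comb_in_D subspace_0[OF D_subspace] by (simp add: op_def)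

end

locale dual_basis_form = dual_basis v u K D
 for v u :: "'r::finite => real^'n" and K :: "'r set" and D :: "(real^'n) set" +
 fixes ip :: "real^'n => real^'n => real"
 assumes ip: "!!x y. x : D ==> y : D ==> ip x y = (SUM k:K. (u k <.> x) * (u k <.> y))"
begin

lemma ip_op: "x : D ==> y : D ==> ip (op bt x) y = (SUM a:K. SUM b:K. bt a b * (u b <.> x) * (u a <.> y))"
 by (simp add: ip op_in_D op_coord sum_distrib_right)

lemma op_symmetric: assumes "!!a b. bt a b = bt b a" shows "symmetric_on D ip (op bt)" unfolding symmetric_on_def
proof (intro conjI ballI allI)
 fix x w assume x: "x : D" and w: "w : D"
 show "op bt x : D" by (rule op_in_D)
 have "ip x (op bt w) = ip (op bt w) x" by (simp add: ip x w op_in_D mult.commute)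
 also have "... = (SUM a:K. SUM b:K. bt a b * (u b <.> w) * (u a <.> x))" by (rule ip_op[OF w x])
 also have "... = ip (op bt x) w" unfolding ip_op[OF x w] by (subst sum.swap, intro sum.cong refl, subst assms) simp
 finally show "ip (op bt x) w = ip x (op bt w)" ..
 fix a b
 have "a *R x + b *R w : D" using x w D_subspace by (simp add: subspace_add subspace_scale)
 thus "op bt (a *R x + b *R w) = a *R op bt x + b *R op bt w"
  using x w by (simp add: op_def inner_add_right distrib_left sum.distrib scaleR_add_left scaleR_sum_right sum_distrib_left mult_ac)
qed

lemma eq_if_ip: assumes "x : D" "y : D" "!!w. w : D ==> ip x w = ip y w" shows "x = y"
proof -
 have "u k <.> x = u k <.> y" if k: "k : K" for k
 proof -
  have vk: "v k : D" using k by (simp add: D span_base)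
  have "ip z (v k) = u k <.> z" if "z : D" for z using k by (simp add: ip that vk dual if_distrib cong: if_cong)
  thus ?thesis using assms vk by metis
 qed
 thus ?thesis using expand[OF assms(1)] expand[OF assms(2)] by (metis (no_types, lifting) sum.cong)
qed

text \<open>Polarization: the quadratic form determines all pairings of a symmetric operator, and
  nondegeneracy of \<open>ip\<close> on D recovers the operator from them.\<close>

lemma the_operator:
 assumes sym: "!!a b. bt a b = bt b a"
  and q: "!!c. q (SUM k:K. c k *R v k) = (SUM k:K. SUM l:K. c k * c l * bt k l)"
 shows "(THE Q. symmetric_on D ip Q & (ALL x:D. q x = ip (Q x) x) & (ALL x. x ~: D --> Q x = 0)) = op bt"
proof (rule the_equality)
 have qop: "q x = ip (op bt x) x" if x: "x : D" for x
 proof -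
  have "q x = q (SUM k:K. (u k <.> x) *R v k)" using expand[OF x] by simp
  thus ?thesis unfolding q ip_op[OF x x] by (simp add: mult_ac)
 qed
 thus "symmetric_on D ip (op bt) & (ALL x:D. q x = ip (op bt x) x) & (ALL x. x ~: D --> op bt x = 0)"
  using op_symmetric[OF sym] by (simp add: op_def)
 have polar: "2 * ip (Q x) w = q (x + w) - q x - q w"
  if Q: "symmetric_on D ip Q" "!!x. x : D ==> q x = ip (Q x) x" and x: "x : D" and w: "w : D" for Q x w
 proof -
  have QD: "Q x : D" "Q w : D" and s: "ip (Q w) x = ip w (Q x)" and "Q (1 *R x + 1 *R w) = 1 *R Q x + 1 *R Q w"
   using Q(1) x w unfolding symmetric_on_def by blast+
  hence add: "Q (x + w) = Q x + Q w" by simp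
  have xw: "x + w : D" "Q x + Q w : D" using x w QD D_subspace by (simp_all add: subspace_add)
  have "q (x + w) = ip (Q x) x + ip (Q x) w + ip (Q w) x + ip (Q w) w"
   unfolding Q(2)[OF xw(1)] add ip[OF xw(2,1)] ip[OF QD(1) x] ip[OF QD(1) w] ip[OF QD(2) x] ip[OF QD(2) w]
   by (simp add: inner_add_right sum.distrib[symmetric] algebra_simps)
  moreover have "ip w (Q x) = ip (Q x) w" by (simp add: ip w QD mult.commute)
  ultimately show ?thesis by (simp add: s Q(2) x w)
 qed
 fix Q assume Q: "symmetric_on D ip Q & (ALL x:D. q x = ip (Q x) x) & (ALL x. x ~: D --> Q x = 0)"
 show "Q = op bt"
 proof
  fix x show "Q x = op bt x"
  proof (cases "x : D")
   case True
   show ?thesis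
   proof (rule eq_if_ip)
    show "Q x : D" using Q True by (simp add: symmetric_on_def)
    fix w assume w: "w : D"
    have "2 * ip (Q x) w = 2 * ip (op bt x) w"
     using polar[OF _ _ True w, of Q] polar[OF op_symmetric[OF sym] qop True w] Q by simp
    thus "ip (Q x) w = ip (op bt x) w" by simp
   qed (rule op_in_D)
  qed (use Q in "simp add: op_def")
 qed
qed

text \<open>The basis does not depend on t, so the limit of the operators is a limit of matrix
  entries.\<close>

lemma Lim_op:
 assumes Q: "\<forall>\<^sub>F t in at_right 0. Q t = op (bt t)"
  and lim: "!!k l. k : K ==> l : K ==> ((%t. t\<^sup>2 * bt t k l) ---> bt0 k l) (at_right 0)"
 shows "Lim (at_right 0) (%t. t\<^sup>2 *R Q t x) = op bt0 x"
proof (rule tendsto_Lim)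
 have "((%t. t\<^sup>2 *R op (bt t) x) ---> op bt0 x) (at_right 0)"
 proof (cases "x : D")
  case True
  have "((%t. SUM a:K. (SUM b:K. t\<^sup>2 * bt t a b * (u b <.> x)) *R v a) ---> (SUM a:K. (SUM b:K. bt0 a b * (u b <.> x)) *R v a)) (at_right 0)"
   by (intro tendsto_sum tendsto_scaleR tendsto_mult_right lim tendsto_const)
  thus ?thesis using True by (simp add: op_def scaleR_sum_right sum_distrib_left mult.assoc)
 qed (simp add: op_def)
 thus "((%t. t\<^sup>2 *R Q t x) ---> op bt0 x) (at_right 0)"
  by (rule Lim_transform_eventually) (use Q in "auto elim!: eventually_mono")
qed simp

end

text \<open>Equality of multisets in the form used later: squares for g give the trace, an indicator
  gives the multiplicities.\<close>

lemma sum_tableau_row: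
 fixes nw :: "'r::finite => nat" and g :: "nat => 'b::comm_monoid_add"
 assumes "!!i. ka i = card {(k, j). j < nw k & j < i}" "N = card {(k, j). j < nw k}" "K = card {k. 0 < nw k}"
 shows "(\<Sum>j = 1..K. g (tableau_row ka N j)) = (\<Sum>k | 0 < nw k. g (nw k))"
proof -
 have "(\<Sum>j = 1..K. g (tableau_row ka N j)) = sum_mset (image_mset g (image_mset (tableau_row ka N) (mset_set {1..K})))"
  by (simp add: sum_unfold_sum_mset multiset.map_comp o_def)
 also have "... = (\<Sum>k | 0 < nw k. g (nw k))"
  unfolding tableau_row_conjugate[OF assms] by (simp add: sum_unfold_sum_mset multiset.map_comp o_def)
 finally show ?thesis .
qed

context control_system begin

text \<open>The chart attached to p induces the identity on covectors at p, so the intrinsic fibre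
  Hamiltonian is the coordinate one.\<close>

lemma ham_hess_eq: "ham_hess P p l k = FD (C.Hp p) (chart P p p, l) (0, k)"
proof -
 have y: "chart P p p : cU p" by (rule chart_cU[OF nbd(1)])
 have "ham_rep P p (chart P p p, xi) = ham P p xi" for xi by (simp add: ham_rep_def chart_dom(1) of_cocoord_self)
 hence "grad (ham P p) = (%xi. C.Hp p (chart P p p, xi))" using grad_ham_rep(1)[OF y] by (simp add: fun_eq_iff)
 moreover have "((%xi. C.Hp p (chart P p p, xi)) has_derivative (%k. FD (C.Hp p) (chart P p p, l) (0, k))) (at l)"
  by (rule has_derivative_slice(1)[OF smooth_on_has_derivative[OF C.smooth_Hp]]) (use y in simp)
 ultimately show ?thesis unfolding ham_hess_def by (metis frechet_derivative_at)
qed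

lemma ctrl_distr_eq: "ctrl_distr P p = range (C.fl p (chart P p p))"
proof -
 have "C.fl p (chart P p p) w = lin_part P p (ctl p p w)" for w
  unfolding C.fl_def cf_lin_part[OF nbd(1)] by (simp add: tcoord_self)
 hence "range (C.fl p (chart P p p)) = lin_part P p ` range (ctl p p)" by (simp add: image_image)
 thus ?thesis using bij_is_surj[OF ctl(2)[OF nbd(1)]] by (simp add: ctrl_distr_def)
qed

text \<open>The end point has to be rewritten in coordinates for all times near t, since the cost is
  differentiated in time at t.\<close>

lemma cost_hess_eq:
 assumes "!!s. s : {-a<..<a} ==> ga s : nbd (ga 0)" and t: "t : {-a<..<a}"
 shows "cost_hess P M' ga t v = hess (%x. deriv (%s. - real_of_ereal
  (value_fun P M' s (chart_inv P (ga 0) x) (chart_inv P (ga 0) (chart P (ga 0) (ga s))))) t) (chart P (ga 0) (ga 0)) v"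
proof -
 have "deriv (%s. geo_cost P M' ga s x) t = deriv (%s. - real_of_ereal
   (value_fun P M' s x (chart_inv P (ga 0) (chart P (ga 0) (ga s))))) t" for x
 proof (rule deriv_cong_ev[OF _ refl])
  have "\<forall>\<^sub>F s in nhds t. s : {-a<..<a}" by (rule eventually_nhds_in_open[OF open_greaterThanLessThan t])
  thus "\<forall>\<^sub>F s in nhds t. geo_cost P M' ga s x = - real_of_ereal (value_fun P M' s x (chart_inv P (ga 0) (chart P (ga 0) (ga s))))"
   by eventually_elim (use assms(1) nbdD(1) in "simp add: geo_cost_def")
 qed
 thus ?thesis by (simp add: cost_hess_def cost_dot_def)
qed

end

theorem theorem2:
  fixes P :: "('m::{t2_space,second_countable_topology}, 'n::finite, 'r::finite) control_problem"
    and \<gamma> :: "real \<Rightarrow> 'm" and \<eta> :: "real \<Rightarrow> real^'n" and l :: "real^'n"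
    and x0 :: 'm and M' :: "'m set" and T :: real
    and N :: "(real \<times> 'm) set" and E :: "real \<Rightarrow> 'm \<Rightarrow> real^'r \<Rightarrow> real^'r"
    and k :: nat and row :: "nat \<Rightarrow> nat"
  assumes "affine_control_problem P"
    and "bracket_generating P"
    and "tonelli P"
    and "ham_complete P"
    and "0 < T"
    and "ham_curve P \<gamma> \<eta>" and "\<gamma> 0 = x0" and "\<eta> 0 = l"
    and "frame_along P T \<gamma> N E"
    and "ample P T N E \<gamma> \<eta>"
    and "equiregular P T N E \<gamma> \<eta>"
    and "open M'" and "compact (closure M')" and "\<gamma> ` {0..T} \<subseteq> M'"
    and "k = dim (ctrl_distr P x0)"
    and "\<And>j. row j = tableau_row (\<lambda>i. growth P N E \<gamma> \<eta> i 0) CARD('n) j"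
  shows "symmetric_on (ctrl_distr P x0) (ham_inner P x0 l) (I_op P M' \<gamma> l)
    \<and> (\<forall>\<mu>. eig_mult (ctrl_distr P x0) (I_op P M' \<gamma> l) \<mu> = card {j \<in> {1..k}. (real (row j))\<^sup>2 = \<mu>})
    \<and> trace_on (ctrl_distr P x0) (I_op P M' \<gamma> l) = (\<Sum>j=1..k. (real (row j))\<^sup>2)"
proof -
 interpret control_system P using assms(1,3) by unfold_locales
 let ?g = "%t. chart P x0 (\<gamma> t)" and ?h = "%t. cocoord P x0 (\<gamma> t) (\<eta> t)"
 let ?D = "ctrl_distr P x0" and ?ip = "ham_inner P x0 l"
 have x0: "x0 : M'" using assms(5,7,14) by (auto simp: image_subset_iff)
 obtain a K ka ep r where gc: "geodesic_cost (cU x0) (cf x0) (cL x0) ?g ?h a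
   (%t x y. real_of_ereal (value_fun P M' t (chart_inv P x0 x) (chart_inv P x0 y))) K ka ep r"
  and gan: "!!t. t : {-a<..<a} ==> \<gamma> t : nbd x0"
  by (rule chart_geodesic_cost[OF assms(12,13,6,7) x0]) (rule that; assumption)
 obtain ta N' w Ph e where fg: "framed_geodesic (cU x0) (cf x0) (cL x0) ?g ?h ta N' w Ph e"
  and pf: "!!t l. t : {-ta<..<ta} ==> pulled_field P N E \<gamma> \<eta> l t = inv (Ph t) (C.fl x0 (?g t) (e t (axis l 1)))"
  by (rule pulled_field_in_chart[OF assms(9,5,6), unfolded assms(7)]) (rule that; assumption)
 interpret G: framed_geodesic "cU x0" "cf x0" "cL x0" ?g ?h ta N' w Ph e by (rule fg)
 have pC: "pulled_field P N E \<gamma> \<eta> l t = G.Cc l t" if "t : {-ta<..<ta}" for t l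
  using pf[OF that] by (simp add: G.Cc_def)
 have flag_eq: "flag P N E \<gamma> \<eta> i t = curve_flag G.Cc i t" if t: "t : {-ta<..<ta}" for i t
 proof -
  have "nth_vderiv j (pulled_field P N E \<gamma> \<eta> l) t = nth_vderiv j (G.Cc l) t" for j l
   by (rule nth_vderiv_cong[OF _ G.smooth_Cc pC t]) auto
  thus ?thesis by (simp add: flag_def curve_flag_def)
 qed
 have I0: "0 : {-ta<..<ta}" using G.ta by simp
 \<comment> \<open>Equiregularity at the initial time, where the neighbourhoods within the interval
   are one-sided.\<close>
 have growth: "\<forall>\<^sub>F s in at_right 0. dim (curve_flag G.Cc i s) = dim (curve_flag G.Cc i 0)" for i
 proof -
  have "\<forall>\<^sub>F s in at 0 within {0..T}. growth P N E \<gamma> \<eta> i s = growth P N E \<gamma> \<eta> i 0"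
   using assms(5,11) by (simp add: equiregular_def)
  hence "\<forall>\<^sub>F s in at_right 0. growth P N E \<gamma> \<eta> i s = growth P N E \<gamma> \<eta> i 0"
   using assms(5) by (simp add: at_within_Icc_at_right)
  moreover have "\<forall>\<^sub>F s in at_right 0. s : {-ta<..<ta}"
   unfolding eventually_at_right_field using G.ta by (intro exI[of _ ta]) auto
  ultimately show ?thesis by eventually_elim (simp add: growth_def flag_eq I0)
 qed
 obtain m where m: "curve_flag G.Cc m 0 = UNIV"
 proof -
  have "0 : {0..T}" using assms(5) by simp
  thus thesis using assms(10) that unfolding ample_def flag_eq[OF I0, symmetric] by blast
 qed
 let ?S = "%t x y. real_of_ereal (value_fun P M' t (chart_inv P x0 x) (chart_inv P x0 y))"
 obtain nw :: "'r => nat" and v :: "'r => real^'n" and bt :: "real => 'r => 'r => real"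
  where vinj: "inj_on v {k. 0 < nw k}" and vind: "independent (v ` {k. 0 < nw k})"
   and hp: "!!p. FD (C.Hp x0) (?g 0, ?h 0) (0, p) = (\<Sum>k | 0 < nw k. (v k <.> p) *R v k)"
   and rng: "range (C.fl x0 (?g 0)) = span (v ` {k. 0 < nw k})"
   and dims: "!!i. dim (curve_flag G.Cc i 0) = card {(k, j). j < nw k & j < i}"
   and card: "card {(k, j). j < nw k} = CARD('n)"
   and bts: "!!t k l. bt t k l = bt t l k"
   and quad: "\<forall>\<^sub>F t in at_right 0. ALL c. hess (%x. deriv (%s. - ?S s x (?g s)) t) (?g 0) (\<Sum>k | 0 < nw k. c k *R v k) =
    (\<Sum>k | 0 < nw k. \<Sum>l | 0 < nw l. c k * c l * bt t k l)"
   and lim: "!!k l. 0 < nw k ==> 0 < nw l ==> ((%t. t\<^sup>2 * bt t k l) ---> (if k = l then (real (nw k))\<^sup>2 else 0)) (at_right 0)"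
  by (rule G.cost_form_asymptotics[OF gc growth m]) (rule that; assumption)
 define R where "R = {k. 0 < nw k}"
 have D: "?D = span (v ` R)" using rng by (simp add: ctrl_distr_eq assms(7) R_def)
 have hh: "ham_hess P x0 l p = (SUM k:R. (v k <.> p) *R v k)" for p
  using hp[of p] by (simp add: ham_hess_eq assms(7,8) cocoord_self R_def)
 obtain u where u: "!!k l. k : R ==> l : R ==> u k <.> v l = (if k = l then 1 else 0)"
  by (rule dual_family[OF vinj[folded R_def] vind[folded R_def]]) (rule that; assumption)
 interpret V: dual_basis v u R ?D by unfold_locales (use D u in auto)
 \<comment> \<open>Preimages of w under the Hessian are not unique. The dual basis supplies one, and
   \<open>val\<close> shows that the pairing depends on the images only.\<close>
 have ipe: "?ip w1 w2 = (SUM k:R. (u k <.> w1) * (u k <.> w2))" if w: "w1 : ?D" "w2 : ?D" for w1 w2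
  unfolding ham_inner_def
 proof (rule the_equality)
  have pre: "w = ham_hess P x0 l (SUM k:R. (u k <.> w) *R u k)" if "w : ?D" for w
  proof -
   have "w = (SUM k:R. (u k <.> w) *R v k)" by (rule V.expand[OF that])
   moreover have "v k <.> (SUM a:R. (u a <.> w) *R u a) = u k <.> w" if "k : R" for k
    using that by (simp add: inner_sum_right inner_commute[of "v k"] u if_distrib cong: if_cong)
   ultimately show ?thesis by (simp add: hh)
  qed
  have val: "et1 <.> ham_hess P x0 l et2 = (SUM k:R. (u k <.> ham_hess P x0 l et1) * (u k <.> ham_hess P x0 l et2))" for et1 et2
  proof -
   have "u k <.> ham_hess P x0 l p = v k <.> p" if "k : R" for k p unfolding hh by (rule V.coord_comb[OF that])
   hence "(SUM k:R. (u k <.> ham_hess P x0 l et1) * (u k <.> ham_hess P x0 l et2)) = (SUM k:R. (v k <.> et1) * (v k <.> et2))"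
    by simp
   thus ?thesis by (simp add: hh[of et2] inner_sum_right inner_commute[of et1] mult.commute)
  qed
  show "EX et1 et2. w1 = ham_hess P x0 l et1 & w2 = ham_hess P x0 l et2 & (SUM k:R. (u k <.> w1) * (u k <.> w2)) = et1 <.> ham_hess P x0 l et2"
  proof (intro exI conjI)
   let ?e = "%w. SUM k:R. (u k <.> w) *R u k"
   show "w1 = ham_hess P x0 l (?e w1)" "w2 = ham_hess P x0 l (?e w2)" by (rule pre[OF w(1)] pre[OF w(2)])+
   show "(SUM k:R. (u k <.> w1) * (u k <.> w2)) = ?e w1 <.> ham_hess P x0 l (?e w2)"
    unfolding pre[OF w(2), symmetric] by (simp add: inner_sum_left)
  qed
  show "r = (SUM k:R. (u k <.> w1) * (u k <.> w2))"
   if ex: "EX et1 et2. w1 = ham_hess P x0 l et1 & w2 = ham_hess P x0 l et2 & r = et1 <.> ham_hess P x0 l et2" for r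
  proof -
   obtain et1 et2 where "w1 = ham_hess P x0 l et1" "w2 = ham_hess P x0 l et2" "r = et1 <.> ham_hess P x0 l et2"
    using ex by blast
   thus ?thesis using val[of et1 et2] by (simp only:)
  qed
 qed
 interpret B: dual_basis_form v u R ?D ?ip by unfold_locales (rule ipe)
 have "\<forall>\<^sub>F t in at_right 0. t : {-a<..<a}"
  unfolding eventually_at_right_field using geodesic_cost.a[OF gc] by (intro exI[of _ a]) auto
 with quad have Q: "\<forall>\<^sub>F t in at_right 0. Q_op P M' \<gamma> l t = V.op (bt t)"
 proof eventually_elim
  case (elim t)
  have "cost_hess P M' \<gamma> t (SUM k:R. c k *R v k) = (SUM k:R. SUM l:R. c k * c l * bt t k l)" for c
   using cost_hess_eq[of a \<gamma> t M'] elim gan by (simp add: assms(7) R_def)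
  from B.the_operator[of "bt t" "cost_hess P M' \<gamma> t", OF bts this] show ?case by (simp add: Q_op_def assms(7))
 qed
 define bt0 where "bt0 k l = (if k = l then (real (nw k))\<^sup>2 else 0)" for k l
 have I: "I_op P M' \<gamma> l = V.op bt0"
  unfolding I_op_def by (intro ext B.Lim_op[OF Q]) (use lim in "simp add: R_def bt0_def")
 have sym: "symmetric_on ?D ?ip (I_op P M' \<gamma> l)" unfolding I by (rule B.op_symmetric) (simp add: bt0_def)
 have Iv: "I_op P M' \<gamma> l (v k) = (real (nw k))\<^sup>2 *R v k" if k: "k : R" for k
 proof -
  have "v k : ?D" using k by (simp add: D span_base)
  thus ?thesis
   using k by (simp add: I V.op_def bt0_def u if_distrib[of "%x. _ * x"] if_distrib[of "%x. x * _"] if_distrib[of "%x. x *R _"] cong: if_cong)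
 qed
 have spec: "eig_mult ?D (I_op P M' \<gamma> l) \<mu> = card {k : R. (real (nw k))\<^sup>2 = \<mu>}"
  "trace_on ?D (I_op P M' \<gamma> l) = (SUM k:R. (real (nw k))\<^sup>2)" for \<mu>
  by (rule diagonal_operator_spectrum[OF vinj[folded R_def] vind[folded R_def] D _ Iv]; use sym in "auto simp: symmetric_on_def")+
 have kR: "k = card {k. 0 < nw k}" using vind vinj by (simp add: assms(15) D R_def dim_eq_card_independent card_image)
 have row: "(\<Sum>j = 1..k. g (row j)) = (SUM k:R. g (nw k))" for g :: "nat => 'c::comm_monoid_add"
  unfolding assms(16) R_def
  by (rule sum_tableau_row[OF _ card[symmetric] kR]) (simp add: growth_def flag_eq[OF I0] dims)
 have "card {k : R. (real (nw k))\<^sup>2 = \<mu>} = card {j : {1..k}. (real (row j))\<^sup>2 = \<mu>}" for \<mu>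
  using row[of "%n. if (real n)\<^sup>2 = \<mu> then 1 else 0 :: nat"] by (simp add: sum.If_cases Int_def)
 thus ?thesis using sym spec row[of "%n. (real n)\<^sup>2"] by simp
qed

end
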